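(* Let $q\ge1$, $D>\mathsf p+q$, $L>q+1$ and $\mathsf k\in\mathbb N$. Suppose that the following conditions hold. (1) There exist $\mathcal C$-measurable (real-valued) random variables $U$ and $V$ such that for every $\mathcal T\in\mathfrak T$, $$P_{\mathcal C}\Big[S_T\Big(r,\frac{U}{r^D}\Big)\Big]\Psi_T\le\frac{V}{r^L}\quad\text{a.s.}\qquad(T\in\mathcal T,\ r\in\mathbb N).$$ (2) For every $\epsilon>0$, $c>0$ and $\mathcal T\in\mathfrak T$, $\ \limsup_{T\to\infty,\,T\in\mathcal T}P_{\mathcal C}[W_T(\delta,c,\epsilon)]\Psi_T\to^P 0$ as $\delta\downarrow0$. (3) (i) For any $k\in\mathbb N$, $u_1,\dots,u_k\in\mathbb R^{\mathsf p}$, $f\in C_b(\mathbb R^{k})$ and any bounded $\mathcal G$-measurable random variable $Y$, $$E_{\mathcal C}\big[f\big((\mathbb Z_T(u_i))_{i=1,\dots,k}\big)\Psi_TY\big]\to^P\overline E_{\mathcal C}\big[f\big((\mathbb Z(u_i))_{i=1,\dots,k}\big)Y\big]\quad(T\to\infty);$$ (ii) $\Psi_T\to^P1$ as $T\to\infty$. (4) $E_{\mathcal C}\Big[\Big(\int_{\mathbb U_T}\mathbb Z_T(u)du\Big)^{-1}\Big]=O_p(1)$ as $T\to\infty$. Then $$E_{\mathcal C}[f(\tilde u_T)Y]\to^P\overline E_{\mathcal C}[f(\tilde u)Y]\quad(T\to\infty)$$ for any bounded $\mathcal G$-measurable random variable $Y$ and any $f\in C(\mathbb R^{\mathsf p};\mathbb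 R^{\mathsf k})$ satisfying $\sup_{u\in\mathbb R^{\mathsf p}}(1+|u|^q)^{-1}|f(u)|<\infty$, where $$\tilde u=\frac{\int_{\mathbb R^{\mathsf p}}u\,\mathbb Z(u)\,du}{\int_{\mathbb R^{\mathsf p}}\mathbb Z(u)\,du}.$$
   Context: $(\Omega,\mathcal F,P)$ is a probability space, $\mathbb T\subset[0,\infty)$ with $\sup\mathbb T=\infty$, $\Theta$ is a bounded domain in $\mathbb R^{\mathsf p}$ with closure $\overline\Theta$, and $\theta^*\in\Theta$. For $T\in\mathbb T$, $\mathbb H_T:\Omega\times\overline\Theta\to\mathbb R$ is a jointly measurable random field, continuous in $\theta\in\overline\Theta$ for every $\omega$. The matrices $a_T\in GL(\mathbb R^{\mathsf p})$ satisfy $a_T\to0$ as $T\to\infty$. Put $\theta_T^\dagger(u)=\theta^*+a_Tu$, $\mathbb U_T=\{u\in\mathbb R^{\mathsf p}:\theta_T^\dagger(u)\in\Theta\}$ and $\mathbb Z_T(u)=\exp\big(\mathbb H_T(\theta_T^\dagger(u))-\mathbb H_T(\theta^* )\big)$ for $u\in\mathbb U_T$. The field $\mathbb Z_T$ is extended to $\mathbb R^{\mathsf p}$ as a (measurable, nonnegative) continuous random field with compact support and $\sup_{u\in\mathbb R^{\mathsf p}\setminus\mathbb U_T}\mathbb Z_T(u)\le\max_{u\in\partial\mathbb U_T}\mathbb Z_T(u)$; the extension is also denoted $\mathbb Z_T$. $\hat C=\{f\in C(\mathbb R^{\mathsf p}):\lim_{|u|\to\infty}f(u)=0\}$ with the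 supremum norm. The quasi Bayesian estimator with respect to a prior density $\varpi$ is $$\tilde\theta_T=\Big[\int_\Theta\exp(\mathbb H_T(\theta))\varpi(\theta)d\theta\Big]^{-1}\int_\Theta\theta\exp(\mathbb H_T(\theta))\varpi(\theta)d\theta,$$ where $\varpi$ is continuous on $\Theta$ with $0<\inf_\Theta\varpi\le\sup_\Theta\varpi<\infty$; $\tilde u_T=a_T^{-1}(\tilde\theta_T-\theta^* )$. $\mathcal C\subset\mathcal G\subset\mathcal F$ are $\sigma$-fields; $P_{\mathcal C}$ denotes conditional probability given $\mathcal C$. $\Psi_T$ ($T\in\mathbb T$) are $[0,1]$-valued $\mathcal C$-measurable random variables. $T_0>0$ is fixed, and $\mathfrak T$ is the set of sequences $(T_n)_{n\in\mathbb N}$ in $\mathbb T$ with $T_n\ge T_0$ for all $n$ and $T_n\to\infty$. $\mathbb V_T(r)=\{u\in\mathbb U_T:|u|\ge r\}$ and $S_T(r,\epsilon)=\{\sup_{u\in\mathbb V_T(r)}\mathbb Z_T(u)\ge\epsilon\}$ (the supremum over the empty set being $0$). For $c>0$, $B_{c,T}=\{u\in\mathbb R^{\mathsf p}:|u|<c,\ \theta_T^\dagger(u)\in\Theta\}$, $w_T(\delta,c)=\sup\{|\log\mathbb Z_T(u_2)-\log\mathbb Z_T(u_1)|:u_1,u_2\in B_{c,T},|u_2-u_1|\le\delta\}$, and $W_T(\delta,c,\epsilon)=\{w_T(\delta,c)>\epsilon\}$. $(\overline\Omega,\overline{\mathcal F},\overline P)$ is an extension of $(\Omega,\mathcal F,P)$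 (random variables on $\Omega$ are regarded as random variables on $\overline\Omega$, and $\overline P|_{\mathcal F}=P$); $\mathbb Z$ is a $\hat C$-valued random variable on it. For a random variable $W$, $\overline E_{\mathcal C}[W]$ (likewise $E_{\mathcal C}[W]$) is the integral of $w$ with respect to a regular conditional distribution of $W$ given $\mathcal C$; unconditional integrability of $W$ is not assumed. $\to^P$ is convergence in probability; $O_p(1)$ means boundedness in probability. *)

theory Defs
  imports "HOL-Probability.Probability"
begin

text \<open>The filter "T tends to infinity, T in I" for an unbounded index set I of reals.\<close>

definition at_top_in :: "real set \<Rightarrow> real filter" where
  "at_top_in I = inf at_top (principal I)"

definition divergent_seqs :: "real set \<Rightarrow> real \<Rightarrow> (nat \<Rightarrow> real) set" where
  "divergent_seqs I T0 = {\<tau>. (\<forall>n. \<tau> n \<in> I \<and> T0 \<le> \<tau> n) \<and> filterlim \<tau> at_top sequentially}"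


section \<open>Convergence and boundedness in probability\<close>

definition conv_in_prob ::
  "'w measure \<Rightarrow> ('i \<Rightarrow> 'w \<Rightarrow> 'b::metric_space) \<Rightarrow> ('w \<Rightarrow> 'b) \<Rightarrow> 'i filter \<Rightarrow> bool" where
  "conv_in_prob M X L F \<longleftrightarrow>
     (\<forall>\<epsilon>>0. ((\<lambda>t. measure M {\<omega> \<in> space M. \<epsilon> \<le> dist (X t \<omega>) (L \<omega>)}) \<longlongrightarrow> 0) F)"

text \<open>The variables take values in [0,\<open>\<infinity>\<close>], the value \<open>\<infinity>\<close> counting as exceeding every bound.\<close>

definition bounded_in_prob ::
  "'w measure \<Rightarrow> ('i \<Rightarrow> 'w \<Rightarrow> ennreal) \<Rightarrow> 'i filter \<Rightarrow> bool" where
  "bounded_in_prob M X F \<longleftrightarrow>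
     (\<forall>\<epsilon>>0. \<exists>K::real. \<forall>\<^sub>F t in F. measure M {\<omega> \<in> space M. ennreal K < X t \<omega>} \<le> \<epsilon>)"


section \<open>Conditioning through regular conditional distributions\<close>

definition event_prob_given :: "'w measure \<Rightarrow> 'w measure \<Rightarrow> 'w set \<Rightarrow> 'w \<Rightarrow> real" where
  "event_prob_given M F A = real_cond_exp M F (indicator A)"

definition regular_cond_distr ::
  "'w measure \<Rightarrow> 'w measure \<Rightarrow> ('w \<Rightarrow> 'b::euclidean_space) \<Rightarrow> ('w \<Rightarrow> 'b measure) \<Rightarrow> bool" where
  "regular_cond_distr M F W \<kappa> \<longleftrightarrow>
     \<kappa> \<in> F \<rightarrow>\<^sub>M prob_algebra borel \<and>
     (\<forall>A \<in> sets borel. AE \<omega> in M.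
        measure (\<kappa> \<omega>) A = event_prob_given M F (W -` A \<inter> space M) \<omega>)"

text \<open>For a random variable W with values in a Euclidean space such a kernel exists and is unique up
  to a null set, so the choice only fixes a version.\<close>

definition cond_law ::
  "'w measure \<Rightarrow> 'w measure \<Rightarrow> ('w \<Rightarrow> 'b::euclidean_space) \<Rightarrow> 'w \<Rightarrow> 'b measure" where
  "cond_law M F W = (SOME \<kappa>. regular_cond_distr M F W \<kappa>)"

text \<open>No unconditional integrability of W is needed here. The Bochner integral is 0 where the identity
  is not integrable with respect to the conditional law; where that can matter, integrability is
  stated separately, and nonnegative variables are treated with values in [0,\<open>\<infinity>\<close>].\<close>

definition cond_expect ::
  "'w measure \<Rightarrow> 'w measure \<Rightarrow> ('w \<Rightarrow> 'b::euclidean_space) \<Rightarrow> 'w \<Rightarrow> 'b" where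
  "cond_expect M F W \<omega> = (\<integral>w. w \<partial>cond_law M F W \<omega>)"

definition cond_nn_expect ::
  "'w measure \<Rightarrow> 'w measure \<Rightarrow> ('w \<Rightarrow> real) \<Rightarrow> 'w \<Rightarrow> ennreal" where
  "cond_nn_expect M F W \<omega> = (\<integral>\<^sup>+w. ennreal w \<partial>cond_law M F W \<omega>)"

text \<open>An extension of M is a probability space N with a factor map \<open>\<pi>\<close> onto M in the measure-theoretic
  sense: a random variable X on M is regarded as \<open>X \<circ> \<pi>\<close> on N, a sub-\<open>\<sigma>\<close>-field F of M as
  \<open>lift_field N \<pi> F\<close>.\<close>

definition prob_extension :: "'w measure \<Rightarrow> 'v measure \<Rightarrow> ('v \<Rightarrow> 'w) \<Rightarrow> bool" where
  "prob_extension M N \<pi> \<longleftrightarrow> prob_space N \<and> \<pi> \<in> N \<rightarrow>\<^sub>M M \<and> distr N M \<pi> = M"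

definition lift_field :: "'v measure \<Rightarrow> ('v \<Rightarrow> 'w) \<Rightarrow> 'w measure \<Rightarrow> 'v measure" where
  "lift_field N \<pi> F = vimage_algebra (space N) \<pi> F"

definition bounded_rv :: "'w measure \<Rightarrow> ('w \<Rightarrow> real) \<Rightarrow> bool" where
  "bounded_rv F Y \<longleftrightarrow> Y \<in> borel_measurable F \<and> bounded (Y ` space F)"


section \<open>The quasi likelihood ratio random field\<close>

text \<open>Below, A is the normalizing matrix \<open>a\<^sub>T\<close>, h a path of \<open>H\<^sub>T\<close>, z a path of \<open>Z\<^sub>T\<close>, and
  \<open>\<theta>\<^sub>s\<close> the true value of the parameter.\<close>

definition U_set :: "(real^'p) set \<Rightarrow> real^'p \<Rightarrow> real^'p^'p \<Rightarrow> (real^'p) set" where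
  "U_set \<Theta> \<theta>\<^sub>s A = {u. \<theta>\<^sub>s + A *v u \<in> \<Theta>}"

definition V_set :: "(real^'p) set \<Rightarrow> real^'p \<Rightarrow> real^'p^'p \<Rightarrow> real \<Rightarrow> (real^'p) set" where
  "V_set \<Theta> \<theta>\<^sub>s A r = {u \<in> U_set \<Theta> \<theta>\<^sub>s A. r \<le> norm u}"

definition B_set :: "(real^'p) set \<Rightarrow> real^'p \<Rightarrow> real^'p^'p \<Rightarrow> real \<Rightarrow> (real^'p) set" where
  "B_set \<Theta> \<theta>\<^sub>s A c = {u. norm u < c \<and> \<theta>\<^sub>s + A *v u \<in> \<Theta>}"

text \<open>The continuous extension with compact support of a path of the ratio field from \<open>U\<^sub>T\<close> to the
  whole space. The set \<open>U\<^sub>T\<close> is bounded, open and nonempty, so both suprema are over nonempty sets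
  on which z is bounded, and the second one is a maximum.\<close>

definition ratio_extension ::
  "(real^'p) set \<Rightarrow> real^'p \<Rightarrow> real^'p^'p \<Rightarrow> (real^'p \<Rightarrow> real) \<Rightarrow> (real^'p \<Rightarrow> real) \<Rightarrow> bool" where
  "ratio_extension \<Theta> \<theta>\<^sub>s A h z \<longleftrightarrow>
     (\<forall>u \<in> U_set \<Theta> \<theta>\<^sub>s A. z u = exp (h (\<theta>\<^sub>s + A *v u) - h \<theta>\<^sub>s)) \<and>
     (\<forall>u. 0 \<le> z u) \<and> continuous_on UNIV z \<and> compact (closure {u. z u \<noteq> 0}) \<and>
     (SUP u \<in> - U_set \<Theta> \<theta>\<^sub>s A. z u) \<le> (SUP u \<in> frontier (U_set \<Theta> \<theta>\<^sub>s A). z u)"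

text \<open>The event \<open>S\<^sub>T(r, e)\<close>; the threshold e is a random variable.\<close>

definition S_event :: "'w measure \<Rightarrow> (real^'p) set \<Rightarrow> real^'p \<Rightarrow> real^'p^'p \<Rightarrow>
    ('w \<Rightarrow> real^'p \<Rightarrow> real) \<Rightarrow> real \<Rightarrow> ('w \<Rightarrow> real) \<Rightarrow> 'w set" where
  "S_event M \<Theta> \<theta>\<^sub>s A Z r e =
     {\<omega> \<in> space M. e \<omega> \<le>
        (if V_set \<Theta> \<theta>\<^sub>s A r = {} then 0 else (SUP u \<in> V_set \<Theta> \<theta>\<^sub>s A r. Z \<omega> u))}"

text \<open>The field is positive on \<open>U\<^sub>T\<close> and its logarithm is bounded there, so that the logarithms and
  the real supremum are genuine.\<close>

definition log_modulus :: "(real^'p) set \<Rightarrow> real^'p \<Rightarrow> real^'p^'p \<Rightarrow>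
    (real^'p \<Rightarrow> real) \<Rightarrow> real \<Rightarrow> real \<Rightarrow> real" where
  "log_modulus \<Theta> \<theta>\<^sub>s A z \<delta> c =
     Sup {\<bar>ln (z u2) - ln (z u1)\<bar> | u1 u2.
            u1 \<in> B_set \<Theta> \<theta>\<^sub>s A c \<and> u2 \<in> B_set \<Theta> \<theta>\<^sub>s A c \<and> norm (u2 - u1) \<le> \<delta>}"

definition W_event :: "'w measure \<Rightarrow> (real^'p) set \<Rightarrow> real^'p \<Rightarrow> real^'p^'p \<Rightarrow>
    ('w \<Rightarrow> real^'p \<Rightarrow> real) \<Rightarrow> real \<Rightarrow> real \<Rightarrow> real \<Rightarrow> 'w set" where
  "W_event M \<Theta> \<theta>\<^sub>s A Z \<delta> c \<epsilon> = {\<omega> \<in> space M. \<epsilon> < log_modulus \<Theta> \<theta>\<^sub>s A (Z \<omega>) \<delta> c}"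

text \<open>The space of continuous functions vanishing at infinity, as a subspace of the bounded continuous
  functions with the supremum norm.\<close>

definition C_hat :: "((real^'p) \<Rightarrow>\<^sub>C real) set" where
  "C_hat = {g. (apply_bcontfun g \<longlongrightarrow> 0) at_infinity}"


section \<open>The quasi Bayesian estimator\<close>

definition qb_estimator ::
  "(real^'p) set \<Rightarrow> (real^'p \<Rightarrow> real) \<Rightarrow> (real^'p \<Rightarrow> real) \<Rightarrow> real^'p" where
  "qb_estimator \<Theta> \<rho> h =
     inverse (LINT \<theta>:\<Theta>|lborel. exp (h \<theta>) * \<rho> \<theta>) *\<^sub>R
     (LINT \<theta>:\<Theta>|lborel. (exp (h \<theta>) * \<rho> \<theta>) *\<^sub>R \<theta>)"

definition u_tilde :: "(real^'p) set \<Rightarrow> real^'p \<Rightarrow> real^'p^'p \<Rightarrow>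
    (real^'p \<Rightarrow> real) \<Rightarrow> (real^'p \<Rightarrow> real) \<Rightarrow> real^'p" where
  "u_tilde \<Theta> \<theta>\<^sub>s A \<rho> h = matrix_inv A *v (qb_estimator \<Theta> \<rho> h - \<theta>\<^sub>s)"

definition u_limit :: "(real^'p \<Rightarrow> real) \<Rightarrow> real^'p" where
  "u_limit z = inverse (\<integral>u. z u \<partial>lborel) *\<^sub>R (\<integral>u. z u *\<^sub>R u \<partial>lborel)"

end

theory Submission imports Defs begin

text \<open>Convergence in probability along \<open>at_top_in I\<close> may be tested along sequences
  (\<open>conv_in_prob_at_top_in\<close>), so everything takes place along one divergent sequence of indices.

  \<^item> After the affine change of variables \<open>\<theta> = \<theta>\<^sub>s + A u\<close> the rescaled estimator is a mean of \<open>u\<close> with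
  the random weights \<open>quasi_weight\<close>, that is, the likelihood ratio field times the prior
  (\<open>u_tilde_eq\<close>). The limit is the mean of \<open>u\<close> under the weights \<open>Zlim\<close>. The task is to pass to the
  limit in a quotient of integrals over the whole space, knowing only that the fields converge at
  finitely many points.

  \<^item> What is far away is controlled by the tail moment: the moment of order \<open>q\<close> of the weights outside
  a ball, divided by their mass. A decomposition into shells, on each of which the field either stays
  below or crosses the threshold of the first condition, bounds its conditional expectation by tails
  of two convergent series times the random constants of the first and the last condition
  (\<open>cond_tail_moment_le\<close>, \<open>tail_moment_small\<close>). By Jensen's inequality the tail moment also
  controls the norm of the estimator (\<open>moment_le_tail_moment\<close>).

  \<^item> In a ball the condition on the modulus of continuity makes the logarithm of the field nearly
  constant on the cells of a fine grid, and the prior is nearly constant because the matrices tend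
  to 0. Hence the estimator is close to a grid mean (\<open>uT_grid_close\<close>). A grid mean is a continuous
  function of finitely many values of the field, for the field equals 1 at the origin, which keeps
  the denominator away from 0; so the convergence of the finite-dimensional distributions applies to
  it (\<open>grid_fidi\<close>).

  \<^item> Almost every path of the limit field equals 1 at the origin, is nonnegative, and decays like
  \<open>norm u powr -D\<close>: each of these passes to the limit through finitely many values, the last by the
  Borel--Cantelli lemma (\<open>AE_limit_path\<close>). So the mean under \<open>Zlim\<close> exists and is the limit of its
  own grid means. This gives the convergence for bounded uniformly continuous test functions, even in
  \<open>L\<^sup>1\<close> (\<open>bounded_test_L1\<close>).

  \<^item> Truncated moments of order \<open>q\<close> pass to the limit, whose conditional moment of order \<open>q\<close> is
  therefore finite (\<open>uL_moment_finite\<close>). A cut-off, whose error is again a tail moment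
  (\<open>cutoff_error\<close>), extends the convergence to functions of growth \<open>q\<close>.

  Expectations with respect to a regular conditional distribution are translated into ordinary
  conditional expectations, component by component. For that, regular conditional distributions have
  to exist: on the line they are given by conditional distribution functions, and a Borel coding by
  real numbers carries this over to Euclidean spaces.\<close>

section \<open>Conditional expectations with respect to a sub-sigma-field\<close>

locale prob_subalgebra = prob_space M for M :: "'a measure" +
  fixes F :: "'a measure"
  assumes subalgebra_MF: "subalgebra M F"

sublocale prob_subalgebra \<subseteq> finite_measure_subalgebra M F
  by unfold_locales (rule subalgebra_MF)

context prob_subalgebra
begin

lemma sets_F_subset: "A \<in> sets F \<Longrightarrow> A \<in> sets M"
  using subalgebra_MF by (auto simp: subalgebra_def)

lemma space_F: "space F = space M"
  using subalgebra_MF by (auto simp: subalgebra_def)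

lemma nn_cond_exp_monotone_convergence:
  assumes [measurable]: "\<And>n::nat. f n \<in> borel_measurable M"
    and "\<And>x. x \<in> space M \<Longrightarrow> incseq (\<lambda>n. f n x)"
    and "\<And>x. x \<in> space M \<Longrightarrow> (SUP n. f n x) = g x"
  shows "AE x in M. (SUP n. nn_cond_exp M F (f n) x) = nn_cond_exp M F g x"
proof -
  have g: "g \<in> borel_measurable M"
    by (rule measurable_cong[THEN iffD1, of _ "\<lambda>x. SUP n. f n x"]) (auto simp: assms)
  note [measurable] = this
  have mono: "AE x in M. \<forall>n. nn_cond_exp M F (f n) x \<le> nn_cond_exp M F (f (Suc n)) x"
    unfolding AE_all_countable
    by (intro allI nn_cond_exp_mono AE_I2) (use assms in \<open>auto simp: incseq_Suc_iff\<close>)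
  show ?thesis
  proof (rule nn_cond_exp_charact)
    fix A assume A [measurable]: "A \<in> sets F"
    then have [measurable]: "A \<in> sets M" by (rule sets_F_subset)
    have "(\<integral>\<^sup>+x\<in>A. (SUP n. nn_cond_exp M F (f n) x) \<partial>M) =
          (\<integral>\<^sup>+x. (SUP n. nn_cond_exp M F (f n) x * indicator A x) \<partial>M)"
      by (simp add: SUP_mult_right_ennreal)
    also have "\<dots> = (SUP n. \<integral>\<^sup>+x. nn_cond_exp M F (f n) x * indicator A x \<partial>M)"
      by (rule nn_integral_monotone_convergence_SUP_AE)
         (use mono in \<open>auto intro!: mult_right_mono elim: AE_mp\<close>)
    also have "\<dots> = (SUP n. \<integral>\<^sup>+x. indicator A x * nn_cond_exp M F (f n) x \<partial>M)"
      by (simp add: mult.commute)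
    also have "\<dots> = (SUP n. \<integral>\<^sup>+x. indicator A x * f n x \<partial>M)"
      by (subst nn_cond_exp_intg) auto
    also have "\<dots> = (\<integral>\<^sup>+x. (SUP n. indicator A x * f n x) \<partial>M)"
      by (rule nn_integral_monotone_convergence_SUP_AE[symmetric])
         (use assms(2) in \<open>auto intro!: mult_left_mono AE_I2 simp: incseq_Suc_iff\<close>)
    also have "\<dots> = (\<integral>\<^sup>+x\<in>A. g x \<partial>M)"
      using assms(3) by (intro nn_integral_cong) (simp add: SUP_mult_left_ennreal[symmetric] mult.commute)
    finally show "(\<integral>\<^sup>+x\<in>A. g x \<partial>M) = (\<integral>\<^sup>+x\<in>A. (SUP n. nn_cond_exp M F (f n) x) \<partial>M)" ..
  qed (use g in auto)
qed

lemma real_cond_exp_L1_contraction: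
  assumes X: "integrable M X" and X': "integrable M X'"
  shows "(\<integral>x. \<bar>real_cond_exp M F X x - real_cond_exp M F X' x\<bar> \<partial>M) \<le> (\<integral>x. \<bar>X x - X' x\<bar> \<partial>M)"
proof -
  have i: "integrable M (\<lambda>x. X x - X' x)" using assms by auto
  have "(\<integral>x. \<bar>real_cond_exp M F X x - real_cond_exp M F X' x\<bar> \<partial>M)
      \<le> (\<integral>x. real_cond_exp M F (\<lambda>x. \<bar>X x - X' x\<bar>) x \<partial>M)"
  proof (rule integral_mono_AE)
    show "integrable M (\<lambda>x. \<bar>real_cond_exp M F X x - real_cond_exp M F X' x\<bar>)"
      using assms by (intro integrable_abs Bochner_Integration.integrable_diff real_cond_exp_int)
    show "integrable M (real_cond_exp M F (\<lambda>x. \<bar>X x - X' x\<bar>))"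
      using i by (intro real_cond_exp_int integrable_abs)
    have "AE x in M. real_cond_exp M F (\<lambda>x. X x - X' x) x \<le> real_cond_exp M F (\<lambda>x. \<bar>X x - X' x\<bar>) x"
      using i by (intro real_cond_exp_mono integrable_abs) auto
    moreover have "AE x in M. real_cond_exp M F (\<lambda>x. - 1 * (X x - X' x)) x \<le> real_cond_exp M F (\<lambda>x. \<bar>X x - X' x\<bar>) x"
      using i by (intro real_cond_exp_mono integrable_abs integrable_mult_right) auto
    moreover have "AE x in M. real_cond_exp M F (\<lambda>x. - 1 * (X x - X' x)) x = - 1 * real_cond_exp M F (\<lambda>x. X x - X' x) x"
      using i by (rule real_cond_exp_cmult)
    moreover have "AE x in M. real_cond_exp M F (\<lambda>x. X x - X' x) x = real_cond_exp M F X x - real_cond_exp M F X' x"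
      using assms by (rule real_cond_exp_diff)
    ultimately show "AE x in M. \<bar>real_cond_exp M F X x - real_cond_exp M F X' x\<bar>
        \<le> real_cond_exp M F (\<lambda>x. \<bar>X x - X' x\<bar>) x"
      by eventually_elim auto
  qed
  also have "\<dots> = (\<integral>x. \<bar>X x - X' x\<bar> \<partial>M)"
    using i by (intro real_cond_exp_int integrable_abs)
  finally show ?thesis .
qed

lemma integrable_bounded_rv:
  "X \<in> borel_measurable M \<Longrightarrow> (\<And>x. x \<in> space M \<Longrightarrow> \<bar>X x\<bar> \<le> B) \<Longrightarrow> integrable M (X::'a \<Rightarrow> real)"
  by (rule integrable_const_bound[where B=B]) auto

lemma event_prob_given_le_1:
  assumes [measurable]: "A \<in> sets M"
  shows "AE x in M. 0 \<le> event_prob_given M F A x \<and> event_prob_given M F A x \<le> 1"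
proof -
  have i: "integrable M (indicator A :: 'a \<Rightarrow> real)"
    by (rule integrable_bounded_rv[where B=1]) (auto simp: indicator_def)
  have "AE x in M. real_cond_exp M F (indicator A) x \<ge> 0"
    by (rule real_cond_exp_ge_c) (use i in auto)
  moreover have "AE x in M. real_cond_exp M F (indicator A) x \<le> 1"
    by (rule real_cond_exp_le_c) (use i in \<open>auto simp: indicator_def\<close>)
  ultimately show ?thesis unfolding event_prob_given_def by eventually_elim auto
qed

lemma ennreal_event_prob_given:
  assumes [measurable]: "A \<in> sets M"
  shows "AE x in M. ennreal (event_prob_given M F A x) = nn_cond_exp M F (indicator A) x"
proof -
  have le: "AE x in M. nn_cond_exp M F (indicator A) x \<le> nn_cond_exp M F (\<lambda>_. 1) x"
    by (rule nn_cond_exp_mono) (auto simp: indicator_def)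
  have one: "AE x in M. 1 = nn_cond_exp M F (\<lambda>_. 1) x"
    by (rule nn_cond_exp_F_meas) auto
  have zero: "AE x in M. 0 = nn_cond_exp M F (\<lambda>_. 0) x"
    by (rule nn_cond_exp_F_meas) auto
  have [simp]: "(\<lambda>x. ennreal (- indicator A x)) = (\<lambda>_::'a. 0)"
    by (auto simp: fun_eq_iff indicator_def ennreal_neg)
  have [simp]: "(\<lambda>x. ennreal (indicator A x)) = (indicator A :: 'a \<Rightarrow> ennreal)"
    by (auto simp: fun_eq_iff indicator_def)
  show ?thesis
    unfolding event_prob_given_def real_cond_exp_def
    using le one zero by eventually_elim (auto intro!: ennreal_enn2real intro: order.strict_trans1[OF _ ennreal_one_less_top])
qed

lemma emeasure_Int_nn_cond_exp:
  assumes [measurable]: "A \<in> sets M" "B \<in> sets F"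
  shows "(\<integral>\<^sup>+x\<in>B. nn_cond_exp M F (indicator A) x \<partial>M) = emeasure M (A \<inter> B)"
proof -
  have [measurable]: "B \<in> sets M" using assms sets_F_subset by auto
  have "(\<integral>\<^sup>+x\<in>B. nn_cond_exp M F (indicator A) x \<partial>M) = (\<integral>\<^sup>+x. indicator B x * indicator A x \<partial>M)"
    by (subst nn_cond_exp_intg[symmetric]) (auto simp: mult.commute)
  also have "\<dots> = (\<integral>\<^sup>+x. indicator (A \<inter> B) x \<partial>M)"
    by (intro nn_integral_cong) (auto simp: indicator_def)
  finally show ?thesis by simp
qed

lemma event_prob_given_mono:
  assumes "A \<in> sets M" "B \<in> sets M" "A \<subseteq> B"
  shows "AE x in M. event_prob_given M F A x \<le> event_prob_given M F B x"
  unfolding event_prob_given_def using assms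
  by (intro real_cond_exp_mono integrable_bounded_rv[where B=1]) (auto simp: indicator_def)

lemma event_prob_given_compl:
  assumes [measurable]: "A \<in> sets M"
  shows "AE x in M. event_prob_given M F (space M - A) x = 1 - event_prob_given M F A x"
proof -
  have i: "integrable M (indicator A :: 'a \<Rightarrow> real)" "integrable M (\<lambda>_::'a. 1::real)"
    by (auto intro: integrable_bounded_rv[where B=1])
  have "AE x in M. real_cond_exp M F (\<lambda>x. 1 - indicator A x) x
      = real_cond_exp M F (\<lambda>_. 1) x - real_cond_exp M F (indicator A) x"
    using i by (intro real_cond_exp_diff)
  moreover have "AE x in M. real_cond_exp M F (\<lambda>_. 1) x = 1"
    using i by (intro real_cond_exp_F_meas) auto
  moreover have "AE x in M. real_cond_exp M F (indicator (space M - A)) x = real_cond_exp M F (\<lambda>x. 1 - indicator A x) x"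
    by (rule real_cond_exp_cong) (auto simp: indicator_def)
  ultimately show ?thesis unfolding event_prob_given_def by eventually_elim auto
qed

lemma event_prob_given_incseq:
  assumes [measurable]: "\<And>n::nat. A n \<in> sets M" and inc: "incseq A"
  shows "AE x in M. (\<lambda>n. event_prob_given M F (A n) x) \<longlonglongrightarrow> event_prob_given M F (\<Union>n. A n) x"
proof -
  have "AE x in M. (SUP n. nn_cond_exp M F (indicator (A n)) x) = nn_cond_exp M F (indicator (\<Union>n. A n)) x"
  proof (rule nn_cond_exp_monotone_convergence)
    show "incseq (\<lambda>n. indicator (A n) x :: ennreal)" for x
      using inc by (auto simp: incseq_def indicator_def)
    show "(SUP n. indicator (A n) x :: ennreal) = indicator (\<Union>n. A n) x" for x
    proof (cases "x \<in> (\<Union>n. A n)")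
      case True
      then obtain n where "x \<in> A n" by auto
      then show ?thesis using True
        by (intro antisym SUP_least) (auto simp: indicator_def intro!: SUP_upper2[of n])
    qed (auto simp: indicator_def)
  qed simp
  moreover have "AE x in M. \<forall>n. ennreal (event_prob_given M F (A n) x) = nn_cond_exp M F (indicator (A n)) x"
    unfolding AE_all_countable by (intro allI ennreal_event_prob_given) simp
  moreover have "AE x in M. ennreal (event_prob_given M F (\<Union>n. A n) x) = nn_cond_exp M F (indicator (\<Union>n. A n)) x"
    by (rule ennreal_event_prob_given) simp
  moreover have "AE x in M. \<forall>n. event_prob_given M F (A n) x \<le> event_prob_given M F (A (Suc n)) x"
    unfolding AE_all_countable using inc by (intro allI event_prob_given_mono) (auto simp: incseq_Suc_iff)
  moreover have "AE x in M. \<forall>n. 0 \<le> event_prob_given M F (A n) x \<and> event_prob_given M F (A n) x \<le> 1"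
    unfolding AE_all_countable by (intro allI event_prob_given_le_1) simp
  moreover have "AE x in M. 0 \<le> event_prob_given M F (\<Union>n. A n) x \<and> event_prob_given M F (\<Union>n. A n) x \<le> 1"
    by (rule event_prob_given_le_1) simp
  ultimately show ?thesis
  proof eventually_elim
    case (elim x)
    have "incseq (\<lambda>n. ennreal (event_prob_given M F (A n) x))"
      using elim by (intro incseq_SucI ennreal_leI) auto
    then have "(\<lambda>n. ennreal (event_prob_given M F (A n) x)) \<longlonglongrightarrow> (SUP n. ennreal (event_prob_given M F (A n) x))"
      by (rule LIMSEQ_SUP)
    then have "(\<lambda>n. ennreal (event_prob_given M F (A n) x)) \<longlonglongrightarrow> ennreal (event_prob_given M F (\<Union>n. A n) x)"
      using elim by simp
    then show ?case
      using elim by (subst (asm) tendsto_ennreal_iff) auto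
  qed
qed

lemma event_prob_given_decseq:
  assumes [measurable]: "\<And>n::nat. A n \<in> sets M" and dec: "decseq A"
  shows "AE x in M. (\<lambda>n. event_prob_given M F (A n) x) \<longlonglongrightarrow> event_prob_given M F (\<Inter>n. A n) x"
proof -
  have eq: "space M - (\<Union>n. space M - A n) = (\<Inter>n. A n)"
    using sets.sets_into_space[OF assms(1)] by auto
  have "AE x in M. (\<lambda>n. event_prob_given M F (space M - A n) x) \<longlonglongrightarrow> event_prob_given M F (\<Union>n. space M - A n) x"
    using dec by (intro event_prob_given_incseq) (auto simp: incseq_def decseq_def)
  moreover have "AE x in M. \<forall>n. event_prob_given M F (space M - A n) x = 1 - event_prob_given M F (A n) x"
    unfolding AE_all_countable by (intro allI event_prob_given_compl) simp
  moreover have "AE x in M. event_prob_given M F (space M - (\<Union>n. space M - A n)) x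
      = 1 - event_prob_given M F (\<Union>n. space M - A n) x"
    by (intro event_prob_given_compl) simp
  ultimately show ?thesis unfolding eq
  proof eventually_elim
    case (elim x)
    have "(\<lambda>n. 1 - event_prob_given M F (space M - A n) x) \<longlonglongrightarrow> 1 - event_prob_given M F (\<Union>n. space M - A n) x"
      using elim by (intro tendsto_diff tendsto_const) auto
    then show ?case using elim by simp
  qed
qed

end

context prob_subalgebra
begin

lemma regular_cond_distrI:
  fixes W :: "'a \<Rightarrow> 'b::euclidean_space"
  assumes \<kappa>: "\<kappa> \<in> F \<rightarrow>\<^sub>M prob_algebra borel" and [measurable]: "W \<in> borel_measurable M"
    and int: "\<And>A B. A \<in> sets borel \<Longrightarrow> B \<in> sets F \<Longrightarrow>
      (\<integral>\<^sup>+x\<in>B. emeasure (\<kappa> x) A \<partial>M) = emeasure M ((W -` A \<inter> space M) \<inter> B)"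
  shows "regular_cond_distr M F W \<kappa>"
  unfolding regular_cond_distr_def
proof (intro conjI ballI \<kappa>)
  fix A :: "'b set" assume A: "A \<in> sets borel"
  have [measurable]: "W -` A \<inter> space M \<in> sets M" using A by measurable
  have "AE x in M. emeasure (\<kappa> x) A = nn_cond_exp M F (indicator (W -` A \<inter> space M)) x"
  proof (rule nn_cond_exp_charact)
    fix B assume B: "B \<in> sets F"
    then have [measurable]: "B \<in> sets M" by (rule sets_F_subset)
    show "(\<integral>\<^sup>+x\<in>B. indicator (W -` A \<inter> space M) x \<partial>M) = (\<integral>\<^sup>+x\<in>B. emeasure (\<kappa> x) A \<partial>M)"
    proof -
      have "(\<integral>\<^sup>+x\<in>B. indicator (W -` A \<inter> space M) x \<partial>M) = (\<integral>\<^sup>+x. indicator ((W -` A \<inter> space M) \<inter> B) x \<partial>M)"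
        by (intro nn_integral_cong) (simp add: indicator_inter_arith)
      then show ?thesis unfolding int[OF A B] by (subst nn_integral_indicator[symmetric]) auto
    qed
  next
    show "(\<lambda>x. emeasure (\<kappa> x) A) \<in> borel_measurable F"
      using measurable_emeasure_kernel[OF measurable_prob_algebraD[OF \<kappa>] A] .
  qed simp
  moreover have "AE x in M. ennreal (event_prob_given M F (W -` A \<inter> space M) x) = nn_cond_exp M F (indicator (W -` A \<inter> space M)) x"
    by (rule ennreal_event_prob_given) simp
  moreover have "AE x in M. 0 \<le> event_prob_given M F (W -` A \<inter> space M) x \<and> event_prob_given M F (W -` A \<inter> space M) x \<le> 1"
    by (rule event_prob_given_le_1) simp
  ultimately show "AE x in M. measure (\<kappa> x) A = event_prob_given M F (W -` A \<inter> space M) x"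
    by eventually_elim (simp add: measure_def, metis enn2real_ennreal)
qed

lemma regular_cond_distrD:
  fixes W :: "'a \<Rightarrow> 'b::euclidean_space"
  assumes r: "regular_cond_distr M F W \<kappa>" and [measurable]: "W \<in> borel_measurable M"
    and g: "g \<in> borel_measurable borel"
  shows "AE x in M. (\<integral>\<^sup>+w. g w \<partial>\<kappa> x) = nn_cond_exp M F (\<lambda>x. g (W x)) x"
proof -
  have \<kappa>: "\<kappa> \<in> F \<rightarrow>\<^sub>M prob_algebra borel" using r by (auto simp: regular_cond_distr_def)
  then have \<kappa>': "\<kappa> \<in> F \<rightarrow>\<^sub>M subprob_algebra borel" by (rule measurable_prob_algebraD)
  have meas [measurable]: "(\<lambda>x. \<integral>\<^sup>+w. g w \<partial>\<kappa> x) \<in> borel_measurable F" if "g \<in> borel_measurable borel" for g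
    using measurable_compose[OF \<kappa>' nn_integral_measurable_subprob_algebra[OF that]] .
  have [simp]: "sets (\<kappa> x) = sets borel" "prob_space (\<kappa> x)" if "x \<in> space M" for x
    using measurable_space[OF \<kappa>] that by (auto simp: space_prob_algebra space_F)
  have mc: "h \<in> borel_measurable borel \<Longrightarrow> x \<in> space M \<Longrightarrow> h \<in> borel_measurable (\<kappa> x)" for h :: "'b \<Rightarrow> ennreal" and x
    by (subst measurable_cong_sets[of _ borel _ borel]) auto
  show ?thesis
    using g
  proof (induction rule: borel_measurable_induct)
    case (cong f g)
    then show ?case by simp
  next
    case (set A)
    have [measurable]: "W -` A \<inter> space M \<in> sets M" using set by measurable
    have "AE x in M. measure (\<kappa> x) A = event_prob_given M F (W -` A \<inter> space M) x"
      using r set by (auto simp: regular_cond_distr_def)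
    moreover have "AE x in M. ennreal (event_prob_given M F (W -` A \<inter> space M) x) = nn_cond_exp M F (indicator (W -` A \<inter> space M)) x"
      by (rule ennreal_event_prob_given) simp
    moreover have "AE x in M. nn_cond_exp M F (indicator (W -` A \<inter> space M)) x = nn_cond_exp M F (\<lambda>x. indicator A (W x)) x"
      using set by (intro nn_cond_exp_cong) (auto simp: indicator_def)
    moreover have "AE x in M. (\<integral>\<^sup>+w. indicator A w \<partial>\<kappa> x) = ennreal (measure (\<kappa> x) A)"
    proof (rule AE_I2)
      fix x assume x: "x \<in> space M"
      interpret k: prob_space "\<kappa> x" using x by simp
      show "(\<integral>\<^sup>+w. indicator A w \<partial>\<kappa> x) = ennreal (measure (\<kappa> x) A)"
        using set x by (simp add: k.emeasure_eq_measure)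
    qed
    ultimately show ?case by eventually_elim simp
  next
    case (mult u c)
    have "AE x in M. c * nn_cond_exp M F (\<lambda>x. u (W x)) x = nn_cond_exp M F (\<lambda>x. c * u (W x)) x"
      using mult.hyps by (intro nn_cond_exp_prod[of "\<lambda>_. c"]) auto
    then show ?case using mult.IH AE_space
    proof eventually_elim
      case (elim x)
      have "u \<in> borel_measurable (\<kappa> x)" using mc[OF mult.hyps(2)] elim by simp
      then show ?case using elim by (simp add: nn_integral_cmult)
    qed
  next
    case (add u v)
    have "AE x in M. nn_cond_exp M F (\<lambda>x. v (W x)) x + nn_cond_exp M F (\<lambda>x. u (W x)) x
       = nn_cond_exp M F (\<lambda>x. v (W x) + u (W x)) x"
      using add.hyps by (intro nn_cond_exp_sum) auto
    then show ?case using add.IH AE_space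
    proof eventually_elim
      case (elim x)
      have "u \<in> borel_measurable (\<kappa> x)" "v \<in> borel_measurable (\<kappa> x)"
        using mc[OF add.hyps(1)] mc[OF add.hyps(3)] elim by simp_all
      then show ?case using elim by (simp add: nn_integral_add)
    qed
  next
    case (seq U)
    have "AE x in M. (SUP i. nn_cond_exp M F (\<lambda>x. U i (W x)) x) = nn_cond_exp M F (\<lambda>x. (SUP i. U i) (W x)) x"
    proof (rule nn_cond_exp_monotone_convergence)
      show "(\<lambda>x. U i (W x)) \<in> borel_measurable M" for i using seq.hyps(1)[of i] by simp
      show "incseq (\<lambda>i. U i (W x))" for x using seq.hyps(3) by (auto simp: incseq_def le_fun_def)
    qed (simp add: image_comp)
    moreover have "AE x in M. \<forall>i. (\<integral>\<^sup>+w. U i w \<partial>\<kappa> x) = nn_cond_exp M F (\<lambda>x. U i (W x)) x"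
      using seq.IH unfolding AE_all_countable by auto
    ultimately show ?case using AE_space
    proof eventually_elim
      case (elim x)
      have "(\<integral>\<^sup>+w. (SUP i. U i) w \<partial>\<kappa> x) = (SUP i. \<integral>\<^sup>+w. U i w \<partial>\<kappa> x)"
        unfolding SUP_apply
        by (rule nn_integral_monotone_convergence_SUP[OF seq.hyps(3)]) (rule mc[OF seq.hyps(1)], use elim in simp)
      then show ?case using elim by simp
    qed
  qed
qed


end

context prob_subalgebra
begin

lemma event_prob_given_F_meas:
  assumes A: "A \<in> sets F"
  shows "AE x in M. event_prob_given M F A x = indicator A x"
proof -
  have [measurable]: "A \<in> sets M" using A by (rule sets_F_subset)
  show ?thesis unfolding event_prob_given_def
    using A by (intro real_cond_exp_F_meas integrable_bounded_rv[where B=1]) auto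
qed

text \<open>For a real variable the regular conditional distribution is read off the conditional
  distribution function along the rationals, which off a null set is monotone with the limits 0 and 1.\<close>

lemma regular_cond_distr_exists_real:
  assumes [measurable]: "W \<in> borel_measurable M"
  shows "\<exists>\<kappa>. regular_cond_distr M F (W :: 'a \<Rightarrow> real) \<kappa>"
proof -
  define E where "E r = {x \<in> space M. W x \<le> r}" for r
  have [measurable]: "E r \<in> sets M" for r unfolding E_def by measurable
  define T where "T q x = event_prob_given M F (E (real_of_rat q)) x" for q x
  have T_meas [measurable]: "T q \<in> borel_measurable F" for q
    unfolding T_def event_prob_given_def by measurable
  define good where "good = {x \<in> space F. (\<forall>q q'. q \<le> q' \<longrightarrow> T q x \<le> T q' x) \<and> (\<forall>q. 0 \<le> T q x \<and> T q x \<le> 1) \<and>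
     (\<lambda>n. T (- rat_of_nat n) x) \<longlonglongrightarrow> 0 \<and> (\<lambda>n. T (rat_of_nat n) x) \<longlonglongrightarrow> 1}"
  have good_F [measurable]: "good \<in> sets F"
    unfolding good_def by measurable
  have AE_good: "AE x in M. x \<in> good"
  proof -
    have "AE x in M. \<forall>q q'. q \<le> q' \<longrightarrow> T q x \<le> T q' x"
      unfolding AE_all_countable
    proof (intro allI)
      fix q q' :: rat
      show "AE x in M. q \<le> q' \<longrightarrow> T q x \<le> T q' x"
      proof (cases "q \<le> q'")
        case True
        then have "E (of_rat q) \<subseteq> E (of_rat q')"
          by (auto simp: E_def) (meson of_rat_less_eq order_trans)
        then have "AE x in M. T q x \<le> T q' x"
          unfolding T_def by (intro event_prob_given_mono) auto
        then show ?thesis by auto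
      qed simp
    qed
    moreover have "AE x in M. \<forall>q. 0 \<le> T q x \<and> T q x \<le> 1"
      unfolding AE_all_countable T_def by (intro allI event_prob_given_le_1) simp
    moreover have "AE x in M. (\<lambda>n. T (- rat_of_nat n) x) \<longlonglongrightarrow> 0"
    proof -
      have "AE x in M. (\<lambda>n. T (- rat_of_nat n) x) \<longlonglongrightarrow> event_prob_given M F (\<Inter>n. E (- real n)) x"
        unfolding T_def of_rat_minus of_rat_of_nat_eq
        by (rule event_prob_given_decseq) (auto simp: decseq_def E_def)
      moreover have "(\<Inter>n. E (- real n)) = {}"
        by (auto simp: E_def) (metis le_minus_iff linorder_not_le reals_Archimedean2)
      moreover have "AE x in M. event_prob_given M F {} x = 0"
        using event_prob_given_F_meas[of "{}"] by simp
      ultimately show ?thesis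
        by (elim AE_mp) simp
    qed
    moreover have "AE x in M. (\<lambda>n. T (rat_of_nat n) x) \<longlonglongrightarrow> 1"
    proof -
      have "AE x in M. (\<lambda>n. T (rat_of_nat n) x) \<longlonglongrightarrow> event_prob_given M F (\<Union>n. E (real n)) x"
        unfolding T_def of_rat_of_nat_eq
        by (rule event_prob_given_incseq) (auto simp: incseq_def E_def)
      moreover have "(\<Union>n. E (real n)) = space M"
        by (auto simp: E_def intro: real_arch_simple)
      moreover have "AE x in M. event_prob_given M F (space M) x = 1"
        using event_prob_given_F_meas[of "space M"] AE_space
        by (auto simp: space_F[symmetric] elim!: AE_mp)
      ultimately show ?thesis
        by (elim AE_mp) simp
    qed
    ultimately show ?thesis using AE_space
      by eventually_elim (auto simp: good_def space_F)
  qed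
  define R where "R t = {q. t < real_of_rat q}" for t
  have R_ne: "R t \<noteq> {}" for t unfolding R_def using of_rat_dense[of t "t+1"] by auto
  \<comment> \<open>The infimum over rationals to the right makes the function right continuous; off the good set any
    distribution function will do, here that of the point mass at 0.\<close>
  define G where "G x t = (if x \<in> good then (INF q\<in>R t. T q x) else (if t < 0 then 0 else 1))" for x t
  have T_bdd: "bdd_below ((\<lambda>q. T q x) ` R t)" if "x \<in> good" for x t
    using that by (auto simp: good_def intro!: bdd_belowI2[where m=0])
  have G_T: "G x t \<le> T q x" if "x \<in> good" "t < of_rat q" for x t q
    using that T_bdd unfolding G_def by (auto intro!: cINF_lower simp: R_def)
  have T_G: "T q x \<le> G x t" if "x \<in> good" "of_rat q \<le> t" for x t q
  proof -
    have "T q x \<le> (INF q\<in>R t. T q x)"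
    proof (rule cINF_greatest[OF R_ne])
      fix q' assume "q' \<in> R t"
      then have "real_of_rat q < of_rat q'" using that by (auto simp: R_def)
      then have "q \<le> q'" by (simp add: of_rat_less)
      then show "T q x \<le> T q' x" using that by (auto simp: good_def)
    qed
    then show ?thesis using that by (simp add: G_def)
  qed
  have G_mono: "G x s \<le> G x t" if "s \<le> t" for x s t
  proof (cases "x \<in> good")
    case True
    then show ?thesis unfolding G_def using that T_bdd R_ne
      by (auto intro!: cINF_superset_mono simp: R_def)
  qed (use that in \<open>auto simp: G_def\<close>)
  have G_right: "continuous (at_right t) (G x)" for x t
  proof (subst continuous_at_right_real_increasing)
    show "G x s \<le> G x t" if "s \<le> t" for s t by (rule G_mono) fact
    show "\<forall>e>0. \<exists>d>0. G x (t + d) - G x t < e"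
    proof (intro allI impI)
      fix e :: real assume e: "0 < e"
      show "\<exists>d>0. G x (t + d) - G x t < e"
      proof (cases "x \<in> good")
        case True
        have "(INF q\<in>R t. T q x) < G x t + e" using True e by (simp add: G_def)
        then have "\<exists>q\<in>R t. T q x < G x t + e"
          by (simp add: cINF_less_iff[OF R_ne T_bdd[OF True]])
        then obtain q where q: "t < of_rat q" "T q x < G x t + e" by (auto simp: R_def)
        define d where "d = (of_rat q - t) / 2"
        have "d > 0" "t + d < of_rat q" using q by (auto simp: d_def field_simps)
        then show ?thesis using G_T[OF True, of "t + d" q] q by (intro exI[of _ d]) auto
      next
        case False
        then show ?thesis using e
          by (intro exI[of _ "if t < 0 then - t / 2 else 1"]) (auto simp: G_def)
      qed
    qed
  qed
  have G_bounds: "0 \<le> G x t" "G x t \<le> 1" for x t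
  proof -
    show "0 \<le> G x t" unfolding G_def using R_ne by (auto intro!: cINF_greatest simp: good_def)
    obtain q where "t < of_rat q" using R_ne[of t] by (auto simp: R_def)
    then show "G x t \<le> 1" using G_T[of x t q] by (auto simp: G_def good_def intro: order_trans)
  qed
  have G_bot: "(G x \<longlongrightarrow> 0) at_bot" for x
  proof (cases "x \<in> good")
    case True
    show ?thesis
    proof (rule order_tendstoI)
      fix a :: real assume "a < 0"
      then show "\<forall>\<^sub>F t in at_bot. a < G x t" using G_bounds(1)[of x] by (auto intro: always_eventually order.strict_trans2)
    next
      fix a :: real assume a: "0 < a"
      have "(\<lambda>n. T (- rat_of_nat n) x) \<longlonglongrightarrow> 0" using True by (auto simp: good_def)
      then have "\<forall>\<^sub>F n in sequentially. T (- rat_of_nat n) x < a" using a by (rule order_tendstoD)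
      then obtain n where "T (- rat_of_nat n) x < a" by (auto simp: eventually_sequentially)
      then have "G x t < a" if "t < - real n" for t
        using G_T[OF True, of t "- rat_of_nat n"] that by (auto simp: of_rat_minus)
      then show "\<forall>\<^sub>F t in at_bot. G x t < a" by (auto simp: eventually_at_bot_dense)
    qed
  next
    case False
    have "\<forall>\<^sub>F t in at_bot. G x t = 0"
      using False by (auto simp: eventually_at_bot_dense G_def intro!: exI[of _ 0])
    then show ?thesis by (rule tendsto_eventually)
  qed
  have G_top: "(G x \<longlongrightarrow> 1) at_top" for x
  proof (cases "x \<in> good")
    case True
    show ?thesis
    proof (rule order_tendstoI)
      fix a :: real assume "1 < a"
      then show "\<forall>\<^sub>F t in at_top. G x t < a" using G_bounds(2)[of x] by (auto intro: always_eventually order.strict_trans1)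
    next
      fix a :: real assume a: "a < 1"
      have "(\<lambda>n. T (rat_of_nat n) x) \<longlonglongrightarrow> 1" using True by (auto simp: good_def)
      then have "\<forall>\<^sub>F n in sequentially. a < T (rat_of_nat n) x" using a by (rule order_tendstoD)
      then obtain n where "a < T (rat_of_nat n) x" by (auto simp: eventually_sequentially)
      then have "a < G x t" if "real n \<le> t" for t
        using T_G[OF True, of "rat_of_nat n" t] that by auto
      then show "\<forall>\<^sub>F t in at_top. a < G x t" by (auto simp: eventually_at_top_linorder)
    qed
  next
    case False
    have "\<forall>\<^sub>F t in at_top. G x t = 1"
      using False by (auto simp: eventually_at_top_linorder G_def intro!: exI[of _ 0])
    then show ?thesis by (rule tendsto_eventually)
  qed
  have G_meas [measurable]: "(\<lambda>x. G x t) \<in> borel_measurable F" for t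
  proof -
    have "(\<lambda>x. (INF q\<in>R t. if x \<in> good then T q x else (if t < 0 then 0 else 1))) \<in> borel_measurable F"
    proof (rule borel_measurable_cINF)
      show "countable (R t)" by simp
      show "bdd_below ((\<lambda>q. if x \<in> good then T q x else if t < 0 then 0 else 1) ` R t)" for x
        by (cases "x \<in> good") (use T_bdd in auto)
    qed measurable
    moreover have "(INF q\<in>R t. if x \<in> good then T q x else (if t < 0 then 0 else 1)) = G x t" for x
      using R_ne by (cases "x \<in> good") (auto simp: G_def)
    ultimately show ?thesis by simp
  qed
  define \<kappa> where "\<kappa> x = interval_measure (G x)" for x
  have \<kappa>_real: "real_distribution (\<kappa> x)" for x
    unfolding \<kappa>_def by (intro real_distribution_interval_measure G_mono G_right G_bot G_top)
  have \<kappa>_Iic: "emeasure (\<kappa> x) {..t} = G x t" for x t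
    unfolding \<kappa>_def by (intro emeasure_interval_measure_Iic G_mono G_right G_bot)
  have \<kappa>_prob: "prob_space (\<kappa> x)" "sets (\<kappa> x) = sets borel" for x
    using \<kappa>_real[of x] by (auto simp: real_distribution_def real_distribution_axioms_def)
  have gen: "sets borel = sigma_sets UNIV (range (atMost :: real \<Rightarrow> real set))"
    by (subst borel_eq_atMost) (simp add: full_SetCompr_eq)
  have stab: "Int_stable (range (atMost :: real \<Rightarrow> real set))"
    by (auto simp: Int_stable_def)
  have \<kappa>_meas: "\<kappa> \<in> F \<rightarrow>\<^sub>M prob_algebra borel"
    by (rule measurable_prob_algebra_generated[OF gen stab])
       (auto simp: \<kappa>_prob \<kappa>_Iic)
  have emeas_meas: "(\<lambda>x. emeasure (\<kappa> x) A) \<in> borel_measurable F" if "A \<in> sets borel" for A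
    using measurable_emeasure_kernel[OF measurable_prob_algebraD[OF \<kappa>_meas] that] .
  have Iic: "AE x in M. G x t = event_prob_given M F (E t) x" for t
  proof -
    have "\<exists>q. t < real_of_rat q \<and> of_rat q < t + inverse (real (Suc n))" for n
      by (rule of_rat_dense) simp
    then obtain q0 where q0: "t < real_of_rat (q0 n)" "of_rat (q0 n) < t + inverse (real (Suc n))" for n
      by metis
    define q where "q n = Min (q0 ` {..n})" for n
    have q: "t < real_of_rat (q n)" "of_rat (q n) < t + inverse (real (Suc n))" for n
    proof -
      have "q n \<in> q0 ` {..n}" unfolding q_def by (rule Min_in) auto
      then show "t < real_of_rat (q n)" using q0 by auto
      have "q n \<le> q0 n" unfolding q_def by (rule Min_le) auto
      then show "of_rat (q n) < t + inverse (real (Suc n))"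
        using q0(2)[of n] by (meson of_rat_less_eq order_le_less_trans)
    qed
    have q_dec: "q n \<le> q m" if "m \<le> n" for m n
      unfolding q_def using that by (intro Min_antimono) auto
    have "AE x in M. (\<lambda>n. event_prob_given M F (E (of_rat (q n))) x) \<longlonglongrightarrow> event_prob_given M F (\<Inter>n. E (of_rat (q n))) x"
    proof (rule event_prob_given_decseq)
      show "decseq (\<lambda>n. E (of_rat (q n)))"
        using q_dec by (auto simp: decseq_def E_def) (meson of_rat_less_eq order_trans)
    qed simp
    moreover have "(\<Inter>n. E (of_rat (q n))) = E t"
    proof -
      have "W x \<le> t" if "\<And>n. W x \<le> of_rat (q n)" for x
      proof (rule field_le_epsilon)
        fix e :: real assume "0 < e"
        then obtain n where "inverse (real (Suc n)) < e" using reals_Archimedean by blast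
        then show "W x \<le> t + e" using that[of n] q(2)[of n] by linarith
      qed
      then show ?thesis using q(1) by (force simp: E_def intro: order_trans less_imp_le)
    qed
    ultimately have "AE x in M. (\<lambda>n. T (q n) x) \<longlonglongrightarrow> event_prob_given M F (E t) x"
      by (simp add: T_def)
    then show ?thesis using AE_good
    proof eventually_elim
      case (elim x)
      have "(\<lambda>n. T (q n) x) \<longlonglongrightarrow> G x t"
      proof (rule order_tendstoI)
        fix a assume "a < G x t"
        then show "\<forall>\<^sub>F n in sequentially. a < T (q n) x"
          using G_T[OF elim(2) q(1)] by (auto intro: always_eventually order.strict_trans2)
      next
        fix a assume "G x t < a"
        then have "(INF q\<in>R t. T q x) < a" using elim(2) by (simp add: G_def)
        then have "\<exists>p\<in>R t. T p x < a"
          by (simp add: cINF_less_iff[OF R_ne T_bdd[OF elim(2)]])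
        then obtain p where p: "t < of_rat p" "T p x < a" by (auto simp: R_def)
        then obtain n where n: "inverse (real (Suc n)) < of_rat p - t"
          using reals_Archimedean[of "of_rat p - t"] by auto
        have "T (q m) x < a" if "n \<le> m" for m
        proof -
          have "q m \<le> q n" using that by (rule q_dec)
          moreover have "q n \<le> p"
            using q(2)[of n] n by (metis add.commute less_diff_eq less_eq_rat_def of_rat_less order_less_trans)
          ultimately have "T (q m) x \<le> T p x" using elim(2) by (auto simp: good_def)
          then show ?thesis using p by simp
        qed
        then show "\<forall>\<^sub>F n in sequentially. T (q n) x < a" by (auto simp: eventually_sequentially)
      qed
      with elim(1) show ?case by (rule LIMSEQ_unique[rotated])
    qed
  qed
  have "regular_cond_distr M F W \<kappa>"
  proof (rule regular_cond_distrI[OF \<kappa>_meas])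
    fix A :: "real set" and B assume A: "A \<in> sets borel" and B [measurable]: "B \<in> sets F"
    then have [measurable]: "B \<in> sets M" by (intro sets_F_subset)
    note A
    then have memb: "A \<in> sigma_sets UNIV (range (atMost :: real \<Rightarrow> real set))" by (simp add: gen)
    have "range (atMost :: real \<Rightarrow> real set) \<subseteq> Pow UNIV" by simp
    from stab this memb show "(\<integral>\<^sup>+x\<in>B. emeasure (\<kappa> x) A \<partial>M) = emeasure M ((W -` A \<inter> space M) \<inter> B)"
    proof (induction rule: sigma_sets_induct_disjoint)
      case (basic A)
      then obtain t where t: "A = {..t}" by auto
      have "W -` {..t} \<inter> space M = E t" by (auto simp: E_def)
      moreover have "(\<integral>\<^sup>+x\<in>B. emeasure (\<kappa> x) {..t} \<partial>M) = (\<integral>\<^sup>+x\<in>B. nn_cond_exp M F (indicator (E t)) x \<partial>M)"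
        using Iic[of t] ennreal_event_prob_given[of "E t"]
        by (intro nn_integral_cong_AE) (auto simp: \<kappa>_Iic elim!: AE_mp)
      ultimately show ?case
        using emeasure_Int_nn_cond_exp[of "E t" B] t by simp
    next
      case empty
      then show ?case by simp
    next
      case (compl A)
      have A: "A \<in> sets borel" using compl gen by simp
      have [measurable]: "W -` A \<inter> space M \<in> sets M" using A by measurable
      have *: "(\<lambda>x. emeasure (\<kappa> x) A) \<in> borel_measurable M"
        using measurable_from_subalg[OF subalg emeas_meas[OF A]] .
      have "(\<integral>\<^sup>+x\<in>B. emeasure (\<kappa> x) (UNIV - A) \<partial>M) = (\<integral>\<^sup>+x. indicator B x - emeasure (\<kappa> x) A * indicator B x \<partial>M)"
      proof (rule nn_integral_cong)
        fix x
        interpret k: prob_space "\<kappa> x" by (rule \<kappa>_prob)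
        have "space (\<kappa> x) = UNIV" using sets_eq_imp_space_eq[OF \<kappa>_prob(2)[of x]] by simp
        then have "emeasure (\<kappa> x) (UNIV - A) = 1 - emeasure (\<kappa> x) A"
          using k.emeasure_space_1 A emeasure_compl[of A "\<kappa> x"] by (simp add: \<kappa>_prob(2))
        then show "emeasure (\<kappa> x) (UNIV - A) * indicator B x = indicator B x - emeasure (\<kappa> x) A * indicator B x"
          by (auto simp: indicator_def)
      qed
      also have "\<dots> = (\<integral>\<^sup>+x. indicator B x \<partial>M) - (\<integral>\<^sup>+x\<in>B. emeasure (\<kappa> x) A \<partial>M)"
      proof (rule nn_integral_diff)
        show "(\<integral>\<^sup>+x\<in>B. emeasure (\<kappa> x) A \<partial>M) \<noteq> \<infinity>"
          unfolding compl by (simp add: emeasure_eq_measure)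
        show "AE x in M. emeasure (\<kappa> x) A * indicator B x \<le> indicator B x"
          using prob_space.emeasure_le_1[OF \<kappa>_prob(1)] by (auto simp: indicator_def)
      qed (use * in auto)
      also have "\<dots> = emeasure M B - emeasure M ((W -` A \<inter> space M) \<inter> B)"
        by (simp add: compl)
      also have "\<dots> = emeasure M (B - (W -` A \<inter> space M) \<inter> B)"
        by (subst emeasure_Diff) (auto simp: emeasure_eq_measure)
      also have "B - (W -` A \<inter> space M) \<inter> B = (W -` (UNIV - A) \<inter> space M) \<inter> B"
        using sets.sets_into_space[OF \<open>B \<in> sets M\<close>] by auto
      finally show ?case .
    next
      case (union A)
      have A: "A i \<in> sets borel" for i using union.hyps gen by auto
      have [measurable]: "W -` A i \<inter> space M \<in> sets M" for i using A[of i] by measurable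
      have *: "(\<lambda>x. emeasure (\<kappa> x) (A i)) \<in> borel_measurable M" for i
        using measurable_from_subalg[OF subalg emeas_meas[OF A]] .
      have "(\<integral>\<^sup>+x\<in>B. emeasure (\<kappa> x) (\<Union>i. A i) \<partial>M) = (\<integral>\<^sup>+x. (\<Sum>i. emeasure (\<kappa> x) (A i) * indicator B x) \<partial>M)"
        using A union.hyps by (intro nn_integral_cong)
          (subst suminf_emeasure[symmetric], auto simp: \<kappa>_prob(2))
      also have "\<dots> = (\<Sum>i. \<integral>\<^sup>+x\<in>B. emeasure (\<kappa> x) (A i) \<partial>M)"
        by (rule nn_integral_suminf) (use * in auto)
      also have "\<dots> = (\<Sum>i. emeasure M ((W -` A i \<inter> space M) \<inter> B))"
        by (simp add: union.IH)
      also have "\<dots> = emeasure M (\<Union>i. (W -` A i \<inter> space M) \<inter> B)"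
        using union.hyps by (intro suminf_emeasure) (auto simp: disjoint_family_on_def)
      also have "(\<Union>i. (W -` A i \<inter> space M) \<inter> B) = (W -` (\<Union>i. A i) \<inter> space M) \<inter> B" by auto
      finally show ?case .
    qed
  qed simp
  then show ?thesis by blast
qed

end

text \<open>With the digits 0 and 1 in base 4, all digits after a position add up to at most a third of the unit
  of that position, so that the digits can be read off by \<open>floor\<close> without ambiguity; in base 2 different sequences could have the same value.\<close>

definition base4_code :: "(nat \<Rightarrow> bool) \<Rightarrow> real" where
  "base4_code b = (\<Sum>n. of_bool (b n) / 4 ^ Suc n)"

lemma summable_base4: "summable (\<lambda>n. of_bool (b n) / 4 ^ Suc n :: real)"
proof (rule summable_comparison_test')
  show "summable (\<lambda>n. (1/4) * (1/4) ^ n :: real)" by (intro summable_mult summable_geometric) auto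
  show "norm (of_bool (b n) / 4 ^ Suc n :: real) \<le> (1/4) * (1/4) ^ n" if "n \<ge> 0" for n
    by (auto simp: power_divide)
qed

lemma base4_code_bounds: "0 \<le> base4_code b" "base4_code b \<le> 1/3"
proof -
  show "0 \<le> base4_code b" unfolding base4_code_def
    by (intro suminf_nonneg summable_base4) auto
  have "base4_code b \<le> (\<Sum>n. (1/4) * (1/4) ^ n :: real)"
    unfolding base4_code_def
    by (intro suminf_le summable_base4 summable_mult summable_geometric) (auto simp: power_divide)
  also have "\<dots> = 1/3"
    by (subst suminf_mult) (auto simp: suminf_geometric)
  finally show "base4_code b \<le> 1/3" .
qed

lemma base4_code_Suc: "4 * base4_code b = of_bool (b 0) + base4_code (\<lambda>n. b (Suc n))"
proof -
  have "base4_code b = of_bool (b 0) / 4 + (\<Sum>n. of_bool (b (Suc n)) / 4 ^ Suc (Suc n))"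
    unfolding base4_code_def using suminf_split_head[OF summable_base4[of b]] by simp
  also have "(\<Sum>n. of_bool (b (Suc n)) / 4 ^ Suc (Suc n) :: real) = (\<Sum>n. (1/4) * (of_bool (b (Suc n)) / 4 ^ Suc n))"
    by (intro suminf_cong) simp
  also have "\<dots> = (1/4) * base4_code (\<lambda>n. b (Suc n))"
    unfolding base4_code_def by (rule suminf_mult[OF summable_base4])
  finally show ?thesis by simp
qed

lemma base4_shift: "\<exists>k::int. 4 ^ n * base4_code b = of_int k + base4_code (\<lambda>i. b (n + i))"
proof (induction n)
  case 0
  show ?case by (intro exI[of _ 0]) simp
next
  case (Suc n)
  then obtain k :: int where k: "4 ^ n * base4_code b = of_int k + base4_code (\<lambda>i. b (n + i))" by auto
  have "4 ^ Suc n * base4_code b = 4 * (4 ^ n * base4_code b)" by simp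
  also have "\<dots> = of_int (4 * k) + 4 * base4_code (\<lambda>i. b (n + i))" unfolding k by simp
  also have "\<dots> = of_int (4 * k + of_bool (b n)) + base4_code (\<lambda>i. b (Suc n + i))"
    unfolding base4_code_Suc by simp
  finally show ?case by blast
qed

lemma base4_digit: "odd \<lfloor>4 ^ Suc n * base4_code b\<rfloor> \<longleftrightarrow> b n"
proof -
  obtain k :: int where k: "4 ^ n * base4_code b = of_int k + base4_code (\<lambda>i. b (n + i))"
    using base4_shift by blast
  have "4 ^ Suc n * base4_code b = 4 * (4 ^ n * base4_code b)" by simp
  also have "\<dots> = of_int (4 * k) + 4 * base4_code (\<lambda>i. b (n + i))" unfolding k by simp
  also have "\<dots> = of_int (4 * k + of_bool (b n)) + base4_code (\<lambda>i. b (Suc n + i))"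
    unfolding base4_code_Suc by simp
  finally have "\<lfloor>4 ^ Suc n * base4_code b\<rfloor> = 4 * k + of_bool (b n)"
    using base4_code_bounds[of "\<lambda>i. b (Suc n + i)"] by (intro floor_unique) auto
  then show ?thesis by simp
qed

text \<open>A Borel coding of a Euclidean space by real numbers with a Borel left inverse: a point is
  recovered from the bits telling which rational half spaces contain it.\<close>

lemma euclidean_borel_coding:
  "\<exists>(c :: 'b::euclidean_space \<Rightarrow> real) d. c \<in> borel_measurable borel \<and> d \<in> borel_measurable borel \<and> (\<forall>x. d (c x) = x)"
proof -
  define e where "e = from_nat_into ((Basis :: 'b set) \<times> (UNIV :: rat set))"
  have e: "range e = (Basis :: 'b set) \<times> (UNIV :: rat set)"
    unfolding e_def
  proof (rule range_from_nat_into)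
    show "countable ((Basis :: 'b set) \<times> (UNIV :: rat set))"
      by (rule countable_SIGMA) (simp_all add: countable_finite)
  qed (use nonempty_Basis in auto)
  define bit where "bit x n \<longleftrightarrow> real_of_rat (snd (e n)) < x \<bullet> fst (e n)" for x :: 'b and n
  define c where "c x = base4_code (bit x)" for x :: 'b
  define dig where "dig y n \<longleftrightarrow> odd \<lfloor>4 ^ Suc n * y\<rfloor>" for y :: real and n
  define s where "s i y = (SUP n. if fst (e n) = i \<and> dig y n then ereal (of_rat (snd (e n))) else - \<infinity>)"
    for i :: 'b and y :: real
  define d where "d y = (\<Sum>i\<in>Basis. real_of_ereal (s i y) *\<^sub>R i)" for y :: real
  have [measurable]: "Measurable.pred borel (\<lambda>y. dig y n)" for n
    unfolding dig_def by measurable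
  have "c \<in> borel_measurable borel"
    unfolding c_def base4_code_def bit_def of_bool_def by measurable
  moreover have "d \<in> borel_measurable borel"
    unfolding d_def s_def by measurable
  moreover have "d (c x) = x" for x
  proof -
    have dig: "dig (c x) n = bit x n" for n unfolding dig_def c_def by (rule base4_digit)
    have "s i (c x) = ereal (x \<bullet> i)" if i: "i \<in> Basis" for i
    proof (rule antisym)
      show "s i (c x) \<le> ereal (x \<bullet> i)"
        unfolding s_def by (intro SUP_least) (auto simp: dig bit_def)
      show "ereal (x \<bullet> i) \<le> s i (c x)"
      proof (rule ereal_le_real)
        show "ereal (x \<bullet> i) \<le> ereal z" if "s i (c x) \<le> ereal z" for z
        proof (rule ccontr)
          assume "\<not> ?thesis"
          then have "z < x \<bullet> i" by simp
          then obtain q where q: "z < of_rat q" "of_rat q < x \<bullet> i" using of_rat_dense by blast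
          obtain n where n: "e n = (i, q)" using e i by (metis (no_types, lifting) SigmaI UNIV_I imageE)
          have "ereal (of_rat q) \<le> s i (c x)"
            unfolding s_def by (rule SUP_upper2[of n]) (use n q in \<open>auto simp: dig bit_def\<close>)
          then have "ereal (of_rat q) \<le> ereal z" using that by (rule order_trans)
          with q show False by simp
        qed
      qed
    qed
    then show ?thesis unfolding d_def by (simp add: euclidean_representation)
  qed
  ultimately show ?thesis by blast
qed

context prob_subalgebra
begin

text \<open>The kernel of the real code, pushed forward along the decoding.\<close>

lemma regular_cond_distr_exists:
  fixes W :: "'a \<Rightarrow> 'b::euclidean_space"
  assumes [measurable]: "W \<in> borel_measurable M"
  shows "\<exists>\<kappa>. regular_cond_distr M F W \<kappa>"
proof -
  obtain c :: "'b \<Rightarrow> real" and d where [measurable]: "c \<in> borel_measurable borel" "d \<in> borel_measurable borel"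
    and dc: "\<And>x. d (c x) = x"
    using euclidean_borel_coding by blast
  obtain \<kappa> where \<kappa>: "regular_cond_distr M F (\<lambda>x. c (W x)) \<kappa>"
    using regular_cond_distr_exists_real[of "\<lambda>x. c (W x)"] by auto
  have \<kappa>_meas: "\<kappa> \<in> F \<rightarrow>\<^sub>M prob_algebra borel"
    using \<kappa> by (simp add: regular_cond_distr_def)
  have "regular_cond_distr M F W (\<lambda>x. distr (\<kappa> x) borel d)"
    unfolding regular_cond_distr_def
  proof (intro conjI ballI)
    show "(\<lambda>x. distr (\<kappa> x) borel d) \<in> F \<rightarrow>\<^sub>M prob_algebra borel"
      using measurable_compose[OF \<kappa>_meas measurable_distr_prob_space[of d borel borel]] by simp
    fix A :: "'b set" assume A: "A \<in> sets borel"
    have dA: "d -` A \<in> sets borel" using measurable_sets[of d borel borel A] A by simp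
    have "AE x in M. measure (\<kappa> x) (d -` A) = event_prob_given M F ((\<lambda>x. c (W x)) -` (d -` A) \<inter> space M) x"
      using \<kappa> dA by (simp add: regular_cond_distr_def)
    moreover have "(\<lambda>x. c (W x)) -` (d -` A) \<inter> space M = W -` A \<inter> space M" by (auto simp: dc)
    moreover have "measure (distr (\<kappa> x) borel d) A = measure (\<kappa> x) (d -` A)" if "x \<in> space M" for x
    proof -
      have s: "sets (\<kappa> x) = sets borel"
        using measurable_space[OF \<kappa>_meas] that by (auto simp: space_prob_algebra space_F)
      then have "d \<in> \<kappa> x \<rightarrow>\<^sub>M borel" by (subst measurable_cong_sets[of _ borel _ borel]) auto
      then show ?thesis using A sets_eq_imp_space_eq[OF s] by (simp add: measure_distr)
    qed
    ultimately show "AE x in M. measure (distr (\<kappa> x) borel d) A = event_prob_given M F (W -` A \<inter> space M) x"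
      using AE_space by auto
  qed
  then show ?thesis by blast
qed

lemma cond_law:
  fixes W :: "'a \<Rightarrow> 'b::euclidean_space"
  assumes "W \<in> borel_measurable M"
  shows "regular_cond_distr M F W (cond_law M F W)"
  unfolding cond_law_def using regular_cond_distr_exists[OF assms] by (rule someI_ex)

lemma cond_law_measurable:
  fixes W :: "'a \<Rightarrow> 'b::euclidean_space"
  assumes "W \<in> borel_measurable M"
  shows "cond_law M F W \<in> M \<rightarrow>\<^sub>M prob_algebra borel"
  using cond_law[OF assms] measurable_from_subalg[OF subalg]
  by (auto simp: regular_cond_distr_def)

lemma measurable_cond_expect:
  fixes W :: "'a \<Rightarrow> 'b::euclidean_space"
  assumes "W \<in> borel_measurable M"
  shows "cond_expect M F W \<in> borel_measurable M"
  unfolding cond_expect_def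
  by (rule measurable_compose[OF measurable_prob_algebraD[OF cond_law_measurable[OF assms]] integral_measurable_subprob_algebra])
     simp

lemma measurable_cond_nn_expect:
  assumes "W \<in> borel_measurable M"
  shows "cond_nn_expect M F W \<in> borel_measurable M"
  unfolding cond_nn_expect_def
  by (rule measurable_compose[OF measurable_prob_algebraD[OF cond_law_measurable[OF assms]] nn_integral_measurable_subprob_algebra])
     simp

lemma cond_nn_expect_eq:
  assumes "W \<in> borel_measurable M"
  shows "AE x in M. cond_nn_expect M F W x = nn_cond_exp M F (\<lambda>x. ennreal (W x)) x"
  unfolding cond_nn_expect_def by (rule regular_cond_distrD[OF cond_law[OF assms] assms]) simp

lemma cond_law_borel_measurable:
  fixes W :: "'a \<Rightarrow> 'b::euclidean_space"
  assumes "W \<in> borel_measurable M" "x \<in> space M" "g \<in> borel_measurable borel"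
  shows "g \<in> borel_measurable (cond_law M F W x)"
  using measurable_space[OF cond_law_measurable[OF assms(1)] assms(2)] assms(3)
  by (subst measurable_cong_sets[of _ borel _ borel]) (auto simp: space_prob_algebra)

lemma AE_integrable_cond_law:
  fixes W :: "'a \<Rightarrow> 'b::euclidean_space"
  assumes [measurable]: "W \<in> borel_measurable M"
    and fin: "AE x in M. nn_cond_exp M F (\<lambda>x. ennreal (norm (W x))) x < \<infinity>"
  shows "AE x in M. integrable (cond_law M F W x) (\<lambda>w. w)"
proof -
  have "AE x in M. (\<integral>\<^sup>+w. ennreal (norm w) \<partial>cond_law M F W x) = nn_cond_exp M F (\<lambda>x. ennreal (norm (W x))) x"
    by (rule regular_cond_distrD[OF cond_law]) auto
  with fin AE_space show ?thesis
    by eventually_elim (auto intro!: integrableI_bounded cond_law_borel_measurable)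
qed

lemma cond_expect_component:
  fixes W :: "'a \<Rightarrow> real^'k"
  assumes [measurable]: "W \<in> borel_measurable M"
    and fin: "AE x in M. nn_cond_exp M F (\<lambda>x. ennreal (norm (W x))) x < \<infinity>"
  shows "AE x in M. cond_expect M F W x $ i = real_cond_exp M F (\<lambda>x. W x $ i) x"
proof -
  have "AE x in M. (\<integral>\<^sup>+w. ennreal (w $ i) \<partial>cond_law M F W x) = nn_cond_exp M F (\<lambda>x. ennreal (W x $ i)) x"
    by (rule regular_cond_distrD[OF cond_law]) auto
  moreover have "AE x in M. (\<integral>\<^sup>+w. ennreal (- (w $ i)) \<partial>cond_law M F W x) = nn_cond_exp M F (\<lambda>x. ennreal (- (W x $ i))) x"
    by (rule regular_cond_distrD[OF cond_law]) auto
  moreover note AE_integrable_cond_law[OF assms]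
  ultimately show ?thesis
  proof eventually_elim
    case (elim x)
    have i: "integrable (cond_law M F W x) (\<lambda>w. w $ i)"
      using integrable_bounded_linear[OF bounded_linear_vec_nth elim(3)] by simp
    have "cond_expect M F W x $ i = (\<integral>w. w $ i \<partial>cond_law M F W x)"
      unfolding cond_expect_def by (rule integral_bounded_linear[OF bounded_linear_vec_nth elim(3), symmetric])
    also have "\<dots> = enn2real (\<integral>\<^sup>+w. ennreal (w $ i) \<partial>cond_law M F W x) - enn2real (\<integral>\<^sup>+w. ennreal (- (w $ i)) \<partial>cond_law M F W x)"
      by (rule real_lebesgue_integral_def[OF i])
    finally show ?case using elim by (simp add: real_cond_exp_def)
  qed
qed

lemma nn_cond_exp_finite:
  assumes "W \<in> borel_measurable M" "(\<integral>\<^sup>+x. W x \<partial>M) < \<infinity>"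
  shows "AE x in M. nn_cond_exp M F W x < \<infinity>"
proof -
  have "(\<integral>\<^sup>+x. 1 * nn_cond_exp M F W x \<partial>M) = (\<integral>\<^sup>+x. 1 * W x \<partial>M)"
    using assms by (intro nn_cond_exp_intg) auto
  then have "(\<integral>\<^sup>+x. nn_cond_exp M F W x \<partial>M) \<noteq> \<infinity>" using assms by simp
  then have "AE x in M. nn_cond_exp M F W x \<noteq> \<infinity>" by (rule nn_integral_PInf_AE[rotated]) simp
  then show ?thesis by (auto simp: less_top)
qed

lemma cond_expect_eq_real_cond_exp:
  fixes W :: "'a \<Rightarrow> real"
  assumes W: "integrable M W"
  shows "AE x in M. cond_expect M F W x = real_cond_exp M F W x"
proof -
  have [measurable]: "W \<in> borel_measurable M" using W by simp
  have "AE x in M. (\<integral>\<^sup>+w. ennreal w \<partial>cond_law M F W x) = nn_cond_exp M F (\<lambda>x. ennreal (W x)) x"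
    by (rule regular_cond_distrD[OF cond_law]) auto
  moreover have "AE x in M. (\<integral>\<^sup>+w. ennreal (- w) \<partial>cond_law M F W x) = nn_cond_exp M F (\<lambda>x. ennreal (- W x)) x"
    by (rule regular_cond_distrD[OF cond_law]) auto
  moreover have "AE x in M. integrable (cond_law M F W x) (\<lambda>w. w)"
    by (intro AE_integrable_cond_law nn_cond_exp_finite) (use W in \<open>auto simp: integrable_iff_bounded\<close>)
  ultimately show ?thesis
    by eventually_elim (simp add: cond_expect_def real_cond_exp_def real_lebesgue_integral_def)
qed

end

section \<open>Change of variables for the rescaled estimator\<close>

lemma nn_integral_lborel_translation:
  fixes t :: "'a::euclidean_space"
  assumes [measurable]: "g \<in> borel_measurable borel"
  shows "(\<integral>\<^sup>+y. g (t + y) \<partial>lborel) = (\<integral>\<^sup>+y. g y \<partial>lborel)"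
proof -
  have "(\<integral>\<^sup>+y. g y \<partial>lborel) = (\<integral>\<^sup>+y. g y \<partial>distr lborel borel ((+) t))"
    by (simp add: lborel_distr_plus)
  also have "\<dots> = (\<integral>\<^sup>+y. g (t + y) \<partial>lborel)"
    by (subst nn_integral_distr) auto
  finally show ?thesis ..
qed

lemma nn_integral_lborel_reflection:
  fixes t :: "'a::euclidean_space"
  assumes [measurable]: "g \<in> borel_measurable borel"
  shows "(\<integral>\<^sup>+y. g (t - y) \<partial>lborel) = (\<integral>\<^sup>+y. g y \<partial>lborel)"
proof -
  have "(\<integral>\<^sup>+y. g y \<partial>lborel) = (\<integral>\<^sup>+y. g y \<partial>density (distr lborel borel (\<lambda>x. t + (-1) *\<^sub>R x)) (\<lambda>_. 1))"
    using lborel_affine[of "-1" t] by simp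
  also have "\<dots> = (\<integral>\<^sup>+y. g (t - y) \<partial>lborel)"
    by (subst nn_integral_density) (auto simp: nn_integral_distr)
  finally show ?thesis ..
qed

text \<open>The image of Lebesgue measure under a linear bijection is again translation invariant, and
  two translation invariant measures are proportional: both sides below are the integral of
  \<open>f (T x) * g y\<close> after the shears \<open>y \<mapsto> T x + y\<close> and \<open>x \<mapsto> x - T' y\<close>.\<close>

lemma nn_integral_lborel_linear_symmetric:
  fixes T T' :: "'a::euclidean_space \<Rightarrow> 'a"
  assumes T: "linear T" and T': "\<And>x. T (T' x) = x"
    and f [measurable]: "f \<in> borel_measurable borel" and g [measurable]: "g \<in> borel_measurable borel"
  shows "(\<integral>\<^sup>+x. f (T x) \<partial>lborel) * (\<integral>\<^sup>+y. g y \<partial>lborel) = (\<integral>\<^sup>+x. g (T x) \<partial>lborel) * (\<integral>\<^sup>+y. f y \<partial>lborel)"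
proof -
  have [measurable]: "T \<in> borel_measurable borel"
    by (intro borel_measurable_continuous_onI linear_continuous_on) (use T in \<open>simp add: linear_conv_bounded_linear\<close>)
  have "(\<integral>\<^sup>+x. f (T x) \<partial>lborel) * (\<integral>\<^sup>+y. g y \<partial>lborel) = (\<integral>\<^sup>+x. (\<integral>\<^sup>+y. f (T x) * g y \<partial>lborel) \<partial>lborel)"
    by (simp add: nn_integral_cmult nn_integral_multc)
  also have "\<dots> = (\<integral>\<^sup>+x. (\<integral>\<^sup>+y. f (T x) * g (T x + y) \<partial>lborel) \<partial>lborel)"
    by (simp add: nn_integral_cmult nn_integral_lborel_translation[of g])
  also have "\<dots> = (\<integral>\<^sup>+y. (\<integral>\<^sup>+x. f (T x) * g (T x + y) \<partial>lborel) \<partial>lborel)"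
    by (rule lborel_pair.Fubini'[symmetric]) measurable
  also have "\<dots> = (\<integral>\<^sup>+y. (\<integral>\<^sup>+x. f (T x - y) * g (T x) \<partial>lborel) \<partial>lborel)"
  proof (rule nn_integral_cong)
    fix y
    have "(\<integral>\<^sup>+x. f (T x) * g (T x + y) \<partial>lborel) = (\<integral>\<^sup>+x. f (T (- T' y + x)) * g (T (- T' y + x) + y) \<partial>lborel)"
      by (rule nn_integral_lborel_translation[symmetric]) measurable
    also have "\<dots> = (\<integral>\<^sup>+x. f (T x - y) * g (T x) \<partial>lborel)"
      by (simp add: linear_diff[OF T] T' algebra_simps)
    finally show "(\<integral>\<^sup>+x. f (T x) * g (T x + y) \<partial>lborel) = \<dots>" .
  qed
  also have "\<dots> = (\<integral>\<^sup>+x. (\<integral>\<^sup>+y. f (T x - y) * g (T x) \<partial>lborel) \<partial>lborel)"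
    by (rule lborel_pair.Fubini') measurable
  also have "\<dots> = (\<integral>\<^sup>+x. g (T x) * (\<integral>\<^sup>+y. f y \<partial>lborel) \<partial>lborel)"
    by (subst mult.commute) (simp add: nn_integral_cmult nn_integral_lborel_reflection[of f])
  also have "\<dots> = (\<integral>\<^sup>+x. g (T x) \<partial>lborel) * (\<integral>\<^sup>+y. f y \<partial>lborel)"
    by (simp add: nn_integral_multc)
  finally show ?thesis .
qed

lemma matrix_inv_inverse:
  fixes A :: "real^'p^'p"
  assumes "invertible A"
  shows "A ** matrix_inv A = mat 1" "matrix_inv A ** A = mat 1"
  using someI_ex[OF assms[unfolded invertible_def]] by (auto simp: matrix_inv_def)

text \<open>In the symmetric formula the indicator of a unit cube as test function yields the constant density
  \<open>k\<close>. Its value, the inverse of the modulus of the determinant, cancels in the estimator.\<close>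

lemma lborel_distr_affine_matrix:
  fixes A :: "real^'p^'p" and t :: "real^'p"
  assumes A: "invertible A"
  shows "\<exists>k>0. distr lborel borel (\<lambda>u. t + A *v u) = density lborel (\<lambda>_. ennreal k)"
proof -
  define T where "T u = A *v u" for u
  define T' where "T' u = matrix_inv A *v u" for u
  have T: "linear T" unfolding T_def by simp
  have T': "T (T' x) = x" for x
    unfolding T_def T'_def using matrix_inv_inverse(1)[OF A] by (simp add: matrix_vector_mul_assoc)
  have T'T: "T' (T x) = x" for x
    unfolding T_def T'_def using matrix_inv_inverse(2)[OF A] by (simp add: matrix_vector_mul_assoc)
  have [measurable]: "T \<in> borel_measurable borel"
    by (intro borel_measurable_continuous_onI linear_continuous_on) (use T in \<open>simp add: linear_conv_bounded_linear\<close>)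
  define B where "B = cbox (0::real^'p) One"
  have B1: "(\<integral>\<^sup>+y. indicator B y \<partial>lborel) = 1"
    by (simp add: B_def emeasure_lborel_cbox_eq)
  define K where "K = (\<integral>\<^sup>+x. indicator B (T x) \<partial>lborel)"
  have K: "(\<integral>\<^sup>+x. f (T x) \<partial>lborel) = K * (\<integral>\<^sup>+y. f y \<partial>lborel)" if [measurable]: "f \<in> borel_measurable borel" for f
    using nn_integral_lborel_linear_symmetric[OF T T' that, of "indicator B"] B1
    by (simp add: B_def K_def)
  have "K \<noteq> 0"
    using K[of "\<lambda>_. 1"] by auto
  moreover have "K < \<infinity>"
  proof -
    have "linear T'" unfolding T'_def by simp
    then have "bounded (T' ` B)"
      by (intro bounded_linear_image) (auto simp: B_def linear_conv_bounded_linear)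
    moreover have "T -` B \<subseteq> T' ` B" by (metis T'T image_eqI subsetI vimageD)
    ultimately have "bounded (T -` B)" by (rule bounded_subset)
    moreover have "K = (\<integral>\<^sup>+x. indicator (T -` B) x \<partial>lborel)" unfolding K_def by (simp add: indicator_def)
    moreover have "T -` B \<in> sets lborel" using measurable_sets[of T borel borel B] by (simp add: B_def)
    ultimately show ?thesis using emeasure_bounded_finite[of "T -` B"] by simp
  qed
  ultimately obtain k where k: "K = ennreal k" "0 < k"
    by (metis ennreal_cases ennreal_0 infinity_ennreal_def le_less less_irrefl)
  have "distr lborel borel (\<lambda>u. t + A *v u) = density lborel (\<lambda>_. ennreal k)"
  proof (rule measure_eqI)
    fix S assume "S \<in> sets (distr lborel borel (\<lambda>u. t + A *v u))"
    then have [measurable]: "S \<in> sets borel" by simp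
    have "emeasure (distr lborel borel (\<lambda>u. t + A *v u)) S = (\<integral>\<^sup>+x. indicator S x \<partial>distr lborel borel (\<lambda>u. t + T u))"
      by (simp add: T_def)
    also have "\<dots> = (\<integral>\<^sup>+x. indicator S (t + T x) \<partial>lborel)"
      by (rule nn_integral_distr) auto
    also have "\<dots> = K * (\<integral>\<^sup>+x. indicator S (t + x) \<partial>lborel)"
      by (rule K[of "\<lambda>x. indicator S (t + x)"]) measurable
    also have "\<dots> = K * emeasure lborel S"
      by (subst nn_integral_lborel_translation) auto
    finally show "emeasure (distr lborel borel (\<lambda>u. t + A *v u)) S = emeasure (density lborel (\<lambda>_. ennreal k)) S"
      by (simp add: emeasure_density nn_integral_cmult k(1))
  qed simp
  with k(2) show ?thesis by blast
qed

lemma integral_affine_matrix: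
  fixes A :: "real^'p^'p" and t :: "real^'p" and F :: "real^'p \<Rightarrow> 'b::{banach, second_countable_topology}"
  assumes k: "0 < k" "distr lborel borel (\<lambda>u. t + A *v u) = density lborel (\<lambda>_. ennreal k)"
    and [measurable]: "F \<in> borel_measurable borel"
  shows "(\<integral>u. F (t + A *v u) \<partial>lborel) = k *\<^sub>R (\<integral>\<theta>. F \<theta> \<partial>lborel)"
proof -
  have m: "(\<lambda>u. t + A *v u) \<in> borel_measurable lborel"
    by (simp, intro borel_measurable_continuous_onI continuous_intros)
  have "(\<integral>u. F (t + A *v u) \<partial>lborel) = (\<integral>\<theta>. F \<theta> \<partial>density lborel (\<lambda>_. ennreal k))"
    unfolding k(2)[symmetric] using m by (subst integral_distr) auto
  also have "\<dots> = (\<integral>\<theta>. k *\<^sub>R F \<theta> \<partial>lborel)"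
    using k(1) by (subst integral_density) auto
  finally show ?thesis by simp
qed

text \<open>Up to the factor \<open>exp (h \<theta>\<^sub>s)\<close>, the density of the quasi posterior in the local coordinate \<open>u\<close>.\<close>

definition quasi_weight :: "(real^'p) set \<Rightarrow> real^'p \<Rightarrow> real^'p^'p \<Rightarrow> (real^'p \<Rightarrow> real) \<Rightarrow> (real^'p \<Rightarrow> real) \<Rightarrow> real^'p \<Rightarrow> real" where
  "quasi_weight \<Theta> \<theta>\<^sub>s A \<rho> z u = indicator (U_set \<Theta> \<theta>\<^sub>s A) u * (z u * \<rho> (\<theta>\<^sub>s + A *v u))"

text \<open>The deterministic data at one index and one elementary event: \<open>h\<close> is the path of the random field
  on the closure of \<open>\<Theta>\<close> and \<open>z\<close> the extended likelihood ratio.\<close>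

locale ratio_path =
  fixes \<Theta> :: "(real^'p) set" and \<theta>\<^sub>s :: "real^'p" and A :: "real^'p^'p"
    and \<rho> :: "real^'p \<Rightarrow> real" and b B :: real and h z :: "real^'p \<Rightarrow> real"
  assumes open_\<Theta>: "open \<Theta>" and bounded_\<Theta>: "bounded \<Theta>" and \<theta>s_in: "\<theta>\<^sub>s \<in> \<Theta>"
    and inv_A: "invertible A" and cont_\<rho>: "continuous_on \<Theta> \<rho>"
    and b_pos: "0 < b" and \<rho>_bounds: "\<And>\<theta>. \<theta> \<in> \<Theta> \<Longrightarrow> b \<le> \<rho> \<theta> \<and> \<rho> \<theta> \<le> B"
    and cont_h: "continuous_on (closure \<Theta>) h"
    and ratio: "ratio_extension \<Theta> \<theta>\<^sub>s A h z"
begin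

abbreviation U where "U \<equiv> U_set \<Theta> \<theta>\<^sub>s A"
abbreviation w where "w \<equiv> quasi_weight \<Theta> \<theta>\<^sub>s A \<rho> z"

lemma cont_affine: "continuous_on S (\<lambda>u. \<theta>\<^sub>s + A *v u)"
  by (intro continuous_intros)

lemma open_U: "open U"
proof -
  have "U = (\<lambda>u. \<theta>\<^sub>s + A *v u) -` \<Theta>" by (auto simp: U_set_def)
  then show ?thesis using open_vimage[OF open_\<Theta> cont_affine] by simp
qed

lemma zero_in_U: "0 \<in> U" using \<theta>s_in by (simp add: U_set_def)

lemma bounded_U: "bounded U"
proof -
  have "U \<subseteq> (\<lambda>\<theta>. matrix_inv A *v (\<theta> - \<theta>\<^sub>s)) ` \<Theta>"
  proof
    fix u assume "u \<in> U"
    moreover have "u = matrix_inv A *v (\<theta>\<^sub>s + A *v u - \<theta>\<^sub>s)"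
      using matrix_inv_inverse(2)[OF inv_A] by (simp add: matrix_vector_mul_assoc)
    ultimately show "u \<in> (\<lambda>\<theta>. matrix_inv A *v (\<theta> - \<theta>\<^sub>s)) ` \<Theta>"
      unfolding U_set_def by blast
  qed
  moreover have "bounded ((\<lambda>\<theta>. matrix_inv A *v (\<theta> - \<theta>\<^sub>s)) ` \<Theta>)"
  proof -
    have "bounded ((\<lambda>u. matrix_inv A *v u) ` ((\<lambda>\<theta>. \<theta> - \<theta>\<^sub>s) ` \<Theta>))"
      by (intro bounded_linear_image bounded_translation_minus bounded_\<Theta>)
         (simp add: linear_conv_bounded_linear[symmetric])
    then show ?thesis by (simp add: image_image)
  qed
  ultimately show ?thesis by (rule bounded_subset[rotated])
qed

lemma z_nonneg: "0 \<le> z u" and cont_z: "continuous_on S z"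
  using ratio unfolding ratio_extension_def by (auto intro: continuous_on_subset)

lemma z_U: "u \<in> U \<Longrightarrow> z u = exp (h (\<theta>\<^sub>s + A *v u) - h \<theta>\<^sub>s)"
  using ratio unfolding ratio_extension_def by auto

lemma z_pos: "u \<in> U \<Longrightarrow> 0 < z u" by (simp add: z_U)

lemma z_zero: "z 0 = 1" using z_U[OF zero_in_U] by simp

lemma z_bounded: "\<exists>K>0. \<forall>u. z u \<le> K"
proof -
  have "compact (closure {u. z u \<noteq> 0})" using ratio unfolding ratio_extension_def by auto
  then have "bounded (z ` closure {u. z u \<noteq> 0})"
    by (intro compact_imp_bounded compact_continuous_image cont_z)
  then obtain K where K: "\<And>u. u \<in> closure {u. z u \<noteq> 0} \<Longrightarrow> \<bar>z u\<bar> \<le> K"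
    by (auto simp: bounded_iff)
  have "z u \<le> max K 1" for u
  proof (cases "z u = 0")
    case False
    then have "u \<in> closure {u. z u \<noteq> 0}" by (intro subsetD[OF closure_subset]) simp
    then show ?thesis using K[of u] by auto
  qed simp
  then show ?thesis by (intro exI[of _ "max K 1"]) auto
qed

lemma borel_z [measurable]: "z \<in> borel_measurable borel"
  by (rule borel_measurable_continuous_onI[OF cont_z])

lemma borel_U [measurable]: "U \<in> sets borel" using open_U by simp

lemma cont_\<rho>_U: "continuous_on U (\<lambda>u. \<rho> (\<theta>\<^sub>s + A *v u))"
  by (intro continuous_on_compose2[OF cont_\<rho>] cont_affine) (auto simp: U_set_def)

lemma borel_w [measurable]: "w \<in> borel_measurable borel"
proof -
  have "(\<lambda>u. indicator U u *\<^sub>R (\<rho> (\<theta>\<^sub>s + A *v u))) \<in> borel_measurable borel"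
    by (rule borel_measurable_continuous_on_indicator[OF borel_U cont_\<rho>_U])
  then have "(\<lambda>u. z u * (indicator U u *\<^sub>R (\<rho> (\<theta>\<^sub>s + A *v u)))) \<in> borel_measurable borel"
    by measurable
  then show ?thesis by (simp add: quasi_weight_def[abs_def] mult_ac)
qed

lemma w_bounds: "u \<in> U \<Longrightarrow> b * z u \<le> w u" "u \<in> U \<Longrightarrow> w u \<le> B * z u" "u \<notin> U \<Longrightarrow> w u = 0" "0 \<le> w u"
proof -
  have *: "u \<in> U \<Longrightarrow> b \<le> \<rho> (\<theta>\<^sub>s + A *v u) \<and> \<rho> (\<theta>\<^sub>s + A *v u) \<le> B"
    using \<rho>_bounds by (auto simp: U_set_def)
  show "u \<in> U \<Longrightarrow> b * z u \<le> w u" "u \<in> U \<Longrightarrow> w u \<le> B * z u" "u \<notin> U \<Longrightarrow> w u = 0"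
    using * z_nonneg[of u] by (auto simp: quasi_weight_def mult.commute[of _ "z u"] intro!: mult_left_mono)
  then show "0 \<le> w u" using b_pos z_nonneg[of u]
    by (cases "u \<in> U") (auto intro: order_trans[OF mult_nonneg_nonneg[of b "z u"]])
qed

lemma B_pos: "0 < B" using \<rho>_bounds[OF \<theta>s_in] b_pos by linarith

lemma integrable_U:
  fixes g :: "real^'p \<Rightarrow> 'b::{banach, second_countable_topology}"
  assumes [measurable]: "g \<in> borel_measurable borel" and g: "\<And>u. u \<in> U \<Longrightarrow> norm (g u) \<le> K" "\<And>u. u \<notin> U \<Longrightarrow> g u = 0"
  shows "integrable lborel g"
proof (rule Bochner_Integration.integrable_bound)
  show "integrable lborel (\<lambda>u. indicator U u * K)"
    using bounded_U by (intro integrable_mult_left integrable_real_indicator)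
      (use emeasure_bounded_finite[OF bounded_U] in auto)
  show "AE u in lborel. norm (g u) \<le> norm (indicator U u * K)"
  proof (rule AE_I2)
    fix u show "norm (g u) \<le> norm (indicator U u * K)"
      using g[of u] by (cases "u \<in> U") auto
  qed
qed simp

lemma integrable_w_mult:
  fixes g :: "real^'p \<Rightarrow> 'b::{banach, second_countable_topology}"
  assumes [measurable]: "g \<in> borel_measurable borel" and g: "\<And>u. u \<in> U \<Longrightarrow> norm (g u) \<le> K"
  shows "integrable lborel (\<lambda>u. w u *\<^sub>R g u)"
proof -
  obtain Z where Z: "0 < Z" "\<And>u. z u \<le> Z" using z_bounded by auto
  show ?thesis
  proof (rule integrable_U)
    fix u assume u: "u \<in> U"
    have "w u \<le> B * Z" using w_bounds(2)[OF u] Z(2)[of u] B_pos by (meson less_imp_le mult_left_mono order_trans)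
    then show "norm (w u *\<^sub>R g u) \<le> (B * Z) * K"
      using g[OF u] w_bounds(4)[of u] by (auto intro!: mult_mono intro: order_trans)
  qed (auto simp: w_bounds)
qed

lemma integrable_w: "integrable lborel w"
  using integrable_w_mult[of "\<lambda>_. 1::real" 1] by simp

lemma U_norm_bound: obtains R where "0 < R" "\<And>u. u \<in> U \<Longrightarrow> norm u \<le> R"
  using bounded_U by (auto simp: bounded_pos)

lemma integrable_zU: "integrable lborel (\<lambda>u. indicator U u * z u)"
proof -
  obtain Z where Z: "0 < Z" "\<And>u. z u \<le> Z" using z_bounded by auto
  show ?thesis by (rule integrable_U[where K=Z]) (use Z z_nonneg in auto)
qed

lemma integral_positive:
  assumes g: "integrable lborel g" "\<And>u. 0 \<le> (g u :: real)" "\<And>u. u \<in> U \<Longrightarrow> 0 < g u"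
  shows "0 < (\<integral>u. g u \<partial>lborel)"
proof -
  have "(\<integral>u. g u \<partial>lborel) \<noteq> 0"
  proof
    assume "(\<integral>u. g u \<partial>lborel) = 0"
    then have "AE u in lborel. g u = 0"
      using g by (subst (asm) integral_nonneg_eq_0_iff_AE) auto
    then have "AE u in lborel. u \<notin> U" by eventually_elim (use g in force)
    then have "U \<in> null_sets lborel" by (subst (asm) AE_iff_null_sets[symmetric]) auto
    then have "negligible U" by (auto simp: negligible_iff_null_sets null_sets_completionI)
    then show False using open_U zero_in_U open_not_negligible by blast
  qed
  moreover have "0 \<le> (\<integral>u. g u \<partial>lborel)" using g by auto
  ultimately show ?thesis by simp
qed

lemma integral_zU_pos: "0 < (\<integral>u. indicator U u * z u \<partial>lborel)"
  by (rule integral_positive[OF integrable_zU]) (use z_pos z_nonneg in auto)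

lemma integral_w_pos: "0 < (\<integral>u. w u \<partial>lborel)"
proof (rule integral_positive[OF integrable_w])
  fix u assume "u \<in> U"
  then show "0 < w u" using w_bounds(1)[of u] z_pos[of u] b_pos mult_pos_pos[of b "z u"] by linarith
qed (rule w_bounds)

lemma integrable_w_id: "integrable lborel (\<lambda>u. w u *\<^sub>R u)"
proof -
  obtain R where "\<And>u. u \<in> U \<Longrightarrow> norm u \<le> R" by (metis U_norm_bound)
  then show ?thesis by (intro integrable_w_mult) auto
qed

text \<open>In the quotient the constant density of the affine change of variables and the factor
  \<open>exp (h \<theta>\<^sub>s)\<close> cancel, and the translation by \<open>\<theta>\<^sub>s\<close> and the matrix \<open>A\<close> are undone by the rescaling.\<close>

theorem u_tilde_eq: "u_tilde \<Theta> \<theta>\<^sub>s A \<rho> h = u_limit w"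
proof -
  define g where "g \<theta> = indicator \<Theta> \<theta> * (exp (h \<theta>) * \<rho> \<theta>)" for \<theta>
  have \<Theta>b [measurable]: "\<Theta> \<in> sets borel" using open_\<Theta> by simp
  have "(\<lambda>\<theta>. indicator \<Theta> \<theta> *\<^sub>R (exp (h \<theta>) * \<rho> \<theta>)) \<in> borel_measurable borel"
    using cont_h cont_\<rho>
    by (intro borel_measurable_continuous_on_indicator \<Theta>b continuous_intros)
       (auto intro: continuous_on_subset[OF _ closure_subset])
  then have [measurable]: "g \<in> borel_measurable borel" by (simp add: g_def[abs_def])
  define E where "E = exp (h \<theta>\<^sub>s)"
  have E: "E > 0" by (simp add: E_def)
  have gw: "g (\<theta>\<^sub>s + A *v u) = E * w u" for u
    by (cases "u \<in> U") (auto simp: g_def quasi_weight_def z_U E_def exp_diff U_set_def)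
  obtain k where k: "0 < k" "distr lborel borel (\<lambda>u. \<theta>\<^sub>s + A *v u) = density lborel (\<lambda>_. ennreal k)"
    using lborel_distr_affine_matrix[OF inv_A] by blast
  define W where "W = (\<integral>u. w u \<partial>lborel)"
  define V where "V = (\<integral>u. w u *\<^sub>R u \<partial>lborel)"
  have W: "W > 0" unfolding W_def by (rule integral_w_pos)
  have "k * (\<integral>\<theta>. g \<theta> \<partial>lborel) = (\<integral>u. g (\<theta>\<^sub>s + A *v u) \<partial>lborel)"
    using integral_affine_matrix[OF k, of g] by simp
  then have den: "(\<integral>\<theta>. g \<theta> \<partial>lborel) = E / k * W"
    using k(1) by (simp add: gw W_def field_simps)
  have "k *\<^sub>R (\<integral>\<theta>. g \<theta> *\<^sub>R \<theta> \<partial>lborel) = (\<integral>u. g (\<theta>\<^sub>s + A *v u) *\<^sub>R (\<theta>\<^sub>s + A *v u) \<partial>lborel)"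
    using integral_affine_matrix[OF k, of "\<lambda>\<theta>. g \<theta> *\<^sub>R \<theta>"] by simp
  also have "\<dots> = (\<integral>u. E *\<^sub>R (w u *\<^sub>R \<theta>\<^sub>s + A *v (w u *\<^sub>R u)) \<partial>lborel)"
    by (simp add: gw scaleR_add_right matrix_vector_mult_scaleR)
  also have "\<dots> = E *\<^sub>R ((\<integral>u. w u *\<^sub>R \<theta>\<^sub>s \<partial>lborel) + (\<integral>u. A *v (w u *\<^sub>R u) \<partial>lborel))"
    using integrable_w integrable_w_id
    by (simp add: integrable_bounded_linear[OF matrix_vector_mul_bounded_linear])
  also have "(\<integral>u. w u *\<^sub>R \<theta>\<^sub>s \<partial>lborel) = W *\<^sub>R \<theta>\<^sub>s"
    using integrable_w by (simp add: W_def)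
  also have "(\<integral>u. A *v (w u *\<^sub>R u) \<partial>lborel) = A *v V"
    unfolding V_def by (rule integral_bounded_linear[OF matrix_vector_mul_bounded_linear integrable_w_id])
  finally have "inverse k *\<^sub>R (k *\<^sub>R (\<integral>\<theta>. g \<theta> *\<^sub>R \<theta> \<partial>lborel)) = inverse k *\<^sub>R (E *\<^sub>R (W *\<^sub>R \<theta>\<^sub>s + A *v V))"
    by simp
  then have num: "(\<integral>\<theta>. g \<theta> *\<^sub>R \<theta> \<partial>lborel) = (E / k) *\<^sub>R (W *\<^sub>R \<theta>\<^sub>s + A *v V)"
    using k(1) by (simp add: divide_inverse mult.commute)
  have "qb_estimator \<Theta> \<rho> h = inverse (E / k * W) *\<^sub>R (E / k) *\<^sub>R (W *\<^sub>R \<theta>\<^sub>s + A *v V)"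
    unfolding qb_estimator_def den[symmetric] num[symmetric]
    by (simp add: set_lebesgue_integral_def g_def[abs_def])
  also have "\<dots> = \<theta>\<^sub>s + A *v (inverse W *\<^sub>R V)"
    using E k(1) W by (simp add: scaleR_add_right matrix_vector_mult_scaleR inverse_eq_divide)
  finally have "u_tilde \<Theta> \<theta>\<^sub>s A \<rho> h = (matrix_inv A ** A) *v (inverse W *\<^sub>R V)"
    by (simp add: u_tilde_def matrix_vector_mul_assoc)
  then show ?thesis
    using matrix_inv_inverse(2)[OF inv_A] by (simp add: u_limit_def W_def V_def)
qed

end

section \<open>Grid means and tail moments\<close>

lemma borel_measurable_vecI:
  assumes "\<And>i. (\<lambda>x. f x $ i) \<in> borel_measurable M"
  shows "(f :: _ \<Rightarrow> real^'p) \<in> borel_measurable M"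
  by (subst borel_measurable_euclidean_space) (use assms in \<open>auto simp: Basis_vec_def inner_axis\<close>)

text \<open>Each point is replaced by a tag, the nearest point of the lattice of mesh \<open>1 / k\<close>. Rounding to the nearest point, instead
  of downwards, puts the origin into the interior of its own cell, so that the tag 0 carries a positive
  volume; as all fields equal 1 there, this bounds the denominators of the grid means from below.\<close>

definition grid :: "nat \<Rightarrow> real^'p \<Rightarrow> real^'p" where
  "grid k u = (\<chi> i. of_int \<lfloor>real k * u $ i + 1/2\<rfloor> / real k)"

lemma borel_grid [measurable]: "grid k \<in> borel_measurable borel"
  by (rule borel_measurable_vecI) (simp add: grid_def, measurable)

lemma norm_grid_diff:
  fixes u :: "real^'p"
  assumes "1 \<le> k"
  shows "norm (grid k u - u) \<le> real CARD('p) / real k"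
proof -
  have "\<bar>of_int \<lfloor>real k * u $ i + 1/2\<rfloor> / real k - u $ i\<bar> \<le> 1 / real k" for i
  proof -
    have "of_int \<lfloor>real k * u $ i + 1/2\<rfloor> / real k - u $ i
        = (of_int \<lfloor>real k * u $ i + 1/2\<rfloor> - real k * u $ i) / real k"
      using assms by (simp add: diff_divide_distrib)
    then have "\<bar>of_int \<lfloor>real k * u $ i + 1/2\<rfloor> / real k - u $ i\<bar>
        = \<bar>of_int \<lfloor>real k * u $ i + 1/2\<rfloor> - real k * u $ i\<bar> / real k"
      by (simp add: abs_divide)
    also have "\<dots> \<le> 1 / real k" using assms by (intro divide_right_mono) linarith+
    finally show ?thesis .
  qed
  then have "(\<Sum>i\<in>UNIV. \<bar>(grid k u - u) $ i\<bar>) \<le> (\<Sum>i::'p\<in>UNIV. 1 / real k)"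
    by (intro sum_mono) (simp add: grid_def)
  then show ?thesis using norm_le_l1_cart[of "grid k u - u"] by simp
qed

lemma grid_tendsto: "(\<lambda>k. grid k u) \<longlonglongrightarrow> (u :: real^'p)"
proof -
  have "(\<lambda>k. grid k u - u) \<longlonglongrightarrow> 0"
  proof (rule Lim_null_comparison)
    show "\<forall>\<^sub>F k in sequentially. norm (grid k u - u) \<le> real CARD('p) / real k"
      unfolding eventually_sequentially using norm_grid_diff by blast
    show "(\<lambda>k. real CARD('p) / real k) \<longlonglongrightarrow> 0" by (rule lim_const_over_n)
  qed
  then show ?thesis by (rule LIM_zero_cancel)
qed

lemma grid_zero:
  assumes "1 \<le> k" "norm u < 1 / (2 * real k)"
  shows "grid k u = 0"
proof -
  have "\<lfloor>real k * u $ i + 1/2\<rfloor> = 0" for i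
  proof -
    have "\<bar>u $ i\<bar> < 1 / (2 * real k)" using component_le_norm_cart[of u i] assms by linarith
    then have "real k * \<bar>u $ i\<bar> < 1 / 2" using assms by (simp add: field_simps)
    then have "\<bar>real k * u $ i\<bar> < 1/2" by (simp add: abs_mult)
    then show ?thesis by (intro floor_unique) auto
  qed
  then show ?thesis by (simp add: grid_def vec_eq_iff)
qed

lemma countable_range_grid: "countable (range (grid k :: real^'p \<Rightarrow> _))"
proof (rule countable_subset)
  show "range (grid k :: real^'p \<Rightarrow> _) \<subseteq> range (\<lambda>x. \<chi> i. of_int (x i) / real k)"
    by (auto simp: grid_def)
qed simp

lemma finite_grid_ball: "finite (grid k ` ball (0::real^'p) m)"
proof (rule finite_subset)
  define N where "N = \<lceil>real k * m\<rceil> + 2"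
  show "grid k ` ball (0::real^'p) m \<subseteq> (\<lambda>x. \<chi> i. of_int (x i) / real k) ` (UNIV \<rightarrow>\<^sub>E {-N..N})"
  proof (rule image_subsetI)
    fix u :: "real^'p" assume u: "u \<in> ball 0 m"
    have "\<lfloor>real k * u $ i + 1/2\<rfloor> \<in> {-N..N}" for i
    proof -
      have "\<bar>u $ i\<bar> \<le> m" using component_le_norm_cart[of u i] u by simp
      then have "\<bar>real k * u $ i\<bar> \<le> real k * m" by (simp add: abs_mult mult_left_mono)
      then show ?thesis unfolding N_def by (simp add: le_floor_iff floor_le_iff) linarith
    qed
    then show "grid k u \<in> (\<lambda>x. \<chi> i. of_int (x i) / real k) ` (UNIV \<rightarrow>\<^sub>E {-N..N})"
      by (intro image_eqI[of _ _ "\<lambda>i. \<lfloor>real k * u $ i + 1/2\<rfloor>"]) (auto simp: grid_def)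
  qed
  show "finite ((\<lambda>x. (\<chi> i. of_int (x i) / real k) :: real^'p) ` (UNIV \<rightarrow>\<^sub>E {-N..N}))"
    by (intro finite_imageI finite_PiE) auto
qed

definition grid_pts :: "nat \<Rightarrow> nat \<Rightarrow> (real^'p) set" where
  "grid_pts k m = grid k ` ball 0 (real m)"

definition grid_vol :: "nat \<Rightarrow> nat \<Rightarrow> real^'p \<Rightarrow> real" where
  "grid_vol k m v = measure lborel {u \<in> ball 0 (real m). grid k u = v}"

text \<open>The mean of the tags under the weights \<open>z\<close>: the Riemann sum counterpart of \<open>u_limit z\<close>
  on a ball.\<close>

definition grid_mean :: "nat \<Rightarrow> nat \<Rightarrow> (real^'p \<Rightarrow> real) \<Rightarrow> real^'p" where
  "grid_mean k m z = inverse (\<Sum>v\<in>grid_pts k m. grid_vol k m v * z v) *\<^sub>R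
     (\<Sum>v\<in>grid_pts k m. (grid_vol k m v * z v) *\<^sub>R v)"

lemma finite_grid_pts: "finite (grid_pts k m)"
  unfolding grid_pts_def by (rule finite_grid_ball)

lemma grid_vol_nonneg: "0 \<le> grid_vol k m v"
  by (simp add: grid_vol_def)

lemma zero_in_grid_pts: "1 \<le> m \<Longrightarrow> 0 \<in> grid_pts k m"
  unfolding grid_pts_def by (intro image_eqI[of _ _ 0]) (auto simp: grid_def vec_eq_iff)

lemma norm_grid_pts:
  fixes v :: "real^'p"
  assumes "v \<in> grid_pts k m" "CARD('p) \<le> k"
  shows "norm v \<le> real m + 1"
proof -
  obtain u where u: "norm u < m" "v = grid k u" using assms by (auto simp: grid_pts_def)
  have "1 \<le> k" using assms(2) by (metis One_nat_def Suc_leI le_trans zero_less_card_finite)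
  then have "norm (grid k u - u) \<le> 1"
    using norm_grid_diff[of k u] assms(2) by (auto intro: order_trans simp: divide_le_eq)
  then show ?thesis using u norm_triangle_sub[of v u] by (simp add: norm_minus_commute)
qed

lemma grid_integral:
  fixes \<phi> :: "real^'p \<Rightarrow> 'b::{banach, second_countable_topology}"
  shows "integrable lborel (\<lambda>u. indicator (ball 0 (real m)) u *\<^sub>R \<phi> (grid k u))" (is ?I)
    and "(\<integral>u. indicator (ball 0 (real m)) u *\<^sub>R \<phi> (grid k u) \<partial>lborel) = (\<Sum>v\<in>grid_pts k m. grid_vol k m v *\<^sub>R \<phi> v)"
proof -
  have eq: "indicator (ball 0 (real m)) u *\<^sub>R \<phi> (grid k u)
      = (\<Sum>v\<in>grid_pts k m. indicator {u \<in> ball 0 (real m). grid k u = v} u *\<^sub>R \<phi> v)" for u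
  proof (cases "u \<in> ball 0 (real m)")
    case True
    have "(\<Sum>v\<in>grid_pts k m. indicator {u \<in> ball 0 (real m). grid k u = v} u *\<^sub>R \<phi> v)
       = (\<Sum>v\<in>grid_pts k m. if v = grid k u then \<phi> v else 0)"
      using True by (intro sum.cong) (auto simp: indicator_def)
    also have "\<dots> = \<phi> (grid k u)"
      using True finite_grid_pts[of k m, where 'a='p] by (subst sum.delta) (auto simp: grid_pts_def)
    finally show ?thesis using True by simp
  qed (auto simp: indicator_def)
  have m [measurable]: "{u \<in> ball 0 (real m). grid k u = v} \<in> sets borel" for v :: "real^'p"
    by measurable
  have f: "emeasure lborel {u \<in> ball 0 (real m). grid k u = v} < \<infinity>" for v :: "real^'p"
    by (rule emeasure_bounded_finite, rule bounded_subset[of "ball 0 (real m)"]) auto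
  have i: "integrable lborel (\<lambda>u. indicator {u \<in> ball 0 (real m). grid k u = v} u *\<^sub>R \<phi> v)" for v
    using f[of v] by (intro integrable_scaleR_left integrable_real_indicator) auto
  show ?I unfolding eq using i by (intro Bochner_Integration.integrable_sum)
  show "(\<integral>u. indicator (ball 0 (real m)) u *\<^sub>R \<phi> (grid k u) \<partial>lborel) = (\<Sum>v\<in>grid_pts k m. grid_vol k m v *\<^sub>R \<phi> v)"
    unfolding eq using i f by (subst Bochner_Integration.integral_sum) (auto simp: grid_vol_def)
qed

lemma grid_vol_zero_pos:
  assumes "1 \<le> k" "1 \<le> m"
  shows "0 < grid_vol k m (0::real^'p)"
proof -
  define r where "r = min (1 / (2 * real k)) (real m)"
  have r: "0 < r" using assms by (auto simp: r_def)
  have "measure lborel (ball (0::real^'p) r) \<le> grid_vol k m (0::real^'p)"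
    unfolding grid_vol_def
  proof (rule measure_mono_fmeasurable)
    show "ball 0 r \<subseteq> {u \<in> ball 0 (real m). grid k u = 0}"
      using grid_zero[OF assms(1)] by (auto simp: r_def)
    have "emeasure lborel {u \<in> ball 0 (real m). grid k u = (0::real^'p)} < \<infinity>"
      by (rule emeasure_bounded_finite, rule bounded_subset[of "ball 0 (real m)"]) auto
    then show "{u \<in> ball 0 (real m). grid k u = (0::real^'p)} \<in> fmeasurable lborel"
      by (intro fmeasurableI) auto
  qed auto
  moreover have "0 < measure lborel (ball (0::real^'p) r)" using r by (simp add: content_ball_gt_0_iff)
  ultimately show ?thesis by linarith
qed

lemma grid_mean_den:
  fixes z :: "real^'p \<Rightarrow> real"
  assumes "1 \<le> k" "1 \<le> m" "z 0 = 1" "\<And>v. 0 \<le> z v"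
  shows "grid_vol k m (0::real^'p) \<le> (\<Sum>v\<in>grid_pts k m. grid_vol k m v * z v)"
    and "0 < (\<Sum>v\<in>grid_pts k m. grid_vol k m v * z v)"
proof -
  have "grid_vol k m (0::real^'p) * z 0 \<le> (\<Sum>v\<in>grid_pts k m. grid_vol k m v * z v)"
    using sum.remove[OF finite_grid_pts zero_in_grid_pts[OF assms(2)], of "\<lambda>v::real^'p. grid_vol k m v * z v" k]
    by (simp add: sum_nonneg grid_vol_nonneg assms(4))
  then show *: "grid_vol k m (0::real^'p) \<le> (\<Sum>v\<in>grid_pts k m. grid_vol k m v * z v)"
    using assms(3) by simp
  show "0 < (\<Sum>v\<in>grid_pts k m. grid_vol k m v * z v)"
    using grid_vol_zero_pos[OF assms(1,2), where 'p='p] * by linarith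
qed

lemma norm_grid_mean:
  fixes z :: "real^'p \<Rightarrow> real"
  assumes k: "CARD('p) \<le> k" and z: "1 \<le> m" "z 0 = 1" "\<And>v. 0 \<le> z v"
  shows "norm (grid_mean k m z) \<le> real m + 1"
proof -
  have k1: "1 \<le> k" using k by (metis One_nat_def Suc_leI le_trans zero_less_card_finite)
  define S where "S = (\<Sum>v\<in>grid_pts k m. grid_vol k m v * z v)"
  have S: "0 < S" unfolding S_def by (intro grid_mean_den(2) k1 z)
  have "norm (\<Sum>v\<in>grid_pts k m. (grid_vol k m v * z v) *\<^sub>R v) \<le> (\<Sum>v\<in>grid_pts k m. (grid_vol k m v * z v) * (real m + 1))"
  proof (rule order_trans[OF norm_sum sum_mono])
    fix v :: "real^'p" assume "v \<in> grid_pts k m"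
    then show "norm ((grid_vol k m v * z v) *\<^sub>R v) \<le> (grid_vol k m v * z v) * (real m + 1)"
      using norm_grid_pts[OF _ k] z grid_vol_nonneg[of k m v] by (auto intro!: mult_left_mono)
  qed
  also have "\<dots> = S * (real m + 1)" by (simp add: S_def sum_distrib_right)
  finally show ?thesis
    unfolding grid_mean_def S_def[symmetric] using S by (simp add: field_simps)
qed

text \<open>The moment of order \<open>q\<close> outside a ball of the probability measure with unnormalized density \<open>w\<close>:
  the single quantity that controls the error of truncation in what follows.\<close>

definition tail_moment :: "real \<Rightarrow> nat \<Rightarrow> (real^'p \<Rightarrow> real) \<Rightarrow> real" where
  "tail_moment q m w = (\<integral>u. indicator {u. real m \<le> norm u} u * norm u powr q * w u \<partial>lborel) / (\<integral>u. w u \<partial>lborel)"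

lemma powr_tangent:
  fixes q x y :: real
  assumes "1 \<le> q" "0 \<le> x" "0 < y"
  shows "q * y powr (q - 1) * x \<le> (q - 1) * y powr q + x powr q"
proof (cases "q = 1")
  case False
  then have q: "1 < q" using assms(1) by (auto simp: less_le)
  have "y powr (q - 1) * x \<le> (y powr (q - 1)) powr (q / (q - 1)) / (q / (q - 1)) + x powr q / q"
    by (rule Youngs_inequality) (use q assms in \<open>auto simp: field_simps\<close>)
  also have "(y powr (q - 1)) powr (q / (q - 1)) = y powr q" using q by (simp add: powr_powr)
  finally have "q * (y powr (q - 1) * x) \<le> q * (y powr q / (q / (q - 1)) + x powr q / q)"
    using q by (intro mult_left_mono) auto
  also have "\<dots> = (q - 1) * y powr q + x powr q" using q by (simp add: field_simps)
  finally show ?thesis by simp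
qed (use assms in auto)

context ratio_path
begin

lemma integrable_w_norm_powr:
  assumes "0 \<le> q" shows "integrable lborel (\<lambda>u. w u * norm u powr q)"
proof -
  obtain R where R: "\<And>u. u \<in> U \<Longrightarrow> norm u \<le> R" by (metis U_norm_bound)
  have "integrable lborel (\<lambda>u. w u *\<^sub>R (norm u powr q))"
    by (rule integrable_w_mult[where K="R powr q"]) (use R assms in \<open>auto intro!: powr_mono2\<close>)
  then show ?thesis by simp
qed

lemma integrable_tail:
  assumes "0 \<le> q" shows "integrable lborel (\<lambda>u. indicator {u. real m \<le> norm u} u * norm u powr q * w u)"
  by (rule Bochner_Integration.integrable_bound[OF integrable_w_norm_powr[OF assms]])
     (use w_bounds(4) in \<open>auto simp: indicator_def abs_mult mult.commute\<close>)

lemma tail_moment_nonneg: "0 \<le> tail_moment q m w"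
  unfolding tail_moment_def
  by (intro divide_nonneg_nonneg integral_nonneg) (use w_bounds(4) in auto)

text \<open>Jensen's inequality for \<open>x \<mapsto> x powr q\<close>, by integrating its tangent at the norm of the mean.\<close>

lemma moment_le_tail_moment:
  assumes q: "1 \<le> q"
  shows "norm (u_limit w) powr q \<le> real m powr q + tail_moment q m w"
proof (cases "u_limit w = 0")
  case True
  then show ?thesis using tail_moment_nonneg[of q m] by simp
next
  case False
  define y where "y = norm (u_limit w)"
  define W where "W = (\<integral>u. w u \<partial>lborel)"
  have y: "0 < y" using False by (simp add: y_def)
  have W: "0 < W" unfolding W_def by (rule integral_w_pos)
  have i1: "integrable lborel (\<lambda>u. w u * norm u)"
    using integrable_norm[OF integrable_w_id] w_bounds(4) by simp
  have iq: "integrable lborel (\<lambda>u. w u * norm u powr q)"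
    using q by (intro integrable_w_norm_powr) auto
  have it: "integrable lborel (\<lambda>u. indicator {u. real m \<le> norm u} u * norm u powr q * w u)"
    using q by (intro integrable_tail) auto
  have "y = norm (\<integral>u. w u *\<^sub>R u \<partial>lborel) / W"
    using W by (simp add: y_def u_limit_def W_def divide_inverse mult.commute)
  also have "norm (\<integral>u. w u *\<^sub>R u \<partial>lborel) \<le> (\<integral>u. w u * norm u \<partial>lborel)"
    using integral_norm_bound[of lborel "\<lambda>u. w u *\<^sub>R u"] w_bounds(4) by simp
  finally have yW: "y * W \<le> (\<integral>u. w u * norm u \<partial>lborel)"
    using W by (simp add: field_simps divide_right_mono)
  have "q * y powr (q - 1) * (y * W) \<le> q * y powr (q - 1) * (\<integral>u. w u * norm u \<partial>lborel)"
    using q yW by (intro mult_left_mono) auto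
  also have "\<dots> = (\<integral>u. w u * (q * y powr (q - 1) * norm u) \<partial>lborel)"
    by (simp add: mult_ac flip: integral_mult_right_zero)
  also have "\<dots> \<le> (\<integral>u. (q - 1) * y powr q * w u + w u * norm u powr q \<partial>lborel)"
  proof (rule integral_mono)
    show "integrable lborel (\<lambda>u. w u * (q * y powr (q - 1) * norm u))"
      using integrable_mult_right[OF i1, of "q * y powr (q - 1)"] by (simp add: mult_ac)
    show "integrable lborel (\<lambda>u. (q - 1) * y powr q * w u + w u * norm u powr q)"
      using integrable_w iq by (intro Bochner_Integration.integrable_add integrable_mult_right)
    fix u
    have "w u * (q * y powr (q - 1) * norm u) \<le> w u * ((q - 1) * y powr q + norm u powr q)"
      using powr_tangent[OF q norm_ge_zero y] w_bounds(4) by (intro mult_left_mono) auto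
    then show "w u * (q * y powr (q - 1) * norm u) \<le> (q - 1) * y powr q * w u + w u * norm u powr q"
      by (simp add: algebra_simps)
  qed
  also have "\<dots> = (q - 1) * y powr q * W + (\<integral>u. w u * norm u powr q \<partial>lborel)"
    using integrable_w iq by (simp add: W_def)
  also have "(\<integral>u. w u * norm u powr q \<partial>lborel) \<le> (\<integral>u. real m powr q * w u + indicator {u. real m \<le> norm u} u * norm u powr q * w u \<partial>lborel)"
  proof (rule integral_mono[OF iq])
    show "integrable lborel (\<lambda>u. real m powr q * w u + indicator {u. real m \<le> norm u} u * norm u powr q * w u)"
      using integrable_w it by (intro Bochner_Integration.integrable_add integrable_mult_right)
    fix u
    show "w u * norm u powr q \<le> real m powr q * w u + indicator {u. real m \<le> norm u} u * norm u powr q * w u"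
    proof (cases "real m \<le> norm u")
      case False
      then have "norm u powr q \<le> real m powr q" using q by (intro powr_mono2) auto
      then have "w u * norm u powr q \<le> w u * real m powr q"
        using w_bounds(4)[of u] by (intro mult_left_mono)
      then show ?thesis using False by (simp add: mult.commute)
    qed (use w_bounds(4)[of u] in \<open>auto simp: mult.commute\<close>)
  qed
  also have "\<dots> = real m powr q * W + tail_moment q m w * W"
    using integrable_w it W by (simp add: W_def tail_moment_def)
  finally have "q * (y powr (q - 1) * y) * W \<le> (q - 1) * y powr q * W + (real m powr q * W + tail_moment q m w * W)"
    by (simp add: mult_ac)
  moreover have "y powr (q - 1) * y = y powr q"
    using y powr_add[of y "q - 1" 1] by simp
  ultimately have "y powr q * W \<le> (real m powr q + tail_moment q m w) * W"
    by (simp add: algebra_simps)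
  then show ?thesis using W by (simp add: y_def)
qed

text \<open>If on a ball the weights of the points and of their tags agree up to a relative error \<open>e\<close>, the
  two means differ by the mesh, by \<open>e\<close> times the diameter, and by the first moment outside the ball.\<close>

lemma u_limit_grid_mean:
  assumes k: "CARD('p) \<le> k" and m: "1 \<le> m" and q: "1 \<le> q" and c: "0 < c" and e: "0 \<le> e"
    and close: "\<And>u. u \<in> ball 0 (real m) \<Longrightarrow> \<bar>w u - c * z (grid k u)\<bar> \<le> e * w u"
  shows "norm (u_limit w - grid_mean k m z) \<le> real CARD('p) / real k + 2 * (real m + 1) * e + 3 * tail_moment q m w"
proof -
  define y where "y = grid_mean k m z"
  define W where "W = (\<integral>u. w u \<partial>lborel)"
  define b0 where "b0 = ball (0::real^'p) (real m)"
  define \<delta> where "\<delta> = real CARD('p) / real k"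
  have k1: "1 \<le> k" using k by (metis One_nat_def Suc_leI le_trans zero_less_card_finite)
  have W: "0 < W" unfolding W_def by (rule integral_w_pos)
  have y: "norm y \<le> real m + 1" unfolding y_def
    by (intro norm_grid_mean k m z_zero z_nonneg)
  define S where "S = (\<Sum>v\<in>grid_pts k m. grid_vol k m v * z v)"
  have S: "0 < S" unfolding S_def by (intro grid_mean_den(2) k1 m z_zero z_nonneg)
  have zero: "(\<integral>u. indicator b0 u *\<^sub>R ((c * z (grid k u)) *\<^sub>R (grid k u - y)) \<partial>lborel) = 0"
  proof -
    have "(\<integral>u. indicator b0 u *\<^sub>R ((c * z (grid k u)) *\<^sub>R (grid k u - y)) \<partial>lborel)
      = (\<Sum>v\<in>grid_pts k m. grid_vol k m v *\<^sub>R ((c * z v) *\<^sub>R (v - y)))"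
      unfolding b0_def by (rule grid_integral(2)[of m "\<lambda>v. (c * z v) *\<^sub>R (v - y)" k])
    also have "\<dots> = c *\<^sub>R ((\<Sum>v\<in>grid_pts k m. (grid_vol k m v * z v) *\<^sub>R v) - S *\<^sub>R y)"
      by (simp add: S_def scaleR_sum_right scaleR_sum_left sum_subtractf[symmetric] algebra_simps)
    also have "S *\<^sub>R y = (\<Sum>v\<in>grid_pts k m. (grid_vol k m v * z v) *\<^sub>R v)"
      using S by (simp add: y_def grid_mean_def S_def[symmetric])
    finally show ?thesis by simp
  qed
  \<comment> \<open>Both means are centred at the grid mean \<open>y\<close>; the second term of \<open>G\<close> has integral 0 by the choice of
    \<open>y\<close>, so the error is the integral of a pointwise difference.\<close>
  define G where "G u = w u *\<^sub>R (u - y) - indicator b0 u *\<^sub>R ((c * z (grid k u)) *\<^sub>R (grid k u - y))" for u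
  have i1: "integrable lborel (\<lambda>u. w u *\<^sub>R (u - y))"
    using integrable_w_id integrable_w by (simp add: scaleR_diff_right)
  have i2: "integrable lborel (\<lambda>u. indicator b0 u *\<^sub>R ((c * z (grid k u)) *\<^sub>R (grid k u - y)))"
    unfolding b0_def by (rule grid_integral(1)[of m "\<lambda>v. (c * z v) *\<^sub>R (v - y)" k])
  have "(\<integral>u. G u \<partial>lborel) = (\<integral>u. w u *\<^sub>R (u - y) \<partial>lborel)"
    unfolding G_def using i1 i2 zero by simp
  also have "\<dots> = W *\<^sub>R (u_limit w - y)"
    using integrable_w_id integrable_w W by (simp add: scaleR_diff_right u_limit_def W_def)
  finally have "W * norm (u_limit w - y) = norm (\<integral>u. G u \<partial>lborel)"
    using W by simp
  also have "\<dots> \<le> (\<integral>u. norm (G u) \<partial>lborel)" by (rule integral_norm_bound)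
  also have "\<dots> \<le> (\<integral>u. (\<delta> + 2 * (real m + 1) * e) * w u + 3 * (indicator {u. real m \<le> norm u} u * norm u powr q * w u) \<partial>lborel)"
  proof (rule integral_mono)
    show "integrable lborel (\<lambda>u. norm (G u))" unfolding G_def using i1 i2 by auto
    show "integrable lborel (\<lambda>u. (\<delta> + 2 * (real m + 1) * e) * w u + 3 * (indicator {u. real m \<le> norm u} u * norm u powr q * w u))"
      using integrable_w integrable_tail q by (intro Bochner_Integration.integrable_add integrable_mult_right) auto
    fix u
    show "norm (G u) \<le> (\<delta> + 2 * (real m + 1) * e) * w u + 3 * (indicator {u. real m \<le> norm u} u * norm u powr q * w u)"
    proof (cases "u \<in> b0")
      case True
      then have u: "grid k u \<in> grid_pts k m" by (auto simp: b0_def grid_pts_def)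
      have "G u = w u *\<^sub>R (u - grid k u) + (w u - c * z (grid k u)) *\<^sub>R (grid k u - y)"
        using True by (simp add: G_def algebra_simps)
      then have "norm (G u) \<le> w u * norm (u - grid k u) + \<bar>w u - c * z (grid k u)\<bar> * norm (grid k u - y)"
        using w_bounds(4)[of u] by (metis abs_of_nonneg norm_scaleR norm_triangle_ineq)
      also have "\<dots> \<le> w u * \<delta> + (e * w u) * (2 * (real m + 1))"
      proof (intro add_mono mult_mono)
        show "norm (u - grid k u) \<le> \<delta>" using norm_grid_diff[OF k1, of u] by (simp add: \<delta>_def norm_minus_commute)
        show "\<bar>w u - c * z (grid k u)\<bar> \<le> e * w u" using True close by (simp add: b0_def)
        show "norm (grid k u - y) \<le> 2 * (real m + 1)"
          using norm_triangle_ineq4[of "grid k u" y] y norm_grid_pts[OF u k] by (simp add: algebra_simps)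
      qed (use w_bounds(4)[of u] e in auto)
      finally show ?thesis using True by (simp add: b0_def algebra_simps)
    next
      case False
      then have mu: "real m \<le> norm u" by (simp add: b0_def)
      have "norm (G u) = w u * norm (u - y)" using False w_bounds(4)[of u] by (simp add: G_def)
      also have "\<dots> \<le> w u * (3 * norm u powr q)"
      proof (rule mult_left_mono)
        have "norm u \<le> norm u powr q"
          using mu m q powr_mono[of 1 q "norm u"] by simp
        moreover have "norm (u - y) \<le> 3 * norm u"
          using norm_triangle_ineq4[of u y] y mu m by linarith
        ultimately show "norm (u - y) \<le> 3 * norm u powr q" by linarith
      qed (rule w_bounds)
      finally show ?thesis using mu w_bounds(4)[of u] e by (simp add: \<delta>_def mult_ac add_increasing)
    qed
  qed
  also have "\<dots> = (\<delta> + 2 * (real m + 1) * e) * W + 3 * (tail_moment q m w * W)"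
    using integrable_w integrable_tail[of q m] q W by (simp add: W_def tail_moment_def)
  finally have "W * norm (u_limit w - y) \<le> W * (\<delta> + 2 * (real m + 1) * e + 3 * tail_moment q m w)"
    by (simp add: algebra_simps)
  then show ?thesis using W by (simp add: y_def \<delta>_def)
qed

end

definition shell :: "nat \<Rightarrow> (real^'p) set" where
  "shell r = {u. real r \<le> norm u \<and> norm u < real r + 1}"

lemma borel_shell [measurable]: "shell r \<in> sets borel"
  unfolding shell_def by measurable

lemma emeasure_shell: "emeasure lborel (shell r :: (real^'p) set) < \<infinity>"
  by (rule emeasure_bounded_finite, rule bounded_subset[of "ball 0 (real r + 1)"]) (auto simp: shell_def)

lemma measure_shell:
  "measure lborel (shell r :: (real^'p) set)
    \<le> unit_ball_vol (real CARD('p)) * real CARD('p) * (real r + 1) ^ (CARD('p) - 1)"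
proof -
  define n where "n = CARD('p)"
  have "shell r = ball (0::real^'p) (real r + 1) - ball 0 (real r)" by (auto simp: shell_def)
  also have "measure lborel \<dots> = measure lborel (ball (0::real^'p) (real r + 1)) - measure lborel (ball (0::real^'p) (real r))"
  proof (rule measure_Diff)
    show "emeasure lborel (ball (0::real^'p) (real r + 1)) \<noteq> \<infinity>"
      using emeasure_bounded_finite[of "ball (0::real^'p) (real r + 1)"] by simp
  qed auto
  also have "\<dots> = unit_ball_vol (real n) * ((real r + 1) ^ n - real r ^ n)"
    by (simp add: content_ball n_def right_diff_distrib)
  also have "(real r + 1) ^ n - real r ^ n \<le> real n * (real r + 1) ^ (n - 1)"
  proof -
    have "(real r + 1) ^ n - real r ^ n = (\<Sum>i<n. real r ^ (n - Suc i) * (real r + 1) ^ i)"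
      by (subst power_diff_sumr2) simp
    also have "\<dots> \<le> (\<Sum>i<n. (real r + 1) ^ (n - 1))"
    proof (rule sum_mono)
      fix i assume i: "i \<in> {..<n}"
      have "real r ^ (n - Suc i) * (real r + 1) ^ i \<le> (real r + 1) ^ (n - Suc i) * (real r + 1) ^ i"
        by (intro mult_right_mono power_mono) auto
      also have "\<dots> = (real r + 1) ^ (n - 1)" using i by (simp flip: power_add)
      finally show "real r ^ (n - Suc i) * (real r + 1) ^ i \<le> (real r + 1) ^ (n - 1)" .
    qed
    finally show ?thesis by simp
  qed
  finally show ?thesis by (simp add: n_def mult.assoc mult_left_mono)
qed

text \<open>The volume of a shell times the supremum of \<open>norm u powr q\<close> there and the decay
  \<open>real r powr -D\<close>. The type argument fixes the dimension.\<close>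

definition shell_weight :: "(real^'p) itself \<Rightarrow> real \<Rightarrow> real \<Rightarrow> nat \<Rightarrow> real" where
  "shell_weight _ q D r = (real r + 1) powr q / real r powr D * measure lborel (shell r :: (real^'p) set)"

lemma shell_weight_nonneg: "0 \<le> shell_weight TYPE(real^'p) q D r"
  by (simp add: shell_weight_def)

text \<open>The volume of the shell of radius \<open>r\<close> is of order \<open>r powr (CARD('p) - 1)\<close>.\<close>

lemma summable_shell_weight:
  assumes q: "0 \<le> q" and D: "real CARD('p) + q < D"
  shows "summable (shell_weight TYPE(real^'p) q D)"
proof -
  define n where "n = CARD('p)"
  have n: "1 \<le> n" by (simp add: n_def Suc_leI)
  define K where "K = 2 powr q * (unit_ball_vol (real n) * real n * 2 powr (real n - 1))"
  have "summable (\<lambda>r. K * real r powr (q - D + (real n - 1)))"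
    using D n by (intro summable_mult) (simp add: summable_real_powr_iff n_def)
  then show ?thesis
  proof (rule summable_comparison_test'[where N=1])
    fix r :: nat assume r: "1 \<le> r"
    have two: "(real r + 1) powr s \<le> 2 powr s * real r powr s" if "0 \<le> s" for s
      using r that by (subst powr_mult[symmetric]) (auto intro!: powr_mono2)
    have "(real r + 1) ^ (n - 1) = (real r + 1) powr (real n - 1)"
      using n by (subst powr_realpow[symmetric]) (auto simp: of_nat_diff)
    also have "\<dots> \<le> 2 powr (real n - 1) * real r powr (real n - 1)"
      using n by (intro two) auto
    finally have 1: "measure lborel (shell r :: (real^'p) set)
        \<le> unit_ball_vol (real n) * real n * (2 powr (real n - 1) * real r powr (real n - 1))"
      using measure_shell[of r, where 'p='p] unfolding n_def[symmetric]
      by (elim order_trans) (auto intro!: mult_left_mono)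
    have "shell_weight TYPE(real^'p) q D r \<le> (2 powr q * real r powr q) / real r powr D *
        (unit_ball_vol (real n) * real n * (2 powr (real n - 1) * real r powr (real n - 1)))"
      unfolding shell_weight_def by (intro mult_mono divide_right_mono two q 1) auto
    also have "\<dots> = K * real r powr (q - D + (real n - 1))"
      using r by (simp add: K_def powr_add powr_diff field_simps)
    finally show "norm (shell_weight TYPE(real^'p) q D r) \<le> K * real r powr (q - D + (real n - 1))"
      using shell_weight_nonneg[of q D r, where 'p='p] by simp
  qed
qed

text \<open>Comparison with the sum over the shells: as \<open>1 \<le> q\<close>, the shells beyond \<open>r0\<close> contribute at most a
  constant times \<open>shell_weight\<close>.\<close>

lemma integrable_decay:
  fixes g :: "real^'p \<Rightarrow> real"
  assumes g [measurable]: "g \<in> borel_measurable borel" and bnd: "\<And>u. 0 \<le> g u" "\<And>u. g u \<le> K0"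
    and q: "1 \<le> q" and D: "real CARD('p) + q < D"
    and r0: "1 \<le> r0" and decay: "\<And>r u. r0 \<le> r \<Longrightarrow> real r \<le> norm u \<Longrightarrow> g u \<le> K / real r powr D"
  shows "integrable lborel (\<lambda>u. (1 + norm u) * g u)"
proof (rule integrableI_bounded)
  define c where "c r = (if r < r0 then (real r + 2) * K0 else (real r + 2) * (K / real r powr D))" for r
  have K0: "0 \<le> K0" using bnd[of 0] by linarith
  have K: "0 \<le> K"
  proof -
    obtain u :: "real^'p" where "norm u = real r0" using vector_choose_size[of "real r0"] by auto
    then have "0 \<le> K / real r0 powr D" using decay[of r0 u] bnd(1)[of u] by linarith
    then show ?thesis using r0 by (simp add: zero_le_divide_iff)
  qed
  have c: "0 \<le> c r" for r using K K0 by (simp add: c_def)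
  have "(\<integral>\<^sup>+u. ennreal (norm ((1 + norm u) * g u)) \<partial>lborel)
     \<le> (\<integral>\<^sup>+u. (\<Sum>r. ennreal (c r) * indicator (shell r :: (real^'p) set) u) \<partial>lborel)"
  proof (rule nn_integral_mono)
    fix u :: "real^'p"
    define r where "r = nat \<lfloor>norm u\<rfloor>"
    have r: "real r \<le> norm u" "norm u < real r + 1" by (auto simp: r_def)
    have "(1 + norm u) * g u \<le> c r"
    proof (cases "r < r0")
      case True
      have "(1 + norm u) * g u \<le> (real r + 2) * K0"
        using r bnd[of u] by (intro mult_mono) auto
      then show ?thesis using True by (simp add: c_def)
    next
      case False
      have "(1 + norm u) * g u \<le> (real r + 2) * (K / real r powr D)"
        using r bnd[of u] decay[of r u] False by (intro mult_mono) auto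
      then show ?thesis using False by (simp add: c_def)
    qed
    then have "ennreal (norm ((1 + norm u) * g u)) \<le> ennreal (c r) * indicator (shell r :: (real^'p) set) u"
      using r bnd(1)[of u] by (simp add: shell_def ennreal_leI)
    also have "\<dots> \<le> (\<Sum>i. ennreal (c i) * indicator (shell i) u)"
    proof -
      define f where "f i = ennreal (c i) * indicator (shell i) u" for i
      have "sum f {r} \<le> suminf f" by (rule sum_le_suminf) auto
      then have "f r \<le> suminf f" by simp
      then show ?thesis unfolding f_def .
    qed
    finally show "ennreal (norm ((1 + norm u) * g u)) \<le> (\<Sum>i. ennreal (c i) * indicator (shell i) u)" .
  qed
  also have "\<dots> = (\<Sum>r. ennreal (c r * measure lborel (shell r :: (real^'p) set)))"
  proof (subst nn_integral_suminf)
    have "emeasure lborel (shell r :: (real^'p) set) = ennreal (measure lborel (shell r :: (real^'p) set))" for r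
      using emeasure_shell[of r, where 'p='p] by (intro emeasure_eq_ennreal_measure) simp
    then show "(\<Sum>r. \<integral>\<^sup>+u. ennreal (c r) * indicator (shell r :: (real^'p) set) u \<partial>lborel)
      = (\<Sum>r. ennreal (c r * measure lborel (shell r :: (real^'p) set)))"
      by (simp add: nn_integral_cmult_indicator ennreal_mult' c)
  qed measurable
  also have "\<dots> < \<infinity>"
  proof -
    have "summable (\<lambda>r. 2 * K * shell_weight TYPE(real^'p) q D r)"
      using q D by (intro summable_mult summable_shell_weight) auto
    then have "summable (\<lambda>r. c r * measure lborel (shell r :: (real^'p) set))"
    proof (rule summable_comparison_test'[where N=r0])
      fix r assume r: "r0 \<le> r"
      have "(real r + 2) \<le> 2 * (real r + 1) powr q"
        using powr_mono[of 1 q "real r + 1"] q by simp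
      then have "(real r + 2) * (K / real r powr D) * measure lborel (shell r :: (real^'p) set)
          \<le> (2 * (real r + 1) powr q) * (K / real r powr D) * measure lborel (shell r :: (real^'p) set)"
        using K by (intro mult_right_mono) auto
      then show "norm (c r * measure lborel (shell r :: (real^'p) set)) \<le> 2 * K * shell_weight TYPE(real^'p) q D r"
        using r c[of r] K by (simp add: c_def shell_weight_def field_simps)
    qed
    then show ?thesis using c by (simp add: suminf_ennreal2 ennreal_less_top)
  qed
  finally show "(\<integral>\<^sup>+u. ennreal (norm ((1 + norm u) * g u)) \<partial>lborel) < \<infinity>" .
qed measurable

text \<open>Suprema over uncountable sets are reduced to a countable dense subset, which makes the crossing
  events and the events on the modulus of continuity measurable.\<close>

lemma SUP_continuous_dense:
  fixes f :: "'b::metric_space \<Rightarrow> real"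
  assumes T: "T \<subseteq> S" "S \<subseteq> closure T" "T \<noteq> {}" and f: "continuous_on S f" "bdd_above (f ` S)"
  shows "(SUP u\<in>S. f u) = (SUP u\<in>T. f u)"
proof (rule antisym)
  show "(SUP u\<in>T. f u) \<le> (SUP u\<in>S. f u)"
    by (rule cSUP_subset_mono) (use assms in auto)
  have bT: "bdd_above (f ` T)" using f T by (meson bdd_above_mono image_mono)
  show "(SUP u\<in>S. f u) \<le> (SUP u\<in>T. f u)"
  proof (rule cSUP_least)
    fix u assume u: "u \<in> S"
    then have "u \<in> closure T" using T by auto
    then obtain x where x: "\<And>n. x n \<in> T" "x \<longlonglongrightarrow> u" unfolding closure_sequential by blast
    have "(\<lambda>n. f (x n)) \<longlonglongrightarrow> f u"
      by (rule continuous_on_tendsto_compose[OF f(1) x(2) u]) (use x(1) T(1) in \<open>auto intro!: always_eventually\<close>)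
    moreover have "f (x n) \<le> (SUP u\<in>T. f u)" for n by (rule cSUP_upper[OF x(1) bT])
    ultimately show "f u \<le> (SUP u\<in>T. f u)" by (intro LIMSEQ_le_const2) auto
  qed (use T in auto)
qed

lemma borel_measurable_SUP_continuous:
  fixes f :: "'w \<Rightarrow> 'b::euclidean_space \<Rightarrow> real"
  assumes "S \<noteq> {}" and cont: "\<And>x. x \<in> space M \<Longrightarrow> continuous_on S (f x)"
    and bdd: "\<And>x. x \<in> space M \<Longrightarrow> bdd_above (f x ` S)"
    and meas: "\<And>u. u \<in> S \<Longrightarrow> (\<lambda>x. f x u) \<in> borel_measurable M"
  shows "(\<lambda>x. SUP u\<in>S. f x u) \<in> borel_measurable M"
proof -
  obtain T where T: "countable T" "T \<subseteq> S" "S \<subseteq> closure T" by (rule separable)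
  then have "T \<noteq> {}" using assms(1) by auto
  have "(\<lambda>x. SUP u\<in>T. f x u) \<in> borel_measurable M"
  proof (rule borel_measurable_cSUP[OF T(1)])
    show "bdd_above ((\<lambda>i. f x i) ` T)" if "x \<in> space M" for x
      using bdd[OF that] T by (meson bdd_above_mono image_mono)
  qed (use meas T in auto)
  then show ?thesis
    by (rule measurable_cong[THEN iffD1, rotated])
       (use SUP_continuous_dense[OF T(2,3) \<open>T \<noteq> {}\<close> cont bdd] in auto)
qed

context ratio_path
begin

lemma bdd_above_z: "bdd_above (z ` S)"
proof -
  obtain K where "\<And>u. z u \<le> K" using z_bounded by auto
  then show ?thesis by (auto simp: bdd_above_def)
qed

text \<open>The condition defining \<open>S_event\<close>, for a single path.\<close>

definition crosses :: "real \<Rightarrow> real \<Rightarrow> bool" where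
  "crosses r e \<longleftrightarrow> e \<le> (if V_set \<Theta> \<theta>\<^sub>s A r = {} then 0 else (SUP u \<in> V_set \<Theta> \<theta>\<^sub>s A r. z u))"

lemma not_crosses:
  assumes "\<not> crosses r e" "u \<in> U" "r \<le> norm u" shows "z u < e"
proof -
  have u: "u \<in> V_set \<Theta> \<theta>\<^sub>s A r" using assms by (simp add: V_set_def)
  then have "z u \<le> (SUP u \<in> V_set \<Theta> \<theta>\<^sub>s A r. z u)" by (intro cSUP_upper bdd_above_z)
  also have "\<dots> < e" using assms(1) u by (auto simp: crosses_def split: if_splits)
  finally show ?thesis .
qed

text \<open>On each shell either the field stays below its threshold, and its contribution is compared
  with the volume of the shell, or it does not, and the contribution, relative to
  the mass, is at most the supremum of \<open>norm u powr q\<close> there.\<close>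

lemma tail_moment_le:
  assumes m: "1 \<le> m" and q: "0 \<le> q" and R: "U \<subseteq> ball 0 (real R)"
  shows "tail_moment q m w \<le> (B / b) * ((\<Sum>r\<in>{m..<R}. (real r + 1) powr q * of_bool (crosses (real r) (c / real r powr D)))
     + \<bar>c\<bar> * inverse (LINT u:U|lborel. z u) * (\<Sum>r\<in>{m..<R}. shell_weight TYPE(real^'p) q D r))"
proof -
  define I where "I = (LINT u:U|lborel. z u)"
  have I_eq: "I = (\<integral>u. indicator U u * z u \<partial>lborel)" by (simp add: I_def set_lebesgue_integral_def)
  have I: "0 < I" unfolding I_eq by (rule integral_zU_pos)
  define S where "S r = crosses (real r) (c / real r powr D)" for r :: nat
  define t where "t r u = (if S r then indicator (shell r) u * (indicator U u * z u)
       else \<bar>c\<bar> / real r powr D * indicator (shell r) u)" for r and u :: "real^'p"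
  have int_t: "integrable lborel (t r)" for r
  proof (cases "S r")
    case True
    have "integrable lborel (\<lambda>u. indicator (shell r) u *\<^sub>R (indicator U u * z u))"
      by (rule integrable_mult_indicator) (auto intro: integrable_zU)
    then show ?thesis using True by (simp add: t_def[abs_def])
  next
    case False
    then show ?thesis using emeasure_shell[of r, where 'p='p]
      by (auto simp: t_def[abs_def] intro!: integrable_mult_right integrable_real_indicator)
  qed
  have "(\<integral>u. indicator {u. real m \<le> norm u} u * norm u powr q * w u \<partial>lborel)
     \<le> (\<integral>u. B * (\<Sum>r\<in>{m..<R}. (real r + 1) powr q * t r u) \<partial>lborel)"
  proof (rule integral_mono[OF integrable_tail[OF q]])
    show "integrable lborel (\<lambda>u. B * (\<Sum>r\<in>{m..<R}. (real r + 1) powr q * t r u))"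
      by (intro integrable_mult_right Bochner_Integration.integrable_sum int_t)
    fix u
    have t0: "0 \<le> t r u" for r using z_nonneg[of u] by (simp add: t_def)
    show "indicator {u. real m \<le> norm u} u * norm u powr q * w u \<le> B * (\<Sum>r\<in>{m..<R}. (real r + 1) powr q * t r u)"
    proof (cases "u \<in> U \<and> real m \<le> norm u")
      case True
      define r where "r = nat \<lfloor>norm u\<rfloor>"
      have r: "real r \<le> norm u" "norm u < real r + 1" by (auto simp: r_def)
      have "norm u < real R" using R True by auto
      then have rm: "r \<in> {m..<R}" using True by (auto simp: r_def le_nat_floor nat_less_iff floor_less_iff le_nat_iff le_floor_iff)
      have "z u \<le> t r u"
      proof (cases "S r")
        case False
        then have "z u < c / real r powr D" using not_crosses[of "real r" _ u] True r by (simp add: S_def)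
        also have "\<dots> \<le> \<bar>c\<bar> / real r powr D" by (intro divide_right_mono) auto
        finally show ?thesis using False r by (simp add: t_def shell_def)
      qed (use True r in \<open>simp add: t_def shell_def\<close>)
      then have "norm u powr q * w u \<le> (real r + 1) powr q * (B * t r u)"
        using r q w_bounds(2)[of u] w_bounds(4)[of u] True B_pos
        by (intro mult_mono powr_mono2) (auto intro: order_trans mult_left_mono)
      also have "\<dots> = B * (\<Sum>i\<in>{r}. (real i + 1) powr q * t i u)" by simp
      also have "\<dots> \<le> B * (\<Sum>i\<in>{m..<R}. (real i + 1) powr q * t i u)"
        using rm t0 B_pos by (intro mult_left_mono sum_mono2) auto
      finally show ?thesis using True by simp
    next
      case False
      then have "indicator {u. real m \<le> norm u} u * norm u powr q * w u = 0" using w_bounds(3)[of u] by auto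
      moreover have "0 \<le> B * (\<Sum>r\<in>{m..<R}. (real r + 1) powr q * t r u)"
        using t0 B_pos by (intro mult_nonneg_nonneg sum_nonneg) auto
      ultimately show ?thesis by linarith
    qed
  qed
  also have "\<dots> = B * (\<Sum>r\<in>{m..<R}. (real r + 1) powr q * (\<integral>u. t r u \<partial>lborel))"
    using int_t by (simp add: Bochner_Integration.integral_sum)
  also have "\<dots> \<le> B * (\<Sum>r\<in>{m..<R}. (real r + 1) powr q * of_bool (S r) * I + \<bar>c\<bar> * shell_weight TYPE(real^'p) q D r)"
  proof (intro mult_left_mono sum_mono)
    fix r
    show "(real r + 1) powr q * (\<integral>u. t r u \<partial>lborel) \<le> (real r + 1) powr q * of_bool (S r) * I + \<bar>c\<bar> * shell_weight TYPE(real^'p) q D r"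
    proof (cases "S r")
      case True
      have "(\<integral>u. t r u \<partial>lborel) \<le> I" unfolding I_eq
        by (rule integral_mono[OF int_t integrable_zU]) (use True z_nonneg in \<open>auto simp: t_def indicator_def\<close>)
      then have "(real r + 1) powr q * (\<integral>u. t r u \<partial>lborel) \<le> (real r + 1) powr q * I" by (intro mult_left_mono) auto
      then show ?thesis using True shell_weight_nonneg[of q D r, where 'p='p] by (simp add: add_increasing2)
    next
      case False
      then have "(\<integral>u. t r u \<partial>lborel) = \<bar>c\<bar> / real r powr D * measure lborel (shell r :: (real^'p) set)"
        using emeasure_shell[of r, where 'p='p] by (simp add: t_def)
      then show ?thesis using False by (simp add: shell_weight_def mult_ac)
    qed
  qed (use B_pos in auto)
  finally have num: "(\<integral>u. indicator {u. real m \<le> norm u} u * norm u powr q * w u \<partial>lborel)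
     \<le> B * ((\<Sum>r\<in>{m..<R}. (real r + 1) powr q * of_bool (S r)) * I + \<bar>c\<bar> * (\<Sum>r\<in>{m..<R}. shell_weight TYPE(real^'p) q D r))"
    by (simp only: sum.distrib sum_distrib_left sum_distrib_right)
  have den: "b * I \<le> (\<integral>u. w u \<partial>lborel)"
  proof -
    have "b * I = (\<integral>u. b * (indicator U u * z u) \<partial>lborel)" by (simp add: I_eq)
    also have "\<dots> \<le> (\<integral>u. w u \<partial>lborel)"
    proof (rule integral_mono)
      show "b * (indicator U u * z u) \<le> w u" for u
        using w_bounds(1,3)[of u] by (cases "u \<in> U") auto
    qed (intro integrable_mult_right integrable_zU integrable_w)+
    finally show ?thesis .
  qed
  have "tail_moment q m w \<le> (B * ((\<Sum>r\<in>{m..<R}. (real r + 1) powr q * of_bool (S r)) * I + \<bar>c\<bar> * (\<Sum>r\<in>{m..<R}. shell_weight TYPE(real^'p) q D r))) / (b * I)"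
    unfolding tail_moment_def
    by (intro frac_le num den) (use b_pos I B_pos in \<open>auto intro!: mult_nonneg_nonneg add_nonneg_nonneg sum_nonneg shell_weight_nonneg\<close>)
  also have "\<dots> = (B / b) * ((\<Sum>r\<in>{m..<R}. (real r + 1) powr q * of_bool (S r))
     + \<bar>c\<bar> * inverse I * (\<Sum>r\<in>{m..<R}. shell_weight TYPE(real^'p) q D r))"
    using b_pos I by (simp add: field_simps)
  finally show ?thesis by (simp add: S_def I_def)
qed

lemma abs_exp_diff_le: "\<bar>1 - exp d\<bar> \<le> exp \<bar>d :: real\<bar> - 1"
proof (cases "d \<ge> 0")
  case False
  have "2 \<le> exp d + exp (- d)"
    using exp_ge_add_one_self[of d] exp_ge_add_one_self[of "-d"] by linarith
  then show ?thesis using False by simp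
qed simp

lemma log_modulus_set_bdd:
  "bdd_above ((\<lambda>(u1, u2). \<bar>ln (z u2) - ln (z u1)\<bar>) ` (U \<times> U))"
proof -
  have "compact (closure \<Theta>)" using bounded_\<Theta> by simp
  then have "bounded (h ` closure \<Theta>)" by (intro compact_imp_bounded compact_continuous_image cont_h)
  then obtain K where K: "\<And>\<theta>. \<theta> \<in> closure \<Theta> \<Longrightarrow> \<bar>h \<theta>\<bar> \<le> K" by (auto simp: bounded_iff)
  have "\<bar>ln (z u2) - ln (z u1)\<bar> \<le> 2 * K" if "u1 \<in> U" "u2 \<in> U" for u1 u2
  proof -
    have "\<theta>\<^sub>s + A *v u1 \<in> closure \<Theta>" "\<theta>\<^sub>s + A *v u2 \<in> closure \<Theta>"
      using that closure_subset by (auto simp: U_set_def)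
    then show ?thesis using K[of "\<theta>\<^sub>s + A *v u1"] K[of "\<theta>\<^sub>s + A *v u2"] that by (simp add: z_U)
  qed
  then show ?thesis by (auto intro!: bdd_aboveI[where M="2*K"])
qed

lemma log_modulus_eq_SUP:
  "log_modulus \<Theta> \<theta>\<^sub>s A z \<delta> c = (SUP u \<in> {(u1, u2). u1 \<in> B_set \<Theta> \<theta>\<^sub>s A c \<and> u2 \<in> B_set \<Theta> \<theta>\<^sub>s A c \<and> norm (u2 - u1) \<le> \<delta>}.
     \<bar>ln (z (snd u)) - ln (z (fst u))\<bar>)"
  unfolding log_modulus_def by (intro arg_cong[where f=Sup]) force

lemma log_modulus_upper:
  assumes "u1 \<in> B_set \<Theta> \<theta>\<^sub>s A c" "u2 \<in> B_set \<Theta> \<theta>\<^sub>s A c" "norm (u2 - u1) \<le> \<delta>"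
  shows "\<bar>ln (z u2) - ln (z u1)\<bar> \<le> log_modulus \<Theta> \<theta>\<^sub>s A z \<delta> c"
  unfolding log_modulus_def
proof (rule cSup_upper)
  show "bdd_above {\<bar>ln (z u2) - ln (z u1)\<bar> |u1 u2. u1 \<in> B_set \<Theta> \<theta>\<^sub>s A c \<and> u2 \<in> B_set \<Theta> \<theta>\<^sub>s A c \<and> norm (u2 - u1) \<le> \<delta>}"
    by (rule bdd_above_mono[OF log_modulus_set_bdd]) (auto simp: B_set_def U_set_def)
qed (use assms in blast)

text \<open>A small modulus of continuity of the log ratio, and of the log prior density, bounds the
  relative error made by replacing the weight of a point by that of its tag.\<close>

lemma weights_close:
  assumes c: "ball 0 c \<subseteq> U" "real m + 1 \<le> c" and k: "CARD('p) \<le> k" "real CARD('p) / real k \<le> \<delta>"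
    and \<epsilon>: "log_modulus \<Theta> \<theta>\<^sub>s A z \<delta> c \<le> \<epsilon>"
    and prior: "\<bar>ln (\<rho> (\<theta>\<^sub>s + A *v u)) - ln (\<rho> \<theta>\<^sub>s)\<bar> \<le> \<epsilon>"
    and u: "u \<in> ball 0 (real m)"
  shows "\<bar>w u - \<rho> \<theta>\<^sub>s * z (grid k u)\<bar> \<le> (exp (2 * \<epsilon>) - 1) * w u"
proof -
  have k1: "1 \<le> k" using k(1) by (metis One_nat_def Suc_leI le_trans zero_less_card_finite)
  have "norm (grid k u) < c"
    using norm_grid_diff[OF k1, of u] k u c(2) norm_triangle_sub[of "grid k u" u]
    by (auto simp: divide_le_eq)
       (smt (verit) divide_le_eq_1 of_nat_0_le_iff of_nat_le_iff)
  then have gB: "grid k u \<in> ball 0 c" and uB: "u \<in> ball 0 c" using u c by auto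
  then have U: "u \<in> U" "grid k u \<in> U" using c by auto
  have "u \<in> B_set \<Theta> \<theta>\<^sub>s A c" "grid k u \<in> B_set \<Theta> \<theta>\<^sub>s A c"
    using U gB uB by (auto simp: B_set_def U_set_def)
  then have "\<bar>ln (z (grid k u)) - ln (z u)\<bar> \<le> log_modulus \<Theta> \<theta>\<^sub>s A z \<delta> c"
    using norm_grid_diff[OF k1, of u] k by (intro log_modulus_upper) auto
  then have l: "\<bar>ln (z (grid k u)) - ln (z u)\<bar> \<le> \<epsilon>" using \<epsilon> by linarith
  have \<rho>: "0 < \<rho> (\<theta>\<^sub>s + A *v u)" "0 < \<rho> \<theta>\<^sub>s"
    using \<rho>_bounds[of "\<theta>\<^sub>s + A *v u"] \<rho>_bounds[OF \<theta>s_in] b_pos U by (auto simp: U_set_def)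
  \<comment> \<open>The logarithm of the ratio of the two weights: one \<open>\<epsilon>\<close> comes from the field, one from the prior.\<close>
  define d where "d = ln (\<rho> \<theta>\<^sub>s) + ln (z (grid k u)) - ln (\<rho> (\<theta>\<^sub>s + A *v u)) - ln (z u)"
  have d: "\<bar>d\<bar> \<le> 2 * \<epsilon>" using l prior by (simp add: d_def)
  have wu: "w u = z u * \<rho> (\<theta>\<^sub>s + A *v u)" using U by (simp add: quasi_weight_def)
  have wd: "\<rho> \<theta>\<^sub>s * z (grid k u) = w u * exp d"
    using \<rho> z_pos[OF U(1)] z_pos[OF U(2)] by (simp add: d_def exp_add exp_diff wu)
  have "\<bar>w u - \<rho> \<theta>\<^sub>s * z (grid k u)\<bar> = w u * \<bar>1 - exp d\<bar>"
  proof -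
    have "w u - w u * exp d = w u * (1 - exp d)" by (simp add: right_diff_distrib)
    then show ?thesis using wd w_bounds(4)[of u] by (simp add: abs_mult)
  qed
  also have "\<dots> \<le> w u * (exp (2 * \<epsilon>) - 1)"
    using abs_exp_diff_le[of d] d w_bounds(4)[of u] by (intro mult_left_mono) (auto intro: order_trans)
  finally show ?thesis by (simp add: mult.commute)
qed

end

section \<open>The estimators along a sequence\<close>

text \<open>The hypotheses along one sequence of indices, with the random constants \<open>cU\<close> and \<open>cV\<close> of the tail
  condition and the bounds \<open>b\<close> and \<open>B\<close> of the prior density fixed.\<close>

locale quasi_bayes =
  fixes M C G :: "'w measure" and N :: "'v measure" and \<pi> :: "'v \<Rightarrow> 'w"
    and \<Theta> :: "(real^'p) set" and \<theta>\<^sub>s :: "real^'p" and \<rho> :: "real^'p \<Rightarrow> real" and b B :: real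
    and A :: "nat \<Rightarrow> real^'p^'p" and H Z :: "nat \<Rightarrow> 'w \<Rightarrow> real^'p \<Rightarrow> real"
    and \<Psi> :: "nat \<Rightarrow> 'w \<Rightarrow> real" and Zlim :: "'v \<Rightarrow> ((real^'p) \<Rightarrow>\<^sub>C real)"
    and q D L :: real and cU cV :: "'w \<Rightarrow> real"
  assumes prob_M: "prob_space M" and sub_G: "subalgebra M G" and sub_C: "subalgebra G C"
    and ext: "prob_extension M N \<pi>"
    and path: "\<And>n \<omega>. \<omega> \<in> space M \<Longrightarrow> ratio_path \<Theta> \<theta>\<^sub>s (A n) \<rho> b B (H n \<omega>) (Z n \<omega>)"
    and A_lim: "A \<longlonglongrightarrow> 0"
    and Z_joint: "\<And>n. (\<lambda>(\<omega>, u). Z n \<omega> u) \<in> borel_measurable (M \<Otimes>\<^sub>M borel)"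
    and \<Psi>_C: "\<And>n. \<Psi> n \<in> borel_measurable C"
    and \<Psi>_range: "\<And>n \<omega>. \<omega> \<in> space M \<Longrightarrow> 0 \<le> \<Psi> n \<omega> \<and> \<Psi> n \<omega> \<le> 1"
    and Zlim_meas: "Zlim \<in> N \<rightarrow>\<^sub>M restrict_space borel C_hat"
    and q: "1 \<le> q" and D: "real CARD('p) + q < D" and L: "q + 1 < L"
    and cU_C: "cU \<in> borel_measurable C" and cV_C: "cV \<in> borel_measurable C"
    and tail: "\<And>n r::nat. 1 \<le> r \<Longrightarrow> AE \<omega> in M.
          event_prob_given M C (S_event M \<Theta> \<theta>\<^sub>s (A n) (Z n) (real r) (\<lambda>\<omega>. cU \<omega> / real r powr D)) \<omega> * \<Psi> n \<omega>
            \<le> cV \<omega> / real r powr L"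
    and modulus: "\<And>\<epsilon> c. 0 < \<epsilon> \<Longrightarrow> 0 < c \<Longrightarrow> conv_in_prob M
            (\<lambda>\<delta> \<omega>. real_of_ereal (limsup (\<lambda>n. ereal
               (event_prob_given M C (W_event M \<Theta> \<theta>\<^sub>s (A n) (Z n) \<delta> c \<epsilon>) \<omega> * \<Psi> n \<omega>))))
            (\<lambda>\<omega>. 0) (at_right 0)"
    and fidi: "\<And>(k::nat) (u::nat \<Rightarrow> real^'p) (g::(nat \<Rightarrow> real) \<Rightarrow> real) (Y::'w \<Rightarrow> real).
          1 \<le> k \<Longrightarrow> continuous_map (Euclidean_space k) euclideanreal g \<Longrightarrow>
          bounded (g ` topspace (Euclidean_space k)) \<Longrightarrow> bounded_rv G Y \<Longrightarrow>
          conv_in_prob N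
            (\<lambda>n \<omega>. cond_expect M C
               (\<lambda>\<omega>. g (\<lambda>i. if i < k then Z n \<omega> (u i) else 0) * \<Psi> n \<omega> * Y \<omega>) (\<pi> \<omega>))
            (cond_expect N (lift_field N \<pi> C)
               (\<lambda>\<omega>. g (\<lambda>i. if i < k then apply_bcontfun (Zlim \<omega>) (u i) else 0) * Y (\<pi> \<omega>)))
            sequentially"
    and \<Psi>_lim: "conv_in_prob M \<Psi> (\<lambda>\<omega>. 1) sequentially"
    and mass: "bounded_in_prob M
          (\<lambda>n. cond_nn_expect M C (\<lambda>\<omega>. inverse (LINT u:U_set \<Theta> \<theta>\<^sub>s (A n)|lborel. Z n \<omega> u)))
          sequentially"
begin

lemma sub_MC: "subalgebra M C"
  using sub_G sub_C by (auto simp: subalgebra_def)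

sublocale M: prob_subalgebra M C
  using prob_M sub_MC by (intro prob_subalgebra.intro prob_subalgebra_axioms.intro)

lemma \<pi>_meas [measurable]: "\<pi> \<in> N \<rightarrow>\<^sub>M M" and distr_\<pi>: "distr N M \<pi> = M" and prob_N: "prob_space N"
  using ext by (auto simp: prob_extension_def)

abbreviation C' where "C' \<equiv> lift_field N \<pi> C"

lemma sub_NC: "subalgebra N C'"
proof -
  have "\<pi> \<in> N \<rightarrow>\<^sub>M C" using \<pi>_meas sub_MC by (auto simp: measurable_def subalgebra_def)
  then have "sets (vimage_algebra (space N) \<pi> C) \<subseteq> sets N" by (intro sets_image_in_sets) auto
  then show ?thesis by (simp add: subalgebra_def lift_field_def)
qed

sublocale N: prob_subalgebra N C'
  using prob_N sub_NC by (intro prob_subalgebra.intro prob_subalgebra_axioms.intro)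

lemma C_G: "f \<in> borel_measurable C \<Longrightarrow> f \<in> borel_measurable G"
  using measurable_from_subalg[OF sub_C] .

lemma G_M: "f \<in> borel_measurable G \<Longrightarrow> f \<in> borel_measurable M"
  using measurable_from_subalg[OF sub_G] .

lemma C_M: "f \<in> borel_measurable C \<Longrightarrow> f \<in> borel_measurable M"
  using measurable_from_subalg[OF sub_MC] .

lemma \<Psi>_M [measurable]: "\<Psi> n \<in> borel_measurable M"
  using C_M[OF \<Psi>_C] .

lemma Z_M [measurable]: "(\<lambda>\<omega>. Z n \<omega> u) \<in> borel_measurable M"
  using measurable_compose[OF measurable_Pair2'[of u borel M] Z_joint[of n]] by simp

abbreviation UT where "UT n \<equiv> U_set \<Theta> \<theta>\<^sub>s (A n)"
abbreviation wT where "wT n \<omega> \<equiv> quasi_weight \<Theta> \<theta>\<^sub>s (A n) \<rho> (Z n \<omega>)"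

text \<open>The rescaled estimator; it agrees with \<open>u_tilde\<close> by the change of variables.\<close>

definition uT :: "nat \<Rightarrow> 'w \<Rightarrow> real^'p" where "uT n \<omega> = u_limit (wT n \<omega>)"

lemma some_path: obtains h z where "ratio_path \<Theta> \<theta>\<^sub>s (A n) \<rho> b B h z"
proof -
  obtain \<omega> where "\<omega> \<in> space M" using M.not_empty by auto
  then show ?thesis using path that by blast
qed

lemma borel_UT [measurable]: "UT n \<in> sets borel"
  by (rule some_path[of n]) (rule ratio_path.borel_U)

lemma bB: "0 < b" "0 < B"
  by (rule some_path[of 0], erule ratio_path.b_pos) (rule some_path[of 0], erule ratio_path.B_pos)

lemma wT_joint [measurable]: "(\<lambda>(\<omega>, u). wT n \<omega> u) \<in> borel_measurable (M \<Otimes>\<^sub>M borel)"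
proof -
  obtain h z where r: "ratio_path \<Theta> \<theta>\<^sub>s (A n) \<rho> b B h z" by (rule some_path)
  have [measurable]: "(\<lambda>u. indicator (UT n) u *\<^sub>R (\<rho> (\<theta>\<^sub>s + A n *v u))) \<in> borel_measurable borel"
    by (rule borel_measurable_continuous_on_indicator[OF borel_UT ratio_path.cont_\<rho>_U[OF r]])
  have [measurable]: "(\<lambda>p. Z n (fst p) (snd p)) \<in> borel_measurable (M \<Otimes>\<^sub>M borel)"
    using Z_joint[of n] by (simp add: case_prod_beta')
  have "(\<lambda>p. Z n (fst p) (snd p) * (indicator (UT n) (snd p) *\<^sub>R (\<rho> (\<theta>\<^sub>s + A n *v (snd p))))) \<in> borel_measurable (M \<Otimes>\<^sub>M borel)"
    by measurable
  then show ?thesis by (simp add: quasi_weight_def case_prod_beta' mult_ac)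
qed

lemma borel_integral_param:
  fixes f :: "'w \<Rightarrow> real^'p \<Rightarrow> 'b::{banach, second_countable_topology}"
  assumes "(\<lambda>(\<omega>, u). f \<omega> u) \<in> borel_measurable (M \<Otimes>\<^sub>M borel)"
  shows "(\<lambda>\<omega>. \<integral>u. f \<omega> u \<partial>lborel) \<in> borel_measurable M"
proof (rule lborel.borel_measurable_lebesgue_integral)
  show "(\<lambda>(\<omega>, u). f \<omega> u) \<in> borel_measurable (M \<Otimes>\<^sub>M lborel)"
    using assms by (subst measurable_cong_sets[of _ "M \<Otimes>\<^sub>M borel" _ borel]) (auto intro: sets_pair_measure_cong)
qed

lemma uT_M [measurable]: "uT n \<in> borel_measurable M"
  unfolding uT_def[abs_def] u_limit_def
  by (intro borel_measurable_scaleR borel_measurable_inverse borel_integral_param) measurable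

lemma tail_moment_M [measurable]: "(\<lambda>\<omega>. tail_moment q m (wT n \<omega>)) \<in> borel_measurable M"
  unfolding tail_moment_def
  by (intro borel_measurable_divide borel_integral_param) measurable

lemma mass_M [measurable]: "(\<lambda>\<omega>. inverse (LINT u:UT n|lborel. Z n \<omega> u)) \<in> borel_measurable M"
proof -
  have [measurable]: "(\<lambda>p. Z n (fst p) (snd p)) \<in> borel_measurable (M \<Otimes>\<^sub>M borel)"
    using Z_joint[of n] by (simp add: case_prod_beta')
  show ?thesis unfolding set_lebesgue_integral_def
    by (intro borel_measurable_inverse borel_integral_param) (simp add: case_prod_beta')
qed

lemma S_event_eq:
  "S_event M \<Theta> \<theta>\<^sub>s (A n) (Z n) r e = {\<omega> \<in> space M. ratio_path.crosses \<Theta> \<theta>\<^sub>s (A n) (Z n \<omega>) r (e \<omega>)}"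
  unfolding S_event_def by (intro Collect_cong conj_cong refl) (simp add: ratio_path.crosses_def[OF path])

lemma S_event_M:
  assumes e [measurable]: "e \<in> borel_measurable M"
  shows "S_event M \<Theta> \<theta>\<^sub>s (A n) (Z n) r e \<in> sets M"
proof -
  let ?V = "V_set \<Theta> \<theta>\<^sub>s (A n) r"
  have [measurable]: "(\<lambda>\<omega>. SUP u\<in>?V. Z n \<omega> u) \<in> borel_measurable M" if "?V \<noteq> {}"
  proof (rule borel_measurable_SUP_continuous[OF that])
    fix \<omega> assume "\<omega> \<in> space M"
    then interpret ratio_path \<Theta> \<theta>\<^sub>s "A n" \<rho> b B "H n \<omega>" "Z n \<omega>" by (rule path)
    show "continuous_on ?V (Z n \<omega>)" "bdd_above (Z n \<omega> ` ?V)" by (rule cont_z bdd_above_z)+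
  qed simp
  show ?thesis unfolding S_event_def by (cases "?V = {}") (simp_all, measurable)
qed

lemma W_event_M:
  assumes "0 \<le> \<delta>" "0 < c"
  shows "W_event M \<Theta> \<theta>\<^sub>s (A n) (Z n) \<delta> c \<epsilon> \<in> sets M"
proof -
  define P where "P = {(u1, u2). u1 \<in> B_set \<Theta> \<theta>\<^sub>s (A n) c \<and> u2 \<in> B_set \<Theta> \<theta>\<^sub>s (A n) c \<and> norm (u2 - u1) \<le> \<delta>}"
  have PU: "P \<subseteq> UT n \<times> UT n" by (auto simp: P_def B_set_def U_set_def)
  have [measurable]: "(\<lambda>\<omega>. SUP u\<in>P. \<bar>ln (Z n \<omega> (snd u)) - ln (Z n \<omega> (fst u))\<bar>) \<in> borel_measurable M"
  proof (rule borel_measurable_SUP_continuous)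
    obtain h z where "ratio_path \<Theta> \<theta>\<^sub>s (A n) \<rho> b B h z" by (rule some_path)
    then have "(0, 0) \<in> P" using ratio_path.zero_in_U assms by (auto simp: P_def B_set_def U_set_def)
    then show "P \<noteq> {}" by auto
    fix \<omega> assume \<omega>: "\<omega> \<in> space M"
    interpret ratio_path \<Theta> \<theta>\<^sub>s "A n" \<rho> b B "H n \<omega>" "Z n \<omega>" by (rule path[OF \<omega>])
    have "continuous_on P (\<lambda>u. Z n \<omega> (snd u))" "continuous_on P (\<lambda>u. Z n \<omega> (fst u))"
      by (auto intro!: continuous_on_compose2[OF cont_z[of UNIV]] continuous_intros)
    moreover have "Z n \<omega> (snd u) \<noteq> 0" "Z n \<omega> (fst u) \<noteq> 0" if "u \<in> P" for u
      using z_pos that PU by (metis less_irrefl mem_Times_iff subsetD)+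
    ultimately show "continuous_on P (\<lambda>u. \<bar>ln (Z n \<omega> (snd u)) - ln (Z n \<omega> (fst u))\<bar>)"
      by (intro continuous_intros) auto
    show "bdd_above ((\<lambda>u. \<bar>ln (Z n \<omega> (snd u)) - ln (Z n \<omega> (fst u))\<bar>) ` P)"
      by (rule bdd_above_mono[OF log_modulus_set_bdd]) (use PU in force)
  qed measurable
  have "W_event M \<Theta> \<theta>\<^sub>s (A n) (Z n) \<delta> c \<epsilon> = {\<omega> \<in> space M. \<epsilon> < (SUP u\<in>P. \<bar>ln (Z n \<omega> (snd u)) - ln (Z n \<omega> (fst u))\<bar>)}"
    unfolding W_event_def P_def
    using ratio_path.log_modulus_eq_SUP[OF path] by (intro Collect_cong conj_cong refl) simp
  then show ?thesis by simp
qed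

lemma uT_eq: "\<omega> \<in> space M \<Longrightarrow> u_tilde \<Theta> \<theta>\<^sub>s (A n) \<rho> (H n \<omega>) = uT n \<omega>"
  unfolding uT_def by (rule ratio_path.u_tilde_eq[OF path])

lemma expectation_\<Psi>_deficit: "(\<lambda>n. \<integral>\<omega>. 1 - \<Psi> n \<omega> \<partial>M) \<longlonglongrightarrow> 0"
proof (rule LIMSEQ_I)
  fix e :: real assume e: "0 < e"
  define S where "S n = {\<omega> \<in> space M. e / 3 \<le> dist (\<Psi> n \<omega>) 1}" for n
  have "(\<lambda>n. measure M (S n)) \<longlonglongrightarrow> 0"
    unfolding S_def using \<Psi>_lim[unfolded conv_in_prob_def, rule_format, of "e / 3"] e by simp
  then have "\<forall>\<^sub>F n in sequentially. measure M (S n) < e / 3"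
    using e by (intro order_tendstoD) auto
  then obtain n0 where n0: "\<And>n. n0 \<le> n \<Longrightarrow> measure M (S n) < e / 3" by (auto simp: eventually_sequentially)
  have "norm ((\<integral>\<omega>. 1 - \<Psi> n \<omega> \<partial>M) - 0) < e" if "n0 \<le> n" for n
  proof -
    have [measurable]: "S n \<in> sets M" unfolding S_def by measurable
    have "(\<integral>\<omega>. 1 - \<Psi> n \<omega> \<partial>M) \<le> (\<integral>\<omega>. e / 3 + indicator (S n) \<omega> \<partial>M)"
    proof (rule integral_mono)
      show "1 - \<Psi> n \<omega> \<le> e / 3 + indicator (S n) \<omega>" if "\<omega> \<in> space M" for \<omega>
        using \<Psi>_range[OF that, of n] that e by (auto simp: S_def indicator_def dist_real_def)
      show "integrable M (\<lambda>\<omega>. 1 - \<Psi> n \<omega>)"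
        by (rule M.integrable_bounded_rv[where B=1]) (use \<Psi>_range[of _ n] in auto)
      show "integrable M (\<lambda>\<omega>. e / 3 + indicator (S n) \<omega>)"
        by (rule M.integrable_bounded_rv[where B="e / 3 + 1"]) (use e in \<open>auto simp: indicator_def\<close>)
    qed
    also have "\<dots> = e / 3 + measure M (S n)"
    proof (subst Bochner_Integration.integral_add)
      show "integrable M (indicator (S n) :: 'w \<Rightarrow> real)"
        by (rule M.integrable_bounded_rv[where B=1]) auto
    qed (auto simp: M.prob_space)
    also have "\<dots> < e" using n0[OF that] e by linarith
    finally have "(\<integral>\<omega>. 1 - \<Psi> n \<omega> \<partial>M) < e" .
    moreover have "0 \<le> (\<integral>\<omega>. 1 - \<Psi> n \<omega> \<partial>M)"
      by (rule Bochner_Integration.integral_nonneg_AE) (use \<Psi>_range in auto)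
    ultimately show ?thesis by simp
  qed
  then show "\<exists>no. \<forall>n\<ge>no. norm ((\<integral>\<omega>. 1 - \<Psi> n \<omega> \<partial>M) - 0) < e" by blast
qed

lemma prob_\<Psi>_small: "(\<lambda>n. M.prob {\<omega> \<in> space M. \<Psi> n \<omega> < 1/2}) \<longlonglongrightarrow> 0"
proof (rule tendsto_sandwich[OF _ _ tendsto_const])
  show "(\<lambda>n. M.prob {\<omega> \<in> space M. 1/2 \<le> dist (\<Psi> n \<omega>) 1}) \<longlonglongrightarrow> 0"
    using \<Psi>_lim[unfolded conv_in_prob_def, rule_format, of "1/2"] by simp
  show "\<forall>\<^sub>F n in sequentially. M.prob {\<omega> \<in> space M. \<Psi> n \<omega> < 1/2} \<le> M.prob {\<omega> \<in> space M. 1/2 \<le> dist (\<Psi> n \<omega>) 1}"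
    by (intro always_eventually allI M.finite_measure_mono) (auto simp: dist_real_def)
qed auto

end

lemma summable_shifted_powr_quotient:
  fixes q L :: real
  assumes q: "0 \<le> q" and L: "q + 1 < L"
  shows "summable (\<lambda>r. (real r + 1) powr q / real r powr L)"
proof -
  have "summable (\<lambda>r. 2 powr q * real r powr (q - L))"
    using L by (intro summable_mult) (simp add: summable_real_powr_iff)
  then show ?thesis
  proof (rule summable_comparison_test'[where N=1])
    fix r :: nat assume r: "1 \<le> r"
    have "(real r + 1) powr q \<le> 2 powr q * real r powr q"
      using r q by (subst powr_mult[symmetric]) (auto intro!: powr_mono2)
    then show "norm ((real r + 1) powr q / real r powr L) \<le> 2 powr q * real r powr (q - L)"
      by (simp add: powr_diff divide_right_mono)
  qed
qed

context prob_subalgebra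
begin

lemma nn_cond_exp_finite_sum:
  assumes "finite I" and [measurable]: "\<And>i. f i \<in> borel_measurable M"
  shows "AE x in M. (\<Sum>i\<in>I. nn_cond_exp M F (f i) x) = nn_cond_exp M F (\<lambda>x. \<Sum>i\<in>I. f i x) x"
  using assms(1)
proof (induction I rule: finite_induct)
  case empty
  have "AE x in M. (0::ennreal) = nn_cond_exp M F (\<lambda>_. 0) x"
    by (rule nn_cond_exp_F_meas) simp
  then show ?case by simp
next
  case (insert i I)
  have "AE x in M. nn_cond_exp M F (f i) x + nn_cond_exp M F (\<lambda>x. \<Sum>i\<in>I. f i x) x
      = nn_cond_exp M F (\<lambda>x. f i x + (\<Sum>i\<in>I. f i x)) x"
    by (rule nn_cond_exp_sum) measurable
  with insert show ?case by (auto elim: eventually_elim2)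
qed

lemma prob_large_small:
  fixes X :: "'a \<Rightarrow> real"
  assumes [measurable]: "X \<in> borel_measurable M" and e: "0 < e"
  obtains K where "0 < K" "prob {x \<in> space M. K < \<bar>X x\<bar>} \<le> e"
proof -
  have "(\<lambda>n. prob {x \<in> space M. real n < \<bar>X x\<bar>}) \<longlonglongrightarrow> prob (\<Inter>n. {x \<in> space M. real n < \<bar>X x\<bar>})"
    by (rule finite_Lim_measure_decseq) (auto simp: decseq_def)
  moreover have "(\<Inter>n. {x \<in> space M. real n < \<bar>X x\<bar>}) = {}"
    by (auto simp: not_less) (meson reals_Archimedean2 less_asym)
  ultimately have "(\<lambda>n. prob {x \<in> space M. real n < \<bar>X x\<bar>}) \<longlonglongrightarrow> 0" by simp
  then have "\<forall>\<^sub>F n in sequentially. prob {x \<in> space M. real n < \<bar>X x\<bar>} < e"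
    using e by (rule order_tendstoD)
  then obtain n0 where n0: "\<And>n. n0 \<le> n \<Longrightarrow> prob {x \<in> space M. real n < \<bar>X x\<bar>} < e"
    by (auto simp: eventually_sequentially)
  show ?thesis by (rule that[of "real (Suc n0)"]) (use n0[of "Suc n0"] in auto)
qed

end

context quasi_bayes
begin

text \<open>Where the field crosses its thresholds the tail moment is controlled by the conditional
  probabilities of crossing, elsewhere by the inverse of the mass. As \<open>U_set\<close> is bounded, only
  finitely many shells count.\<close>

lemma cond_tail_moment_le:
  assumes m: "1 \<le> m"
  shows "AE \<omega> in M. ennreal (\<Psi> n \<omega>) * nn_cond_exp M C (\<lambda>\<omega>. ennreal (tail_moment q m (wT n \<omega>))) \<omega>
     \<le> ennreal (B / b) * (ennreal (\<bar>cV \<omega>\<bar> * (\<Sum>r. (real (r + m) + 1) powr q / real (r + m) powr L))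
       + ennreal (\<bar>cU \<omega>\<bar> * (\<Sum>r. shell_weight TYPE(real^'p) q D (r + m)))
        * nn_cond_exp M C (\<lambda>\<omega>. ennreal (inverse (LINT u:UT n|lborel. Z n \<omega> u))) \<omega>)"
proof -
  define s where "s = (\<Sum>r. (real (r + m) + 1) powr q / real (r + m) powr L)"
  define \<kappa> where "\<kappa> = (\<Sum>r. shell_weight TYPE(real^'p) q D (r + m))"
  define Q where "Q \<omega> = inverse (LINT u:UT n|lborel. Z n \<omega> u)" for \<omega>
  define J where "J \<omega> = tail_moment q m (wT n \<omega>)" for \<omega>
  obtain h z where "ratio_path \<Theta> \<theta>\<^sub>s (A n) \<rho> b B h z" by (rule some_path)
  then obtain R0 where R0: "\<And>u. u \<in> UT n \<Longrightarrow> norm u \<le> R0" by (metis ratio_path.U_norm_bound)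
  obtain R :: nat where "R0 < real R" using reals_Archimedean2 by blast
  then have R: "UT n \<subseteq> ball 0 (real R)" using R0 by force
  define S where "S r = S_event M \<Theta> \<theta>\<^sub>s (A n) (Z n) (real r) (\<lambda>\<omega>. cU \<omega> / real r powr D)" for r :: nat
  have [measurable]: "cU \<in> borel_measurable M" "cV \<in> borel_measurable M" using C_M cU_C cV_C by auto
  have [measurable]: "S r \<in> sets M" for r unfolding S_def by (rule S_event_M) measurable
  have [measurable]: "Q \<in> borel_measurable M" "J \<in> borel_measurable M" unfolding Q_def J_def by measurable
  have split: "(\<Sum>r\<in>{m..<R}. f r) \<le> (\<Sum>r. f (r + m))" if "summable f" "\<And>r. 0 \<le> f r" for f :: "nat \<Rightarrow> real"
  proof -
    have "(\<Sum>r\<in>{m..<R}. f r) = (\<Sum>r\<in>{..<R - m}. f (r + m))"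
      by (rule sum.reindex_bij_witness[of _ "\<lambda>r. r + m" "\<lambda>r. r - m"]) auto
    also have "\<dots> \<le> (\<Sum>r. f (r + m))"
      using that summable_ignore_initial_segment[OF that(1)] by (intro sum_le_suminf) auto
    finally show ?thesis .
  qed
  have sum_s: "summable (\<lambda>r. (real r + 1) powr q / real r powr L)"
    using q L by (intro summable_shifted_powr_quotient) auto
  have sum_\<kappa>: "summable (shell_weight TYPE(real^'p) q D)"
    using q D by (intro summable_shell_weight) auto
  have \<kappa>: "(\<Sum>r\<in>{m..<R}. shell_weight TYPE(real^'p) q D r) \<le> \<kappa>" "0 \<le> \<kappa>"
    unfolding \<kappa>_def using sum_\<kappa> summable_ignore_initial_segment[OF sum_\<kappa>]
    by (auto intro!: split suminf_nonneg shell_weight_nonneg)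
  have s: "(\<Sum>r\<in>{m..<R}. (real r + 1) powr q / real r powr L) \<le> s" "0 \<le> s"
  proof -
    show "(\<Sum>r\<in>{m..<R}. (real r + 1) powr q / real r powr L) \<le> s"
      unfolding s_def by (rule split[OF sum_s]) simp
    show "0 \<le> s" unfolding s_def
      by (rule suminf_nonneg[OF summable_ignore_initial_segment[OF sum_s]]) simp
  qed
  define X1 where "X1 \<omega> = (\<Sum>r\<in>{m..<R}. ennreal ((real r + 1) powr q) * indicator (S r) \<omega>)" for \<omega>
  define X2 where "X2 \<omega> = ennreal (\<bar>cU \<omega>\<bar> * \<kappa>) * ennreal (Q \<omega>)" for \<omega>
  have [measurable]: "X1 \<in> borel_measurable M" "X2 \<in> borel_measurable M" unfolding X1_def X2_def by measurable
  have "AE \<omega> in M. nn_cond_exp M C (\<lambda>\<omega>. ennreal (J \<omega>)) \<omega> \<le> nn_cond_exp M C (\<lambda>\<omega>. ennreal (B / b) * (X1 \<omega> + X2 \<omega>)) \<omega>"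
  proof (intro M.nn_cond_exp_mono AE_I2)
    fix \<omega> assume \<omega>: "\<omega> \<in> space M"
    interpret ratio_path \<Theta> \<theta>\<^sub>s "A n" \<rho> b B "H n \<omega>" "Z n \<omega>" by (rule path[OF \<omega>])
    have cr: "of_bool (crosses (real r) (cU \<omega> / real r powr D)) = indicat_real (S r) \<omega>" for r :: nat
      using \<omega> by (auto simp: S_def S_event_eq indicator_def)
    have Q0: "0 \<le> Q \<omega>"
      unfolding Q_def set_lebesgue_integral_def using integral_zU_pos by simp
    have "J \<omega> \<le> (B / b) * ((\<Sum>r\<in>{m..<R}. (real r + 1) powr q * indicator (S r) \<omega>)
       + \<bar>cU \<omega>\<bar> * Q \<omega> * (\<Sum>r\<in>{m..<R}. shell_weight TYPE(real^'p) q D r))"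
      using tail_moment_le[OF m _ R, of q "cU \<omega>" D] q unfolding cr J_def Q_def by simp
    also have "\<dots> \<le> (B / b) * ((\<Sum>r\<in>{m..<R}. (real r + 1) powr q * indicator (S r) \<omega>) + \<bar>cU \<omega>\<bar> * \<kappa> * Q \<omega>)"
    proof -
      have "\<bar>cU \<omega>\<bar> * Q \<omega> * (\<Sum>r\<in>{m..<R}. shell_weight TYPE(real^'p) q D r) \<le> \<bar>cU \<omega>\<bar> * Q \<omega> * \<kappa>"
        using \<kappa> Q0 by (intro mult_left_mono) auto
      then show ?thesis using b_pos B_pos by (intro mult_left_mono add_left_mono) (auto simp: mult_ac)
    qed
    finally have "ennreal (J \<omega>) \<le> ennreal ((B / b) * ((\<Sum>r\<in>{m..<R}. (real r + 1) powr q * indicator (S r) \<omega>) + \<bar>cU \<omega>\<bar> * \<kappa> * Q \<omega>))"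
      by (rule ennreal_leI)
    also have "\<dots> = ennreal (B / b) * (X1 \<omega> + X2 \<omega>)"
    proof -
      have "X1 \<omega> = ennreal (\<Sum>r\<in>{m..<R}. (real r + 1) powr q * indicator (S r) \<omega>)"
        unfolding X1_def by (subst sum_ennreal[symmetric]) (auto intro!: sum.cong simp: indicator_def)
      moreover have "X2 \<omega> = ennreal (\<bar>cU \<omega>\<bar> * \<kappa> * Q \<omega>)"
        unfolding X2_def using \<kappa> Q0 by (simp add: ennreal_mult)
      ultimately show ?thesis using b_pos B_pos \<kappa> Q0
        by (subst ennreal_mult) (auto simp: ennreal_plus sum_nonneg)
    qed
    finally show "ennreal (J \<omega>) \<le> ennreal (B / b) * (X1 \<omega> + X2 \<omega>)" .
  qed measurable
  moreover have "AE \<omega> in M. ennreal (B / b) * nn_cond_exp M C (\<lambda>\<omega>. X1 \<omega> + X2 \<omega>) \<omega> = nn_cond_exp M C (\<lambda>\<omega>. ennreal (B / b) * (X1 \<omega> + X2 \<omega>)) \<omega>"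
    by (rule M.nn_cond_exp_prod) measurable
  moreover have "AE \<omega> in M. nn_cond_exp M C X1 \<omega> + nn_cond_exp M C X2 \<omega> = nn_cond_exp M C (\<lambda>\<omega>. X1 \<omega> + X2 \<omega>) \<omega>"
    by (rule M.nn_cond_exp_sum) measurable
  moreover have "AE \<omega> in M. (\<Sum>r\<in>{m..<R}. nn_cond_exp M C (\<lambda>\<omega>. ennreal ((real r + 1) powr q) * indicator (S r) \<omega>) \<omega>) = nn_cond_exp M C X1 \<omega>"
    unfolding X1_def by (rule M.nn_cond_exp_finite_sum) measurable
  moreover have "AE \<omega> in M. \<forall>r. ennreal ((real r + 1) powr q) * nn_cond_exp M C (indicator (S r)) \<omega> = nn_cond_exp M C (\<lambda>\<omega>. ennreal ((real r + 1) powr q) * indicator (S r) \<omega>) \<omega>"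
    unfolding AE_all_countable by (intro allI M.nn_cond_exp_prod) measurable
  moreover have "AE \<omega> in M. \<forall>r. ennreal (event_prob_given M C (S r) \<omega>) = nn_cond_exp M C (indicator (S r)) \<omega>"
    unfolding AE_all_countable by (intro allI M.ennreal_event_prob_given) measurable
  moreover have "AE \<omega> in M. \<forall>r::nat. 1 \<le> r \<longrightarrow> event_prob_given M C (S r) \<omega> * \<Psi> n \<omega> \<le> cV \<omega> / real r powr L"
    unfolding AE_all_countable using tail[of _ n] by (auto simp: S_def)
  moreover have "AE \<omega> in M. ennreal (\<bar>cU \<omega>\<bar> * \<kappa>) * nn_cond_exp M C (\<lambda>\<omega>. ennreal (Q \<omega>)) \<omega> = nn_cond_exp M C X2 \<omega>"
    unfolding X2_def
  proof (rule M.nn_cond_exp_prod)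
    show "(\<lambda>\<omega>. ennreal (\<bar>cU \<omega>\<bar> * \<kappa>)) \<in> borel_measurable C"
      using cU_C by simp
  qed measurable
  ultimately have "AE \<omega> in M. ennreal (\<Psi> n \<omega>) * nn_cond_exp M C (\<lambda>\<omega>. ennreal (J \<omega>)) \<omega>
     \<le> ennreal (B / b) * (ennreal (\<bar>cV \<omega>\<bar> * s) + ennreal (\<bar>cU \<omega>\<bar> * \<kappa>) * nn_cond_exp M C (\<lambda>\<omega>. ennreal (Q \<omega>)) \<omega>)"
    using AE_space
  proof eventually_elim
    case (elim \<omega>)
    have \<Psi>: "0 \<le> \<Psi> n \<omega>" "\<Psi> n \<omega> \<le> 1" using \<Psi>_range elim by auto
    have "ennreal (\<Psi> n \<omega>) * nn_cond_exp M C X1 \<omega>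
        = (\<Sum>r\<in>{m..<R}. ennreal ((real r + 1) powr q) * (ennreal (event_prob_given M C (S r) \<omega>) * ennreal (\<Psi> n \<omega>)))"
      using elim by (simp add: sum_distrib_left mult_ac flip: elim(4))
    also have "\<dots> \<le> (\<Sum>r\<in>{m..<R}. ennreal (\<bar>cV \<omega>\<bar> * ((real r + 1) powr q / real r powr L)))"
    proof (rule sum_mono)
      fix r assume "r \<in> {m..<R}"
      then have "1 \<le> r" using m by auto
      then have "event_prob_given M C (S r) \<omega> * \<Psi> n \<omega> \<le> cV \<omega> / real r powr L" using elim by auto
      also have "\<dots> \<le> \<bar>cV \<omega>\<bar> / real r powr L" by (intro divide_right_mono) auto
      finally have "ennreal (event_prob_given M C (S r) \<omega>) * ennreal (\<Psi> n \<omega>) \<le> ennreal (\<bar>cV \<omega>\<bar> / real r powr L)"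
        using \<Psi> by (simp add: ennreal_mult''[symmetric] ennreal_leI)
      then have "ennreal ((real r + 1) powr q) * (ennreal (event_prob_given M C (S r) \<omega>) * ennreal (\<Psi> n \<omega>))
         \<le> ennreal ((real r + 1) powr q) * ennreal (\<bar>cV \<omega>\<bar> / real r powr L)" by (rule mult_left_mono) simp
      also have "\<dots> = ennreal (\<bar>cV \<omega>\<bar> * ((real r + 1) powr q / real r powr L))"
        by (simp add: ennreal_mult[symmetric] mult_ac)
      finally show "ennreal ((real r + 1) powr q) * (ennreal (event_prob_given M C (S r) \<omega>) * ennreal (\<Psi> n \<omega>)) \<le> \<dots>" .
    qed
    also have "\<dots> = ennreal (\<bar>cV \<omega>\<bar> * (\<Sum>r\<in>{m..<R}. (real r + 1) powr q / real r powr L))"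
      by (subst sum_ennreal) (auto simp: sum_distrib_left)
    also have "\<dots> \<le> ennreal (\<bar>cV \<omega>\<bar> * s)" using s by (intro ennreal_leI mult_left_mono) auto
    finally have 1: "ennreal (\<Psi> n \<omega>) * nn_cond_exp M C X1 \<omega> \<le> ennreal (\<bar>cV \<omega>\<bar> * s)" .
    have 2: "ennreal (\<Psi> n \<omega>) * nn_cond_exp M C X2 \<omega> \<le> nn_cond_exp M C X2 \<omega>"
      using mult_right_mono[of "ennreal (\<Psi> n \<omega>)" 1 "nn_cond_exp M C X2 \<omega>"] \<Psi> by simp
    have "ennreal (\<Psi> n \<omega>) * nn_cond_exp M C (\<lambda>\<omega>. ennreal (J \<omega>)) \<omega>
       \<le> ennreal (\<Psi> n \<omega>) * (ennreal (B / b) * (nn_cond_exp M C X1 \<omega> + nn_cond_exp M C X2 \<omega>))"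
      using elim by (intro mult_left_mono) auto
    also have "\<dots> = ennreal (B / b) * (ennreal (\<Psi> n \<omega>) * nn_cond_exp M C X1 \<omega> + ennreal (\<Psi> n \<omega>) * nn_cond_exp M C X2 \<omega>)"
      by (simp add: algebra_simps)
    also have "\<dots> \<le> ennreal (B / b) * (ennreal (\<bar>cV \<omega>\<bar> * s) + nn_cond_exp M C X2 \<omega>)"
      by (intro mult_left_mono add_mono 1 2) auto
    finally show ?case using elim by simp
  qed
  then show ?thesis by (simp add: J_def Q_def s_def \<kappa>_def)
qed

text \<open>The right-hand side of \<open>cond_tail_moment_le\<close> consists of tails of convergent series, with factors that
  are bounded off an event of small probability; there also \<open>\<Psi> n\<close> is at least 1/2.\<close>

lemma tail_moment_small:
  assumes e: "0 < e"
  shows "\<exists>m0\<ge>1. \<forall>m\<ge>m0. \<forall>\<^sub>F n in sequentially.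
    M.prob {\<omega> \<in> space M. ennreal e < nn_cond_exp M C (\<lambda>\<omega>. ennreal (tail_moment q m (wT n \<omega>))) \<omega>} \<le> e"
proof -
  have e4: "0 < e / 4" using e by simp
  have [measurable]: "cU \<in> borel_measurable M" "cV \<in> borel_measurable M" using C_M cU_C cV_C by auto
  obtain K1 where K1: "0 < K1" "M.prob {\<omega> \<in> space M. K1 < \<bar>cV \<omega>\<bar>} \<le> e / 4"
    by (rule M.prob_large_small[OF _ e4, of cV]) auto
  obtain K2 where K2: "0 < K2" "M.prob {\<omega> \<in> space M. K2 < \<bar>cU \<omega>\<bar>} \<le> e / 4"
    by (rule M.prob_large_small[OF _ e4, of cU]) auto
  define EQ where "EQ n = cond_nn_expect M C (\<lambda>\<omega>. inverse (LINT u:UT n|lborel. Z n \<omega> u))" for n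
  have [measurable]: "EQ n \<in> borel_measurable M" for n
    unfolding EQ_def by (rule M.measurable_cond_nn_expect) measurable
  obtain K3' where K3': "\<forall>\<^sub>F n in sequentially. M.prob {\<omega> \<in> space M. ennreal K3' < EQ n \<omega>} \<le> e / 4"
    using mass e4 unfolding bounded_in_prob_def EQ_def by blast
  define K3 where "K3 = max K3' 0"
  have K3: "0 \<le> K3" "ennreal K3' \<le> ennreal K3" by (auto simp: K3_def intro: ennreal_leI)
  define s where "s m = (\<Sum>r. (real (r + m) + 1) powr q / real (r + m) powr L)" for m
  define \<kappa> where "\<kappa> m = (\<Sum>r. shell_weight TYPE(real^'p) q D (r + m))" for m
  have sum_s: "summable (\<lambda>r. (real r + 1) powr q / real r powr L)"
    using q L by (intro summable_shifted_powr_quotient) auto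
  have sum_\<kappa>: "summable (shell_weight TYPE(real^'p) q D)"
    using q D by (intro summable_shell_weight) auto
  \<comment> \<open>With this bound for the tails of the series the conditional tail moment, multiplied by \<open>\<Psi> n \<ge> 1/2\<close>, is at
    most \<open>e / 2\<close>.\<close>
  define \<eta> where "\<eta> = e / (2 * (B / b) * (K1 + K2 * K3))"
  have den: "0 < 2 * (B / b) * (K1 + K2 * K3)"
    using bB K1 K2 K3 by (intro mult_pos_pos add_pos_nonneg) auto
  have \<eta>: "0 < \<eta>" unfolding \<eta>_def using e den by (intro divide_pos_pos)
  obtain m1 where m1: "\<And>m. m1 \<le> m \<Longrightarrow> norm (s m) < \<eta>"
    using suminf_exist_split[OF \<eta> sum_s] unfolding s_def by blast
  obtain m2 where m2: "\<And>m. m2 \<le> m \<Longrightarrow> norm (\<kappa> m) < \<eta>"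
    using suminf_exist_split[OF \<eta> sum_\<kappa>] unfolding \<kappa>_def by blast
  define m0 where "m0 = max 1 (max m1 m2)"
  show ?thesis
  proof (intro exI[of _ m0] conjI allI impI)
    show "1 \<le> m0" by (simp add: m0_def)
    fix m assume m: "m0 \<le> m"
    then have m1m: "1 \<le> m" and sm: "\<bar>s m\<bar> \<le> \<eta>" and km: "\<bar>\<kappa> m\<bar> \<le> \<eta>"
      using m1[of m] m2[of m] by (auto simp: m0_def)
    have "\<forall>\<^sub>F n in sequentially. M.prob {\<omega> \<in> space M. \<Psi> n \<omega> < 1/2} < e / 4"
      using prob_\<Psi>_small e4 by (rule order_tendstoD)
    with K3' show "\<forall>\<^sub>F n in sequentially.
      M.prob {\<omega> \<in> space M. ennreal e < nn_cond_exp M C (\<lambda>\<omega>. ennreal (tail_moment q m (wT n \<omega>))) \<omega>} \<le> e"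
    proof eventually_elim
      case (elim n)
      define E1 where "E1 = {\<omega> \<in> space M. K1 < \<bar>cV \<omega>\<bar>}"
      define E2 where "E2 = {\<omega> \<in> space M. K2 < \<bar>cU \<omega>\<bar>}"
      define E3 where "E3 = {\<omega> \<in> space M. ennreal K3' < EQ n \<omega>}"
      define E4 where "E4 = {\<omega> \<in> space M. \<Psi> n \<omega> < 1/2}"
      have [measurable]: "E1 \<in> sets M" "E2 \<in> sets M" "E3 \<in> sets M" "E4 \<in> sets M"
        unfolding E1_def E2_def E3_def E4_def by measurable
      have "AE \<omega> in M. EQ n \<omega> = nn_cond_exp M C (\<lambda>\<omega>. ennreal (inverse (LINT u:UT n|lborel. Z n \<omega> u))) \<omega>"
        unfolding EQ_def by (rule M.cond_nn_expect_eq) measurable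
      with cond_tail_moment_le[OF m1m, of n] AE_space
      have "AE \<omega> in M. \<omega> \<in> {\<omega> \<in> space M. ennreal e < nn_cond_exp M C (\<lambda>\<omega>. ennreal (tail_moment q m (wT n \<omega>))) \<omega>}
         \<longrightarrow> \<omega> \<in> (E1 \<union> E2) \<union> (E3 \<union> E4)"
      proof eventually_elim
        case (elim \<omega>)
        let ?J = "nn_cond_exp M C (\<lambda>\<omega>. ennreal (tail_moment q m (wT n \<omega>))) \<omega>"
        show ?case
        proof (rule impI, rule ccontr)
          assume J: "\<omega> \<in> {\<omega> \<in> space M. ennreal e < nn_cond_exp M C (\<lambda>\<omega>. ennreal (tail_moment q m (wT n \<omega>))) \<omega>}"
            and "\<omega> \<notin> (E1 \<union> E2) \<union> (E3 \<union> E4)"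
          then have c: "\<bar>cV \<omega>\<bar> \<le> K1" "\<bar>cU \<omega>\<bar> \<le> K2" "EQ n \<omega> \<le> ennreal K3" "1/2 \<le> \<Psi> n \<omega>"
            using elim K3 by (auto simp: E1_def E2_def E3_def E4_def not_less intro: order_trans)
          have "ennreal (1/2) * ?J \<le> ennreal (\<Psi> n \<omega>) * ?J" using c by (intro mult_right_mono ennreal_leI) auto
          also have "\<dots> \<le> ennreal (B / b) * (ennreal (\<bar>cV \<omega>\<bar> * s m) + ennreal (\<bar>cU \<omega>\<bar> * \<kappa> m) * EQ n \<omega>)"
            using elim by (simp add: s_def \<kappa>_def)
          also have "\<dots> \<le> ennreal (B / b) * (ennreal (K1 * \<eta>) + ennreal (K2 * \<eta>) * ennreal K3)"
            using c sm km K1 K2 \<eta> by (intro mult_left_mono add_mono mult_mono ennreal_leI order_trans[OF mult_left_mono mult_right_mono]) auto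
          also have "\<dots> = ennreal ((B / b) * (K1 * \<eta> + K2 * \<eta> * K3))"
          proof -
            have eq1: "ennreal (K2 * \<eta>) * ennreal K3 = ennreal (K2 * \<eta> * K3)"
              using K2 K3 \<eta> by (simp add: ennreal_mult'')
            have eq2: "ennreal (K1 * \<eta>) + ennreal (K2 * \<eta> * K3) = ennreal (K1 * \<eta> + K2 * \<eta> * K3)"
              by (rule ennreal_plus[symmetric]) (use K1 K2 K3 \<eta> in auto)
            show ?thesis unfolding eq1 eq2
              by (rule ennreal_mult[symmetric]) (use bB K1 K2 K3 \<eta> in auto)
          qed
          also have "(B / b) * (K1 * \<eta> + K2 * \<eta> * K3) = e / 2"
          proof -
            have "x * (K1 * \<eta> + K2 * \<eta> * K3) = (2 * x * (K1 + K2 * K3)) * \<eta> / 2" for x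
              by (simp add: field_simps)
            then have eq: "(B / b) * (K1 * \<eta> + K2 * \<eta> * K3) = (2 * (B / b) * (K1 + K2 * K3)) * \<eta> / 2" .
            have "y * (e / y) / 2 = e / 2" if "0 < y" for y :: real using that by simp
            from this[OF den] have "(2 * (B / b) * (K1 + K2 * K3)) * \<eta> / 2 = e / 2" unfolding \<eta>_def .
            with eq show ?thesis by (rule trans)
          qed
          finally have "ennreal 2 * (ennreal (1/2) * ?J) \<le> ennreal 2 * ennreal (e / 2)"
            by (intro mult_left_mono) auto
          moreover have "ennreal 2 * (ennreal (1/2) * y) = y" for y
          proof -
            have "ennreal 2 * ennreal (1/2) = 1" by (subst ennreal_mult[symmetric]) auto
            then show ?thesis by (metis mult.assoc mult_1)
          qed
          moreover have "ennreal 2 * ennreal (e / 2) = ennreal e"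
            using e by (subst ennreal_mult[symmetric]) auto
          ultimately have "?J \<le> ennreal e" by metis
          with J show False by auto
        qed
      qed
      then have "M.prob {\<omega> \<in> space M. ennreal e < nn_cond_exp M C (\<lambda>\<omega>. ennreal (tail_moment q m (wT n \<omega>))) \<omega>}
         \<le> M.prob ((E1 \<union> E2) \<union> (E3 \<union> E4))"
        by (rule M.finite_measure_mono_AE) measurable
      also have "\<dots> \<le> (M.prob E1 + M.prob E2) + (M.prob E3 + M.prob E4)"
        by (intro order_trans[OF measure_Un_le] add_mono) auto
      also have "\<dots> \<le> e" using K1 K2 elim by (simp add: E1_def E2_def E3_def E4_def)
      finally show ?case .
    qed
  qed
qed

text \<open>Off an event of small probability, a small upper limit bounds the conditional probabilities times
  \<open>\<Psi> n\<close> from some index on. Integration removes the conditioning, and the factor \<open>\<Psi> n\<close> costs no more than the mean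
  of \<open>1 - \<Psi> n\<close>.\<close>

lemma modulus_small:
  assumes "0 < \<epsilon>" "0 < c" "0 < \<eta>" "0 < \<delta>0"
  shows "\<exists>\<delta>>0. \<delta> < \<delta>0 \<and> (\<forall>\<^sub>F n in sequentially. M.prob (W_event M \<Theta> \<theta>\<^sub>s (A n) (Z n) \<delta> c \<epsilon>) \<le> \<eta>)"
proof -
  define x where "x \<delta> n \<omega> = event_prob_given M C (W_event M \<Theta> \<theta>\<^sub>s (A n) (Z n) \<delta> c \<epsilon>) \<omega> * \<Psi> n \<omega>" for \<delta> n \<omega>
  define e where "e = \<eta> / 8"
  have e: "0 < e" using assms by (simp add: e_def)
  have [measurable]: "x \<delta> n \<in> borel_measurable M" for \<delta> n
    unfolding x_def event_prob_given_def by measurable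
  define ls where "ls \<delta> \<omega> = real_of_ereal (limsup (\<lambda>n. ereal (x \<delta> n \<omega>)))" for \<delta> \<omega>
  have [measurable]: "ls \<delta> \<in> borel_measurable M" for \<delta> unfolding ls_def by measurable
  have "((\<lambda>\<delta>. M.prob {\<omega> \<in> space M. e \<le> dist (ls \<delta> \<omega>) 0}) \<longlongrightarrow> 0) (at_right 0)"
    using modulus[OF assms(1,2)] e unfolding conv_in_prob_def ls_def x_def by blast
  then have "\<forall>\<^sub>F \<delta> in at_right 0. M.prob {\<omega> \<in> space M. e \<le> dist (ls \<delta> \<omega>) 0} < e"
    using e by (rule order_tendstoD)
  then obtain d where d: "0 < d" "\<And>\<delta>. 0 < \<delta> \<Longrightarrow> \<delta> < d \<Longrightarrow> M.prob {\<omega> \<in> space M. e \<le> dist (ls \<delta> \<omega>) 0} < e"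
    by (auto simp: eventually_at_right_field)
  define \<delta> where "\<delta> = min d \<delta>0 / 2"
  have \<delta>: "0 < \<delta>" "\<delta> < d" "\<delta> < \<delta>0" using d assms by (auto simp: \<delta>_def)
  have small: "M.prob {\<omega> \<in> space M. e \<le> dist (ls \<delta> \<omega>) 0} < e" using d \<delta> by auto
  define W where "W n = W_event M \<Theta> \<theta>\<^sub>s (A n) (Z n) \<delta> c \<epsilon>" for n
  have [measurable]: "W n \<in> sets M" for n unfolding W_def using \<delta> assms by (intro W_event_M) auto
  have x_range: "AE \<omega> in M. \<forall>n. 0 \<le> x \<delta> n \<omega> \<and> x \<delta> n \<omega> \<le> 1"
  proof -
    have "AE \<omega> in M. \<forall>n. 0 \<le> event_prob_given M C (W n) \<omega> \<and> event_prob_given M C (W n) \<omega> \<le> 1"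
      unfolding AE_all_countable by (intro allI M.event_prob_given_le_1) simp
    with AE_space show ?thesis
    proof eventually_elim
      case (elim \<omega>)
      then show ?case using \<Psi>_range[of \<omega>] by (auto simp: x_def W_def intro!: mult_le_one)
    qed
  qed
  \<comment> \<open>Some \<open>x \<delta> n\<close> with \<open>n \<ge> k\<close> is not small; on the intersection
    of all of them the upper limit is not small.\<close>
  define E where "E k = {\<omega> \<in> space M. \<exists>n\<ge>k. e \<le> x \<delta> n \<omega>}" for k
  have [measurable]: "E k \<in> sets M" for k unfolding E_def by measurable
  have "(\<lambda>k. M.prob (E k)) \<longlonglongrightarrow> M.prob (\<Inter>k. E k)"
    by (rule M.finite_Lim_measure_decseq) (auto simp: decseq_def E_def intro: order_trans)
  moreover have "M.prob (\<Inter>k. E k) \<le> M.prob {\<omega> \<in> space M. e \<le> dist (ls \<delta> \<omega>) 0}"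
  proof (rule M.finite_measure_mono_AE)
    show "AE \<omega> in M. \<omega> \<in> (\<Inter>k. E k) \<longrightarrow> \<omega> \<in> {\<omega> \<in> space M. e \<le> dist (ls \<delta> \<omega>) 0}"
      using x_range
    proof eventually_elim
      case (elim \<omega>)
      show ?case
      proof
        assume \<omega>: "\<omega> \<in> (\<Inter>k. E k)"
        have "ereal e \<le> limsup (\<lambda>n. ereal (x \<delta> n \<omega>))"
          unfolding limsup_INF_SUP
        proof (rule INF_greatest)
          fix k
          obtain n where "n \<ge> k" "e \<le> x \<delta> n \<omega>" using \<omega> by (auto simp: E_def)
          then show "ereal e \<le> (SUP n\<in>{k..}. ereal (x \<delta> n \<omega>))" by (intro SUP_upper2[of n]) auto
        qed
        moreover have "limsup (\<lambda>n. ereal (x \<delta> n \<omega>)) \<le> 1"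
          using elim by (intro Limsup_bounded always_eventually) auto
        ultimately have "e \<le> ls \<delta> \<omega>"
          unfolding ls_def by (cases "limsup (\<lambda>n. ereal (x \<delta> n \<omega>))") auto
        then show "\<omega> \<in> {\<omega> \<in> space M. e \<le> dist (ls \<delta> \<omega>) 0}" using \<omega> by (auto simp: E_def)
      qed
    qed
  qed measurable
  ultimately have "\<forall>\<^sub>F k in sequentially. M.prob (E k) < 2 * e"
    using small e by (intro order_tendstoD(2)[where y="M.prob (\<Inter>k. E k)"]) auto
  then obtain k where k: "M.prob (E k) < 2 * e" by (auto simp: eventually_sequentially)
  have "\<forall>\<^sub>F n in sequentially. (\<integral>\<omega>. 1 - \<Psi> n \<omega> \<partial>M) < e"
    using expectation_\<Psi>_deficit e by (rule order_tendstoD)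
  moreover have "\<forall>\<^sub>F n in sequentially. k \<le> n" by (rule eventually_ge_at_top)
  ultimately have "\<forall>\<^sub>F n in sequentially. M.prob (W n) \<le> \<eta>"
  proof eventually_elim
    case (elim n)
    have ix: "integrable M (x \<delta> n)"
      by (rule M.integrable_const_bound[where B=1]) (use x_range in \<open>auto elim!: eventually_mono\<close>)
    have iW: "integrable M (indicator (W n) :: 'w \<Rightarrow> real)"
      by (rule M.integrable_bounded_rv[where B=1]) auto
    have i\<Psi>: "integrable M (\<lambda>\<omega>. 1 - \<Psi> n \<omega>)"
      by (rule M.integrable_bounded_rv[where B=1]) (use \<Psi>_range[of _ n] in auto)
    have iW\<Psi>: "integrable M (\<lambda>\<omega>. \<Psi> n \<omega> * indicator (W n) \<omega>)"
      by (rule M.integrable_bounded_rv[where B=1]) (use \<Psi>_range[of _ n] in \<open>auto simp: indicator_def\<close>)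
    have "(\<integral>\<omega>. \<Psi> n \<omega> * indicator (W n) \<omega> \<partial>M) = (\<integral>\<omega>. \<Psi> n \<omega> * real_cond_exp M C (indicator (W n)) \<omega> \<partial>M)"
      by (rule M.real_cond_exp_intg(2)[symmetric, OF iW\<Psi> \<Psi>_C]) simp
    also have "\<dots> = (\<integral>\<omega>. x \<delta> n \<omega> \<partial>M)"
      by (simp add: x_def event_prob_given_def W_def mult.commute)
    also have "\<dots> \<le> (\<integral>\<omega>. e + indicator (E k) \<omega> \<partial>M)"
    proof (rule integral_mono_AE[OF ix])
      show "integrable M (\<lambda>\<omega>. e + indicator (E k) \<omega>)"
        by (rule M.integrable_bounded_rv[where B="e + 1"]) (use e in \<open>auto simp: indicator_def\<close>)
      show "AE \<omega> in M. x \<delta> n \<omega> \<le> e + indicator (E k) \<omega>"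
        using x_range AE_space
      proof eventually_elim
        case (elim \<omega>)
        show ?case
        proof (cases "\<omega> \<in> E k")
          case True
          then show ?thesis using elim(1)[rule_format, of n] e by simp
        next
          case False
          then have "\<not> e \<le> x \<delta> n \<omega>" using elim(2) \<open>k \<le> n\<close> unfolding E_def by blast
          then show ?thesis using False by simp
        qed
      qed
    qed
    also have "\<dots> = e + M.prob (E k)"
    proof (subst Bochner_Integration.integral_add)
      show "integrable M (indicator (E k) :: 'w \<Rightarrow> real)"
        by (rule M.integrable_bounded_rv[where B=1]) auto
    qed (auto simp: M.prob_space)
    finally have 1: "(\<integral>\<omega>. \<Psi> n \<omega> * indicator (W n) \<omega> \<partial>M) \<le> 3 * e" using k by linarith
    have "M.prob (W n) = (\<integral>\<omega>. indicator (W n) \<omega> \<partial>M)" by simp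
    also have "\<dots> \<le> (\<integral>\<omega>. \<Psi> n \<omega> * indicator (W n) \<omega> + (1 - \<Psi> n \<omega>) \<partial>M)"
      by (rule integral_mono[OF iW Bochner_Integration.integrable_add[OF iW\<Psi> i\<Psi>]])
         (use \<Psi>_range[of _ n] in \<open>auto simp: indicator_def\<close>)
    also have "\<dots> = (\<integral>\<omega>. \<Psi> n \<omega> * indicator (W n) \<omega> \<partial>M) + (\<integral>\<omega>. 1 - \<Psi> n \<omega> \<partial>M)"
      by (rule Bochner_Integration.integral_add[OF iW\<Psi> i\<Psi>])
    also have "\<dots> \<le> \<eta>" using 1 elim(1) e by (simp add: e_def)
    finally show ?case .
  qed
  then show ?thesis using \<delta> by (auto simp: W_def)
qed

end

lemma (in prob_space) conv_in_prob_L1: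
  fixes X :: "nat \<Rightarrow> 'a \<Rightarrow> real"
  assumes [measurable]: "\<And>n. X n \<in> borel_measurable M" "Y \<in> borel_measurable M"
    and bnd: "\<And>n. AE x in M. \<bar>X n x\<bar> \<le> K" "AE x in M. \<bar>Y x\<bar> \<le> K"
    and conv: "conv_in_prob M X Y sequentially"
  shows "(\<lambda>n. \<integral>x. \<bar>X n x - Y x\<bar> \<partial>M) \<longlonglongrightarrow> 0"
proof (rule LIMSEQ_I)
  fix e :: real assume e: "0 < e"
  have "AE x in M. 0 \<le> K" using bnd(2) by eventually_elim linarith
  then have K: "0 \<le> K" by simp
  define c where "c = e / (2 + 4 * K)"
  have c: "0 < c" "c * (1 + 2 * K) < e" using e K by (auto simp: c_def field_simps intro!: add_pos_nonneg)
  have "(\<lambda>n. prob {x \<in> space M. c \<le> dist (X n x) (Y x)}) \<longlonglongrightarrow> 0"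
    using conv c(1) unfolding conv_in_prob_def by blast
  then have "\<forall>\<^sub>F n in sequentially. prob {x \<in> space M. c \<le> dist (X n x) (Y x)} < c"
    using c(1) by (rule order_tendstoD)
  then obtain n0 where n0: "\<And>n. n0 \<le> n \<Longrightarrow> prob {x \<in> space M. c \<le> dist (X n x) (Y x)} < c"
    by (auto simp: eventually_sequentially)
  have "norm ((\<integral>x. \<bar>X n x - Y x\<bar> \<partial>M) - 0) < e" if "n0 \<le> n" for n
  proof -
    define S where "S = {x \<in> space M. c \<le> dist (X n x) (Y x)}"
    have [measurable]: "S \<in> sets M" unfolding S_def by measurable
    have iS: "integrable M (indicator S :: 'a \<Rightarrow> real)" by (rule integrable_const_bound[where B=1]) auto
    have "(\<integral>x. \<bar>X n x - Y x\<bar> \<partial>M) \<le> (\<integral>x. c + 2 * K * indicator S x \<partial>M)"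
    proof (rule integral_mono_AE)
      show "integrable M (\<lambda>x. \<bar>X n x - Y x\<bar>)"
        by (rule integrable_const_bound[where B="2 * K"])
           (use bnd(1)[of n] bnd(2) in \<open>auto elim!: eventually_elim2\<close>)
      show "integrable M (\<lambda>x. c + 2 * K * indicator S x)" using iS by auto
      show "AE x in M. \<bar>X n x - Y x\<bar> \<le> c + 2 * K * indicator S x"
        using bnd(1)[of n] bnd(2) AE_space
        by eventually_elim (use c K in \<open>auto simp: S_def indicator_def dist_real_def not_le\<close>)
    qed
    also have "\<dots> = c + 2 * K * prob S"
      using iS by (subst Bochner_Integration.integral_add) (auto simp: prob_space)
    also have "\<dots> \<le> c + 2 * K * c" using n0[OF that] K by (intro add_left_mono mult_left_mono) (auto simp: S_def)
    also have "\<dots> < e" using c(2) by (simp add: algebra_simps)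
    finally show ?thesis by (simp add: integral_nonneg_AE)
  qed
  then show "\<exists>no. \<forall>n\<ge>no. norm ((\<integral>x. \<bar>X n x - Y x\<bar> \<partial>M) - 0) < e" by blast
qed

lemma (in prob_space) conv_in_prob_cong_AE:
  fixes X X' :: "nat \<Rightarrow> 'a \<Rightarrow> real"
  assumes [measurable]: "\<And>n. X n \<in> borel_measurable M" "Y \<in> borel_measurable M"
      "\<And>n. X' n \<in> borel_measurable M" "Y' \<in> borel_measurable M"
    and eq: "\<And>n. AE x in M. X n x = X' n x" "AE x in M. Y x = Y' x"
    and conv: "conv_in_prob M X Y sequentially"
  shows "conv_in_prob M X' Y' sequentially"
proof -
  have "prob {x \<in> space M. e \<le> dist (X n x) (Y x)} = prob {x \<in> space M. e \<le> dist (X' n x) (Y' x)}" for e n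
    by (rule finite_measure_eq_AE) (use eq(1)[of n] eq(2) in \<open>auto elim!: eventually_elim2\<close>)
  then show ?thesis using conv by (simp add: conv_in_prob_def)
qed

lemma (in prob_subalgebra) real_cond_exp_bounded:
  assumes "X \<in> borel_measurable M" and "\<And>x. x \<in> space M \<Longrightarrow> \<bar>X x\<bar> \<le> K"
  shows "AE x in M. \<bar>real_cond_exp M F X x\<bar> \<le> K"
proof -
  have i: "integrable M X" by (rule integrable_bounded_rv) (use assms in auto)
  have "AE x in M. real_cond_exp M F X x \<ge> - K"
    by (rule real_cond_exp_ge_c[OF i]) (use assms(2) in force)
  moreover have "AE x in M. real_cond_exp M F X x \<le> K"
    by (rule real_cond_exp_le_c[OF i]) (use assms(2) in force)
  ultimately show ?thesis by eventually_elim auto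
qed

lemma continuous_apply_bcontfun: "continuous_on UNIV (\<lambda>f. apply_bcontfun f (u::'b::topological_space) :: real)"
  unfolding continuous_on_iff
proof (intro ballI allI impI)
  fix f :: "'b \<Rightarrow>\<^sub>C real" and e :: real assume "0 < e"
  moreover have "dist (apply_bcontfun f' u) (apply_bcontfun f u) \<le> dist f' f" for f'
    by (rule dist_bounded)
  ultimately show "\<exists>d>0. \<forall>f'\<in>UNIV. dist f' f < d \<longrightarrow> dist (apply_bcontfun f' u) (apply_bcontfun f u) < e"
    by (meson order_le_less_trans)
qed

lemma borel_measurable_Euclidean_space:
  assumes g: "continuous_map (Euclidean_space k) euclideanreal g"
    and X: "\<And>i. i < k \<Longrightarrow> X i \<in> borel_measurable M"
  shows "(\<lambda>\<omega>. g (\<lambda>i. if i < k then X i \<omega> else 0)) \<in> borel_measurable M"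
proof -
  define S where "S = topspace (Euclidean_space k)"
  have E: "Euclidean_space k = top_of_set S"
    by (simp add: S_def Euclidean_space_def topspace_Euclidean_space euclidean_product_topology)
  have "continuous_on S g" using g unfolding E by simp
  then have "g \<in> borel_measurable (restrict_space borel S)"
    by (rule borel_measurable_continuous_on_restrict)
  moreover have "(\<lambda>\<omega> i. if i < k then X i \<omega> else 0) \<in> M \<rightarrow>\<^sub>M restrict_space borel S"
  proof (rule measurable_restrict_space2)
    show "(\<lambda>\<omega> i. if i < k then X i \<omega> else 0) \<in> space M \<rightarrow> S"
      by (auto simp: S_def topspace_Euclidean_space)
    show "(\<lambda>\<omega> i. if i < k then X i \<omega> else 0) \<in> borel_measurable M"
    proof (rule measurable_coordinatewise_then_product)
      show "(\<lambda>\<omega>. if i < k then X i \<omega> else 0) \<in> borel_measurable M" for i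
        using X[of i] by (cases "i < k") auto
    qed
  qed
  ultimately show ?thesis by (rule measurable_compose[rotated])
qed

context quasi_bayes
begin

lemma Zlim_N [measurable]: "(\<lambda>\<omega>. apply_bcontfun (Zlim \<omega>) u) \<in> borel_measurable N"
proof -
  have "Zlim \<in> borel_measurable N" using Zlim_meas by (simp add: measurable_restrict_space2_iff)
  then show ?thesis
    by (rule measurable_compose) (rule borel_measurable_continuous_onI[OF continuous_apply_bcontfun])
qed

lemma AE_\<pi>:
  assumes "AE \<omega> in M. P \<omega>" shows "AE \<omega> in N. P (\<pi> \<omega>)"
proof (rule AE_distrD[OF \<pi>_meas])
  show "AE \<omega> in distr N M \<pi>. P \<omega>" unfolding distr_\<pi> by (rule assms)
qed

lemma integral_\<pi>:
  fixes f :: "'w \<Rightarrow> real"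
  assumes "f \<in> borel_measurable M" shows "(\<integral>\<omega>. f (\<pi> \<omega>) \<partial>N) = (\<integral>\<omega>. f \<omega> \<partial>M)"
  using integral_distr[OF \<pi>_meas assms] distr_\<pi> by simp

lemma bounded_rvD:
  assumes "bounded_rv G Y"
  shows "Y \<in> borel_measurable M" "\<exists>K>0. \<forall>\<omega>\<in>space M. \<bar>Y \<omega>\<bar> \<le> K"
proof -
  show "Y \<in> borel_measurable M" by (rule G_M) (use assms in \<open>simp add: bounded_rv_def\<close>)
  have "space G = space M" using sub_G by (simp add: subalgebra_def)
  then show "\<exists>K>0. \<forall>\<omega>\<in>space M. \<bar>Y \<omega>\<bar> \<le> K"
    using assms by (auto simp: bounded_rv_def bounded_pos)
qed

text \<open>As all variables are bounded, convergence in probability is convergence in the mean, and \<open>\<Psi> n\<close> may be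
  replaced by 1 at the cost of the mean of \<open>1 - \<Psi> n\<close>.\<close>

lemma fidi_L1:
  fixes u :: "nat \<Rightarrow> real^'p"
  assumes k: "1 \<le> k" and g: "continuous_map (Euclidean_space k) euclideanreal g"
    and bg: "bounded (g ` topspace (Euclidean_space k))" and Y: "bounded_rv G Y"
  shows "(\<lambda>n. \<integral>\<omega>. \<bar>real_cond_exp M C (\<lambda>\<omega>. g (\<lambda>i. if i < k then Z n \<omega> (u i) else 0) * Y \<omega>) (\<pi> \<omega>)
     - real_cond_exp N C' (\<lambda>\<omega>. g (\<lambda>i. if i < k then apply_bcontfun (Zlim \<omega>) (u i) else 0) * Y (\<pi> \<omega>)) \<omega>\<bar> \<partial>N) \<longlonglongrightarrow> 0"
proof -
  note [measurable] = bounded_rvD(1)[OF Y]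
  obtain KY where KY: "0 < KY" "\<And>\<omega>. \<omega> \<in> space M \<Longrightarrow> \<bar>Y \<omega>\<bar> \<le> KY" using bounded_rvD(2)[OF Y] by auto
  obtain Kg where Kg: "0 < Kg" "\<And>x. x \<in> topspace (Euclidean_space k) \<Longrightarrow> \<bar>g x\<bar> \<le> Kg"
    using bg by (auto simp: bounded_pos)
  define K where "K = Kg * KY"
  have K: "0 < K" using Kg KY by (simp add: K_def)
  define gn where "gn n \<omega> = g (\<lambda>i. if i < k then Z n \<omega> (u i) else 0)" for n \<omega>
  define gl where "gl \<omega> = g (\<lambda>i. if i < k then apply_bcontfun (Zlim \<omega>) (u i) else 0)" for \<omega>
  have gn: "\<bar>gn n \<omega>\<bar> \<le> Kg" and gl: "\<bar>gl \<omega>'\<bar> \<le> Kg" for n \<omega> \<omega>'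
    unfolding gn_def gl_def by (auto intro!: Kg(2) simp: topspace_Euclidean_space)
  have [measurable]: "gn n \<in> borel_measurable M" for n
    unfolding gn_def by (rule borel_measurable_Euclidean_space[OF g]) measurable
  have [measurable]: "gl \<in> borel_measurable N"
    unfolding gl_def by (rule borel_measurable_Euclidean_space[OF g]) measurable
  have b1: "\<bar>gn n \<omega> * Y \<omega>\<bar> \<le> K" if "\<omega> \<in> space M" for n \<omega>
    using gn[of n \<omega>] KY(2)[OF that] Kg KY unfolding K_def abs_mult by (intro mult_mono) auto
  have b2: "\<bar>gn n \<omega> * \<Psi> n \<omega> * Y \<omega>\<bar> \<le> K" if "\<omega> \<in> space M" for n \<omega>
  proof -
    have "\<bar>gn n \<omega> * \<Psi> n \<omega> * Y \<omega>\<bar> = \<bar>gn n \<omega> * Y \<omega>\<bar> * \<Psi> n \<omega>"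
      using \<Psi>_range[OF that, of n] by (simp add: abs_mult mult_ac)
    also have "\<dots> \<le> K * 1" using b1[OF that, of n] \<Psi>_range[OF that, of n] K by (intro mult_mono) auto
    finally show ?thesis by simp
  qed
  have b3: "\<bar>gl \<omega> * Y (\<pi> \<omega>)\<bar> \<le> K" if "\<omega> \<in> space N" for \<omega>
    using gl[of \<omega>] KY(2)[OF measurable_space[OF \<pi>_meas that]] Kg KY unfolding K_def abs_mult by (intro mult_mono) auto
  define an where "an n = real_cond_exp M C (\<lambda>\<omega>. gn n \<omega> * Y \<omega>)" for n
  define bn where "bn n = real_cond_exp M C (\<lambda>\<omega>. gn n \<omega> * \<Psi> n \<omega> * Y \<omega>)" for n
  define l where "l = real_cond_exp N C' (\<lambda>\<omega>. gl \<omega> * Y (\<pi> \<omega>))"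
  have [measurable]: "an n \<in> borel_measurable M" "bn n \<in> borel_measurable M" "l \<in> borel_measurable N" for n
    unfolding an_def bn_def l_def by measurable
  have i1: "integrable M (\<lambda>\<omega>. gn n \<omega> * Y \<omega>)" for n
    by (rule M.integrable_bounded_rv[OF _ b1]) auto
  have i2: "integrable M (\<lambda>\<omega>. gn n \<omega> * \<Psi> n \<omega> * Y \<omega>)" for n
    by (rule M.integrable_bounded_rv[OF _ b2]) auto
  have i3: "integrable N (\<lambda>\<omega>. gl \<omega> * Y (\<pi> \<omega>))"
    by (rule N.integrable_bounded_rv[OF _ b3]) auto
  have ba: "AE \<omega> in N. \<bar>an n (\<pi> \<omega>)\<bar> \<le> K" for n
    unfolding an_def by (rule AE_\<pi>) (rule M.real_cond_exp_bounded[OF _ b1], auto)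
  have bb: "AE \<omega> in N. \<bar>bn n (\<pi> \<omega>)\<bar> \<le> K" for n
    unfolding bn_def by (rule AE_\<pi>) (rule M.real_cond_exp_bounded[OF _ b2], auto)
  have bl: "AE \<omega> in N. \<bar>l \<omega>\<bar> \<le> K"
    unfolding l_def by (rule N.real_cond_exp_bounded[OF _ b3]) auto
  have "conv_in_prob N (\<lambda>n \<omega>. bn n (\<pi> \<omega>)) l sequentially"
  proof (rule N.conv_in_prob_cong_AE[OF _ _ _ _ _ _ fidi[OF k g bg Y, of u, folded gn_def gl_def]])
    show "(\<lambda>\<omega>. cond_expect M C (\<lambda>\<omega>. gn n \<omega> * \<Psi> n \<omega> * Y \<omega>) (\<pi> \<omega>)) \<in> borel_measurable N" for n
      by (rule measurable_compose[OF \<pi>_meas]) (rule M.measurable_cond_expect, measurable)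
    show "cond_expect N C' (\<lambda>\<omega>. gl \<omega> * Y (\<pi> \<omega>)) \<in> borel_measurable N"
      by (rule N.measurable_cond_expect) measurable
    show "AE \<omega> in N. cond_expect M C (\<lambda>\<omega>. gn n \<omega> * \<Psi> n \<omega> * Y \<omega>) (\<pi> \<omega>) = bn n (\<pi> \<omega>)" for n
      unfolding bn_def by (rule AE_\<pi>) (rule M.cond_expect_eq_real_cond_exp[OF i2])
    show "AE \<omega> in N. cond_expect N C' (\<lambda>\<omega>. gl \<omega> * Y (\<pi> \<omega>)) \<omega> = l \<omega>"
      unfolding l_def by (rule N.cond_expect_eq_real_cond_exp[OF i3])
  qed measurable
  then have 1: "(\<lambda>n. \<integral>\<omega>. \<bar>bn n (\<pi> \<omega>) - l \<omega>\<bar> \<partial>N) \<longlonglongrightarrow> 0"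
    by (intro N.conv_in_prob_L1[OF _ _ bb bl]) measurable
  have 2: "(\<integral>\<omega>. \<bar>an n (\<pi> \<omega>) - bn n (\<pi> \<omega>)\<bar> \<partial>N) \<le> K * (\<integral>\<omega>. 1 - \<Psi> n \<omega> \<partial>M)" for n
  proof -
    have "(\<integral>\<omega>. \<bar>an n (\<pi> \<omega>) - bn n (\<pi> \<omega>)\<bar> \<partial>N) = (\<integral>\<omega>. \<bar>an n \<omega> - bn n \<omega>\<bar> \<partial>M)"
      by (rule integral_\<pi>) measurable
    also have "\<dots> \<le> (\<integral>\<omega>. \<bar>gn n \<omega> * Y \<omega> - gn n \<omega> * \<Psi> n \<omega> * Y \<omega>\<bar> \<partial>M)"
      unfolding an_def bn_def by (rule M.real_cond_exp_L1_contraction[OF i1 i2])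
    also have "\<dots> \<le> (\<integral>\<omega>. K * (1 - \<Psi> n \<omega>) \<partial>M)"
    proof (rule integral_mono)
      show "integrable M (\<lambda>\<omega>. \<bar>gn n \<omega> * Y \<omega> - gn n \<omega> * \<Psi> n \<omega> * Y \<omega>\<bar>)" using i1 i2 by auto
      have "integrable M (\<lambda>\<omega>. 1 - \<Psi> n \<omega>)"
        by (rule M.integrable_bounded_rv[where B=1]) (use \<Psi>_range[of _ n] in auto)
      then show "integrable M (\<lambda>\<omega>. K * (1 - \<Psi> n \<omega>))" by simp
      fix \<omega> assume \<omega>: "\<omega> \<in> space M"
      have "\<bar>gn n \<omega> * Y \<omega> - gn n \<omega> * \<Psi> n \<omega> * Y \<omega>\<bar> = \<bar>gn n \<omega> * Y \<omega>\<bar> * (1 - \<Psi> n \<omega>)"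
      proof -
        have "gn n \<omega> * Y \<omega> - gn n \<omega> * \<Psi> n \<omega> * Y \<omega> = (gn n \<omega> * Y \<omega>) * (1 - \<Psi> n \<omega>)" by (simp add: algebra_simps)
        then show ?thesis using \<Psi>_range[OF \<omega>, of n] by (simp add: abs_mult)
      qed
      also have "\<dots> \<le> K * (1 - \<Psi> n \<omega>)" using b1[OF \<omega>, of n] \<Psi>_range[OF \<omega>, of n] by (intro mult_right_mono) auto
      finally show "\<bar>gn n \<omega> * Y \<omega> - gn n \<omega> * \<Psi> n \<omega> * Y \<omega>\<bar> \<le> K * (1 - \<Psi> n \<omega>)" .
    qed
    finally show ?thesis by simp
  qed
  have ia: "integrable N (\<lambda>\<omega>. an n (\<pi> \<omega>))" and ib: "integrable N (\<lambda>\<omega>. bn n (\<pi> \<omega>))" and il: "integrable N l" for n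
    by (rule N.integrable_const_bound[where B=K], use ba bb bl in auto)+
  have "(\<lambda>n. K * (\<integral>\<omega>. 1 - \<Psi> n \<omega> \<partial>M) + (\<integral>\<omega>. \<bar>bn n (\<pi> \<omega>) - l \<omega>\<bar> \<partial>N)) \<longlonglongrightarrow> K * 0 + 0"
    by (intro tendsto_intros expectation_\<Psi>_deficit 1)
  then have lim0: "(\<lambda>n. K * (\<integral>\<omega>. 1 - \<Psi> n \<omega> \<partial>M) + (\<integral>\<omega>. \<bar>bn n (\<pi> \<omega>) - l \<omega>\<bar> \<partial>N)) \<longlonglongrightarrow> 0" by simp
  have "(\<lambda>n. \<integral>\<omega>. \<bar>an n (\<pi> \<omega>) - l \<omega>\<bar> \<partial>N) \<longlonglongrightarrow> 0"
  proof (rule tendsto_sandwich[OF _ _ tendsto_const lim0])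
    show "\<forall>\<^sub>F n in sequentially. (\<integral>\<omega>. \<bar>an n (\<pi> \<omega>) - l \<omega>\<bar> \<partial>N) \<le> K * (\<integral>\<omega>. 1 - \<Psi> n \<omega> \<partial>M) + (\<integral>\<omega>. \<bar>bn n (\<pi> \<omega>) - l \<omega>\<bar> \<partial>N)"
    proof (intro always_eventually allI)
      fix n
      have "(\<integral>\<omega>. \<bar>an n (\<pi> \<omega>) - l \<omega>\<bar> \<partial>N) \<le> (\<integral>\<omega>. \<bar>an n (\<pi> \<omega>) - bn n (\<pi> \<omega>)\<bar> + \<bar>bn n (\<pi> \<omega>) - l \<omega>\<bar> \<partial>N)"
        using ia[of n] ib[of n] il by (intro integral_mono) auto
      also have "\<dots> = (\<integral>\<omega>. \<bar>an n (\<pi> \<omega>) - bn n (\<pi> \<omega>)\<bar> \<partial>N) + (\<integral>\<omega>. \<bar>bn n (\<pi> \<omega>) - l \<omega>\<bar> \<partial>N)"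
        using ia[of n] ib[of n] il by (intro Bochner_Integration.integral_add) auto
      finally show "(\<integral>\<omega>. \<bar>an n (\<pi> \<omega>) - l \<omega>\<bar> \<partial>N) \<le> K * (\<integral>\<omega>. 1 - \<Psi> n \<omega> \<partial>M) + (\<integral>\<omega>. \<bar>bn n (\<pi> \<omega>) - l \<omega>\<bar> \<partial>N)"
        using 2[of n] by linarith
    qed
  qed auto
  then show ?thesis unfolding an_def l_def gn_def gl_def .
qed

lemma fidi_expectation:
  fixes u :: "nat \<Rightarrow> real^'p"
  assumes k: "1 \<le> k" and g: "continuous_map (Euclidean_space k) euclideanreal g"
    and bg: "bounded (g ` topspace (Euclidean_space k))" and Y: "bounded_rv G Y"
  shows "(\<lambda>n. \<integral>\<omega>. g (\<lambda>i. if i < k then Z n \<omega> (u i) else 0) * Y \<omega> \<partial>M)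
     \<longlonglongrightarrow> (\<integral>\<omega>. g (\<lambda>i. if i < k then apply_bcontfun (Zlim \<omega>) (u i) else 0) * Y (\<pi> \<omega>) \<partial>N)"
proof -
  note [measurable] = bounded_rvD(1)[OF Y]
  obtain KY where KY: "0 < KY" "\<And>\<omega>. \<omega> \<in> space M \<Longrightarrow> \<bar>Y \<omega>\<bar> \<le> KY" using bounded_rvD(2)[OF Y] by auto
  obtain Kg where Kg: "0 < Kg" "\<And>x. x \<in> topspace (Euclidean_space k) \<Longrightarrow> \<bar>g x\<bar> \<le> Kg"
    using bg by (auto simp: bounded_pos)
  define gn where "gn n \<omega> = g (\<lambda>i. if i < k then Z n \<omega> (u i) else 0)" for n \<omega>
  define gl where "gl \<omega> = g (\<lambda>i. if i < k then apply_bcontfun (Zlim \<omega>) (u i) else 0)" for \<omega>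
  have gn: "\<bar>gn n \<omega>\<bar> \<le> Kg" and gl: "\<bar>gl \<omega>'\<bar> \<le> Kg" for n \<omega> \<omega>'
    unfolding gn_def gl_def by (auto intro!: Kg(2) simp: topspace_Euclidean_space)
  have [measurable]: "gn n \<in> borel_measurable M" for n
    unfolding gn_def by (rule borel_measurable_Euclidean_space[OF g]) measurable
  have [measurable]: "gl \<in> borel_measurable N"
    unfolding gl_def by (rule borel_measurable_Euclidean_space[OF g]) measurable
  have i1: "integrable M (\<lambda>\<omega>. gn n \<omega> * Y \<omega>)" for n
    by (rule M.integrable_bounded_rv[where B="Kg * KY"])
       (use gn KY Kg in \<open>auto simp: abs_mult intro!: mult_mono\<close>)
  have i3: "integrable N (\<lambda>\<omega>. gl \<omega> * Y (\<pi> \<omega>))"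
    by (rule N.integrable_bounded_rv[where B="Kg * KY"])
       (use gl KY(2)[OF measurable_space[OF \<pi>_meas]] KY(1) Kg in \<open>auto simp: abs_mult intro!: mult_mono\<close>)
  define an where "an n = real_cond_exp M C (\<lambda>\<omega>. gn n \<omega> * Y \<omega>)" for n
  define l where "l = real_cond_exp N C' (\<lambda>\<omega>. gl \<omega> * Y (\<pi> \<omega>))"
  have L1: "(\<lambda>n. \<integral>\<omega>. \<bar>an n (\<pi> \<omega>) - l \<omega>\<bar> \<partial>N) \<longlonglongrightarrow> 0"
    using fidi_L1[OF k g bg Y, of u] unfolding an_def l_def gn_def gl_def .
  have [measurable]: "an n \<in> borel_measurable M" for n unfolding an_def by measurable
  have il: "integrable N l" unfolding l_def by (rule N.real_cond_exp_int(1)[OF i3])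
  have ia: "integrable N (\<lambda>\<omega>. an n (\<pi> \<omega>))" for n
    using integrable_distr[OF \<pi>_meas, of "an n"] M.real_cond_exp_int(1)[OF i1, of n] by (simp add: distr_\<pi> an_def)
  have "(\<lambda>n. (\<integral>\<omega>. gn n \<omega> * Y \<omega> \<partial>M) - (\<integral>\<omega>. gl \<omega> * Y (\<pi> \<omega>) \<partial>N)) \<longlonglongrightarrow> 0"
  proof (rule Lim_null_comparison[OF _ L1])
    show "\<forall>\<^sub>F n in sequentially. norm ((\<integral>\<omega>. gn n \<omega> * Y \<omega> \<partial>M) - (\<integral>\<omega>. gl \<omega> * Y (\<pi> \<omega>) \<partial>N)) \<le> (\<integral>\<omega>. \<bar>an n (\<pi> \<omega>) - l \<omega>\<bar> \<partial>N)"
    proof (intro always_eventually allI)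
      fix n
      have "(\<integral>\<omega>. gn n \<omega> * Y \<omega> \<partial>M) = (\<integral>\<omega>. an n \<omega> \<partial>M)"
        unfolding an_def by (rule M.real_cond_exp_int(2)[symmetric, OF i1])
      also have "\<dots> = (\<integral>\<omega>. an n (\<pi> \<omega>) \<partial>N)" by (rule integral_\<pi>[symmetric]) measurable
      finally have "(\<integral>\<omega>. gn n \<omega> * Y \<omega> \<partial>M) - (\<integral>\<omega>. gl \<omega> * Y (\<pi> \<omega>) \<partial>N) = (\<integral>\<omega>. an n (\<pi> \<omega>) - l \<omega> \<partial>N)"
        using N.real_cond_exp_int(2)[OF i3] ia il by (simp add: l_def)
      then show "norm ((\<integral>\<omega>. gn n \<omega> * Y \<omega> \<partial>M) - (\<integral>\<omega>. gl \<omega> * Y (\<pi> \<omega>) \<partial>N)) \<le> (\<integral>\<omega>. \<bar>an n (\<pi> \<omega>) - l \<omega>\<bar> \<partial>N)"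
        using integral_norm_bound[of N "\<lambda>\<omega>. an n (\<pi> \<omega>) - l \<omega>"] by simp
    qed
  qed
  then show ?thesis unfolding gn_def gl_def by (rule LIM_zero_cancel)
qed

end

section \<open>The limit field\<close>

lemma continuous_map_Euclidean_spaceI:
  assumes "continuous_on UNIV (g :: (nat \<Rightarrow> real) \<Rightarrow> real)"
  shows "continuous_map (Euclidean_space k) euclideanreal g"
proof -
  have "Euclidean_space k = top_of_set (topspace (Euclidean_space k))"
    by (simp add: Euclidean_space_def topspace_Euclidean_space euclidean_product_topology)
  moreover have "continuous_on (topspace (Euclidean_space k)) g"
    using assms by (rule continuous_on_subset) simp
  ultimately show ?thesis by (metis continuous_map_iff_continuous)
qed

lemma continuous_on_coordinate [continuous_intros]:
  "continuous_on S (\<lambda>x :: nat \<Rightarrow> real. x i)"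
  by (rule continuous_on_subset[OF continuous_on_product_coordinates]) simp

text \<open>What is known of almost every path of the limit field. The constants of the decay depend on the path.\<close>

definition limit_path :: "real \<Rightarrow> (real^'p \<Rightarrow> real) \<Rightarrow> bool" where
  "limit_path D z \<longleftrightarrow> continuous_on UNIV z \<and> z 0 = 1 \<and> (\<forall>u. 0 \<le> z u) \<and> (\<exists>K. \<forall>u. z u \<le> K) \<and>
     (\<exists>K r0. 1 \<le> r0 \<and> (\<forall>r u. r0 \<le> r \<longrightarrow> real r \<le> norm u \<longrightarrow> z u \<le> K / real r powr D))"

lemma limit_path_integrable:
  fixes z :: "real^'p \<Rightarrow> real"
  assumes z: "limit_path D z" and q: "1 \<le> q" and D: "real CARD('p) + q < D"
  shows "integrable lborel z" "integrable lborel (\<lambda>u. z u *\<^sub>R u)" "0 < (\<integral>u. z u \<partial>lborel)"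
proof -
  have c: "continuous_on UNIV z" and z0: "z 0 = 1" and pos: "\<And>u. 0 \<le> z u"
    using z by (auto simp: limit_path_def)
  obtain K0 where K0: "\<And>u. z u \<le> K0" using z by (auto simp: limit_path_def)
  obtain K r0 where dec: "1 \<le> r0" "\<And>r u. r0 \<le> r \<Longrightarrow> real r \<le> norm u \<Longrightarrow> z u \<le> K / real r powr D"
    using z unfolding limit_path_def by blast
  have [measurable]: "z \<in> borel_measurable borel" by (rule borel_measurable_continuous_onI[OF c])
  have i: "integrable lborel (\<lambda>u. (1 + norm u) * z u)"
    by (rule integrable_decay[OF _ pos K0 q D dec]) auto
  show iz: "integrable lborel z"
    by (rule Bochner_Integration.integrable_bound[OF i]) (auto simp: pos abs_mult algebra_simps)
  show "integrable lborel (\<lambda>u. z u *\<^sub>R u)"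
    by (rule Bochner_Integration.integrable_bound[OF i]) (auto simp: pos abs_mult algebra_simps)
  show "0 < (\<integral>u. z u \<partial>lborel)"
  proof -
    have "(\<integral>u. z u \<partial>lborel) \<noteq> 0"
    proof
      assume "(\<integral>u. z u \<partial>lborel) = 0"
      then have "AE u in lborel. z u = 0"
        using iz pos by (subst (asm) integral_nonneg_eq_0_iff_AE) auto
      then have "AE u in lborel. u \<notin> {u. 0 < z u}" by eventually_elim auto
      moreover have o: "open {u. 0 < z u}"
        using open_Collect_less[OF continuous_on_const c] by simp
      ultimately have "{u. 0 < z u} \<in> null_sets lborel" by (subst (asm) AE_iff_null_sets[symmetric]) auto
      then have "negligible {u. 0 < z u}" by (auto simp: negligible_iff_null_sets null_sets_completionI)
      moreover have "0 \<in> {u. 0 < z u}" using z0 by simp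
      ultimately show False using o open_not_negligible by blast
    qed
    moreover have "0 \<le> (\<integral>u. z u \<partial>lborel)" using pos by auto
    ultimately show ?thesis by simp
  qed
qed

text \<open>Refining the grid and then enlarging the ball recovers the mean of the whole path.\<close>

lemma grid_mean_tendsto:
  fixes z :: "real^'p \<Rightarrow> real"
  assumes z: "limit_path D z" and m: "1 \<le> m"
  shows "(\<lambda>k. grid_mean k m z) \<longlonglongrightarrow> u_limit (\<lambda>u. indicator (ball 0 (real m)) u * z u)"
proof -
  have c: "continuous_on UNIV z" and z0: "z 0 = 1" and pos: "\<And>u. 0 \<le> z u"
    using z by (auto simp: limit_path_def)
  obtain K0 where K0: "\<And>u. z u \<le> K0" using z by (auto simp: limit_path_def)
  have [measurable]: "z \<in> borel_measurable borel" by (rule borel_measurable_continuous_onI[OF c])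
  define b where "b = ball (0::real^'p) (real m)"
  have [measurable]: "b \<in> sets borel" by (simp add: b_def)
  have fb: "emeasure lborel b < \<infinity>" unfolding b_def by (rule emeasure_bounded_finite) simp
  have ib: "integrable lborel (\<lambda>u. indicator b u * C)" for C :: real
    using fb by (intro integrable_mult_left integrable_real_indicator) (auto simp: b_def)
  have zg: "(\<lambda>k. z (grid k u)) \<longlonglongrightarrow> z u" for u
    by (rule continuous_on_tendsto_compose[OF c grid_tendsto]) auto
  have 1: "(\<lambda>k. \<integral>u. indicator b u *\<^sub>R z (grid k u) \<partial>lborel) \<longlonglongrightarrow> (\<integral>u. indicator b u *\<^sub>R z u \<partial>lborel)"
    by (rule integral_dominated_convergence[OF _ _ ib[of K0]])
       (use pos K0 zg in \<open>auto simp: b_def indicator_def intro!: AE_I2\<close>)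
  have 2: "(\<lambda>k. \<integral>u. indicator b u *\<^sub>R (z (grid (Suc k) u) *\<^sub>R grid (Suc k) u) \<partial>lborel) \<longlonglongrightarrow> (\<integral>u. indicator b u *\<^sub>R (z u *\<^sub>R u) \<partial>lborel)"
  proof (rule integral_dominated_convergence[OF _ _ ib[of "K0 * (real m + real CARD('p))"]])
    show "AE u in lborel. (\<lambda>k. indicator b u *\<^sub>R (z (grid (Suc k) u) *\<^sub>R grid (Suc k) u)) \<longlonglongrightarrow> indicator b u *\<^sub>R (z u *\<^sub>R u)"
      by (intro AE_I2 tendsto_scaleR tendsto_const LIMSEQ_Suc[OF zg] LIMSEQ_Suc[OF grid_tendsto])
    fix k
    show "AE u in lborel. norm (indicator b u *\<^sub>R (z (grid (Suc k) u) *\<^sub>R grid (Suc k) u)) \<le> indicator b u * (K0 * (real m + real CARD('p)))"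
    proof (rule AE_I2)
      fix u :: "real^'p"
      show "norm (indicator b u *\<^sub>R (z (grid (Suc k) u) *\<^sub>R grid (Suc k) u)) \<le> indicator b u * (K0 * (real m + real CARD('p)))"
      proof (cases "u \<in> b")
        case True
        have "norm (grid (Suc k) u - u) \<le> real CARD('p)"
        proof -
          have "real CARD('p) / real (Suc k) \<le> real CARD('p)" by (simp add: divide_le_eq)
          then show ?thesis using norm_grid_diff[of "Suc k" u] by simp
        qed
        then have "norm (grid (Suc k) u) \<le> real m + real CARD('p)"
          using True norm_triangle_sub[of "grid (Suc k) u" u] by (auto simp: b_def)
        then show ?thesis using True pos[of "grid (Suc k) u"] K0[of "grid (Suc k) u"] by (auto intro!: mult_mono)
      qed simp
    qed
    show "(\<lambda>u. indicator b u *\<^sub>R (z (grid (Suc k) u) *\<^sub>R grid (Suc k) u)) \<in> borel_measurable lborel"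
      by measurable
    show "(\<lambda>u. indicator b u *\<^sub>R (z u *\<^sub>R u)) \<in> borel_measurable lborel"
      by measurable
  qed
  have den: "(\<integral>u. indicator b u *\<^sub>R z u \<partial>lborel) \<noteq> 0"
  proof
    assume 0: "(\<integral>u. indicator b u *\<^sub>R z u \<partial>lborel) = 0"
    have i: "integrable lborel (\<lambda>u. indicator b u *\<^sub>R z u)"
      by (rule Bochner_Integration.integrable_bound[OF ib[of K0]])
         (use pos order_trans[OF K0 abs_ge_self] in \<open>auto simp: b_def indicator_def intro!: AE_I2\<close>)
    have "AE u in lborel. indicator b u *\<^sub>R z u = 0"
      using i 0 pos by (subst (asm) integral_nonneg_eq_0_iff_AE) auto
    then have "AE u in lborel. u \<notin> b \<inter> {u. 0 < z u}" by eventually_elim auto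
    moreover have o: "open (b \<inter> {u. 0 < z u})"
      using open_Collect_less[OF continuous_on_const c] by (auto simp: b_def)
    ultimately have "b \<inter> {u. 0 < z u} \<in> null_sets lborel" by (subst (asm) AE_iff_null_sets[symmetric]) auto
    then have "negligible (b \<inter> {u. 0 < z u})" by (auto simp: negligible_iff_null_sets null_sets_completionI)
    moreover have "0 \<in> b \<inter> {u. 0 < z u}" using z0 m by (simp add: b_def)
    ultimately show False using o open_not_negligible by blast
  qed
  have "(\<lambda>k. inverse (\<integral>u. indicator b u *\<^sub>R z (grid (Suc k) u) \<partial>lborel) *\<^sub>R (\<integral>u. indicator b u *\<^sub>R (z (grid (Suc k) u) *\<^sub>R grid (Suc k) u) \<partial>lborel))
     \<longlonglongrightarrow> inverse (\<integral>u. indicator b u *\<^sub>R z u \<partial>lborel) *\<^sub>R (\<integral>u. indicator b u *\<^sub>R (z u *\<^sub>R u) \<partial>lborel)"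
    by (intro tendsto_scaleR tendsto_inverse den LIMSEQ_Suc[OF 1] 2)
  moreover have "inverse (\<integral>u. indicator b u *\<^sub>R z (grid k u) \<partial>lborel) *\<^sub>R (\<integral>u. indicator b u *\<^sub>R (z (grid k u) *\<^sub>R grid k u) \<partial>lborel) = grid_mean k m z" for k
    unfolding b_def using grid_integral(2)[of m z k] grid_integral(2)[of m "\<lambda>v. z v *\<^sub>R v" k]
    by (simp add: grid_mean_def)
  moreover have "inverse (\<integral>u. indicator b u *\<^sub>R z u \<partial>lborel) *\<^sub>R (\<integral>u. indicator b u *\<^sub>R (z u *\<^sub>R u) \<partial>lborel) = u_limit (\<lambda>u. indicator (ball 0 (real m)) u * z u)"
    by (simp add: u_limit_def b_def)
  ultimately have "(\<lambda>k. grid_mean (Suc k) m z) \<longlonglongrightarrow> u_limit (\<lambda>u. indicator (ball 0 (real m)) u * z u)" by simp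
  then show ?thesis by (rule LIMSEQ_imp_Suc)
qed

lemma u_limit_ball_tendsto:
  fixes z :: "real^'p \<Rightarrow> real"
  assumes z: "limit_path D z" and q: "1 \<le> q" and D: "real CARD('p) + q < D"
  shows "(\<lambda>m. u_limit (\<lambda>u. indicator (ball 0 (real m)) u * z u)) \<longlonglongrightarrow> u_limit z"
proof -
  note i = limit_path_integrable[OF z q D]
  have pos: "\<And>u. 0 \<le> z u" using z by (auto simp: limit_path_def)
  have [measurable]: "z \<in> borel_measurable borel" using i(1) by simp
  have ev: "\<forall>\<^sub>F m in sequentially. indicator (ball 0 (real m)) u = (1::real)" for u :: "real^'p"
  proof -
    obtain m0 :: nat where "norm u < real m0" using reals_Archimedean2 by blast
    then show ?thesis by (auto simp: eventually_sequentially intro!: exI[of _ m0])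
  qed
  have 1: "(\<lambda>m. \<integral>u. indicator (ball 0 (real m)) u * z u \<partial>lborel) \<longlonglongrightarrow> (\<integral>u. z u \<partial>lborel)"
  proof (rule integral_dominated_convergence[OF _ _ i(1)])
    show "AE u in lborel. (\<lambda>m. indicator (ball 0 (real m)) u * z u) \<longlonglongrightarrow> z u"
    proof (rule AE_I2)
      fix u :: "real^'p"
      show "(\<lambda>m. indicator (ball 0 (real m)) u * z u) \<longlonglongrightarrow> z u"
        by (intro tendsto_eventually eventually_mono[OF ev[of u]]) simp
    qed
  qed (use pos in \<open>auto simp: indicator_def\<close>)
  have 2: "(\<lambda>m. \<integral>u. (indicator (ball 0 (real m)) u * z u) *\<^sub>R u \<partial>lborel) \<longlonglongrightarrow> (\<integral>u. z u *\<^sub>R u \<partial>lborel)"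
  proof (rule integral_dominated_convergence[OF _ _ integrable_norm[OF i(2)]])
    show "AE u in lborel. (\<lambda>m. (indicator (ball 0 (real m)) u * z u) *\<^sub>R u) \<longlonglongrightarrow> z u *\<^sub>R u"
    proof (rule AE_I2)
      fix u :: "real^'p"
      show "(\<lambda>m. (indicator (ball 0 (real m)) u * z u) *\<^sub>R u) \<longlonglongrightarrow> z u *\<^sub>R u"
        by (intro tendsto_eventually eventually_mono[OF ev[of u]]) simp
    qed
  qed (use pos in \<open>auto simp: indicator_def\<close>)
  show ?thesis unfolding u_limit_def
    by (intro tendsto_scaleR tendsto_inverse 1 2) (use i(3) in simp)
qed

context quasi_bayes
begin

abbreviation zl where "zl \<omega> \<equiv> apply_bcontfun (Zlim \<omega>)"

lemma zl_continuous: "continuous_on S (zl \<omega>)"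
  by (rule continuous_on_apply_bcontfun)

lemma zl_bounded: "\<bar>zl \<omega> u\<bar> \<le> norm (Zlim \<omega>)"
  using norm_bounded[of "Zlim \<omega>" u] by simp

lemma bounded_rv_const: "bounded_rv G (\<lambda>_. c)"
  unfolding bounded_rv_def bounded_iff by auto

text \<open>A closed condition on the value at a point, coded as the vanishing of a continuous function, passes
  to the limit since the expectations do.\<close>

lemma zl_point_AE:
  assumes g: "continuous_on UNIV (g :: real \<Rightarrow> real)" "\<And>x. 0 \<le> g x \<and> g x \<le> 1"
    and null: "\<And>n \<omega>. \<omega> \<in> space M \<Longrightarrow> g (Z n \<omega> u) = 0"
  shows "AE \<omega> in N. g (zl \<omega> u) = 0"
proof -
  have "(\<lambda>n. \<integral>\<omega>. g (if (0::nat) < 1 then Z n \<omega> u else 0) * 1 \<partial>M) \<longlonglongrightarrow> (\<integral>\<omega>. g (if (0::nat) < 1 then zl \<omega> u else 0) * 1 \<partial>N)"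
  proof (rule fidi_expectation[where k=1 and g="\<lambda>x. g (x 0)" and u="\<lambda>_. u" and Y="\<lambda>_. 1"])
    show "continuous_map (Euclidean_space 1) euclideanreal (\<lambda>x. g (x 0))"
      by (intro continuous_map_Euclidean_spaceI continuous_on_compose2[OF g(1)] continuous_intros) auto
    show "bounded ((\<lambda>x. g (x 0)) ` topspace (Euclidean_space 1))"
      using g(2) by (auto simp: bounded_iff intro!: exI[of _ 1])
  qed (auto simp: bounded_rv_const)
  moreover have "(\<integral>\<omega>. g (if (0::nat) < 1 then Z n \<omega> u else 0) * 1 \<partial>M) = 0" for n
    using null by (simp cong: Bochner_Integration.integral_cong)
  ultimately have 0: "(\<integral>\<omega>. g (zl \<omega> u) \<partial>N) = 0" by (simp add: LIMSEQ_const_iff)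
  have [measurable]: "g \<in> borel_measurable borel" by (rule borel_measurable_continuous_onI[OF g(1)])
  have "integrable N (\<lambda>\<omega>. g (zl \<omega> u))"
    by (rule N.integrable_bounded_rv[where B=1]) (use g(2) in auto)
  then show ?thesis using 0 g(2) by (subst (asm) integral_nonneg_eq_0_iff_AE) auto
qed

lemma zl_zero: "AE \<omega> in N. zl \<omega> 0 = 1"
proof -
  have "AE \<omega> in N. min 1 \<bar>zl \<omega> 0 - 1\<bar> = 0"
  proof (rule zl_point_AE[where g="\<lambda>x. min 1 \<bar>x - 1\<bar>"])
    show "min 1 \<bar>Z n \<omega> 0 - 1\<bar> = 0" if "\<omega> \<in> space M" for n \<omega>
      using ratio_path.z_zero[OF path[OF that], of n] by simp
  qed (auto intro!: continuous_intros)
  then show ?thesis by eventually_elim auto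
qed

lemma zl_nonneg: "AE \<omega> in N. \<forall>u. 0 \<le> zl \<omega> u"
proof -
  obtain T where T: "countable T" "T \<subseteq> (UNIV :: (real^'p) set)" "UNIV \<subseteq> closure T" by (rule separable)
  have "AE \<omega> in N. min 1 (max 0 (- zl \<omega> u)) = 0" for u
  proof (rule zl_point_AE[where g="\<lambda>x. min 1 (max 0 (- x))"])
    show "min 1 (max 0 (- Z n \<omega> u)) = 0" if "\<omega> \<in> space M" for n \<omega>
      using ratio_path.z_nonneg[OF path[OF that], of n u] by simp
  qed (auto intro!: continuous_intros)
  then have "AE \<omega> in N. \<forall>u\<in>T. min 1 (max 0 (- zl \<omega> u)) = 0"
    using T(1) by (simp add: AE_ball_countable)
  then show ?thesis
  proof eventually_elim
    case (elim \<omega>)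
    have "0 \<le> zl \<omega> u" if "u \<in> T" for u using elim that by (auto simp: min_def max_def split: if_splits)
    then have "closure T \<subseteq> {u. 0 \<le> zl \<omega> u}"
      by (intro closure_minimal closed_Collect_le continuous_on_const zl_continuous) auto
    then show ?case using T(3) by auto
  qed
qed

lemma eventually_A_small:
  assumes e: "0 < e"
  shows "\<forall>\<^sub>F n in sequentially. \<forall>u\<in>ball 0 c. norm (A n *v u) < e"
proof -
  define e' where "e' = e / (real CARD('p) * real CARD('p) * (\<bar>c\<bar> + 1))"
  have e': "0 < e'" using e by (simp add: e'_def)
  have "\<forall>\<^sub>F n in sequentially. norm (A n) < e'"
    using tendsto_norm[OF A_lim] e' by (intro order_tendstoD) auto
  then show ?thesis
  proof eventually_elim
    case (elim n)
    have Aij: "\<bar>A n $ i $ j\<bar> \<le> e'" for i j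
    proof -
      have "\<bar>A n $ i $ j\<bar> \<le> norm (A n $ i)" by (rule component_le_norm_cart)
      also have "\<dots> \<le> norm (A n)" by (rule Finite_Cartesian_Product.norm_nth_le)
      finally show ?thesis using elim by linarith
    qed
    show ?case
    proof
      fix u :: "real^'p" assume u: "u \<in> ball 0 c"
      have "norm (A n *v u) \<le> (\<Sum>i\<in>UNIV. \<bar>(A n *v u) $ i\<bar>)" by (rule norm_le_l1_cart)
      also have "\<dots> \<le> (\<Sum>i::'p\<in>UNIV. real CARD('p) * (e' * \<bar>c\<bar>))"
      proof (rule sum_mono)
        fix i :: 'p
        have "\<bar>(A n *v u) $ i\<bar> \<le> (\<Sum>j\<in>UNIV. \<bar>A n $ i $ j * u $ j\<bar>)"
          unfolding matrix_vector_mult_def by (simp add: sum_abs)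
        also have "\<dots> \<le> (\<Sum>j::'p\<in>UNIV. e' * \<bar>c\<bar>)"
        proof (rule sum_mono)
          fix j :: 'p
          have "\<bar>u $ j\<bar> \<le> \<bar>c\<bar>" using u component_le_norm_cart[of u j] by auto
          then show "\<bar>A n $ i $ j * u $ j\<bar> \<le> e' * \<bar>c\<bar>"
            using Aij[of i j] e' unfolding abs_mult by (intro mult_mono) auto
        qed
        finally show "\<bar>(A n *v u) $ i\<bar> \<le> real CARD('p) * (e' * \<bar>c\<bar>)" by simp
      qed
      also have "\<dots> = real CARD('p) * real CARD('p) * (e' * \<bar>c\<bar>)" by simp
      also have "\<dots> < e"
      proof -
        have "p * (e / (p * (\<bar>c\<bar> + 1)) * \<bar>c\<bar>) = e * (\<bar>c\<bar> / (\<bar>c\<bar> + 1))" if "0 < p" for p :: real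
          using that by simp
        moreover have "e * (\<bar>c\<bar> / (\<bar>c\<bar> + 1)) < e * 1" using e by (intro mult_strict_left_mono) auto
        ultimately show ?thesis unfolding e'_def by simp
      qed
      finally show "norm (A n *v u) < e" .
    qed
  qed
qed

lemma eventually_in_UT: "\<forall>\<^sub>F n in sequentially. ball 0 c \<subseteq> UT n"
proof -
  obtain h z where r: "ratio_path \<Theta> \<theta>\<^sub>s (A 0) \<rho> b B h z" by (rule some_path)
  obtain e where e: "0 < e" "ball \<theta>\<^sub>s e \<subseteq> \<Theta>"
    using ratio_path.open_\<Theta>[OF r] ratio_path.\<theta>s_in[OF r] by (meson open_contains_ball)
  show ?thesis using eventually_A_small[OF e(1), of c]
    by eventually_elim (use e(2) in \<open>auto simp: U_set_def dist_norm subset_iff\<close>)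
qed

end

context quasi_bayes
begin

text \<open>The tail bound of the approximating fields survives in the limit at finitely many points. The
  random thresholds are frozen on the \<open>C\<close>-measurable events where \<open>cU\<close> and \<open>cV\<close> are bounded by a constant.\<close>

lemma zl_tail_finite:
  fixes v :: "nat \<Rightarrow> real^'p"
  assumes r: "1 \<le> r" and k: "1 \<le> k" and v: "\<And>i. i < k \<Longrightarrow> real r \<le> norm (v i)" and K: "0 < K"
  defines "S \<equiv> {\<omega> \<in> space M. cU \<omega> \<le> K \<and> cV \<omega> \<le> K}"
  shows "N.prob {\<omega> \<in> space N. (\<exists>i<k. (K + 1) / real r powr D < zl \<omega> (v i)) \<and> \<pi> \<omega> \<in> S} \<le> K / real r powr L"
proof -
  define t where "t = K / real r powr D"
  \<comment> \<open>A continuous substitute for the indicator of a crossing: it vanishes unless some value exceeds the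
    threshold \<open>t\<close>, and it is 1 as soon as some value exceeds \<open>(K + 1) / real r powr D\<close>.\<close>
  define g where "g x = min 1 (real r powr D * (\<Sum>i<k. max 0 (x i - t)))" for x :: "nat \<Rightarrow> real"
  have rD: "0 < real r powr D" using r by simp
  have [measurable]: "cU \<in> borel_measurable M" "cV \<in> borel_measurable M" using C_M cU_C cV_C by auto
  have SC: "S \<in> sets C"
  proof -
    have "S = {\<omega> \<in> space C. cU \<omega> \<le> K \<and> cV \<omega> \<le> K}" using sub_MC by (auto simp: S_def subalgebra_def)
    also have "\<dots> \<in> sets C" using cU_C cV_C by measurable
    finally show ?thesis .
  qed
  then have SM [measurable]: "S \<in> sets M" using sub_MC by (auto simp: subalgebra_def)
  have SG: "S \<in> sets G" using SC sub_C by (auto simp: subalgebra_def)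
  have Y: "bounded_rv G (indicator S)"
    using SG by (auto simp: bounded_rv_def bounded_iff indicator_def intro!: exI[of _ 1])
  have g01: "0 \<le> g x" "g x \<le> 1" for x
    using rD by (auto simp: g_def intro!: mult_nonneg_nonneg sum_nonneg)
  have lim: "(\<lambda>n. \<integral>\<omega>. g (\<lambda>i. if i < k then Z n \<omega> (v i) else 0) * indicator S \<omega> \<partial>M)
     \<longlonglongrightarrow> (\<integral>\<omega>. g (\<lambda>i. if i < k then zl \<omega> (v i) else 0) * indicator S (\<pi> \<omega>) \<partial>N)"
  proof (rule fidi_expectation[OF k _ _ Y])
    show "continuous_map (Euclidean_space k) euclideanreal g"
      unfolding g_def by (intro continuous_map_Euclidean_spaceI continuous_intros)
    show "bounded (g ` topspace (Euclidean_space k))"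
      using g01 by (auto simp: bounded_iff intro!: exI[of _ 1])
  qed
  have g_meas: "(\<lambda>\<omega>. g (\<lambda>i. if i < k then f i \<omega> else 0)) \<in> borel_measurable X"
    if "\<And>i. f i \<in> borel_measurable X" for f :: "nat \<Rightarrow> 'x \<Rightarrow> real" and X
  proof -
    note [measurable] = that
    have "(\<lambda>\<omega>. min 1 (real r powr D * (\<Sum>i<k. max 0 (f i \<omega> - t)))) \<in> borel_measurable X" by measurable
    then show ?thesis by (simp add: g_def)
  qed
  have upper: "\<forall>\<^sub>F n in sequentially. (\<integral>\<omega>. g (\<lambda>i. if i < k then Z n \<omega> (v i) else 0) * indicator S \<omega> \<partial>M)
      \<le> K / real r powr L + (\<integral>\<omega>. 1 - \<Psi> n \<omega> \<partial>M)"
  proof -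
    obtain c where c: "\<And>i. i < k \<Longrightarrow> norm (v i) < c"
    proof -
      have "norm (v i) < Max ((\<lambda>i. norm (v i)) ` {..<k}) + 1" if "i < k" for i
      proof -
        have "norm (v i) \<le> Max ((\<lambda>i. norm (v i)) ` {..<k})" by (rule Max_ge) (use that in auto)
        then show ?thesis by linarith
      qed
      then show ?thesis using that by blast
    qed
    show ?thesis
      using eventually_in_UT[of c]
    proof eventually_elim
      case (elim n)
      define E where "E = S_event M \<Theta> \<theta>\<^sub>s (A n) (Z n) (real r) (\<lambda>\<omega>. cU \<omega> / real r powr D)"
      have [measurable]: "E \<in> sets M" unfolding E_def by (rule S_event_M) measurable
      have i\<Psi>: "integrable M (\<lambda>\<omega>. 1 - \<Psi> n \<omega>)"
        by (rule M.integrable_bounded_rv[where B=1]) (use \<Psi>_range[of _ n] in auto)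
      have iE: "integrable M (\<lambda>\<omega>. (\<Psi> n \<omega> * indicator S \<omega>) * indicator E \<omega>)"
        by (rule M.integrable_bounded_rv[where B=1]) (use \<Psi>_range[of _ n] in \<open>auto simp: indicator_def\<close>)
      have "(\<integral>\<omega>. g (\<lambda>i. if i < k then Z n \<omega> (v i) else 0) * indicator S \<omega> \<partial>M)
         \<le> (\<integral>\<omega>. (\<Psi> n \<omega> * indicator S \<omega>) * indicator E \<omega> + (1 - \<Psi> n \<omega>) \<partial>M)"
      proof (rule integral_mono)
        show "integrable M (\<lambda>\<omega>. g (\<lambda>i. if i < k then Z n \<omega> (v i) else 0) * indicator S \<omega>)"
          by (rule M.integrable_bounded_rv[where B=1])
             (use g01 g_meas[of "\<lambda>i \<omega>. Z n \<omega> (v i)" M] in \<open>auto simp: indicator_def\<close>)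
        show "integrable M (\<lambda>\<omega>. (\<Psi> n \<omega> * indicator S \<omega>) * indicator E \<omega> + (1 - \<Psi> n \<omega>))"
          using iE i\<Psi> by (rule Bochner_Integration.integrable_add)
        fix \<omega> assume \<omega>: "\<omega> \<in> space M"
        interpret ratio_path \<Theta> \<theta>\<^sub>s "A n" \<rho> b B "H n \<omega>" "Z n \<omega>" by (rule path[OF \<omega>])
        show "g (\<lambda>i. if i < k then Z n \<omega> (v i) else 0) * indicator S \<omega> \<le> (\<Psi> n \<omega> * indicator S \<omega>) * indicator E \<omega> + (1 - \<Psi> n \<omega>)"
        proof (cases "\<omega> \<in> S \<and> \<omega> \<notin> E")
          case True
          have "g (\<lambda>i. if i < k then Z n \<omega> (v i) else 0) = 0"
          proof -
            have "Z n \<omega> (v i) \<le> t" if "i < k" for i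
            proof -
              have "\<not> crosses (real r) (cU \<omega> / real r powr D)" using True \<omega> by (auto simp: E_def S_event_eq)
              moreover have "v i \<in> UT n" using c[OF that] elim by auto
              ultimately have "Z n \<omega> (v i) < cU \<omega> / real r powr D" using v[OF that] by (rule not_crosses)
              also have "\<dots> \<le> t" using True by (auto simp: t_def S_def intro: divide_right_mono)
              finally show ?thesis by simp
            qed
            then have "(\<Sum>i<k. max 0 ((if i < k then Z n \<omega> (v i) else 0) - t)) = 0"
              by (intro sum.neutral) auto
            then show ?thesis by (simp add: g_def)
          qed
          then show ?thesis using \<Psi>_range[OF \<omega>, of n] by auto
        next
          case False
          then show ?thesis
            using g01[of "\<lambda>i. if i < k then Z n \<omega> (v i) else 0"] \<Psi>_range[OF \<omega>, of n] by (auto simp: indicator_def)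
        qed
      qed
      also have "\<dots> = (\<integral>\<omega>. (\<Psi> n \<omega> * indicator S \<omega>) * indicator E \<omega> \<partial>M) + (\<integral>\<omega>. 1 - \<Psi> n \<omega> \<partial>M)"
        using iE i\<Psi> by (rule Bochner_Integration.integral_add)
      also have "(\<integral>\<omega>. (\<Psi> n \<omega> * indicator S \<omega>) * indicator E \<omega> \<partial>M) = (\<integral>\<omega>. (\<Psi> n \<omega> * indicator S \<omega>) * real_cond_exp M C (indicator E) \<omega> \<partial>M)"
        using SC \<Psi>_C by (intro M.real_cond_exp_intg(2)[symmetric, OF iE]) auto
      also have "\<dots> \<le> (\<integral>\<omega>. K / real r powr L \<partial>M)"
      proof (rule integral_mono_AE)
        show "integrable M (\<lambda>\<omega>. (\<Psi> n \<omega> * indicator S \<omega>) * real_cond_exp M C (indicator E) \<omega>)"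
          using SC \<Psi>_C by (intro M.real_cond_exp_intg(1)[OF iE]) auto
        show "AE \<omega> in M. (\<Psi> n \<omega> * indicator S \<omega>) * real_cond_exp M C (indicator E) \<omega> \<le> K / real r powr L"
          using tail[OF r, of n]
        proof eventually_elim
          case (elim \<omega>)
          show ?case
          proof (cases "\<omega> \<in> S")
            case True
            have "\<Psi> n \<omega> * real_cond_exp M C (indicator E) \<omega> \<le> cV \<omega> / real r powr L"
              using elim by (simp add: event_prob_given_def E_def mult.commute)
            also have "\<dots> \<le> K / real r powr L" using True by (auto simp: S_def intro: divide_right_mono)
            finally show ?thesis using True by simp
          qed (use K in simp)
        qed
      qed simp
      also have "\<dots> = K / real r powr L" by (simp add: M.prob_space)
      finally show ?case by simp
    qed
  qed
  have le: "(\<integral>\<omega>. g (\<lambda>i. if i < k then zl \<omega> (v i) else 0) * indicator S (\<pi> \<omega>) \<partial>N) \<le> K / real r powr L + 0"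
    by (rule tendsto_le[OF _ tendsto_add[OF tendsto_const expectation_\<Psi>_deficit] lim upper]) simp
  define F where "F = {\<omega> \<in> space N. (\<exists>i<k. (K + 1) / real r powr D < zl \<omega> (v i)) \<and> \<pi> \<omega> \<in> S}"
  have [measurable]: "F \<in> sets N" unfolding F_def by measurable
  have "N.prob F = (\<integral>\<omega>. indicator F \<omega> \<partial>N)" by simp
  also have "\<dots> \<le> (\<integral>\<omega>. g (\<lambda>i. if i < k then zl \<omega> (v i) else 0) * indicator S (\<pi> \<omega>) \<partial>N)"
  proof (rule integral_mono)
    show "integrable N (indicator F :: 'v \<Rightarrow> real)" by (rule N.integrable_bounded_rv[where B=1]) auto
    show "integrable N (\<lambda>\<omega>. g (\<lambda>i. if i < k then zl \<omega> (v i) else 0) * indicator S (\<pi> \<omega>))"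
      by (rule N.integrable_bounded_rv[where B=1])
         (use g01 g_meas[of "\<lambda>i \<omega>. zl \<omega> (v i)" N] in \<open>auto simp: indicator_def\<close>)
    fix \<omega>
    show "indicator F \<omega> \<le> g (\<lambda>i. if i < k then zl \<omega> (v i) else 0) * indicator S (\<pi> \<omega>)"
    proof (cases "\<omega> \<in> F")
      case True
      then obtain i where i: "i < k" "(K + 1) / real r powr D < zl \<omega> (v i)" and S: "\<pi> \<omega> \<in> S" by (auto simp: F_def)
      have "1 / real r powr D \<le> max 0 (zl \<omega> (v i) - t)" using i(2) by (simp add: t_def add_divide_distrib)
      also have "\<dots> \<le> (\<Sum>i<k. max 0 ((if i < k then zl \<omega> (v i) else 0) - t))"
        using member_le_sum[of i "{..<k}" "\<lambda>i. max 0 ((if i < k then zl \<omega> (v i) else 0) - t)"] i(1) by simp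
      finally have "1 \<le> real r powr D * (\<Sum>i<k. max 0 ((if i < k then zl \<omega> (v i) else 0) - t))"
        using rD by (simp add: divide_le_eq mult.commute)
      then show ?thesis using True S by (simp add: g_def)
    qed (use g01 in auto)
  qed
  finally show ?thesis using le by (simp add: F_def)
qed

text \<open>The probabilities of crossing at radius \<open>r\<close> are summable because \<open>1 < L\<close>, so the Borel--Cantelli lemma
  excludes crossings at a countable dense set of points beyond a random radius; continuity extends this
  to all points.\<close>

lemma AE_zl_tail:
  assumes K: "0 < K"
  shows "AE \<omega> in N. cU (\<pi> \<omega>) \<le> K \<and> cV (\<pi> \<omega>) \<le> K \<longrightarrow>
    (\<exists>r0. \<forall>r\<ge>r0. \<forall>u. real r \<le> norm u \<longrightarrow> zl \<omega> u \<le> (K + 1) / real r powr D)"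
proof -
  have [measurable]: "cU \<in> borel_measurable M" "cV \<in> borel_measurable M" using C_M cU_C cV_C by auto
  define S where "S = {\<omega> \<in> space M. cU \<omega> \<le> K \<and> cV \<omega> \<le> K}"
  have [measurable]: "S \<in> sets M" unfolding S_def by measurable
  have "\<exists>T. countable T \<and> T \<noteq> {} \<and> T \<subseteq> {u :: real^'p. real r \<le> norm u} \<and> {u. real r \<le> norm u} \<subseteq> closure T" for r
  proof -
    obtain T where T: "countable T" "T \<subseteq> {u :: real^'p. real r \<le> norm u}" "{u. real r \<le> norm u} \<subseteq> closure T"
      by (rule separable)
    obtain u :: "real^'p" where "norm u = real r" using vector_choose_size[of "real r"] by auto
    then have "u \<in> {u. real r \<le> norm u}" by simp
    then have "u \<in> closure T" using T(3) by blast
    then have "T \<noteq> {}" by auto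
    with T show ?thesis by blast
  qed
  then obtain T where T: "\<And>r. countable (T r)" "\<And>r. T r \<noteq> {}" "\<And>r. T r \<subseteq> {u :: real^'p. real r \<le> norm u}"
      "\<And>r. {u. real r \<le> norm u} \<subseteq> closure (T r)" by metis
  define v where "v r = from_nat_into (T r)" for r
  have v: "range (v r) = T r" for r unfolding v_def using T by (simp add: range_from_nat_into)
  have vn: "real r \<le> norm (v r i)" for r i using T(3)[of r] v[of r] by auto
  define F where "F r k = {\<omega> \<in> space N. (\<exists>i<k. (K + 1) / real r powr D < zl \<omega> (v r i)) \<and> \<pi> \<omega> \<in> S}" for r k
  define F' where "F' r = (\<Union>k. F r k)" for r
  have [measurable]: "F r k \<in> sets N" for r k unfolding F_def by measurable
  have [measurable]: "F' r \<in> sets N" for r unfolding F'_def by measurable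
  have small: "N.prob (F' r) \<le> K / real r powr L" if "1 \<le> r" for r
  proof -
    have "(\<lambda>k. N.prob (F r (Suc k))) \<longlonglongrightarrow> N.prob (\<Union>k. F r (Suc k))"
      by (rule N.finite_Lim_measure_incseq) (auto simp: incseq_def F_def intro: less_le_trans)
    moreover have "(\<Union>k. F r (Suc k)) = F' r"
      unfolding F'_def F_def by (auto intro: less_SucI)
    moreover have "N.prob (F r (Suc k)) \<le> K / real r powr L" for k
      unfolding F_def S_def using vn by (intro zl_tail_finite that K) auto
    ultimately show ?thesis by (intro LIMSEQ_le_const2) auto
  qed
  have "summable (\<lambda>r. N.prob (F' r))"
  proof (rule summable_comparison_test'[where N=1])
    show "summable (\<lambda>r. K * real r powr (- L))"
      using L q by (intro summable_mult) (simp add: summable_real_powr_iff)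
    show "norm (N.prob (F' r)) \<le> K * real r powr (- L)" if "1 \<le> r" for r
      using small[OF that] by (simp add: powr_minus divide_inverse)
  qed
  then have "AE \<omega> in N. eventually (\<lambda>r. \<omega> \<in> space N - F' r) sequentially"
    by (intro borel_cantelli_AE1) (auto simp: N.emeasure_eq_measure)
  with AE_space show ?thesis
  proof eventually_elim
    case (elim \<omega>)
    show ?case
    proof
      assume "cU (\<pi> \<omega>) \<le> K \<and> cV (\<pi> \<omega>) \<le> K"
      then have S: "\<pi> \<omega> \<in> S" using measurable_space[OF \<pi>_meas elim(1)] by (simp add: S_def)
      obtain r0 where r0: "\<And>r. r0 \<le> r \<Longrightarrow> \<omega> \<notin> F' r" using elim(2) by (auto simp: eventually_sequentially)
      have "zl \<omega> u \<le> (K + 1) / real r powr D" if r: "r0 \<le> r" and u: "real r \<le> norm u" for r u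
      proof -
        have "zl \<omega> w \<le> (K + 1) / real r powr D" if w: "w \<in> T r" for w
        proof (rule ccontr)
          assume *: "\<not> ?thesis"
          obtain i where "w = v r i" using w unfolding v[symmetric] by blast
          then have "\<omega> \<in> F r (Suc i)" using * S elim(1) by (auto simp: F_def not_le)
          then show False using r0[OF r] by (auto simp: F'_def)
        qed
        then have "closure (T r) \<subseteq> {w. zl \<omega> w \<le> (K + 1) / real r powr D}"
          by (intro closure_minimal closed_Collect_le continuous_on_const zl_continuous) auto
        then show ?thesis using T(4)[of r] u by auto
      qed
      then show "\<exists>r0. \<forall>r\<ge>r0. \<forall>u. real r \<le> norm u \<longrightarrow> zl \<omega> u \<le> (K + 1) / real r powr D" by blast
    qed
  qed
qed

lemma AE_limit_path: "AE \<omega> in N. limit_path D (zl \<omega>)"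
proof -
  have "AE \<omega> in N. \<forall>K::nat. cU (\<pi> \<omega>) \<le> real (Suc K) \<and> cV (\<pi> \<omega>) \<le> real (Suc K) \<longrightarrow>
    (\<exists>r0. \<forall>r\<ge>r0. \<forall>u. real r \<le> norm u \<longrightarrow> zl \<omega> u \<le> (real (Suc K) + 1) / real r powr D)"
    unfolding AE_all_countable by (intro allI AE_zl_tail) simp
  with zl_zero zl_nonneg show ?thesis
  proof eventually_elim
    case (elim \<omega>)
    obtain K where K: "max (cU (\<pi> \<omega>)) (cV (\<pi> \<omega>)) \<le> real K" using real_arch_simple by blast
    then have "cU (\<pi> \<omega>) \<le> real (Suc K) \<and> cV (\<pi> \<omega>) \<le> real (Suc K)" by auto
    then obtain r0 where r0: "\<And>r u. r0 \<le> r \<Longrightarrow> real r \<le> norm u \<Longrightarrow> zl \<omega> u \<le> (real (Suc K) + 1) / real r powr D"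
      using elim(3) by blast
    have "\<exists>K r0. 1 \<le> r0 \<and> (\<forall>r u. r0 \<le> r \<longrightarrow> real r \<le> norm u \<longrightarrow> zl \<omega> u \<le> K / real r powr D)"
      by (rule exI[of _ "real (Suc K) + 1"], rule exI[of _ "max 1 r0"]) (use r0 in auto)
    moreover have "\<exists>K. \<forall>u. zl \<omega> u \<le> K"
      by (rule exI[of _ "norm (Zlim \<omega>)"]) (use zl_bounded[of \<omega>] in \<open>auto simp: abs_le_iff\<close>)
    ultimately show ?case
      unfolding limit_path_def using elim(1,2) zl_continuous[of UNIV \<omega>] by blast
  qed
qed

end

lemma (in prob_space) tendsto_L1_bounded:
  fixes X :: "nat \<Rightarrow> 'a \<Rightarrow> real"
  assumes [measurable]: "\<And>n. X n \<in> borel_measurable M" "Y \<in> borel_measurable M"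
    and bnd: "\<And>n x. \<bar>X n x\<bar> \<le> K" "\<And>x. \<bar>Y x\<bar> \<le> K"
    and lim: "AE x in M. (\<lambda>n. X n x) \<longlonglongrightarrow> Y x"
  shows "(\<lambda>n. \<integral>x. \<bar>X n x - Y x\<bar> \<partial>M) \<longlonglongrightarrow> 0"
proof -
  have "(\<lambda>n. \<integral>x. \<bar>X n x - Y x\<bar> \<partial>M) \<longlonglongrightarrow> (\<integral>x. 0 \<partial>M)"
  proof (rule integral_dominated_convergence[where w="\<lambda>_. 2 * K"])
    show "AE x in M. (\<lambda>n. \<bar>X n x - Y x\<bar>) \<longlonglongrightarrow> 0"
      using lim
    proof eventually_elim
      case (elim x)
      then have "(\<lambda>n. X n x - Y x) \<longlonglongrightarrow> 0" by (rule LIM_zero)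
      then show ?case by (rule tendsto_rabs_zero)
    qed
    show "AE x in M. norm \<bar>X n x - Y x\<bar> \<le> 2 * K" for n
      using bnd(1)[of n] bnd(2) by (intro AE_I2) (smt (verit) real_norm_def)
  qed auto
  then show ?thesis by simp
qed

context quasi_bayes
begin

lemma zl_joint [measurable]: "(\<lambda>(\<omega>, u). zl \<omega> u) \<in> borel_measurable (N \<Otimes>\<^sub>M borel)"
proof (rule borel_measurable_LIMSEQ_real)
  show "(\<lambda>k. case p of (\<omega>, u) \<Rightarrow> zl \<omega> (grid k u)) \<longlonglongrightarrow> (case p of (\<omega>, u) \<Rightarrow> zl \<omega> u)" for p
    by (cases p) (auto intro!: continuous_on_tendsto_compose[OF zl_continuous[of UNIV] grid_tendsto])
  fix k
  have "(\<lambda>p. zl (fst p) (grid k (snd p))) \<in> borel_measurable (N \<Otimes>\<^sub>M borel)"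
  proof (rule measurable_compose_countable'[where I="range (grid k :: real^'p \<Rightarrow> _)" and f="\<lambda>v p. zl (fst p) v" and g="\<lambda>p. grid k (snd p)"])
    show "(\<lambda>p. zl (fst p) v) \<in> borel_measurable (N \<Otimes>\<^sub>M borel)" for v by measurable
    show "countable (range (grid k :: real^'p \<Rightarrow> _))" by (rule countable_range_grid)
    show "(\<lambda>p. grid k (snd p :: real^'p)) \<in> N \<Otimes>\<^sub>M borel \<rightarrow>\<^sub>M count_space (range (grid k))"
      by (subst measurable_count_space_eq_countable[OF countable_range_grid]) auto
  qed
  then show "(\<lambda>p. case p of (\<omega>, u) \<Rightarrow> zl \<omega> (grid k u)) \<in> borel_measurable (N \<Otimes>\<^sub>M borel)"
    by (simp add: case_prod_beta')
qed

lemma borel_integral_param_N: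
  fixes f :: "'v \<Rightarrow> real^'p \<Rightarrow> 'b::{banach, second_countable_topology}"
  assumes "(\<lambda>(\<omega>, u). f \<omega> u) \<in> borel_measurable (N \<Otimes>\<^sub>M borel)"
  shows "(\<lambda>\<omega>. \<integral>u. f \<omega> u \<partial>lborel) \<in> borel_measurable N"
proof (rule lborel.borel_measurable_lebesgue_integral)
  show "(\<lambda>(\<omega>, u). f \<omega> u) \<in> borel_measurable (N \<Otimes>\<^sub>M lborel)"
    using assms by (subst measurable_cong_sets[of _ "N \<Otimes>\<^sub>M borel" _ borel]) (auto intro: sets_pair_measure_cong)
qed

definition uL :: "'v \<Rightarrow> real^'p" where "uL \<omega> = u_limit (zl \<omega>)"

lemma uL_N [measurable]: "uL \<in> borel_measurable N"
  unfolding uL_def[abs_def] u_limit_def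
  by (intro borel_measurable_scaleR borel_measurable_inverse borel_integral_param_N) measurable

lemma uL_ball_N [measurable]: "(\<lambda>\<omega>. u_limit (\<lambda>u. indicator (ball 0 (real m)) u * zl \<omega> u)) \<in> borel_measurable N"
proof -
  have [measurable]: "(\<lambda>p. zl (fst p) (snd p)) \<in> borel_measurable (N \<Otimes>\<^sub>M borel)"
    using zl_joint by (simp add: case_prod_beta')
  have [measurable]: "(\<lambda>p. indicator (ball (0::real^'p) (real m)) (snd p) :: real) \<in> borel_measurable (N \<Otimes>\<^sub>M borel)"
    by (rule measurable_compose[OF measurable_snd borel_measurable_indicator]) simp
  show ?thesis unfolding u_limit_def
    by (intro borel_measurable_scaleR borel_measurable_inverse borel_integral_param_N; unfold case_prod_beta'; measurable)
qed

lemma grid_mean_N [measurable]: "(\<lambda>\<omega>. grid_mean k m (zl \<omega>)) \<in> borel_measurable N"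
  unfolding grid_mean_def by measurable

lemma grid_mean_M [measurable]: "(\<lambda>\<omega>. grid_mean k m (Z n \<omega>)) \<in> borel_measurable M"
  unfolding grid_mean_def by measurable

text \<open>Dominated convergence turns the convergence of the grid means of a single path into convergence in
  the mean.\<close>

lemma limit_grid_approx:
  fixes f0 :: "real^'p \<Rightarrow> real"
  assumes f0: "continuous_on UNIV f0" "\<And>x. \<bar>f0 x\<bar> \<le> K" and e: "0 < e"
  shows "\<exists>m0. \<forall>m\<ge>m0. \<exists>k0. \<forall>k\<ge>k0. (\<integral>\<omega>. \<bar>f0 (grid_mean k m (zl \<omega>)) - f0 (uL \<omega>)\<bar> \<partial>N) < e"
proof -
  have [measurable]: "f0 \<in> borel_measurable borel" by (rule borel_measurable_continuous_onI[OF f0(1)])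
  define ub where "ub m \<omega> = u_limit (\<lambda>u. indicator (ball 0 (real m)) u * zl \<omega> u)" for m \<omega>
  have [measurable]: "ub m \<in> borel_measurable N" for m unfolding ub_def by measurable
  have "(\<lambda>m. \<integral>\<omega>. \<bar>f0 (ub m \<omega>) - f0 (uL \<omega>)\<bar> \<partial>N) \<longlonglongrightarrow> 0"
  proof (rule N.tendsto_L1_bounded[where K=K])
    show "\<bar>f0 (ub m \<omega>)\<bar> \<le> K" "\<bar>f0 (uL \<omega>)\<bar> \<le> K" for m \<omega> by (rule f0)+
    show "AE \<omega> in N. (\<lambda>m. f0 (ub m \<omega>)) \<longlonglongrightarrow> f0 (uL \<omega>)"
      using AE_limit_path
    proof eventually_elim
      case (elim \<omega>)
      show ?case unfolding ub_def uL_def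
        by (rule continuous_on_tendsto_compose[OF f0(1) u_limit_ball_tendsto[OF elim q D]]) auto
    qed
  qed measurable
  then have "\<forall>\<^sub>F m in sequentially. (\<integral>\<omega>. \<bar>f0 (ub m \<omega>) - f0 (uL \<omega>)\<bar> \<partial>N) < e / 2"
    using e by (intro order_tendstoD) auto
  then obtain m1 where m1: "\<And>m. m1 \<le> m \<Longrightarrow> (\<integral>\<omega>. \<bar>f0 (ub m \<omega>) - f0 (uL \<omega>)\<bar> \<partial>N) < e / 2"
    by (auto simp: eventually_sequentially)
  show ?thesis
  proof (rule exI[of _ "max 1 m1"], intro allI impI)
    fix m assume m: "max 1 m1 \<le> m"
    have "(\<lambda>k. \<integral>\<omega>. \<bar>f0 (grid_mean k m (zl \<omega>)) - f0 (ub m \<omega>)\<bar> \<partial>N) \<longlonglongrightarrow> 0"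
    proof (rule N.tendsto_L1_bounded[where K=K])
      show "\<bar>f0 (grid_mean k m (zl \<omega>))\<bar> \<le> K" "\<bar>f0 (ub m \<omega>)\<bar> \<le> K" for k \<omega> by (rule f0)+
      show "AE \<omega> in N. (\<lambda>k. f0 (grid_mean k m (zl \<omega>))) \<longlonglongrightarrow> f0 (ub m \<omega>)"
        using AE_limit_path
      proof eventually_elim
        case (elim \<omega>)
        have "1 \<le> m" using m by simp
        then show ?case unfolding ub_def
          by (intro continuous_on_tendsto_compose[OF f0(1) grid_mean_tendsto[OF elim]]) auto
      qed
    qed measurable
    then have "\<forall>\<^sub>F k in sequentially. (\<integral>\<omega>. \<bar>f0 (grid_mean k m (zl \<omega>)) - f0 (ub m \<omega>)\<bar> \<partial>N) < e / 2"
      using e by (intro order_tendstoD) auto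
    then obtain k0 where k0: "\<And>k. k0 \<le> k \<Longrightarrow> (\<integral>\<omega>. \<bar>f0 (grid_mean k m (zl \<omega>)) - f0 (ub m \<omega>)\<bar> \<partial>N) < e / 2"
      by (auto simp: eventually_sequentially)
    show "\<exists>k0. \<forall>k\<ge>k0. (\<integral>\<omega>. \<bar>f0 (grid_mean k m (zl \<omega>)) - f0 (uL \<omega>)\<bar> \<partial>N) < e"
    proof (intro exI[of _ k0] allI impI)
      fix k assume k: "k0 \<le> k"
      have i: "integrable N (\<lambda>\<omega>. f0 (X \<omega>))" if [measurable]: "X \<in> borel_measurable N" for X
        by (rule N.integrable_bounded_rv[where B=K]) (use f0(2) in auto)
      have i1: "integrable N (\<lambda>\<omega>. \<bar>f0 (grid_mean k m (zl \<omega>)) - f0 (ub m \<omega>)\<bar>)"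
        and i2: "integrable N (\<lambda>\<omega>. \<bar>f0 (ub m \<omega>) - f0 (uL \<omega>)\<bar>)"
        and i3: "integrable N (\<lambda>\<omega>. \<bar>f0 (grid_mean k m (zl \<omega>)) - f0 (uL \<omega>)\<bar>)"
        by (intro integrable_abs Bochner_Integration.integrable_diff i; measurable)+
      have "(\<integral>\<omega>. \<bar>f0 (grid_mean k m (zl \<omega>)) - f0 (uL \<omega>)\<bar> \<partial>N)
         \<le> (\<integral>\<omega>. \<bar>f0 (grid_mean k m (zl \<omega>)) - f0 (ub m \<omega>)\<bar> + \<bar>f0 (ub m \<omega>) - f0 (uL \<omega>)\<bar> \<partial>N)"
        by (rule integral_mono[OF i3 Bochner_Integration.integrable_add[OF i1 i2]]) auto
      also have "\<dots> = (\<integral>\<omega>. \<bar>f0 (grid_mean k m (zl \<omega>)) - f0 (ub m \<omega>)\<bar> \<partial>N) + (\<integral>\<omega>. \<bar>f0 (ub m \<omega>) - f0 (uL \<omega>)\<bar> \<partial>N)"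
        by (rule Bochner_Integration.integral_add[OF i1 i2])
      also have "\<dots> < e" using k0[OF k] m1[of m] m by simp
      finally show "(\<integral>\<omega>. \<bar>f0 (grid_mean k m (zl \<omega>)) - f0 (uL \<omega>)\<bar> \<partial>N) < e" .
    qed
  qed
qed

text \<open>The grid mean is a continuous function of finitely many values of the field: its denominator
  stays away from 0 because the field equals 1 at the origin, which is a grid point.\<close>

lemma grid_fidi:
  fixes f0 :: "real^'p \<Rightarrow> real"
  assumes f0: "continuous_on UNIV f0" "\<And>x. \<bar>f0 x\<bar> \<le> K" and Y: "bounded_rv G Y"
    and k: "1 \<le> k" and m: "1 \<le> m"
  shows "(\<lambda>n. \<integral>\<omega>. \<bar>real_cond_exp M C (\<lambda>\<omega>. f0 (grid_mean k m (Z n \<omega>)) * Y \<omega>) (\<pi> \<omega>)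
     - real_cond_exp N C' (\<lambda>\<omega>. f0 (grid_mean k m (zl \<omega>)) * Y (\<pi> \<omega>)) \<omega>\<bar> \<partial>N) \<longlonglongrightarrow> 0"
proof -
  note [measurable] = bounded_rvD(1)[OF Y]
  have [measurable]: "f0 \<in> borel_measurable borel" by (rule borel_measurable_continuous_onI[OF f0(1)])
  define P where "P = (grid_pts k m :: (real^'p) set)"
  define c where "c = card P"
  obtain e where e: "bij_betw e {..<c} P"
    using ex_bij_betw_nat_finite[OF finite_grid_pts[of k m, where 'a='p]] unfolding c_def P_def
    by (auto simp: atLeast0LessThan)
  have c: "1 \<le> c" using zero_in_grid_pts[OF m, of k, where 'a='p] finite_grid_pts[of k m, where 'a='p]
    unfolding c_def P_def by (metis One_nat_def Suc_leI card_gt_0_iff empty_iff)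
  define v0 where "v0 = grid_vol k m (0 :: real^'p)"
  have v0: "0 < v0" unfolding v0_def by (rule grid_vol_zero_pos[OF k m])
  \<comment> \<open>On the values of a field that is nonnegative and equals 1 at the origin the two maxima have no
    effect; they make \<open>g\<close> continuous on the whole space.\<close>
  define g where "g x = f0 (inverse (max v0 (\<Sum>i<c. grid_vol k m (e i) * max 0 (x i))) *\<^sub>R
      (\<Sum>i<c. (grid_vol k m (e i) * max 0 (x i)) *\<^sub>R e i))" for x :: "nat \<Rightarrow> real"
  have g_eq: "g (\<lambda>i. if i < c then z (e i) else 0) = f0 (grid_mean k m z)"
    if z: "z 0 = 1" "\<And>u. 0 \<le> z u" for z
  proof -
    have "(\<Sum>i<c. grid_vol k m (e i) * max 0 (if i < c then z (e i) else 0)) = (\<Sum>i<c. grid_vol k m (e i) * z (e i))"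
      using z by (intro sum.cong) auto
    also have "\<dots> = (\<Sum>v\<in>grid_pts k m. grid_vol k m v * z v)"
      using sum.reindex_bij_betw[OF e, of "\<lambda>v. grid_vol k m v * z v"] by (simp add: P_def)
    finally have 1: "(\<Sum>i<c. grid_vol k m (e i) * max 0 (if i < c then z (e i) else 0)) = (\<Sum>v\<in>grid_pts k m. grid_vol k m v * z v)" .
    have "(\<Sum>i<c. (grid_vol k m (e i) * max 0 (if i < c then z (e i) else 0)) *\<^sub>R e i) = (\<Sum>i<c. (grid_vol k m (e i) * z (e i)) *\<^sub>R e i)"
      using z by (intro sum.cong) auto
    also have "\<dots> = (\<Sum>v\<in>grid_pts k m. (grid_vol k m v * z v) *\<^sub>R v)"
      using sum.reindex_bij_betw[OF e, of "\<lambda>v. (grid_vol k m v * z v) *\<^sub>R v"] by (simp add: P_def)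
    finally have 2: "(\<Sum>i<c. (grid_vol k m (e i) * max 0 (if i < c then z (e i) else 0)) *\<^sub>R e i) = (\<Sum>v\<in>grid_pts k m. (grid_vol k m v * z v) *\<^sub>R v)" .
    have "max v0 (\<Sum>v\<in>grid_pts k m. grid_vol k m v * z v) = (\<Sum>v\<in>grid_pts k m. grid_vol k m v * z v)"
      unfolding v0_def using grid_mean_den(1)[of k m z] k m z by (intro max_absorb2) auto
    then show ?thesis unfolding g_def 1 2 by (simp add: grid_mean_def)
  qed
  have lim: "(\<lambda>n. \<integral>\<omega>. \<bar>real_cond_exp M C (\<lambda>\<omega>. g (\<lambda>i. if i < c then Z n \<omega> (e i) else 0) * Y \<omega>) (\<pi> \<omega>)
     - real_cond_exp N C' (\<lambda>\<omega>. g (\<lambda>i. if i < c then zl \<omega> (e i) else 0) * Y (\<pi> \<omega>)) \<omega>\<bar> \<partial>N) \<longlonglongrightarrow> 0"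
  proof (rule fidi_L1[OF c _ _ Y])
    have pos: "max v0 y \<noteq> 0" for y using v0 by (auto simp: max_def)
    show "continuous_map (Euclidean_space c) euclideanreal g"
      unfolding g_def
      by (intro continuous_map_Euclidean_spaceI continuous_on_compose2[OF f0(1)] continuous_intros ballI pos) auto
    show "bounded (g ` topspace (Euclidean_space c))"
      using f0(2) by (auto simp: bounded_iff g_def intro!: exI[of _ K])
  qed
  have a: "AE \<omega> in N. real_cond_exp M C (\<lambda>\<omega>. g (\<lambda>i. if i < c then Z n \<omega> (e i) else 0) * Y \<omega>) (\<pi> \<omega>)
      = real_cond_exp M C (\<lambda>\<omega>. f0 (grid_mean k m (Z n \<omega>)) * Y \<omega>) (\<pi> \<omega>)" for n
  proof (rule AE_\<pi>, rule M.real_cond_exp_cong)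
    have eq: "g (\<lambda>i. if i < c then Z n \<omega> (e i) else 0) * Y \<omega> = f0 (grid_mean k m (Z n \<omega>)) * Y \<omega>" if "\<omega> \<in> space M" for \<omega>
      using ratio_path.z_zero[OF path[OF that]] ratio_path.z_nonneg[OF path[OF that]] by (subst g_eq) auto
    show "AE \<omega> in M. g (\<lambda>i. if i < c then Z n \<omega> (e i) else 0) * Y \<omega> = f0 (grid_mean k m (Z n \<omega>)) * Y \<omega>"
      by (rule AE_I2) (rule eq)
    show "(\<lambda>\<omega>. f0 (grid_mean k m (Z n \<omega>)) * Y \<omega>) \<in> borel_measurable M" by measurable
    then show "(\<lambda>\<omega>. g (\<lambda>i. if i < c then Z n \<omega> (e i) else 0) * Y \<omega>) \<in> borel_measurable M"
      by (rule measurable_cong[THEN iffD2, rotated]) (rule eq)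
  qed
  have b: "AE \<omega> in N. real_cond_exp N C' (\<lambda>\<omega>. g (\<lambda>i. if i < c then zl \<omega> (e i) else 0) * Y (\<pi> \<omega>)) \<omega>
      = real_cond_exp N C' (\<lambda>\<omega>. f0 (grid_mean k m (zl \<omega>)) * Y (\<pi> \<omega>)) \<omega>"
  proof (rule N.real_cond_exp_cong)
    show "AE \<omega> in N. g (\<lambda>i. if i < c then zl \<omega> (e i) else 0) * Y (\<pi> \<omega>) = f0 (grid_mean k m (zl \<omega>)) * Y (\<pi> \<omega>)"
      using zl_zero zl_nonneg by eventually_elim (subst g_eq, auto)
    have "(\<lambda>\<omega>. g (\<lambda>i. if i < c then zl \<omega> (e i) else 0)) \<in> borel_measurable N"
      unfolding g_def by measurable
    then show "(\<lambda>\<omega>. g (\<lambda>i. if i < c then zl \<omega> (e i) else 0) * Y (\<pi> \<omega>)) \<in> borel_measurable N" by measurable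
  qed measurable
  show ?thesis
  proof (rule Lim_transform_eventually[OF lim], rule always_eventually, rule allI, rule integral_cong_AE)
    fix n
    show "AE \<omega> in N. \<bar>real_cond_exp M C (\<lambda>\<omega>. g (\<lambda>i. if i < c then Z n \<omega> (e i) else 0) * Y \<omega>) (\<pi> \<omega>)
        - real_cond_exp N C' (\<lambda>\<omega>. g (\<lambda>i. if i < c then zl \<omega> (e i) else 0) * Y (\<pi> \<omega>)) \<omega>\<bar>
      = \<bar>real_cond_exp M C (\<lambda>\<omega>. f0 (grid_mean k m (Z n \<omega>)) * Y \<omega>) (\<pi> \<omega>)
        - real_cond_exp N C' (\<lambda>\<omega>. f0 (grid_mean k m (zl \<omega>)) * Y (\<pi> \<omega>)) \<omega>\<bar>"
      using a[of n] b by eventually_elim simp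
  qed (intro borel_measurable_abs borel_measurable_diff borel_measurable_cond_exp2
        measurable_compose[OF \<pi>_meas borel_measurable_cond_exp2])+
qed

end

section \<open>Convergence of the estimator\<close>

context quasi_bayes
begin

text \<open>Capped at 1, the tail moment is at most 1 where its conditional expectation is large, an event of
  small probability.\<close>

lemma expectation_tail_moment_small:
  assumes e: "0 < e"
  shows "\<exists>m0\<ge>1. \<forall>m\<ge>m0. \<forall>\<^sub>F n in sequentially. (\<integral>\<omega>. min 1 (tail_moment q m (wT n \<omega>)) \<partial>M) \<le> 2 * e"
proof -
  obtain m0 where m0: "1 \<le> m0" "\<And>m. m0 \<le> m \<Longrightarrow> \<forall>\<^sub>F n in sequentially.
    M.prob {\<omega> \<in> space M. ennreal e < nn_cond_exp M C (\<lambda>\<omega>. ennreal (tail_moment q m (wT n \<omega>))) \<omega>} \<le> e"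
    using tail_moment_small[OF e] by blast
  show ?thesis
  proof (rule exI[of _ m0], intro conjI m0(1) allI impI)
    fix m assume "m0 \<le> m"
    from m0(2)[OF this] show "\<forall>\<^sub>F n in sequentially. (\<integral>\<omega>. min 1 (tail_moment q m (wT n \<omega>)) \<partial>M) \<le> 2 * e"
    proof eventually_elim
      case (elim n)
      define J where "J \<omega> = tail_moment q m (wT n \<omega>)" for \<omega>
      have [measurable]: "J \<in> borel_measurable M" unfolding J_def by measurable
      have J0: "0 \<le> J \<omega>" if "\<omega> \<in> space M" for \<omega>
        unfolding J_def by (rule ratio_path.tail_moment_nonneg[OF path[OF that]])
      define E where "E = {\<omega> \<in> space M. ennreal e < nn_cond_exp M C (\<lambda>\<omega>. ennreal (J \<omega>)) \<omega>}"
      have [measurable]: "E \<in> sets M" unfolding E_def by measurable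
      have i: "integrable M (\<lambda>\<omega>. min 1 (J \<omega>))"
        by (rule M.integrable_bounded_rv[where B=1]) (use J0 in \<open>auto simp: min_def abs_le_iff intro: order_trans[of _ 0]\<close>)
      have "AE \<omega> in M. nn_cond_exp M C (\<lambda>\<omega>. ennreal (min 1 (J \<omega>))) \<omega> \<le> nn_cond_exp M C (\<lambda>\<omega>. ennreal (J \<omega>)) \<omega>"
        by (rule M.nn_cond_exp_mono) (auto intro!: AE_I2 ennreal_leI)
      moreover have "AE \<omega> in M. nn_cond_exp M C (\<lambda>\<omega>. ennreal (min 1 (J \<omega>))) \<omega> \<le> nn_cond_exp M C (\<lambda>_. 1) \<omega>"
        by (rule M.nn_cond_exp_mono) (auto intro!: AE_I2 ennreal_leI simp del: ennreal_1 simp flip: ennreal_1)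
      moreover have "AE \<omega> in M. 1 = nn_cond_exp M C (\<lambda>_. 1) \<omega>"
        by (rule M.nn_cond_exp_F_meas) simp
      ultimately have le: "AE \<omega> in M. nn_cond_exp M C (\<lambda>\<omega>. ennreal (min 1 (J \<omega>))) \<omega> \<le> ennreal e + indicator E \<omega>"
        using AE_space
      proof eventually_elim
        case (elim \<omega>)
        show ?case
        proof (cases "\<omega> \<in> E")
          case True
          then show ?thesis using elim by (simp add: add_increasing)
        next
          case False
          then have "nn_cond_exp M C (\<lambda>\<omega>. ennreal (J \<omega>)) \<omega> \<le> ennreal e" using elim by (auto simp: E_def not_less)
          then show ?thesis using elim False by simp
        qed
      qed
      have "ennreal (\<integral>\<omega>. min 1 (J \<omega>) \<partial>M) = (\<integral>\<^sup>+\<omega>. ennreal (min 1 (J \<omega>)) \<partial>M)"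
        using i J0 by (subst nn_integral_eq_integral) (auto intro!: AE_I2)
      also have "\<dots> = (\<integral>\<^sup>+\<omega>. 1 * ennreal (min 1 (J \<omega>)) \<partial>M)" by simp
      also have "\<dots> = (\<integral>\<^sup>+\<omega>. 1 * nn_cond_exp M C (\<lambda>\<omega>. ennreal (min 1 (J \<omega>))) \<omega> \<partial>M)"
        by (rule M.nn_cond_exp_intg[symmetric]) measurable
      also have "\<dots> \<le> (\<integral>\<^sup>+\<omega>. ennreal e + indicator E \<omega> \<partial>M)"
        using le by (intro nn_integral_mono_AE) simp
      also have "\<dots> = ennreal e + emeasure M E"
        by (subst nn_integral_add) (auto simp: M.emeasure_space_1)
      also have "\<dots> = ennreal (e + M.prob E)" using e by (simp add: M.emeasure_eq_measure)
      finally have "(\<integral>\<omega>. min 1 (J \<omega>) \<partial>M) \<le> e + M.prob E" using e by (subst (asm) ennreal_le_iff) auto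
      then show ?case using elim by (simp add: J_def E_def)
    qed
  qed
qed

lemma eventually_prior_close:
  assumes \<epsilon>: "0 < \<epsilon>"
  shows "\<forall>\<^sub>F n in sequentially. \<forall>u\<in>ball 0 c. \<bar>ln (\<rho> (\<theta>\<^sub>s + A n *v u)) - ln (\<rho> \<theta>\<^sub>s)\<bar> \<le> \<epsilon>"
proof -
  obtain h z where r: "ratio_path \<Theta> \<theta>\<^sub>s (A 0) \<rho> b B h z" by (rule some_path)
  note o = ratio_path.open_\<Theta>[OF r] and in_\<Theta> = ratio_path.\<theta>s_in[OF r]
  have pos: "0 < \<rho> \<theta>" if "\<theta> \<in> \<Theta>" for \<theta> using ratio_path.\<rho>_bounds[OF r that] bB by linarith
  have "continuous_on \<Theta> (\<lambda>\<theta>. ln (\<rho> \<theta>))"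
    using pos by (intro continuous_on_ln ratio_path.cont_\<rho>[OF r]) force
  then obtain d where d: "0 < d" "\<And>\<theta>. \<theta> \<in> \<Theta> \<Longrightarrow> dist \<theta> \<theta>\<^sub>s < d \<Longrightarrow> dist (ln (\<rho> \<theta>)) (ln (\<rho> \<theta>\<^sub>s)) < \<epsilon>"
    unfolding continuous_on_iff using in_\<Theta> \<epsilon> by metis
  show ?thesis using eventually_A_small[OF d(1), of c] eventually_in_UT[of c]
  proof eventually_elim
    case (elim n)
    show ?case
    proof
      fix u :: "real^'p" assume u: "u \<in> ball 0 c"
      then have "\<theta>\<^sub>s + A n *v u \<in> \<Theta>" using elim(2) by (auto simp: U_set_def)
      moreover have "dist (\<theta>\<^sub>s + A n *v u) \<theta>\<^sub>s < d" using elim(1) u by (auto simp: dist_norm)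
      ultimately show "\<bar>ln (\<rho> (\<theta>\<^sub>s + A n *v u)) - ln (\<rho> \<theta>\<^sub>s)\<bar> \<le> \<epsilon>" using d(2) by (fastforce simp: dist_real_def)
    qed
  qed
qed

text \<open>For a fixed large ball and a fine grid, the rescaled estimator is close to the grid mean of the
  field, uniformly in large \<open>n\<close>: the error splits into the tail moment, the modulus of continuity of
  the log field and the oscillation of the prior.\<close>

lemma uT_grid_close:
  fixes f0 :: "real^'p \<Rightarrow> real"
  assumes f0: "uniformly_continuous_on UNIV f0" "\<And>x. \<bar>f0 x\<bar> \<le> K" and \<eta>: "0 < \<eta>"
  shows "\<exists>m0\<ge>1. \<forall>m\<ge>m0. \<exists>k0. \<forall>k\<ge>k0. \<forall>\<^sub>F n in sequentially.
     (\<integral>\<omega>. \<bar>f0 (uT n \<omega>) - f0 (grid_mean k m (Z n \<omega>))\<bar> \<partial>M) < \<eta>"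
proof -
  have [measurable]: "f0 \<in> borel_measurable borel"
    by (rule borel_measurable_continuous_onI[OF uniformly_continuous_imp_continuous[OF f0(1)]])
  define K1 where "K1 = K + 1"
  have K1: "0 < K1" "\<And>x. \<bar>f0 x\<bar> \<le> K1"
  proof -
    show "0 < K1" using order_trans[OF abs_ge_zero f0(2)[of 0]] by (simp add: K1_def)
    show "\<bar>f0 x\<bar> \<le> K1" for x using f0(2)[of x] by (simp add: K1_def)
  qed
  define e1 where "e1 = \<eta> / 8"
  have e1: "0 < e1" using \<eta> by (simp add: e1_def)
  have "\<exists>d>0. \<forall>x\<in>UNIV. \<forall>x'\<in>UNIV. dist x' x < d \<longrightarrow> dist (f0 x') (f0 x) < e1"
    using f0(1) e1 unfolding uniformly_continuous_on_def by simp
  then obtain d where d: "0 < d" "\<And>x y. dist x y < d \<Longrightarrow> dist (f0 x) (f0 y) < e1" by auto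
  \<comment> \<open>A bounded uniformly continuous function is Lipschitz up to an error \<open>e1\<close>: at distances of at least \<open>d\<close>
    the bound \<open>2 * K1\<close> is dominated by \<open>c0\<close> times the distance.\<close>
  define c0 where "c0 = 2 * K1 / d"
  have c0: "0 < c0" using K1(1) d(1) by (simp add: c0_def)
  have lip: "\<bar>f0 x - f0 y\<bar> \<le> e1 + c0 * norm (x - y)" for x y
  proof (cases "dist x y < d")
    case True
    then have "\<bar>f0 x - f0 y\<bar> < e1" using d(2)[OF True] by (simp add: dist_real_def)
    moreover have "0 \<le> c0 * norm (x - y)" using c0 by simp
    ultimately show ?thesis by linarith
  next
    case False
    then have "1 \<le> norm (x - y) / d" using d(1) by (simp add: dist_norm le_divide_eq)
    then have "2 * K1 * 1 \<le> 2 * K1 * (norm (x - y) / d)" using K1(1) by (intro mult_left_mono) auto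
    then have "2 * K1 \<le> c0 * norm (x - y)" by (simp add: c0_def)
    then show ?thesis using K1(2)[of x] K1(2)[of y] e1 by linarith
  qed
  define K' where "K' = max (2 * K1) (3 * c0)"
  have K': "0 < K'" "2 * K1 \<le> K'" "3 * c0 \<le> K'" using K1(1) by (auto simp: K'_def)
  define e where "e = e1 / (2 * K')"
  have e: "0 < e" "K' * (2 * e) = e1" using e1 K' by (auto simp: e_def)
  obtain m0 where m0: "1 \<le> m0" "\<And>m. m0 \<le> m \<Longrightarrow> \<forall>\<^sub>F n in sequentially. (\<integral>\<omega>. min 1 (tail_moment q m (wT n \<omega>)) \<partial>M) \<le> 2 * e"
    using expectation_tail_moment_small[OF e(1)] by blast
  show ?thesis
  proof (rule exI[of _ m0], intro conjI m0(1) allI impI)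
    fix m assume m: "m0 \<le> m"
    then have m1: "1 \<le> m" using m0 by simp
    \<comment> \<open>The relative error \<open>x\<close> of the weights is chosen after the radius \<open>m\<close>, and the mesh after both.\<close>
    define x where "x = e1 / (c0 * (2 * (real m + 1)))"
    have x: "0 < x" "c0 * (2 * (real m + 1) * x) = e1" using e1 c0 by (auto simp: x_def)
    define \<epsilon> where "\<epsilon> = ln (1 + x) / 2"
    have \<epsilon>: "0 < \<epsilon>" "exp (2 * \<epsilon>) - 1 = x" using x by (auto simp: \<epsilon>_def)
    \<comment> \<open>The tags of points of the ball of radius \<open>m\<close> lie in the ball of radius \<open>c\<close>.\<close>
    define c where "c = real m + 1"
    have c: "0 < c" by (simp add: c_def)
    define \<eta>' where "\<eta>' = e1 / (2 * K1)"
    have \<eta>': "0 < \<eta>'" "2 * K1 * \<eta>' = e1" using e1 K1(1) by (auto simp: \<eta>'_def)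
    obtain \<delta> where \<delta>: "0 < \<delta>" and W: "\<forall>\<^sub>F n in sequentially. M.prob (W_event M \<Theta> \<theta>\<^sub>s (A n) (Z n) \<delta> c \<epsilon>) \<le> \<eta>'"
      using modulus_small[OF \<epsilon>(1) c \<eta>'(1) zero_less_one] by blast
    define P where "P = real CARD('p)"
    have P: "0 < P" by (simp add: P_def)
    define \<delta>' where "\<delta>' = min \<delta> (min 1 (e1 / c0))"
    have \<delta>': "0 < \<delta>'" using \<delta> e1 c0 by (simp add: \<delta>'_def)
    obtain k0 :: nat where k0: "P / \<delta>' \<le> real k0" using real_arch_simple by blast
    show "\<exists>k0. \<forall>k\<ge>k0. \<forall>\<^sub>F n in sequentially. (\<integral>\<omega>. \<bar>f0 (uT n \<omega>) - f0 (grid_mean k m (Z n \<omega>))\<bar> \<partial>M) < \<eta>"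
    proof (rule exI[of _ k0], intro allI impI)
      fix k assume "k0 \<le> k"
      then have "P / \<delta>' \<le> real k" using k0 by linarith
      then have "P \<le> real k * \<delta>'" using \<delta>' by (simp add: pos_divide_le_eq)
      moreover have kpos: "0 < real k"
        using \<open>P / \<delta>' \<le> real k\<close> P \<delta>' by (smt (verit) divide_pos_pos)
      ultimately have Pk: "P / real k \<le> \<delta>'" by (simp add: divide_le_eq mult.commute)
      have "P / real k \<le> 1" using Pk by (simp add: \<delta>'_def)
      then have k: "CARD('p) \<le> k" using kpos by (simp add: P_def divide_le_eq)
      have Pk1: "real CARD('p) / real k \<le> \<delta>" using Pk by (simp add: P_def \<delta>'_def)
      have "P / real k \<le> e1 / c0" using Pk by (simp add: \<delta>'_def)
      then have Pk2: "c0 * (real CARD('p) / real k) \<le> e1" using c0 by (simp add: P_def le_divide_eq mult.commute)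
      show "\<forall>\<^sub>F n in sequentially. (\<integral>\<omega>. \<bar>f0 (uT n \<omega>) - f0 (grid_mean k m (Z n \<omega>))\<bar> \<partial>M) < \<eta>"
        using m0(2)[OF m] W eventually_in_UT[of c] eventually_prior_close[OF \<epsilon>(1), of "real m"]
      proof eventually_elim
        case (elim n)
        define E where "E = W_event M \<Theta> \<theta>\<^sub>s (A n) (Z n) \<delta> c \<epsilon>"
        have [measurable]: "E \<in> sets M" unfolding E_def using \<delta> c by (intro W_event_M) auto
        define J where "J \<omega> = tail_moment q m (wT n \<omega>)" for \<omega>
        have [measurable]: "J \<in> borel_measurable M" unfolding J_def by measurable
        have J0: "0 \<le> J \<omega>" if "\<omega> \<in> space M" for \<omega>
          unfolding J_def by (rule ratio_path.tail_moment_nonneg[OF path[OF that]])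
        have iJ: "integrable M (\<lambda>\<omega>. min 1 (J \<omega>))"
          by (rule M.integrable_bounded_rv[where B=1]) (use J0 in \<open>auto simp: min_def abs_le_iff intro: order_trans[of _ 0]\<close>)
        have triv: "\<bar>f0 (uT n \<omega>) - f0 (grid_mean k m (Z n \<omega>))\<bar> \<le> 2 * K1" for \<omega>
          using K1(2)[of "uT n \<omega>"] K1(2)[of "grid_mean k m (Z n \<omega>)"] by linarith
        have iE: "integrable M (indicator E :: 'w \<Rightarrow> real)" by (rule M.integrable_bounded_rv[where B=1]) auto
        have "(\<integral>\<omega>. \<bar>f0 (uT n \<omega>) - f0 (grid_mean k m (Z n \<omega>))\<bar> \<partial>M)
           \<le> (\<integral>\<omega>. 3 * e1 + (K' * min 1 (J \<omega>) + 2 * K1 * indicator E \<omega>) \<partial>M)"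
        proof (rule integral_mono)
          show "integrable M (\<lambda>\<omega>. \<bar>f0 (uT n \<omega>) - f0 (grid_mean k m (Z n \<omega>))\<bar>)"
            by (rule M.integrable_bounded_rv[where B="2 * K1"]) (use triv in auto)
          show "integrable M (\<lambda>\<omega>. 3 * e1 + (K' * min 1 (J \<omega>) + 2 * K1 * indicator E \<omega>))"
            using iJ iE by (intro Bochner_Integration.integrable_add integrable_mult_right) auto
          fix \<omega> assume \<omega>: "\<omega> \<in> space M"
          interpret ratio_path \<Theta> \<theta>\<^sub>s "A n" \<rho> b B "H n \<omega>" "Z n \<omega>" by (rule path[OF \<omega>])
          have nonneg: "0 \<le> K' * min 1 (J \<omega>)" using K' J0[OF \<omega>] by simp
          show "\<bar>f0 (uT n \<omega>) - f0 (grid_mean k m (Z n \<omega>))\<bar> \<le> 3 * e1 + (K' * min 1 (J \<omega>) + 2 * K1 * indicator E \<omega>)"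
          proof (cases "\<omega> \<in> E")
            case True
            then show ?thesis using triv[of \<omega>] nonneg e1 by simp
          next
            case False
            show ?thesis
            proof (cases "1 \<le> J \<omega>")
              case True
              then have "2 * K1 \<le> K' * min 1 (J \<omega>)" using K' by simp
              moreover have "0 \<le> 2 * K1 * indicator E \<omega>" using K1(1) by simp
              ultimately show ?thesis using triv[of \<omega>] e1 by linarith
            next
              case J1: False
              have lm: "log_modulus \<Theta> \<theta>\<^sub>s (A n) (Z n \<omega>) \<delta> c \<le> \<epsilon>"
                using False \<omega> by (auto simp: E_def W_event_def not_less)
              have pos: "0 < \<rho> \<theta>\<^sub>s" using \<rho>_bounds[OF \<theta>s_in] b_pos by linarith
              have "norm (uT n \<omega> - grid_mean k m (Z n \<omega>)) \<le> real CARD('p) / real k + 2 * (real m + 1) * x + 3 * tail_moment q m w"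
                unfolding uT_def
              proof (rule u_limit_grid_mean[OF k m1 q pos])
                show "0 \<le> x" using x by simp
                fix u :: "real^'p" assume u: "u \<in> ball 0 (real m)"
                show "\<bar>w u - \<rho> \<theta>\<^sub>s * Z n \<omega> (grid k u)\<bar> \<le> x * w u"
                  using weights_close[OF elim(3) _ k Pk1 lm _ u] elim(4) u \<epsilon>(2) by (simp add: c_def)
              qed
              then have "c0 * norm (uT n \<omega> - grid_mean k m (Z n \<omega>)) \<le> c0 * (real CARD('p) / real k + 2 * (real m + 1) * x + 3 * J \<omega>)"
                using c0 by (intro mult_left_mono) (auto simp: J_def)
              also have "\<dots> = c0 * (real CARD('p) / real k) + c0 * (2 * (real m + 1) * x) + 3 * c0 * J \<omega>"
                by (simp add: algebra_simps)
              also have "\<dots> \<le> e1 + e1 + K' * J \<omega>"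
                using Pk2 x(2) K' J0[OF \<omega>] by (intro add_mono mult_right_mono) auto
              finally have "\<bar>f0 (uT n \<omega>) - f0 (grid_mean k m (Z n \<omega>))\<bar> \<le> 3 * e1 + K' * J \<omega>"
                using lip[of "uT n \<omega>" "grid_mean k m (Z n \<omega>)"] by linarith
              then show ?thesis using J1 False by simp
            qed
          qed
        qed
        also have "\<dots> = 3 * e1 + (K' * (\<integral>\<omega>. min 1 (J \<omega>) \<partial>M) + 2 * K1 * M.prob E)"
          using iJ iE by (simp add: M.prob_space)
        also have "\<dots> \<le> 3 * e1 + (K' * (2 * e) + 2 * K1 * \<eta>')"
          using elim(1,2) K'(1) K1(1) by (intro add_left_mono add_mono mult_left_mono) (auto simp: J_def E_def)
        also have "\<dots> < \<eta>" unfolding e(2) \<eta>'(2) using e1 by (simp add: e1_def)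
        finally show ?case .
      qed
    qed
  qed
qed

text \<open>The grid means of the fields converge by \<open>grid_fidi\<close>, and on both sides they are close to the means
  themselves, uniformly in large \<open>n\<close>. Conditional expectations do not increase distances in the mean.\<close>

lemma bounded_test_L1:
  fixes f0 :: "real^'p \<Rightarrow> real"
  assumes f0: "uniformly_continuous_on UNIV f0" "\<And>x. \<bar>f0 x\<bar> \<le> K" and Y: "bounded_rv G Y"
  shows "(\<lambda>n. \<integral>\<omega>. \<bar>real_cond_exp M C (\<lambda>\<omega>. f0 (uT n \<omega>) * Y \<omega>) (\<pi> \<omega>)
     - real_cond_exp N C' (\<lambda>\<omega>. f0 (uL \<omega>) * Y (\<pi> \<omega>)) \<omega>\<bar> \<partial>N) \<longlonglongrightarrow> 0"
proof (rule LIMSEQ_I)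
  fix e :: real assume e: "0 < e"
  note [measurable] = bounded_rvD(1)[OF Y]
  have c0: "continuous_on UNIV f0" by (rule uniformly_continuous_imp_continuous[OF f0(1)])
  have [measurable]: "f0 \<in> borel_measurable borel" by (rule borel_measurable_continuous_onI[OF c0])
  obtain KY where KY: "0 < KY" "\<And>\<omega>. \<omega> \<in> space M \<Longrightarrow> \<bar>Y \<omega>\<bar> \<le> KY" using bounded_rvD(2)[OF Y] by auto
  have KYN: "\<bar>Y (\<pi> \<omega>)\<bar> \<le> KY" if "\<omega> \<in> space N" for \<omega> using KY(2) measurable_space[OF \<pi>_meas that] by auto
  define \<eta> where "\<eta> = e / (4 * KY)"
  have \<eta>: "0 < \<eta>" "KY * \<eta> = e / 4" using e KY by (auto simp: \<eta>_def)
  obtain m1 where m1: "1 \<le> m1" "\<And>m. m1 \<le> m \<Longrightarrow> \<exists>k0. \<forall>k\<ge>k0. \<forall>\<^sub>F n in sequentially. (\<integral>\<omega>. \<bar>f0 (uT n \<omega>) - f0 (grid_mean k m (Z n \<omega>))\<bar> \<partial>M) < \<eta>"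
    using uT_grid_close[OF f0 \<eta>(1)] by blast
  obtain m2 where m2: "\<And>m. m2 \<le> m \<Longrightarrow> \<exists>k0. \<forall>k\<ge>k0. (\<integral>\<omega>. \<bar>f0 (grid_mean k m (zl \<omega>)) - f0 (uL \<omega>)\<bar> \<partial>N) < \<eta>"
    using limit_grid_approx[OF c0 f0(2) \<eta>(1)] by blast
  define m where "m = max m1 m2"
  obtain k1 where k1: "\<And>k. k1 \<le> k \<Longrightarrow> \<forall>\<^sub>F n in sequentially. (\<integral>\<omega>. \<bar>f0 (uT n \<omega>) - f0 (grid_mean k m (Z n \<omega>))\<bar> \<partial>M) < \<eta>"
    using m1(2)[of m] by (auto simp: m_def)
  obtain k2 where k2: "\<And>k. k2 \<le> k \<Longrightarrow> (\<integral>\<omega>. \<bar>f0 (grid_mean k m (zl \<omega>)) - f0 (uL \<omega>)\<bar> \<partial>N) < \<eta>"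
    using m2[of m] by (auto simp: m_def)
  define k where "k = max 1 (max k1 k2)"
  have km: "1 \<le> k" "1 \<le> m" using m1(1) by (auto simp: k_def m_def)
  have iM: "integrable M (\<lambda>\<omega>. f0 (X \<omega>) * Y \<omega>)" if [measurable]: "X \<in> borel_measurable M" for X
    by (rule M.integrable_bounded_rv[where B="K * KY"])
       (use f0(2) KY order_trans[OF abs_ge_zero f0(2)[of 0]] in \<open>auto simp: abs_mult intro!: mult_mono\<close>)
  have iN: "integrable N (\<lambda>\<omega>. f0 (X \<omega>) * Y (\<pi> \<omega>))" if [measurable]: "X \<in> borel_measurable N" for X
    by (rule N.integrable_bounded_rv[where B="K * KY"])
       (use f0(2) KYN KY(1) order_trans[OF abs_ge_zero f0(2)[of 0]] in \<open>auto simp: abs_mult intro!: mult_mono\<close>)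
  define a where "a n = real_cond_exp M C (\<lambda>\<omega>. f0 (uT n \<omega>) * Y \<omega>)" for n
  define g where "g n = real_cond_exp M C (\<lambda>\<omega>. f0 (grid_mean k m (Z n \<omega>)) * Y \<omega>)" for n
  define gl where "gl = real_cond_exp N C' (\<lambda>\<omega>. f0 (grid_mean k m (zl \<omega>)) * Y (\<pi> \<omega>))"
  define l where "l = real_cond_exp N C' (\<lambda>\<omega>. f0 (uL \<omega>) * Y (\<pi> \<omega>))"
  have [measurable]: "a n \<in> borel_measurable M" "g n \<in> borel_measurable M" for n unfolding a_def g_def by measurable
  have int\<pi>: "integrable N (\<lambda>\<omega>. X (\<pi> \<omega>))" if "integrable M X" for X :: "'w \<Rightarrow> real"
    using integrable_distr[OF \<pi>_meas, of X] that by (simp add: distr_\<pi>)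
  have ia: "integrable N (\<lambda>\<omega>. a n (\<pi> \<omega>))" and ig: "integrable N (\<lambda>\<omega>. g n (\<pi> \<omega>))" for n
    unfolding a_def g_def by (intro int\<pi> M.real_cond_exp_int(1) iM; measurable)+
  have igl: "integrable N gl" and il: "integrable N l"
    unfolding gl_def l_def by (intro N.real_cond_exp_int(1) iN; measurable)+
  have 2: "(\<integral>\<omega>. \<bar>gl \<omega> - l \<omega>\<bar> \<partial>N) < e / 4"
  proof -
    have "(\<integral>\<omega>. \<bar>gl \<omega> - l \<omega>\<bar> \<partial>N) \<le> (\<integral>\<omega>. \<bar>f0 (grid_mean k m (zl \<omega>)) * Y (\<pi> \<omega>) - f0 (uL \<omega>) * Y (\<pi> \<omega>)\<bar> \<partial>N)"
      unfolding gl_def l_def by (intro N.real_cond_exp_L1_contraction iN; measurable)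
    also have "\<dots> \<le> (\<integral>\<omega>. KY * \<bar>f0 (grid_mean k m (zl \<omega>)) - f0 (uL \<omega>)\<bar> \<partial>N)"
    proof (rule integral_mono)
      show "integrable N (\<lambda>\<omega>. \<bar>f0 (grid_mean k m (zl \<omega>)) * Y (\<pi> \<omega>) - f0 (uL \<omega>) * Y (\<pi> \<omega>)\<bar>)"
        by (intro integrable_abs Bochner_Integration.integrable_diff iN; measurable)
      have "integrable N (\<lambda>\<omega>. f0 (X \<omega>))" if [measurable]: "X \<in> borel_measurable N" for X
        by (rule N.integrable_bounded_rv[where B=K]) (use f0(2) in auto)
      then show "integrable N (\<lambda>\<omega>. KY * \<bar>f0 (grid_mean k m (zl \<omega>)) - f0 (uL \<omega>)\<bar>)"
        by (intro integrable_mult_right integrable_abs Bochner_Integration.integrable_diff; measurable)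
      show "\<bar>f0 (grid_mean k m (zl \<omega>)) * Y (\<pi> \<omega>) - f0 (uL \<omega>) * Y (\<pi> \<omega>)\<bar> \<le> KY * \<bar>f0 (grid_mean k m (zl \<omega>)) - f0 (uL \<omega>)\<bar>"
        if "\<omega> \<in> space N" for \<omega>
        using KYN[OF that] by (subst left_diff_distrib[symmetric]) (simp add: abs_mult mult.commute mult_right_mono)
    qed
    also have "\<dots> < e / 4" using k2[of k] KY(1) \<eta>(2) by (simp add: k_def mult_strict_left_mono flip: \<eta>(2))
    finally show ?thesis .
  qed
  have "\<forall>\<^sub>F n in sequentially. (\<integral>\<omega>. \<bar>g n (\<pi> \<omega>) - gl \<omega>\<bar> \<partial>N) < e / 4"
    using grid_fidi[OF c0 f0(2) Y km] e unfolding g_def gl_def by (intro order_tendstoD) auto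
  moreover have "\<forall>\<^sub>F n in sequentially. (\<integral>\<omega>. \<bar>f0 (uT n \<omega>) - f0 (grid_mean k m (Z n \<omega>))\<bar> \<partial>M) < \<eta>"
    using k1[of k] by (simp add: k_def)
  ultimately have "\<forall>\<^sub>F n in sequentially. (\<integral>\<omega>. \<bar>a n (\<pi> \<omega>) - l \<omega>\<bar> \<partial>N) < e"
  proof eventually_elim
    case (elim n)
    have 1: "(\<integral>\<omega>. \<bar>a n (\<pi> \<omega>) - g n (\<pi> \<omega>)\<bar> \<partial>N) < e / 4"
    proof -
      have "(\<integral>\<omega>. \<bar>a n (\<pi> \<omega>) - g n (\<pi> \<omega>)\<bar> \<partial>N) = (\<integral>\<omega>. \<bar>a n \<omega> - g n \<omega>\<bar> \<partial>M)"
        by (rule integral_\<pi>) measurable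
      also have "\<dots> \<le> (\<integral>\<omega>. \<bar>f0 (uT n \<omega>) * Y \<omega> - f0 (grid_mean k m (Z n \<omega>)) * Y \<omega>\<bar> \<partial>M)"
        unfolding a_def g_def by (intro M.real_cond_exp_L1_contraction iM; measurable)
      also have "\<dots> \<le> (\<integral>\<omega>. KY * \<bar>f0 (uT n \<omega>) - f0 (grid_mean k m (Z n \<omega>))\<bar> \<partial>M)"
      proof (rule integral_mono)
        show "integrable M (\<lambda>\<omega>. \<bar>f0 (uT n \<omega>) * Y \<omega> - f0 (grid_mean k m (Z n \<omega>)) * Y \<omega>\<bar>)"
          by (intro integrable_abs Bochner_Integration.integrable_diff iM; measurable)
        have "integrable M (\<lambda>\<omega>. f0 (X \<omega>))" if [measurable]: "X \<in> borel_measurable M" for X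
          by (rule M.integrable_bounded_rv[where B=K]) (use f0(2) in auto)
        then show "integrable M (\<lambda>\<omega>. KY * \<bar>f0 (uT n \<omega>) - f0 (grid_mean k m (Z n \<omega>))\<bar>)"
          by (intro integrable_mult_right integrable_abs Bochner_Integration.integrable_diff; measurable)
        show "\<bar>f0 (uT n \<omega>) * Y \<omega> - f0 (grid_mean k m (Z n \<omega>)) * Y \<omega>\<bar> \<le> KY * \<bar>f0 (uT n \<omega>) - f0 (grid_mean k m (Z n \<omega>))\<bar>"
          if "\<omega> \<in> space M" for \<omega>
          using KY(2)[OF that] by (subst left_diff_distrib[symmetric]) (simp add: abs_mult mult.commute mult_right_mono)
      qed
      also have "\<dots> < e / 4" using elim(2) KY(1) by (simp add: mult_strict_left_mono flip: \<eta>(2))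
      finally show ?thesis .
    qed
    have "(\<integral>\<omega>. \<bar>a n (\<pi> \<omega>) - l \<omega>\<bar> \<partial>N)
       \<le> (\<integral>\<omega>. \<bar>a n (\<pi> \<omega>) - g n (\<pi> \<omega>)\<bar> + (\<bar>g n (\<pi> \<omega>) - gl \<omega>\<bar> + \<bar>gl \<omega> - l \<omega>\<bar>) \<partial>N)"
      using ia[of n] ig[of n] igl il by (intro integral_mono) auto
    also have "\<dots> = (\<integral>\<omega>. \<bar>a n (\<pi> \<omega>) - g n (\<pi> \<omega>)\<bar> \<partial>N) + ((\<integral>\<omega>. \<bar>g n (\<pi> \<omega>) - gl \<omega>\<bar> \<partial>N) + (\<integral>\<omega>. \<bar>gl \<omega> - l \<omega>\<bar> \<partial>N))"
      using ia[of n] ig[of n] igl il by simp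
    also have "\<dots> < e" using 1 2 elim(1) e by linarith
    finally show ?case .
  qed
  then show "\<exists>no. \<forall>n\<ge>no. norm ((\<integral>\<omega>. \<bar>real_cond_exp M C (\<lambda>\<omega>. f0 (uT n \<omega>) * Y \<omega>) (\<pi> \<omega>)
     - real_cond_exp N C' (\<lambda>\<omega>. f0 (uL \<omega>) * Y (\<pi> \<omega>)) \<omega>\<bar> \<partial>N) - 0) < e"
    by (simp add: a_def l_def eventually_sequentially integral_nonneg_AE)
qed

end

lemma uniformly_continuous_const_outside_ball:
  fixes f :: "real^'p \<Rightarrow> real"
  assumes f: "continuous_on UNIV f" and c: "\<And>x. R \<le> norm x \<Longrightarrow> f x = c"
  shows "uniformly_continuous_on UNIV f" and "\<exists>K. \<forall>x. \<bar>f x\<bar> \<le> K"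
proof -
  have u: "uniformly_continuous_on (cball 0 (R + 1)) f"
    by (rule compact_uniformly_continuous[OF continuous_on_subset[OF f]]) auto
  show "uniformly_continuous_on UNIV f"
    unfolding uniformly_continuous_on_def
  proof (intro allI impI)
    fix e :: real assume e: "0 < e"
    then obtain d where d: "0 < d" "\<And>x y. norm x \<le> R + 1 \<Longrightarrow> norm y \<le> R + 1 \<Longrightarrow> dist y x < d \<Longrightarrow> dist (f y) (f x) < e"
      using u unfolding uniformly_continuous_on_def by auto
    have "dist (f y) (f x) < e" if xy: "dist y x < min d 1" for x y
    proof (cases "norm x \<le> R \<or> norm y \<le> R")
      case True
      then have "norm x \<le> R + 1" "norm y \<le> R + 1"
        using xy norm_triangle_sub[of x y] norm_triangle_sub[of y x] by (auto simp: dist_norm norm_minus_commute)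
      then show ?thesis using d xy by auto
    next
      case False
      then show ?thesis using c[of x] c[of y] e by auto
    qed
    then show "\<exists>d>0. \<forall>x\<in>UNIV. \<forall>x'\<in>UNIV. dist x' x < d \<longrightarrow> dist (f x') (f x) < e"
      using d(1) by (intro exI[of _ "min d 1"]) auto
  qed
  have "bounded (f ` cball 0 R)"
    by (intro compact_imp_bounded compact_continuous_image continuous_on_subset[OF f]) auto
  then obtain K where "\<forall>x\<in>cball 0 R. \<bar>f x\<bar> \<le> K" by (auto simp: bounded_iff)
  then have K: "\<bar>f x\<bar> \<le> K" if "norm x \<le> R" for x using that by simp
  have "\<bar>f x\<bar> \<le> max K \<bar>c\<bar>" for x
    using K[of x] c[of x] by (cases "norm x \<le> R") auto
  then show "\<exists>K. \<forall>x. \<bar>f x\<bar> \<le> K" by blast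
qed

lemma (in prob_subalgebra) ennreal_real_cond_exp:
  assumes X: "integrable M X" "\<And>x. x \<in> space M \<Longrightarrow> 0 \<le> X x"
  shows "AE x in M. ennreal (real_cond_exp M F X x) = nn_cond_exp M F (\<lambda>x. ennreal (X x)) x"
proof -
  have [measurable]: "X \<in> borel_measurable M" using X by simp
  have "AE x in M. nn_cond_exp M F (\<lambda>x. ennreal (X x)) x < \<infinity>"
    by (rule nn_cond_exp_finite) (use X in \<open>auto simp: integrable_iff_bounded cong: nn_integral_cong\<close>)
  moreover have "AE x in M. nn_cond_exp M F (\<lambda>x. ennreal (- X x)) x = nn_cond_exp M F (\<lambda>_. 0) x"
    by (rule nn_cond_exp_cong) (use X(2) in \<open>auto intro!: AE_I2 ennreal_neg\<close>)
  moreover have "AE x in M. 0 = nn_cond_exp M F (\<lambda>_. 0) x"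
    by (rule nn_cond_exp_F_meas) simp
  ultimately show ?thesis
    unfolding real_cond_exp_def by eventually_elim simp
qed

lemma (in prob_space) markov_abs:
  assumes X: "integrable M X" and c: "0 < c"
  shows "prob {x \<in> space M. c \<le> \<bar>X x\<bar>} \<le> (\<integral>x. \<bar>X x\<bar> \<partial>M) / c"
  using integral_Markov_inequality_measure[of M "\<lambda>x. \<bar>X x\<bar>" "space M" c] X c
  by (auto simp: integrable_abs)

context quasi_bayes
begin

lemma uT_bounded: "\<exists>R::nat. \<forall>\<omega>\<in>space M. norm (uT n \<omega>) \<le> real R"
proof -
  obtain h z where "ratio_path \<Theta> \<theta>\<^sub>s (A n) \<rho> b B h z" by (rule some_path)
  then obtain R0 where R0: "\<And>u. u \<in> UT n \<Longrightarrow> norm u \<le> R0" by (metis ratio_path.U_norm_bound)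
  obtain R :: nat where R: "R0 < real R" using reals_Archimedean2 by blast
  have "norm (uT n \<omega>) \<le> real R" if \<omega>: "\<omega> \<in> space M" for \<omega>
  proof -
    interpret ratio_path \<Theta> \<theta>\<^sub>s "A n" \<rho> b B "H n \<omega>" "Z n \<omega>" by (rule path[OF \<omega>])
    have "(\<lambda>u. indicator {u. real R \<le> norm u} u * norm u powr q * w u) = (\<lambda>u. 0)"
    proof
      fix u
      show "indicator {u. real R \<le> norm u} u * norm u powr q * w u = 0"
        using R0[of u] R w_bounds(3)[of u] by (cases "u \<in> UT n") auto
    qed
    then have "tail_moment q R w = 0" unfolding tail_moment_def by (simp only:) simp
    then have "norm (u_limit w) powr q \<le> real R powr q" using moment_le_tail_moment[OF q, of R] by simp
    then show ?thesis
      using powr_less_mono2[of q "real R" "norm (u_limit w)"] q unfolding uT_def by force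
  qed
  then show ?thesis by blast
qed

lemma uT_powr_le:
  assumes "\<omega> \<in> space M"
  shows "norm (uT n \<omega>) powr q \<le> real m powr q + tail_moment q m (wT n \<omega>)"
  unfolding uT_def using ratio_path.moment_le_tail_moment[OF path[OF assms] q] .

text \<open>The conditional moments of the estimators are tight, and each truncated moment passes to the limit.\<close>

lemma uL_moment_finite: "AE \<omega> in N. nn_cond_exp N C' (\<lambda>\<omega>. ennreal (norm (uL \<omega>) powr q)) \<omega> < \<infinity>"
proof -
  define \<phi> where "\<phi> j u = min (norm u powr q) (real j)" for j and u :: "real^'p"
  have \<phi>0: "0 \<le> \<phi> j u" "\<bar>\<phi> j u\<bar> \<le> real j" for j u by (auto simp: \<phi>_def)
  have c: "continuous_on UNIV (\<phi> j)" for j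
    unfolding \<phi>_def using q by (intro continuous_on_min continuous_on_powr' continuous_on_norm_id continuous_on_const) auto
  have u\<phi>: "uniformly_continuous_on UNIV (\<phi> j)" for j
  proof (rule uniformly_continuous_const_outside_ball(1)[OF c, of "max 1 (real j)" j "real j"])
    fix x :: "real^'p" assume x: "max 1 (real j) \<le> norm x"
    then have "norm x \<le> norm x powr q" using powr_mono[of 1 q "norm x"] q by simp
    then show "\<phi> j x = real j" using x by (simp add: \<phi>_def)
  qed
  have [measurable]: "\<phi> j \<in> borel_measurable borel" for j by (rule borel_measurable_continuous_onI[OF c])
  define l where "l j = real_cond_exp N C' (\<lambda>\<omega>. \<phi> j (uL \<omega>))" for j
  define X where "X = nn_cond_exp N C' (\<lambda>\<omega>. ennreal (norm (uL \<omega>) powr q))"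
  have [measurable]: "l j \<in> borel_measurable N" "X \<in> borel_measurable N" for j unfolding l_def X_def by measurable
  have i: "integrable N (\<lambda>\<omega>. \<phi> j (uL \<omega>))" for j
    by (rule N.integrable_bounded_rv[where B="real j"]) (use \<phi>0 in auto)
  have iM: "integrable M (\<lambda>\<omega>. \<phi> j (uT n \<omega>))" for j n
    by (rule M.integrable_bounded_rv[where B="real j"]) (use \<phi>0 in auto)
  have l: "AE \<omega> in N. \<forall>j. ennreal (l j \<omega>) = nn_cond_exp N C' (\<lambda>\<omega>. ennreal (\<phi> j (uL \<omega>))) \<omega>"
    unfolding AE_all_countable l_def using i \<phi>0 by (intro allI N.ennreal_real_cond_exp) auto
  have sup: "AE \<omega> in N. (SUP j. nn_cond_exp N C' (\<lambda>\<omega>. ennreal (\<phi> j (uL \<omega>))) \<omega>) = X \<omega>"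
    unfolding X_def
  proof (rule N.nn_cond_exp_monotone_convergence)
    show "incseq (\<lambda>j. ennreal (\<phi> j (uL \<omega>)))" for \<omega>
      by (auto simp: incseq_def \<phi>_def intro!: ennreal_leI)
    show "(SUP j. ennreal (\<phi> j (uL \<omega>))) = ennreal (norm (uL \<omega>) powr q)" for \<omega>
    proof (rule antisym)
      show "(SUP j. ennreal (\<phi> j (uL \<omega>))) \<le> ennreal (norm (uL \<omega>) powr q)"
        by (intro SUP_least ennreal_leI) (simp add: \<phi>_def)
      obtain j :: nat where "norm (uL \<omega>) powr q \<le> real j" using real_arch_simple by blast
      then show "ennreal (norm (uL \<omega>) powr q) \<le> (SUP j. ennreal (\<phi> j (uL \<omega>)))"
        by (intro SUP_upper2[of j]) (auto simp: \<phi>_def)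
    qed
  qed measurable
  have mono: "AE \<omega> in N. \<forall>j. l j \<omega> \<le> l (Suc j) \<omega>"
    unfolding AE_all_countable l_def by (intro allI N.real_cond_exp_mono AE_I2 i) (simp add: \<phi>_def)
  have tight: "\<exists>K. N.prob {\<omega> \<in> space N. ennreal K < X \<omega>} \<le> 2 * e" if e: "0 < e" for e
  proof -
    obtain m where m: "\<forall>\<^sub>F n in sequentially.
      M.prob {\<omega> \<in> space M. ennreal e < nn_cond_exp M C (\<lambda>\<omega>. ennreal (tail_moment q m (wT n \<omega>))) \<omega>} \<le> e"
      using tail_moment_small[OF e] by blast
    define K where "K = real m powr q + e + 1"
    \<comment> \<open>For the estimators the bound \<open>real m powr q + e\<close> comes from the tail moment; the additional 1 absorbs
      the passage to the limit in the mean.\<close>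
    have lK: "N.prob {\<omega> \<in> space N. K < l j \<omega>} \<le> 2 * e" for j
    proof -
      define a where "a n = real_cond_exp M C (\<lambda>\<omega>. \<phi> j (uT n \<omega>) * 1)" for n
      have [measurable]: "a n \<in> borel_measurable M" for n unfolding a_def by measurable
      have "(\<lambda>n. \<integral>\<omega>. \<bar>a n (\<pi> \<omega>) - l j \<omega>\<bar> \<partial>N) \<longlonglongrightarrow> 0"
        using bounded_test_L1[OF u\<phi> \<phi>0(2) bounded_rv_const[of 1], of j] unfolding a_def l_def by simp
      then have "\<forall>\<^sub>F n in sequentially. (\<integral>\<omega>. \<bar>a n (\<pi> \<omega>) - l j \<omega>\<bar> \<partial>N) < e"
        using e by (rule order_tendstoD)
      with m have "\<forall>\<^sub>F n in sequentially. N.prob {\<omega> \<in> space N. K < l j \<omega>} \<le> 2 * e"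
      proof eventually_elim
        case (elim n)
        define J where "J \<omega> = tail_moment q m (wT n \<omega>)" for \<omega>
        have [measurable]: "J \<in> borel_measurable M" unfolding J_def by measurable
        define E where "E = {\<omega> \<in> space M. ennreal e < nn_cond_exp M C (\<lambda>\<omega>. ennreal (J \<omega>)) \<omega>}"
        define E' where "E' = {\<omega> \<in> space N. 1 \<le> \<bar>a n (\<pi> \<omega>) - l j \<omega>\<bar>}"
        have [measurable]: "E \<in> sets M" "E' \<in> sets N" unfolding E_def E'_def by measurable
        have "AE \<omega> in M. ennreal (a n \<omega>) = nn_cond_exp M C (\<lambda>\<omega>. ennreal (\<phi> j (uT n \<omega>))) \<omega>"
          unfolding a_def using M.ennreal_real_cond_exp[OF iM, of j n] \<phi>0 by simp
        moreover have "AE \<omega> in M. nn_cond_exp M C (\<lambda>\<omega>. ennreal (\<phi> j (uT n \<omega>))) \<omega>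
            \<le> nn_cond_exp M C (\<lambda>\<omega>. ennreal (real m powr q) + ennreal (J \<omega>)) \<omega>"
        proof (intro M.nn_cond_exp_mono AE_I2)
          fix \<omega> assume \<omega>: "\<omega> \<in> space M"
          have "\<phi> j (uT n \<omega>) \<le> real m powr q + J \<omega>" using uT_powr_le[OF \<omega>, of n m] by (simp add: \<phi>_def J_def)
          then show "ennreal (\<phi> j (uT n \<omega>)) \<le> ennreal (real m powr q) + ennreal (J \<omega>)"
            using ratio_path.tail_moment_nonneg[OF path[OF \<omega>], of q m n] ennreal_leI[of "\<phi> j (uT n \<omega>)" "real m powr q + J \<omega>"]
            by (simp add: J_def)
        qed measurable
        moreover have "AE \<omega> in M. nn_cond_exp M C (\<lambda>_. ennreal (real m powr q)) \<omega> + nn_cond_exp M C (\<lambda>\<omega>. ennreal (J \<omega>)) \<omega>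
            = nn_cond_exp M C (\<lambda>\<omega>. ennreal (real m powr q) + ennreal (J \<omega>)) \<omega>"
          by (rule M.nn_cond_exp_sum) measurable
        moreover have "AE \<omega> in M. ennreal (real m powr q) = nn_cond_exp M C (\<lambda>_. ennreal (real m powr q)) \<omega>"
          by (rule M.nn_cond_exp_F_meas) simp
        ultimately have "AE \<omega> in M. \<omega> \<notin> E \<longrightarrow> a n \<omega> \<le> real m powr q + e"
          using AE_space
        proof eventually_elim
          case (elim \<omega>)
          show ?case
          proof
            assume "\<omega> \<notin> E"
            then have "nn_cond_exp M C (\<lambda>\<omega>. ennreal (J \<omega>)) \<omega> \<le> ennreal e" using elim by (auto simp: E_def not_less)
            then have le: "ennreal (real m powr q) + nn_cond_exp M C (\<lambda>\<omega>. ennreal (J \<omega>)) \<omega> \<le> ennreal (real m powr q) + ennreal e"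
              by (rule add_left_mono)
            have "ennreal (a n \<omega>) \<le> nn_cond_exp M C (\<lambda>\<omega>. ennreal (real m powr q) + ennreal (J \<omega>)) \<omega>"
              using elim(1,2) by simp
            also have "\<dots> = ennreal (real m powr q) + nn_cond_exp M C (\<lambda>\<omega>. ennreal (J \<omega>)) \<omega>"
              using elim(3,4) by simp
            also note le
            also have "ennreal (real m powr q) + ennreal e = ennreal (real m powr q + e)" using e by simp
            finally have "ennreal (a n \<omega>) \<le> ennreal (real m powr q + e)" .
            then show "a n \<omega> \<le> real m powr q + e" using e by (subst (asm) ennreal_le_iff) auto
          qed
        qed
        then have "AE \<omega> in N. \<pi> \<omega> \<notin> E \<longrightarrow> a n (\<pi> \<omega>) \<le> real m powr q + e" by (rule AE_\<pi>)
        then have "N.prob {\<omega> \<in> space N. K < l j \<omega>} \<le> N.prob ((\<pi> -` E \<inter> space N) \<union> E')"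
        proof (intro N.finite_measure_mono_AE)
          show "AE \<omega> in N. \<omega> \<in> {\<omega> \<in> space N. K < l j \<omega>} \<longrightarrow> \<omega> \<in> (\<pi> -` E \<inter> space N) \<union> E'"
            if "AE \<omega> in N. \<pi> \<omega> \<notin> E \<longrightarrow> a n (\<pi> \<omega>) \<le> real m powr q + e"
            using that by eventually_elim (auto simp: E'_def K_def)
        qed measurable
        also have "\<dots> \<le> N.prob (\<pi> -` E \<inter> space N) + N.prob E'" by (rule measure_Un_le) measurable
        also have "N.prob (\<pi> -` E \<inter> space N) = M.prob E"
          using measure_distr[OF \<pi>_meas, of E] by (simp add: distr_\<pi>)
        also have "N.prob E' \<le> (\<integral>\<omega>. \<bar>a n (\<pi> \<omega>) - l j \<omega>\<bar> \<partial>N) / 1"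
          unfolding E'_def
        proof (rule N.markov_abs)
          have "integrable N (\<lambda>\<omega>. a n (\<pi> \<omega>))"
            using integrable_distr[OF \<pi>_meas, of "a n"] M.real_cond_exp_int(1)[OF iM, of j n] by (simp add: distr_\<pi> a_def)
          moreover have "integrable N (l j)" unfolding l_def by (rule N.real_cond_exp_int(1)[OF i])
          ultimately show "integrable N (\<lambda>\<omega>. a n (\<pi> \<omega>) - l j \<omega>)" by auto
        qed simp
        finally show ?case using elim by (simp add: E_def J_def)
      qed
      then show ?thesis by (auto simp: eventually_sequentially)
    qed
    define Bj where "Bj j = {\<omega> \<in> space N. \<exists>i\<le>j. K < l i \<omega>}" for j
    have [measurable]: "Bj j \<in> sets N" for j unfolding Bj_def by measurable
    have "N.prob (Bj j) \<le> 2 * e" for j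
    proof -
      have "N.prob (Bj j) \<le> N.prob {\<omega> \<in> space N. K < l j \<omega>}"
      proof (rule N.finite_measure_mono_AE)
        show "AE \<omega> in N. \<omega> \<in> Bj j \<longrightarrow> \<omega> \<in> {\<omega> \<in> space N. K < l j \<omega>}"
          using mono
        proof eventually_elim
          case (elim \<omega>)
          then have "incseq (\<lambda>j. l j \<omega>)" by (auto intro: incseq_SucI)
          then show ?case by (auto simp: Bj_def incseq_def intro: less_le_trans)
        qed
      qed measurable
      then show ?thesis using lK[of j] by linarith
    qed
    moreover have "(\<lambda>j. N.prob (Bj j)) \<longlonglongrightarrow> N.prob (\<Union>j. Bj j)"
      by (rule N.finite_Lim_measure_incseq) (auto simp: incseq_def Bj_def intro: order_trans)
    ultimately have "N.prob (\<Union>j. Bj j) \<le> 2 * e" by (intro LIMSEQ_le_const2) auto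
    moreover have "N.prob {\<omega> \<in> space N. ennreal K < X \<omega>} \<le> N.prob (\<Union>j. Bj j)"
    proof (rule N.finite_measure_mono_AE)
      show "AE \<omega> in N. \<omega> \<in> {\<omega> \<in> space N. ennreal K < X \<omega>} \<longrightarrow> \<omega> \<in> (\<Union>j. Bj j)"
        using l sup
      proof eventually_elim
        case (elim \<omega>)
        show ?case
        proof
          assume \<omega>: "\<omega> \<in> {\<omega> \<in> space N. ennreal K < X \<omega>}"
          then have "ennreal K < (SUP j. nn_cond_exp N C' (\<lambda>\<omega>. ennreal (\<phi> j (uL \<omega>))) \<omega>)" using elim by simp
          then obtain j where "ennreal K < nn_cond_exp N C' (\<lambda>\<omega>. ennreal (\<phi> j (uL \<omega>))) \<omega>" by (auto simp: less_SUP_iff)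
          then have "ennreal K < ennreal (l j \<omega>)" using elim by simp
          then have "K < l j \<omega>" by (meson ennreal_leI leD leI)
          then show "\<omega> \<in> (\<Union>j. Bj j)" using \<omega> by (auto simp: Bj_def)
        qed
      qed
    qed measurable
    ultimately show ?thesis by (intro exI[of _ K]) linarith
  qed
  have "N.prob {\<omega> \<in> space N. X \<omega> = \<infinity>} \<le> 0"
  proof (rule field_le_epsilon)
    fix e :: real assume e: "0 < e"
    then obtain K where K: "N.prob {\<omega> \<in> space N. ennreal K < X \<omega>} \<le> 2 * (e / 2)" using tight[of "e / 2"] by auto
    have "N.prob {\<omega> \<in> space N. X \<omega> = \<infinity>} \<le> N.prob {\<omega> \<in> space N. ennreal K < X \<omega>}"
      by (rule N.finite_measure_mono) (auto simp: less_top[symmetric])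
    then show "N.prob {\<omega> \<in> space N. X \<omega> = \<infinity>} \<le> 0 + e" using K by linarith
  qed
  then have "N.prob {\<omega> \<in> space N. X \<omega> = \<infinity>} = 0" using measure_nonneg[of N] by (auto intro: antisym)
  then have "AE \<omega> in N. \<not> X \<omega> = \<infinity>"
    by (subst (asm) N.prob_eq_0) auto
  then show ?thesis unfolding X_def by eventually_elim (simp add: less_top)
qed

end

lemma (in prob_space) AE_tendsto_conv_in_prob:
  fixes X :: "nat \<Rightarrow> 'a \<Rightarrow> real"
  assumes [measurable]: "\<And>n. X n \<in> borel_measurable M" "Y \<in> borel_measurable M"
    and lim: "AE x in M. (\<lambda>n. X n x) \<longlonglongrightarrow> Y x"
  shows "conv_in_prob M X Y sequentially"
  unfolding conv_in_prob_def
proof (intro allI impI)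
  fix e :: real assume e: "0 < e"
  define S where "S n = {x \<in> space M. e \<le> dist (X n x) (Y x)}" for n
  have [measurable]: "S n \<in> sets M" for n unfolding S_def by measurable
  have "(\<lambda>n. \<integral>x. indicator (S n) x \<partial>M) \<longlonglongrightarrow> (\<integral>x. (0::real) \<partial>M)"
  proof (rule integral_dominated_convergence[where w="\<lambda>_. 1"])
    show "AE x in M. (\<lambda>n. indicator (S n) x) \<longlonglongrightarrow> (0::real)"
      using lim
    proof eventually_elim
      case (elim x)
      then have "\<forall>\<^sub>F n in sequentially. dist (X n x) (Y x) < e" using e by (rule tendstoD)
      then have "\<forall>\<^sub>F n in sequentially. indicator (S n) x = (0::real)"
        by eventually_elim (auto simp: S_def)
      then show ?case by (rule tendsto_eventually)
    qed
  qed auto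
  then show "(\<lambda>n. prob {x \<in> space M. e \<le> dist (X n x) (Y x)}) \<longlonglongrightarrow> 0" by (simp add: S_def[symmetric])
qed

text \<open>Cutting a function down to a ball is monotone in the radius on its positive and on its negative
  part, so the conditional expectations converge whenever the limit is conditionally integrable.\<close>

lemma (in prob_subalgebra) real_cond_exp_cutoff:
  fixes X :: "'a \<Rightarrow> real" and \<xi> :: "nat \<Rightarrow> 'a \<Rightarrow> real"
  assumes [measurable]: "X \<in> borel_measurable M" "\<And>m. \<xi> m \<in> borel_measurable M"
    and \<xi>: "\<And>m x. 0 \<le> \<xi> m x" "\<And>m x. \<xi> m x \<le> \<xi> (Suc m) x" "\<And>x. \<exists>m. \<xi> m x = 1" "\<And>m x. \<xi> m x \<le> 1"
    and fin: "AE x in M. nn_cond_exp M F (\<lambda>x. ennreal \<bar>X x\<bar>) x < \<infinity>"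
  shows "AE x in M. (\<lambda>m. real_cond_exp M F (\<lambda>x. \<xi> m x * X x) x) \<longlonglongrightarrow> real_cond_exp M F X x"
proof -
  have part: "AE x in M. (\<lambda>m. enn2real (nn_cond_exp M F (\<lambda>x. ennreal (\<xi> m x * V x)) x)) \<longlonglongrightarrow> enn2real (nn_cond_exp M F (\<lambda>x. ennreal (V x)) x)"
    if [measurable]: "V \<in> borel_measurable M" and V: "\<And>x. \<bar>V x\<bar> = \<bar>X x\<bar>" for V
  proof -
    have mono: "ennreal (\<xi> m x * V x) \<le> ennreal (\<xi> (Suc m) x * V x)" for m x
    proof (cases "0 \<le> V x")
      case True
      then show ?thesis using \<xi>(2)[of m x] by (intro ennreal_leI mult_right_mono)
    next
      case False
      then have "\<xi> m x * V x \<le> 0" using \<xi>(1)[of m x] by (simp add: mult_nonneg_nonpos)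
      then show ?thesis by (simp add: ennreal_neg)
    qed
    have "AE x in M. (SUP m. nn_cond_exp M F (\<lambda>x. ennreal (\<xi> m x * V x)) x) = nn_cond_exp M F (\<lambda>x. ennreal (V x)) x"
    proof (rule nn_cond_exp_monotone_convergence)
      show "incseq (\<lambda>m. ennreal (\<xi> m x * V x))" for x using mono by (rule incseq_SucI)
      show "(SUP m. ennreal (\<xi> m x * V x)) = ennreal (V x)" for x
      proof (rule antisym)
        show "(SUP m. ennreal (\<xi> m x * V x)) \<le> ennreal (V x)"
        proof (rule SUP_least)
          fix m
          show "ennreal (\<xi> m x * V x) \<le> ennreal (V x)"
          proof (cases "0 \<le> V x")
            case True
            then show ?thesis using \<xi>(4)[of m x] mult_right_mono[of "\<xi> m x" 1 "V x"] by (intro ennreal_leI) simp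
          next
            case False
            then have "\<xi> m x * V x \<le> 0" using \<xi>(1)[of m x] by (simp add: mult_nonneg_nonpos)
            then show ?thesis by (simp add: ennreal_neg)
          qed
        qed
        obtain m where "\<xi> m x = 1" using \<xi>(3) by blast
        then show "ennreal (V x) \<le> (SUP m. ennreal (\<xi> m x * V x))" by (intro SUP_upper2[of m]) auto
      qed
    qed measurable
    moreover have "AE x in M. \<forall>m. nn_cond_exp M F (\<lambda>x. ennreal (\<xi> m x * V x)) x \<le> nn_cond_exp M F (\<lambda>x. ennreal (\<xi> (Suc m) x * V x)) x"
      unfolding AE_all_countable by (intro allI nn_cond_exp_mono AE_I2 mono) measurable
    moreover have "AE x in M. nn_cond_exp M F (\<lambda>x. ennreal (V x)) x \<le> nn_cond_exp M F (\<lambda>x. ennreal \<bar>X x\<bar>) x"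
    proof (intro nn_cond_exp_mono AE_I2 ennreal_leI)
      show "V x \<le> \<bar>X x\<bar>" for x unfolding V[symmetric] by simp
    qed measurable
    ultimately show ?thesis using fin
    proof eventually_elim
      case (elim x)
      define y where "y = enn2real (nn_cond_exp M F (\<lambda>x. ennreal (V x)) x)"
      have y: "nn_cond_exp M F (\<lambda>x. ennreal (V x)) x = ennreal y" "0 \<le> y"
        using elim by (auto simp: y_def intro!: ennreal_enn2real[symmetric] intro: order.strict_trans1)
      have "(\<lambda>m. nn_cond_exp M F (\<lambda>x. ennreal (\<xi> m x * V x)) x) \<longlonglongrightarrow> (SUP m. nn_cond_exp M F (\<lambda>x. ennreal (\<xi> m x * V x)) x)"
        using elim(2) by (intro LIMSEQ_SUP incseq_SucI) auto
      then have "(\<lambda>m. nn_cond_exp M F (\<lambda>x. ennreal (\<xi> m x * V x)) x) \<longlonglongrightarrow> ennreal y" using elim(1) y by simp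
      then show ?case unfolding y_def[symmetric] using y(2) by (rule tendsto_enn2real)
    qed
  qed
  have "AE x in M. (\<lambda>m. enn2real (nn_cond_exp M F (\<lambda>x. ennreal (\<xi> m x * X x)) x)) \<longlonglongrightarrow> enn2real (nn_cond_exp M F (\<lambda>x. ennreal (X x)) x)"
    by (rule part) auto
  moreover have "AE x in M. (\<lambda>m. enn2real (nn_cond_exp M F (\<lambda>x. ennreal (\<xi> m x * (- X x))) x)) \<longlonglongrightarrow> enn2real (nn_cond_exp M F (\<lambda>x. ennreal (- X x)) x)"
    by (rule part) auto
  ultimately show ?thesis
    unfolding real_cond_exp_def by eventually_elim (use tendsto_diff in fastforce)
qed

context quasi_bayes
begin

definition cutoff :: "nat \<Rightarrow> real^'p \<Rightarrow> real" where
  "cutoff m u = max 0 (min 1 (real m + 1 - norm u))"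

lemma cutoff: "0 \<le> cutoff m u" "cutoff m u \<le> 1" "cutoff m u \<le> cutoff (Suc m) u"
    "norm u \<le> real m \<Longrightarrow> cutoff m u = 1" "real m + 1 \<le> norm u \<Longrightarrow> cutoff m u = 0"
  by (auto simp: cutoff_def)

lemma continuous_cutoff: "continuous_on S (cutoff m)"
  unfolding cutoff_def by (intro continuous_intros)

lemma uL_growth_finite:
  assumes X: "X \<in> borel_measurable N" and K: "0 \<le> K" "\<And>\<omega>. \<omega> \<in> space N \<Longrightarrow> \<bar>X \<omega>\<bar> \<le> K * (1 + norm (uL \<omega>) powr q)"
  shows "AE \<omega> in N. nn_cond_exp N C' (\<lambda>\<omega>. ennreal \<bar>X \<omega>\<bar>) \<omega> < \<infinity>"
proof -
  note [measurable] = X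
  have "AE \<omega> in N. nn_cond_exp N C' (\<lambda>\<omega>. ennreal \<bar>X \<omega>\<bar>) \<omega> \<le> nn_cond_exp N C' (\<lambda>\<omega>. ennreal K + ennreal K * ennreal (norm (uL \<omega>) powr q)) \<omega>"
  proof (intro N.nn_cond_exp_mono AE_I2)
    fix \<omega> assume "\<omega> \<in> space N"
    from ennreal_leI[OF K(2)[OF this]] K(1)
    show "ennreal \<bar>X \<omega>\<bar> \<le> ennreal K + ennreal K * ennreal (norm (uL \<omega>) powr q)"
      by (simp add: distrib_left ennreal_mult)
  qed measurable
  moreover have "AE \<omega> in N. nn_cond_exp N C' (\<lambda>_. ennreal K) \<omega> + nn_cond_exp N C' (\<lambda>\<omega>. ennreal K * ennreal (norm (uL \<omega>) powr q)) \<omega>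
      = nn_cond_exp N C' (\<lambda>\<omega>. ennreal K + ennreal K * ennreal (norm (uL \<omega>) powr q)) \<omega>"
    by (rule N.nn_cond_exp_sum) measurable
  moreover have "AE \<omega> in N. ennreal K = nn_cond_exp N C' (\<lambda>_. ennreal K) \<omega>"
    by (rule N.nn_cond_exp_F_meas) simp
  moreover have "AE \<omega> in N. ennreal K * nn_cond_exp N C' (\<lambda>\<omega>. ennreal (norm (uL \<omega>) powr q)) \<omega> = nn_cond_exp N C' (\<lambda>\<omega>. ennreal K * ennreal (norm (uL \<omega>) powr q)) \<omega>"
    by (rule N.nn_cond_exp_prod) measurable
  ultimately show ?thesis using uL_moment_finite
  proof eventually_elim
    case (elim \<omega>)
    have "ennreal K * nn_cond_exp N C' (\<lambda>\<omega>. ennreal (norm (uL \<omega>) powr q)) \<omega> < \<infinity>"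
      using elim(5) by (simp add: ennreal_mult_less_top)
    then have "nn_cond_exp N C' (\<lambda>\<omega>. ennreal K + ennreal K * ennreal (norm (uL \<omega>) powr q)) \<omega> < \<infinity>"
      using elim(2,3,4) by (metis ennreal_add_less_top ennreal_less_top infinity_ennreal_def)
    then show ?case using elim(1) by (rule order.strict_trans1[rotated])
  qed
qed

text \<open>The error vanishes unless the estimator lies outside the ball of radius \<open>m \<ge> 2 * c\<close>; there Jensen's
  inequality leaves at least half of \<open>norm (uT n \<omega>) powr q\<close> to the tail moment beyond \<open>c\<close>.\<close>

lemma cutoff_error:
  fixes f :: "real^'p \<Rightarrow> real"
  assumes K: "0 \<le> K" "\<And>u. \<bar>f u\<bar> \<le> K * (1 + norm u powr q)" and c: "1 \<le> c" "2 * c \<le> m" and \<omega>: "\<omega> \<in> space M"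
  shows "\<bar>f (uT n \<omega>) - cutoff m (uT n \<omega>) * f (uT n \<omega>)\<bar> \<le> 4 * K * tail_moment q c (wT n \<omega>)"
proof (cases "norm (uT n \<omega>) \<le> real m")
  case True
  then show ?thesis
    using cutoff(4)[OF True] K(1) ratio_path.tail_moment_nonneg[OF path[OF \<omega>], of q c n] by simp
next
  case False
  define y where "y = norm (uT n \<omega>) powr q"
  have big: "2 * real c \<le> norm (uT n \<omega>)" using False c(2) by linarith
  have c1: "1 \<le> real c powr q" using c q by (simp add: ge_one_powr_ge_zero)
  have "2 * real c powr q \<le> 2 powr q * real c powr q"
    using powr_mono[of 1 q 2] q by (intro mult_right_mono) auto
  also have "\<dots> = (2 * real c) powr q" by (simp add: powr_mult)
  also have "\<dots> \<le> y" unfolding y_def using big q by (intro powr_mono2) auto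
  finally have y: "2 * real c powr q \<le> y" .
  then have y1: "1 \<le> y" using c1 by linarith
  have "y \<le> real c powr q + tail_moment q c (wT n \<omega>)" unfolding y_def by (rule uT_powr_le[OF \<omega>])
  then have yJ: "y \<le> 2 * tail_moment q c (wT n \<omega>)" using y by linarith
  have "\<bar>f (uT n \<omega>) - cutoff m (uT n \<omega>) * f (uT n \<omega>)\<bar> = (1 - cutoff m (uT n \<omega>)) * \<bar>f (uT n \<omega>)\<bar>"
  proof -
    have "f (uT n \<omega>) - cutoff m (uT n \<omega>) * f (uT n \<omega>) = (1 - cutoff m (uT n \<omega>)) * f (uT n \<omega>)"
      by (simp add: left_diff_distrib)
    then show ?thesis using cutoff(2)[of m "uT n \<omega>"] by (simp add: abs_mult)
  qed
  also have "\<dots> \<le> 1 * (K * (1 + y))"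
    using K(2)[of "uT n \<omega>"] cutoff(1,2)[of m "uT n \<omega>"] by (intro mult_mono) (auto simp: y_def)
  also have "\<dots> \<le> K * (4 * tail_moment q c (wT n \<omega>))"
    using K(1) y1 yJ by (simp add: mult_left_mono)
  finally show ?thesis by (simp add: mult_ac)
qed

text \<open>Three errors: \<open>cutoff_error\<close> along the sequence, \<open>bounded_test_L1\<close> for the function cut off, and
  \<open>real_cond_exp_cutoff\<close> in the limit. The first determines the least radius of the cut-off, the third
  the radius, and then the second holds for large \<open>n\<close>.\<close>

lemma component_convergence:
  fixes f :: "real^'p \<Rightarrow> real"
  assumes f: "continuous_on UNIV f" and K: "0 \<le> K" "\<And>u. \<bar>f u\<bar> \<le> K * (1 + norm u powr q)" and Y: "bounded_rv G Y"
  shows "conv_in_prob N (\<lambda>n \<omega>. real_cond_exp M C (\<lambda>\<omega>. Y \<omega> * f (uT n \<omega>)) (\<pi> \<omega>))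
    (real_cond_exp N C' (\<lambda>\<omega>. Y (\<pi> \<omega>) * f (uL \<omega>))) sequentially"
  unfolding conv_in_prob_def
proof (intro allI impI)
  fix e0 :: real assume e0: "0 < e0"
  define e where "e = e0 / 3"
  have e: "0 < e" using e0 by (simp add: e_def)
  note [measurable] = bounded_rvD(1)[OF Y]
  have [measurable]: "f \<in> borel_measurable borel" by (rule borel_measurable_continuous_onI[OF f])
  have [measurable]: "cutoff m \<in> borel_measurable borel" for m by (rule borel_measurable_continuous_onI[OF continuous_cutoff])
  obtain KY where KY: "0 < KY" "\<And>\<omega>. \<omega> \<in> space M \<Longrightarrow> \<bar>Y \<omega>\<bar> \<le> KY" using bounded_rvD(2)[OF Y] by auto
  have KYN: "\<bar>Y (\<pi> \<omega>)\<bar> \<le> KY" if "\<omega> \<in> space N" for \<omega> using KY(2) measurable_space[OF \<pi>_meas that] by auto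
  define a where "a n = real_cond_exp M C (\<lambda>\<omega>. Y \<omega> * f (uT n \<omega>))" for n
  define am where "am m n = real_cond_exp M C (\<lambda>\<omega>. (cutoff m (uT n \<omega>) * f (uT n \<omega>)) * Y \<omega>)" for m n
  define l where "l = real_cond_exp N C' (\<lambda>\<omega>. Y (\<pi> \<omega>) * f (uL \<omega>))"
  define lm where "lm m = real_cond_exp N C' (\<lambda>\<omega>. (cutoff m (uL \<omega>) * f (uL \<omega>)) * Y (\<pi> \<omega>))" for m
  have [measurable]: "a n \<in> borel_measurable M" "am m n \<in> borel_measurable M" "l \<in> borel_measurable N" "lm m \<in> borel_measurable N" for m n
    unfolding a_def am_def l_def lm_def by measurable
  have T3: "conv_in_prob N lm l sequentially"
  proof (rule N.AE_tendsto_conv_in_prob)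
    have "AE \<omega> in N. (\<lambda>m. real_cond_exp N C' (\<lambda>\<omega>. cutoff m (uL \<omega>) * (Y (\<pi> \<omega>) * f (uL \<omega>))) \<omega>) \<longlonglongrightarrow> l \<omega>"
      unfolding l_def
    proof (rule N.real_cond_exp_cutoff)
      show "\<exists>m. cutoff m (uL \<omega>) = 1" for \<omega>
        using real_arch_simple[of "norm (uL \<omega>)"] cutoff(4) by blast
      show "AE \<omega> in N. nn_cond_exp N C' (\<lambda>\<omega>. ennreal \<bar>Y (\<pi> \<omega>) * f (uL \<omega>)\<bar>) \<omega> < \<infinity>"
      proof (rule uL_growth_finite[of _ "KY * K"])
        fix \<omega> assume "\<omega> \<in> space N"
        then show "\<bar>Y (\<pi> \<omega>) * f (uL \<omega>)\<bar> \<le> KY * K * (1 + norm (uL \<omega>) powr q)"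
          using KYN K(2)[of "uL \<omega>"] KY(1) unfolding abs_mult mult.assoc by (intro mult_mono) auto
      qed (use KY K in auto)
    qed (auto intro: cutoff)
    then show "AE \<omega> in N. (\<lambda>m. lm m \<omega>) \<longlonglongrightarrow> l \<omega>" by (simp add: lm_def mult_ac)
  qed measurable
  show "(\<lambda>n. N.prob {\<omega> \<in> space N. e0 \<le> dist (a n (\<pi> \<omega>)) (l \<omega>)}) \<longlonglongrightarrow> 0"
  proof (rule LIMSEQ_I)
    fix d0 :: real assume d0: "0 < d0"
    define d where "d = d0 / 4"
    have d: "0 < d" using d0 by (simp add: d_def)
    define e' where "e' = min d (e / (4 * K * KY + 1) / 2)"
    have e': "0 < e'" using d e K KY by (auto simp: e'_def intro!: divide_pos_pos add_nonneg_pos)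
    have e'2: "(4 * K * KY) * e' < e"
    proof -
      have p: "0 < 4 * K * KY + 1" using K KY by (intro add_nonneg_pos) auto
      have "(4 * K * KY) * e' \<le> (4 * K * KY + 1) * e'" using e' by (intro mult_right_mono) auto
      also have "\<dots> \<le> (4 * K * KY + 1) * (e / (4 * K * KY + 1) / 2)" using p by (intro mult_left_mono) (auto simp: e'_def)
      also have "\<dots> = e / 2"
      proof -
        have "x * (e / x / 2) = e / 2" if "0 < x" for x :: real using that by simp
        from this[OF p] show ?thesis .
      qed
      finally show ?thesis using e by linarith
    qed
    obtain c where c: "1 \<le> c" "\<forall>\<^sub>F n in sequentially.
      M.prob {\<omega> \<in> space M. ennreal e' < nn_cond_exp M C (\<lambda>\<omega>. ennreal (tail_moment q c (wT n \<omega>))) \<omega>} \<le> e'"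
      using tail_moment_small[OF e'] by blast
    have "\<forall>\<^sub>F m in sequentially. N.prob {\<omega> \<in> space N. e \<le> dist (lm m \<omega>) (l \<omega>)} < d"
      using T3 e d unfolding conv_in_prob_def by (intro order_tendstoD) auto
    moreover have "\<forall>\<^sub>F m in sequentially. 2 * c \<le> m" by (rule eventually_ge_at_top)
    ultimately have "\<forall>\<^sub>F m in sequentially. N.prob {\<omega> \<in> space N. e \<le> dist (lm m \<omega>) (l \<omega>)} < d \<and> 2 * c \<le> m"
      by eventually_elim simp
    then obtain m where m: "N.prob {\<omega> \<in> space N. e \<le> dist (lm m \<omega>) (l \<omega>)} < d" "2 * c \<le> m"
      by (auto simp: eventually_sequentially)
    define f0 where "f0 u = cutoff m u * f u" for u
    have cf0: "continuous_on UNIV f0" unfolding f0_def by (intro continuous_intros continuous_cutoff f)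
    have f0c: "f0 u = 0" if "real m + 1 \<le> norm u" for u using cutoff(5)[OF that] by (simp add: f0_def)
    note uf0 = uniformly_continuous_const_outside_ball(1)[OF cf0 f0c]
    obtain K0 where K0: "\<And>u. \<bar>f0 u\<bar> \<le> K0" using uniformly_continuous_const_outside_ball(2)[OF cf0 f0c] by blast
    have "(\<lambda>n. \<integral>\<omega>. \<bar>am m n (\<pi> \<omega>) - lm m \<omega>\<bar> \<partial>N) \<longlonglongrightarrow> 0"
      using bounded_test_L1[OF uf0 K0 Y] unfolding am_def lm_def f0_def .
    then have T2: "\<forall>\<^sub>F n in sequentially. (\<integral>\<omega>. \<bar>am m n (\<pi> \<omega>) - lm m \<omega>\<bar> \<partial>N) < e * d"
      using e d by (intro order_tendstoD) auto
    have "\<forall>\<^sub>F n in sequentially. N.prob {\<omega> \<in> space N. e0 \<le> dist (a n (\<pi> \<omega>)) (l \<omega>)} < d0"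
      using c(2) T2
    proof eventually_elim
      case (elim n)
      define J where "J \<omega> = tail_moment q c (wT n \<omega>)" for \<omega>
      have [measurable]: "J \<in> borel_measurable M" unfolding J_def by measurable
      define E where "E = {\<omega> \<in> space M. ennreal e' < nn_cond_exp M C (\<lambda>\<omega>. ennreal (J \<omega>)) \<omega>}"
      define E2 where "E2 = {\<omega> \<in> space N. e \<le> \<bar>am m n (\<pi> \<omega>) - lm m \<omega>\<bar>}"
      define E3 where "E3 = {\<omega> \<in> space N. e \<le> dist (lm m \<omega>) (l \<omega>)}"
      have [measurable]: "E \<in> sets M" "E2 \<in> sets N" "E3 \<in> sets N" unfolding E_def E2_def E3_def by measurable
      obtain R :: nat where R: "\<And>\<omega>. \<omega> \<in> space M \<Longrightarrow> norm (uT n \<omega>) \<le> real R" using uT_bounded by blast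
      have i1: "integrable M (\<lambda>\<omega>. Y \<omega> * f (uT n \<omega>))"
      proof (rule M.integrable_bounded_rv[where B="KY * (K * (1 + real R powr q))"])
        fix \<omega> assume \<omega>: "\<omega> \<in> space M"
        have "\<bar>f (uT n \<omega>)\<bar> \<le> K * (1 + norm (uT n \<omega>) powr q)" by (rule K(2))
        also have "\<dots> \<le> K * (1 + real R powr q)"
          using R[OF \<omega>] q K(1) by (intro mult_left_mono add_left_mono powr_mono2) auto
        finally show "\<bar>Y \<omega> * f (uT n \<omega>)\<bar> \<le> KY * (K * (1 + real R powr q))"
          unfolding abs_mult using KY(2)[OF \<omega>] KY(1) by (intro mult_mono) auto
      qed measurable
      have i2: "integrable M (\<lambda>\<omega>. f0 (uT n \<omega>) * Y \<omega>)"
      proof (rule M.integrable_bounded_rv[where B="K0 * KY"])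
        show "(\<lambda>\<omega>. f0 (uT n \<omega>) * Y \<omega>) \<in> borel_measurable M" unfolding f0_def by measurable
        show "\<bar>f0 (uT n \<omega>) * Y \<omega>\<bar> \<le> K0 * KY" if "\<omega> \<in> space M" for \<omega>
          unfolding abs_mult using K0[of "uT n \<omega>"] KY(2)[OF that] KY(1) by (intro mult_mono) auto
      qed
      have T1: "AE \<omega> in M. \<omega> \<notin> E \<longrightarrow> \<bar>a n \<omega> - am m n \<omega>\<bar> < e"
      proof -
        have "AE \<omega> in M. real_cond_exp M C (\<lambda>\<omega>. Y \<omega> * f (uT n \<omega>) - f0 (uT n \<omega>) * Y \<omega>) \<omega> = a n \<omega> - am m n \<omega>"
          using M.real_cond_exp_diff[OF i1 i2] unfolding a_def am_def f0_def .
        moreover have "AE \<omega> in M. ennreal \<bar>real_cond_exp M C (\<lambda>\<omega>. Y \<omega> * f (uT n \<omega>) - f0 (uT n \<omega>) * Y \<omega>) \<omega>\<bar>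
            \<le> nn_cond_exp M C (\<lambda>\<omega>. ennreal \<bar>Y \<omega> * f (uT n \<omega>) - f0 (uT n \<omega>) * Y \<omega>\<bar>) \<omega>"
          using i1 i2 by (intro M.real_cond_exp_abs) auto
        moreover have "AE \<omega> in M. nn_cond_exp M C (\<lambda>\<omega>. ennreal \<bar>Y \<omega> * f (uT n \<omega>) - f0 (uT n \<omega>) * Y \<omega>\<bar>) \<omega>
            \<le> nn_cond_exp M C (\<lambda>\<omega>. ennreal (4 * K * KY) * ennreal (J \<omega>)) \<omega>"
        proof (intro M.nn_cond_exp_mono AE_I2)
          fix \<omega> assume \<omega>: "\<omega> \<in> space M"
          have "\<bar>Y \<omega> * f (uT n \<omega>) - f0 (uT n \<omega>) * Y \<omega>\<bar> = \<bar>f (uT n \<omega>) - cutoff m (uT n \<omega>) * f (uT n \<omega>)\<bar> * \<bar>Y \<omega>\<bar>"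
            unfolding abs_mult[symmetric] by (simp add: f0_def algebra_simps)
          also have "\<dots> \<le> (4 * K * J \<omega>) * KY"
            unfolding J_def using cutoff_error[OF K c(1) m(2) \<omega>, of n] KY(2)[OF \<omega>] K(1) ratio_path.tail_moment_nonneg[OF path[OF \<omega>], of q c n]
            by (intro mult_mono) auto
          finally have "ennreal \<bar>Y \<omega> * f (uT n \<omega>) - f0 (uT n \<omega>) * Y \<omega>\<bar> \<le> ennreal ((4 * K * KY) * J \<omega>)"
            by (intro ennreal_leI) (simp add: mult_ac)
          then show "ennreal \<bar>Y \<omega> * f (uT n \<omega>) - f0 (uT n \<omega>) * Y \<omega>\<bar> \<le> ennreal (4 * K * KY) * ennreal (J \<omega>)"
            using K(1) KY(1) by (simp add: ennreal_mult')
        qed (use i1 i2 in measurable)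
        moreover have "AE \<omega> in M. ennreal (4 * K * KY) * nn_cond_exp M C (\<lambda>\<omega>. ennreal (J \<omega>)) \<omega> = nn_cond_exp M C (\<lambda>\<omega>. ennreal (4 * K * KY) * ennreal (J \<omega>)) \<omega>"
          by (rule M.nn_cond_exp_prod) measurable
        ultimately show ?thesis using AE_space
        proof eventually_elim
          case (elim \<omega>)
          show ?case
          proof
            assume "\<omega> \<notin> E"
            then have "nn_cond_exp M C (\<lambda>\<omega>. ennreal (J \<omega>)) \<omega> \<le> ennreal e'" using elim by (auto simp: E_def not_less)
            then have "ennreal (4 * K * KY) * nn_cond_exp M C (\<lambda>\<omega>. ennreal (J \<omega>)) \<omega> \<le> ennreal (4 * K * KY) * ennreal e'"
              by (rule mult_left_mono) simp
            also have "\<dots> = ennreal ((4 * K * KY) * e')" using K(1) KY(1) by (simp add: ennreal_mult')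
            finally have le: "ennreal (4 * K * KY) * nn_cond_exp M C (\<lambda>\<omega>. ennreal (J \<omega>)) \<omega> \<le> ennreal ((4 * K * KY) * e')" .
            have "ennreal \<bar>a n \<omega> - am m n \<omega>\<bar> \<le> nn_cond_exp M C (\<lambda>\<omega>. ennreal \<bar>Y \<omega> * f (uT n \<omega>) - f0 (uT n \<omega>) * Y \<omega>\<bar>) \<omega>"
              using elim(2) unfolding elim(1) .
            also note elim(3)
            also note elim(4)[symmetric]
            also note le
            finally have "ennreal \<bar>a n \<omega> - am m n \<omega>\<bar> \<le> ennreal ((4 * K * KY) * e')" .
            then have "\<bar>a n \<omega> - am m n \<omega>\<bar> \<le> (4 * K * KY) * e'" using K(1) KY(1) e' by (subst (asm) ennreal_le_iff) auto
            then show "\<bar>a n \<omega> - am m n \<omega>\<bar> < e" using e'2 by linarith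
          qed
        qed
      qed
      have "N.prob {\<omega> \<in> space N. e0 \<le> dist (a n (\<pi> \<omega>)) (l \<omega>)} \<le> N.prob ((\<pi> -` E \<inter> space N) \<union> (E2 \<union> E3))"
      proof (rule N.finite_measure_mono_AE)
        show "AE \<omega> in N. \<omega> \<in> {\<omega> \<in> space N. e0 \<le> dist (a n (\<pi> \<omega>)) (l \<omega>)} \<longrightarrow> \<omega> \<in> (\<pi> -` E \<inter> space N) \<union> (E2 \<union> E3)"
          using AE_\<pi>[OF T1]
        proof eventually_elim
          case (elim \<omega>)
          show ?case
          proof (rule impI, rule ccontr)
            assume "\<omega> \<in> {\<omega> \<in> space N. e0 \<le> dist (a n (\<pi> \<omega>)) (l \<omega>)}"
              and "\<omega> \<notin> (\<pi> -` E \<inter> space N) \<union> (E2 \<union> E3)"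
            then have "e0 \<le> \<bar>a n (\<pi> \<omega>) - l \<omega>\<bar>" "\<bar>am m n (\<pi> \<omega>) - lm m \<omega>\<bar> < e" "\<bar>lm m \<omega> - l \<omega>\<bar> < e"
                "\<bar>a n (\<pi> \<omega>) - am m n (\<pi> \<omega>)\<bar> < e"
              using elim by (auto simp: E2_def E3_def dist_real_def not_le)
            moreover have "e0 = 3 * e" by (simp add: e_def)
            ultimately show False by linarith
          qed
        qed
      qed measurable
      also have "\<dots> \<le> N.prob (\<pi> -` E \<inter> space N) + (N.prob E2 + N.prob E3)"
        by (intro order_trans[OF measure_Un_le] add_left_mono measure_Un_le) measurable
      also have "N.prob (\<pi> -` E \<inter> space N) = M.prob E"
        using measure_distr[OF \<pi>_meas, of E] by (simp add: distr_\<pi>)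
      also have "M.prob E + (N.prob E2 + N.prob E3) < d0"
      proof -
        have "N.prob E2 \<le> (\<integral>\<omega>. \<bar>am m n (\<pi> \<omega>) - lm m \<omega>\<bar> \<partial>N) / e"
          unfolding E2_def
        proof (rule N.markov_abs[OF _ e])
          have "integrable N (\<lambda>\<omega>. am m n (\<pi> \<omega>))"
            using integrable_distr[OF \<pi>_meas, of "am m n"] M.real_cond_exp_int(1)[OF i2] by (simp add: distr_\<pi> am_def f0_def)
          moreover have "integrable N (lm m)"
            unfolding lm_def
          proof (intro N.real_cond_exp_int(1) N.integrable_bounded_rv[where B="K0 * KY"])
            show "\<bar>cutoff m (uL \<omega>) * f (uL \<omega>) * Y (\<pi> \<omega>)\<bar> \<le> K0 * KY" if "\<omega> \<in> space N" for \<omega>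
              using K0[of "uL \<omega>"] KYN[OF that] KY(1) unfolding f0_def[symmetric] abs_mult[of "f0 _"] by (intro mult_mono) auto
          qed measurable
          ultimately show "integrable N (\<lambda>\<omega>. am m n (\<pi> \<omega>) - lm m \<omega>)" by auto
        qed
        also have "\<dots> \<le> d" using elim(2) e by (simp add: divide_le_eq mult.commute less_imp_le)
        finally have "N.prob E2 \<le> d" .
        moreover have "M.prob E \<le> d" using elim(1) by (simp add: E_def J_def e'_def)
        moreover have "N.prob E3 < d" using m(1) by (simp add: E3_def)
        ultimately show ?thesis using d0 by (simp add: d_def)
      qed
      finally show ?case .
    qed
    then show "\<exists>no. \<forall>n\<ge>no. norm (N.prob {\<omega> \<in> space N. e0 \<le> dist (a n (\<pi> \<omega>)) (l \<omega>)} - 0) < d0"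
      by (simp add: eventually_sequentially)
  qed
qed

end

lemma cond_expect_cong:
  assumes "\<And>\<omega>. \<omega> \<in> space M \<Longrightarrow> W \<omega> = W' \<omega>"
  shows "cond_expect M F W = cond_expect M F W'"
proof -
  have "W -` A \<inter> space M = W' -` A \<inter> space M" for A using assms by auto
  then have "regular_cond_distr M F W = regular_cond_distr M F W'"
    by (simp add: regular_cond_distr_def fun_eq_iff)
  then show ?thesis by (simp add: cond_expect_def cond_law_def fun_eq_iff)
qed

context quasi_bayes
begin

text \<open>Expectations with respect to the regular conditional distributions agree almost surely, in each
  component, with conditional expectations, for which \<open>component_convergence\<close> holds.\<close>

theorem convergence_along_sequence:
  fixes f :: "real^'p \<Rightarrow> real^'k"
  assumes f: "continuous_on UNIV f" and growth: "bdd_above (range (\<lambda>u. norm (f u) / (1 + norm u powr q)))"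
    and Y: "bounded_rv G Y"
  shows "AE \<omega> in N. integrable lborel (zl \<omega>) \<and> integrable lborel (\<lambda>u. zl \<omega> u *\<^sub>R u) \<and> 0 < (\<integral>u. zl \<omega> u \<partial>lborel)"
    and "AE \<omega> in N. integrable (cond_law N C' (\<lambda>\<omega>. Y (\<pi> \<omega>) *\<^sub>R f (u_limit (zl \<omega>))) \<omega>) (\<lambda>w. w)"
    and "conv_in_prob N (\<lambda>n \<omega>. cond_expect M C (\<lambda>\<omega>. Y \<omega> *\<^sub>R f (u_tilde \<Theta> \<theta>\<^sub>s (A n) \<rho> (H n \<omega>))) (\<pi> \<omega>))
      (cond_expect N C' (\<lambda>\<omega>. Y (\<pi> \<omega>) *\<^sub>R f (u_limit (zl \<omega>)))) sequentially"
proof -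
  show "AE \<omega> in N. integrable lborel (zl \<omega>) \<and> integrable lborel (\<lambda>u. zl \<omega> u *\<^sub>R u) \<and> 0 < (\<integral>u. zl \<omega> u \<partial>lborel)"
    using AE_limit_path by eventually_elim (use limit_path_integrable[OF _ q D] in blast)
  note [measurable] = bounded_rvD(1)[OF Y]
  have [measurable]: "f \<in> borel_measurable borel" by (rule borel_measurable_continuous_onI[OF f])
  obtain KY where KY: "0 < KY" "\<And>\<omega>. \<omega> \<in> space M \<Longrightarrow> \<bar>Y \<omega>\<bar> \<le> KY" using bounded_rvD(2)[OF Y] by auto
  obtain K0 where K0: "\<And>u. norm (f u) / (1 + norm u powr q) \<le> K0" using growth by (auto simp: bdd_above_def)
  define K where "K = max K0 0"
  have K: "0 \<le> K" "norm (f u) \<le> K * (1 + norm u powr q)" for u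
  proof -
    show "0 \<le> K" by (simp add: K_def)
    have p: "0 < 1 + norm u powr q" by (intro add_pos_nonneg) auto
    have "norm (f u) / (1 + norm u powr q) \<le> K" using K0[of u] by (simp add: K_def)
    then show "norm (f u) \<le> K * (1 + norm u powr q)" using p by (simp add: pos_divide_le_eq)
  qed
  define WL where "WL \<omega> = Y (\<pi> \<omega>) *\<^sub>R f (uL \<omega>)" for \<omega>
  define W where "W n \<omega> = Y \<omega> *\<^sub>R f (uT n \<omega>)" for n \<omega>
  have WL_meas[measurable]: "WL \<in> borel_measurable N" unfolding WL_def by measurable
  have [measurable]: "W n \<in> borel_measurable M" for n unfolding W_def by measurable
  have finL: "AE \<omega> in N. nn_cond_exp N C' (\<lambda>\<omega>. ennreal (norm (WL \<omega>))) \<omega> < \<infinity>"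
  proof -
    have "AE \<omega> in N. nn_cond_exp N C' (\<lambda>\<omega>. ennreal \<bar>norm (WL \<omega>)\<bar>) \<omega> < \<infinity>"
    proof (rule uL_growth_finite[of _ "KY * K"])
      fix \<omega> assume "\<omega> \<in> space N"
      then have "\<bar>Y (\<pi> \<omega>)\<bar> \<le> KY" using KY(2) measurable_space[OF \<pi>_meas] by auto
      then have "\<bar>Y (\<pi> \<omega>)\<bar> * norm (f (uL \<omega>)) \<le> KY * (K * (1 + norm (uL \<omega>) powr q))"
        using K(2)[of "uL \<omega>"] KY(1) by (intro mult_mono) auto
      then show "\<bar>norm (WL \<omega>)\<bar> \<le> KY * K * (1 + norm (uL \<omega>) powr q)" by (simp add: WL_def mult.assoc)
    qed (use KY(1) K(1) in auto)
    then show ?thesis by simp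
  qed
  have finT: "AE \<omega> in M. nn_cond_exp M C (\<lambda>\<omega>. ennreal (norm (W n \<omega>))) \<omega> < \<infinity>" for n
  proof (rule M.nn_cond_exp_finite)
    obtain R :: nat where R: "\<And>\<omega>. \<omega> \<in> space M \<Longrightarrow> norm (uT n \<omega>) \<le> real R" using uT_bounded by blast
    have "norm (W n \<omega>) \<le> KY * (K * (1 + real R powr q))" if \<omega>: "\<omega> \<in> space M" for \<omega>
    proof -
      have "norm (f (uT n \<omega>)) \<le> K * (1 + norm (uT n \<omega>) powr q)" by (rule K(2))
      also have "\<dots> \<le> K * (1 + real R powr q)"
        using R[OF \<omega>] q K(1) by (intro mult_left_mono add_left_mono powr_mono2) auto
      finally show ?thesis unfolding W_def norm_scaleR using KY(2)[OF \<omega>] KY(1) by (intro mult_mono) auto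
    qed
    then have "integrable M (W n)"
      by (intro M.integrable_const_bound[where B="KY * (K * (1 + real R powr q))"]) auto
    then show "(\<integral>\<^sup>+\<omega>. ennreal (norm (W n \<omega>)) \<partial>M) < \<infinity>" by (simp add: integrable_iff_bounded)
  qed measurable
  show "AE \<omega> in N. integrable (cond_law N C' (\<lambda>\<omega>. Y (\<pi> \<omega>) *\<^sub>R f (u_limit (zl \<omega>))) \<omega>) (\<lambda>w. w)"
    using N.AE_integrable_cond_law[OF WL_meas finL] by (simp add: WL_def[abs_def] uL_def)
  define X where "X n \<omega> = cond_expect M C (W n) (\<pi> \<omega>)" for n \<omega>
  define XL where "XL = cond_expect N C' WL"
  define x where "x i n \<omega> = real_cond_exp M C (\<lambda>\<omega>. Y \<omega> * f (uT n \<omega>) $ i) (\<pi> \<omega>)" for i n \<omega>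
  define xL where "xL i = real_cond_exp N C' (\<lambda>\<omega>. Y (\<pi> \<omega>) * f (uL \<omega>) $ i)" for i
  have [measurable]: "x i n \<in> borel_measurable N" "xL i \<in> borel_measurable N" for i n
    unfolding x_def xL_def by (rule measurable_compose[OF \<pi>_meas borel_measurable_cond_exp2], rule borel_measurable_cond_exp2)
  have comp: "conv_in_prob N (x i) (xL i) sequentially" for i
    unfolding x_def xL_def
  proof (rule component_convergence[OF _ K(1) _ Y])
    show "continuous_on UNIV (\<lambda>u. f u $ i)" using f by (intro continuous_intros)
    show "\<bar>f u $ i\<bar> \<le> K * (1 + norm u powr q)" for u
      using component_le_norm_cart[of "f u" i] K(2)[of u] by linarith
  qed
  have eqX: "AE \<omega> in N. \<forall>i. X n \<omega> $ i = x i n \<omega>" for n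
  proof (subst AE_all_countable, rule allI)
    fix i
    have "AE \<omega> in M. cond_expect M C (W n) \<omega> $ i = real_cond_exp M C (\<lambda>\<omega>. W n \<omega> $ i) \<omega>"
      by (rule M.cond_expect_component[OF _ finT]) measurable
    then have "AE \<omega> in N. cond_expect M C (W n) (\<pi> \<omega>) $ i = real_cond_exp M C (\<lambda>\<omega>. W n \<omega> $ i) (\<pi> \<omega>)"
      by (rule AE_\<pi>)
    then show "AE \<omega> in N. X n \<omega> $ i = x i n \<omega>" by (simp add: X_def x_def W_def)
  qed
  have eqL: "AE \<omega> in N. \<forall>i. XL \<omega> $ i = xL i \<omega>"
  proof (subst AE_all_countable, rule allI)
    fix i
    have "AE \<omega> in N. cond_expect N C' WL \<omega> $ i = real_cond_exp N C' (\<lambda>\<omega>. WL \<omega> $ i) \<omega>"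
      by (rule N.cond_expect_component[OF _ finL]) measurable
    then show "AE \<omega> in N. XL \<omega> $ i = xL i \<omega>" by (simp add: XL_def xL_def WL_def)
  qed
  have "conv_in_prob N X XL sequentially"
    unfolding conv_in_prob_def
  proof (intro allI impI)
    fix e :: real assume e: "0 < e"
    define c where "c = e / real CARD('k)"
    have c: "0 < c" using e by (simp add: c_def)
    define S where "S i n = {\<omega> \<in> space N. c \<le> dist (x i n \<omega>) (xL i \<omega>)}" for i n
    have [measurable]: "S i n \<in> sets N" for i n unfolding S_def by measurable
    have "(\<lambda>n. \<Sum>i\<in>UNIV. N.prob (S i n)) \<longlonglongrightarrow> (\<Sum>i\<in>(UNIV::'k set). 0)"
      using comp c unfolding conv_in_prob_def S_def by (intro tendsto_sum) auto
    then have lim: "(\<lambda>n. \<Sum>i\<in>UNIV. N.prob (S i n)) \<longlonglongrightarrow> 0" by simp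
    show "(\<lambda>n. N.prob {\<omega> \<in> space N. e \<le> dist (X n \<omega>) (XL \<omega>)}) \<longlonglongrightarrow> 0"
    proof (rule tendsto_sandwich[OF _ _ tendsto_const lim])
      show "\<forall>\<^sub>F n in sequentially. N.prob {\<omega> \<in> space N. e \<le> dist (X n \<omega>) (XL \<omega>)} \<le> (\<Sum>i\<in>UNIV. N.prob (S i n))"
      proof (rule always_eventually, rule allI)
        fix n
        have "N.prob {\<omega> \<in> space N. e \<le> dist (X n \<omega>) (XL \<omega>)} \<le> N.prob (\<Union>i\<in>UNIV. S i n)"
        proof (rule N.finite_measure_mono_AE)
          show "AE \<omega> in N. \<omega> \<in> {\<omega> \<in> space N. e \<le> dist (X n \<omega>) (XL \<omega>)} \<longrightarrow> \<omega> \<in> (\<Union>i\<in>UNIV. S i n)"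
            using eqX[of n] eqL
          proof eventually_elim
            case (elim \<omega>)
            show ?case
            proof (rule impI, rule ccontr)
              assume a: "\<omega> \<in> {\<omega> \<in> space N. e \<le> dist (X n \<omega>) (XL \<omega>)}" and "\<omega> \<notin> (\<Union>i\<in>UNIV. S i n)"
              then have small: "\<bar>(X n \<omega> - XL \<omega>) $ i\<bar> < c" for i
                using elim by (auto simp: S_def dist_real_def not_le)
              have "norm (X n \<omega> - XL \<omega>) \<le> (\<Sum>i\<in>UNIV. \<bar>(X n \<omega> - XL \<omega>) $ i\<bar>)" by (rule norm_le_l1_cart)
              also have "\<dots> < (\<Sum>i\<in>(UNIV::'k set). c)" using small by (intro sum_strict_mono) auto
              also have "\<dots> = e" by (simp add: c_def)
              finally show False using a by (simp add: dist_norm)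
            qed
          qed
        qed measurable
        also have "\<dots> \<le> (\<Sum>i\<in>UNIV. N.prob (S i n))" by (rule measure_UNION_le) auto
        finally show "N.prob {\<omega> \<in> space N. e \<le> dist (X n \<omega>) (XL \<omega>)} \<le> (\<Sum>i\<in>UNIV. N.prob (S i n))" .
      qed
    qed auto
  qed
  moreover have "cond_expect M C (\<lambda>\<omega>. Y \<omega> *\<^sub>R f (u_tilde \<Theta> \<theta>\<^sub>s (A n) \<rho> (H n \<omega>))) = cond_expect M C (W n)" for n
    by (rule cond_expect_cong) (simp add: W_def uT_eq)
  ultimately show "conv_in_prob N (\<lambda>n \<omega>. cond_expect M C (\<lambda>\<omega>. Y \<omega> *\<^sub>R f (u_tilde \<Theta> \<theta>\<^sub>s (A n) \<rho> (H n \<omega>))) (\<pi> \<omega>))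
      (cond_expect N C' (\<lambda>\<omega>. Y (\<pi> \<omega>) *\<^sub>R f (u_limit (zl \<omega>)))) sequentially"
    by (simp add: X_def[abs_def] XL_def WL_def[abs_def] uL_def)
qed

end

lemma eventually_at_top_in: "eventually P (at_top_in I) \<longleftrightarrow> (\<exists>t0. \<forall>t\<ge>t0. t \<in> I \<longrightarrow> P t)"
  by (auto simp: at_top_in_def eventually_inf_principal eventually_at_top_linorder)

lemma filterlim_at_top_in:
  assumes "\<tau> \<in> divergent_seqs I T0" shows "filterlim \<tau> (at_top_in I) sequentially"
  using assms unfolding divergent_seqs_def at_top_in_def
  by (auto simp: filterlim_inf filterlim_principal)

lemma divergent_seq_through:
  assumes I: "\<not> bdd_above I" and P: "\<And>t0. \<exists>t\<ge>t0. t \<in> I \<and> P t"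
  shows "\<exists>\<tau>\<in>divergent_seqs I T0. \<forall>n. P (\<tau> n)"
proof -
  have "\<exists>t\<ge>max T0 (real n). t \<in> I \<and> P t" for n :: nat by (rule P)
  then obtain \<tau> where \<tau>: "\<And>n. max T0 (real n) \<le> \<tau> n" "\<And>n. \<tau> n \<in> I" "\<And>n. P (\<tau> n)" by metis
  have "filterlim \<tau> at_top sequentially"
    by (rule filterlim_at_top_mono[OF filterlim_real_sequentially]) (use \<tau>(1) in auto)
  then have "\<tau> \<in> divergent_seqs I T0" using \<tau> by (auto simp: divergent_seqs_def)
  then show ?thesis using \<tau>(3) by blast
qed

text \<open>Otherwise the probabilities of a deviation would stay away from 0 along some divergent sequence.\<close>

lemma conv_in_prob_at_top_in:
  assumes I: "\<not> bdd_above I"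
    and seq: "\<And>\<tau>. \<tau> \<in> divergent_seqs I T0 \<Longrightarrow> conv_in_prob N (\<lambda>n. X (\<tau> n)) L sequentially"
  shows "conv_in_prob N X L (at_top_in I)"
  unfolding conv_in_prob_def
proof (intro allI impI)
  fix e :: real assume e: "0 < e"
  define g where "g t = measure N {\<omega> \<in> space N. e \<le> dist (X t \<omega>) (L \<omega>)}" for t
  have "\<forall>\<^sub>F t in at_top_in I. dist (g t) 0 < r" if r: "0 < r" for r
  proof (rule ccontr)
    assume "\<not> ?thesis"
    then have "\<exists>t\<ge>t0. t \<in> I \<and> r \<le> g t" for t0
      unfolding eventually_at_top_in by (auto simp: g_def not_less)
    then obtain \<tau> where \<tau>: "\<tau> \<in> divergent_seqs I T0" "\<And>n. r \<le> g (\<tau> n)"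
      using divergent_seq_through[OF I, of "\<lambda>t. r \<le> g t" T0] by blast
    have "(\<lambda>n. g (\<tau> n)) \<longlonglongrightarrow> 0" using seq[OF \<tau>(1)] e unfolding conv_in_prob_def g_def by blast
    then have "r \<le> 0" by (rule LIMSEQ_le_const) (use \<tau>(2) in auto)
    then show False using r by simp
  qed
  then show "((\<lambda>t. measure N {\<omega> \<in> space N. e \<le> dist (X t \<omega>) (L \<omega>)}) \<longlongrightarrow> 0) (at_top_in I)"
    unfolding g_def[symmetric] by (rule tendstoI)
qed

lemma conv_in_prob_compose:
  "conv_in_prob M X L F \<Longrightarrow> filterlim \<tau> F sequentially \<Longrightarrow> conv_in_prob M (\<lambda>n. X (\<tau> n)) L sequentially"
  unfolding conv_in_prob_def using filterlim_compose by blast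

lemma bounded_in_prob_compose:
  "bounded_in_prob M X F \<Longrightarrow> filterlim \<tau> F sequentially \<Longrightarrow> bounded_in_prob M (\<lambda>n. X (\<tau> n)) sequentially"
  unfolding bounded_in_prob_def using eventually_compose_filterlim by blast

theorem theorem2p5:
  fixes M C G :: "'w measure"
    and N :: "'v measure" and \<pi> :: "'v \<Rightarrow> 'w"
    and I :: "real set" and T0 :: real
    and \<Theta> :: "(real^'p) set" and \<theta>\<^sub>s :: "real^'p"
    and H :: "real \<Rightarrow> 'w \<Rightarrow> real^'p \<Rightarrow> real"
    and a :: "real \<Rightarrow> real^'p^'p"
    and Z :: "real \<Rightarrow> 'w \<Rightarrow> real^'p \<Rightarrow> real"
    and \<rho> :: "real^'p \<Rightarrow> real"
    and \<Psi> :: "real \<Rightarrow> 'w \<Rightarrow> real"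
    and Zlim :: "'v \<Rightarrow> ((real^'p) \<Rightarrow>\<^sub>C real)"
    and q D L :: real
    and f :: "real^'p \<Rightarrow> real^'k" and Y :: "'w \<Rightarrow> real"
  assumes "prob_space M" and "subalgebra M G" and "subalgebra G C"
    and "prob_extension M N \<pi>"
    and "I \<subseteq> {0..}" and "\<not> bdd_above I" and "0 < T0"
    and "open \<Theta>" and "connected \<Theta>" and "bounded \<Theta>" and "\<theta>\<^sub>s \<in> \<Theta>"
    and "\<And>T. T \<in> I \<Longrightarrow>
          (\<lambda>(\<omega>, \<theta>). H T \<omega> \<theta>) \<in> borel_measurable (M \<Otimes>\<^sub>M restrict_space borel (closure \<Theta>))"
    and "\<And>T \<omega>. T \<in> I \<Longrightarrow> \<omega> \<in> space M \<Longrightarrow> continuous_on (closure \<Theta>) (H T \<omega>)"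
    and "\<And>T. T \<in> I \<Longrightarrow> invertible (a T)"
    and "(a \<longlongrightarrow> 0) (at_top_in I)"
    and "\<And>T. T \<in> I \<Longrightarrow> (\<lambda>(\<omega>, u). Z T \<omega> u) \<in> borel_measurable (M \<Otimes>\<^sub>M borel)"
    and "\<And>T \<omega>. T \<in> I \<Longrightarrow> \<omega> \<in> space M \<Longrightarrow> ratio_extension \<Theta> \<theta>\<^sub>s (a T) (H T \<omega>) (Z T \<omega>)"
    and "continuous_on \<Theta> \<rho>" and "\<exists>b B. 0 < b \<and> (\<forall>\<theta>\<in>\<Theta>. b \<le> \<rho> \<theta> \<and> \<rho> \<theta> \<le> B)"
    and "\<And>T. T \<in> I \<Longrightarrow> \<Psi> T \<in> borel_measurable C"
    and "\<And>T \<omega>. T \<in> I \<Longrightarrow> \<omega> \<in> space M \<Longrightarrow> 0 \<le> \<Psi> T \<omega> \<and> \<Psi> T \<omega> \<le> 1"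
    and "Zlim \<in> N \<rightarrow>\<^sub>M restrict_space borel C_hat"
    and "1 \<le> q" and "real CARD('p) + q < D" and "q + 1 < L"
    and cond1: "\<exists>U \<in> borel_measurable C. \<exists>V \<in> borel_measurable C.
          \<forall>\<tau> \<in> divergent_seqs I T0. \<forall>n. \<forall>r::nat. 1 \<le> r \<longrightarrow>
            (AE \<omega> in M.
               event_prob_given M C
                 (S_event M \<Theta> \<theta>\<^sub>s (a (\<tau> n)) (Z (\<tau> n)) (real r) (\<lambda>\<omega>. U \<omega> / real r powr D)) \<omega>
               * \<Psi> (\<tau> n) \<omega> \<le> V \<omega> / real r powr L)"
    and cond2: "\<And>\<epsilon> c \<tau>. 0 < \<epsilon> \<Longrightarrow> 0 < c \<Longrightarrow> \<tau> \<in> divergent_seqs I T0 \<Longrightarrow>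
          conv_in_prob M
            (\<lambda>\<delta> \<omega>. real_of_ereal (limsup (\<lambda>n. ereal
               (event_prob_given M C (W_event M \<Theta> \<theta>\<^sub>s (a (\<tau> n)) (Z (\<tau> n)) \<delta> c \<epsilon>) \<omega>
                * \<Psi> (\<tau> n) \<omega>))))
            (\<lambda>\<omega>. 0) (at_right 0)"
    and cond3i: "\<And>(k::nat) (u::nat \<Rightarrow> real^'p) (g::(nat \<Rightarrow> real) \<Rightarrow> real) (Y::'w \<Rightarrow> real).
          1 \<le> k \<Longrightarrow> continuous_map (Euclidean_space k) euclideanreal g \<Longrightarrow>
          bounded (g ` topspace (Euclidean_space k)) \<Longrightarrow> bounded_rv G Y \<Longrightarrow>
          conv_in_prob N
            (\<lambda>T \<omega>. cond_expect M C
               (\<lambda>\<omega>. g (\<lambda>i. if i < k then Z T \<omega> (u i) else 0) * \<Psi> T \<omega> * Y \<omega>) (\<pi> \<omega>))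
            (cond_expect N (lift_field N \<pi> C)
               (\<lambda>\<omega>. g (\<lambda>i. if i < k then apply_bcontfun (Zlim \<omega>) (u i) else 0) * Y (\<pi> \<omega>)))
            (at_top_in I)"
    and cond3ii: "conv_in_prob M \<Psi> (\<lambda>\<omega>. 1) (at_top_in I)"
    and cond4: "bounded_in_prob M
          (\<lambda>T. cond_nn_expect M C
             (\<lambda>\<omega>. inverse (LINT u:U_set \<Theta> \<theta>\<^sub>s (a T)|lborel. Z T \<omega> u)))
          (at_top_in I)"
    and "bounded_rv G Y"
    and "continuous_on UNIV f" and "bdd_above (range (\<lambda>u. norm (f u) / (1 + norm u powr q)))"
  shows "(AE \<omega> in N. integrable lborel (apply_bcontfun (Zlim \<omega>)) \<and>
            integrable lborel (\<lambda>u. apply_bcontfun (Zlim \<omega>) u *\<^sub>R u) \<and>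
            0 < (\<integral>u. apply_bcontfun (Zlim \<omega>) u \<partial>lborel)) \<and>
    (AE \<omega> in N. integrable
       (cond_law N (lift_field N \<pi> C) (\<lambda>\<omega>. Y (\<pi> \<omega>) *\<^sub>R f (u_limit (apply_bcontfun (Zlim \<omega>)))) \<omega>)
       (\<lambda>w. w)) \<and>
    conv_in_prob N
      (\<lambda>T \<omega>. cond_expect M C (\<lambda>\<omega>. Y \<omega> *\<^sub>R f (u_tilde \<Theta> \<theta>\<^sub>s (a T) \<rho> (H T \<omega>))) (\<pi> \<omega>))
      (cond_expect N (lift_field N \<pi> C) (\<lambda>\<omega>. Y (\<pi> \<omega>) *\<^sub>R f (u_limit (apply_bcontfun (Zlim \<omega>)))))
      (at_top_in I)"
proof -
  obtain U V where UV: "U \<in> borel_measurable C" "V \<in> borel_measurable C"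
    and tail: "\<And>\<tau> n (r::nat). \<tau> \<in> divergent_seqs I T0 \<Longrightarrow> 1 \<le> r \<Longrightarrow> AE \<omega> in M.
       event_prob_given M C (S_event M \<Theta> \<theta>\<^sub>s (a (\<tau> n)) (Z (\<tau> n)) (real r) (\<lambda>\<omega>. U \<omega> / real r powr D)) \<omega>
        * \<Psi> (\<tau> n) \<omega> \<le> V \<omega> / real r powr L"
    using cond1 by blast
  obtain b B where b: "0 < b" and B: "\<And>\<theta>. \<theta> \<in> \<Theta> \<Longrightarrow> b \<le> \<rho> \<theta> \<and> \<rho> \<theta> \<le> B" using assms(19) by blast
  have path: "ratio_path \<Theta> \<theta>\<^sub>s (a T) \<rho> b B (H T \<omega>) (Z T \<omega>)" if "T \<in> I" "\<omega> \<in> space M" for T \<omega>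
    proof (rule ratio_path.intro)
    show "invertible (a T)" "continuous_on (closure \<Theta>) (H T \<omega>)" "ratio_extension \<Theta> \<theta>\<^sub>s (a T) (H T \<omega>) (Z T \<omega>)"
      using assms(13,14,17) that by blast+
  qed (use assms(8,10,11,18) b B in auto)
  have qb: "quasi_bayes M C G N \<pi> \<Theta> \<theta>\<^sub>s \<rho> b B (\<lambda>n. a (\<tau> n)) (\<lambda>n. H (\<tau> n)) (\<lambda>n. Z (\<tau> n)) (\<lambda>n. \<Psi> (\<tau> n)) Zlim q D L U V"
    if \<tau>: "\<tau> \<in> divergent_seqs I T0" for \<tau>
  proof -
    have \<tau>I: "\<tau> n \<in> I" for n using \<tau> by (simp add: divergent_seqs_def)
    note lim = filterlim_at_top_in[OF \<tau>]
    show ?thesis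
    proof (rule quasi_bayes.intro)
      show "(\<lambda>n. a (\<tau> n)) \<longlonglongrightarrow> 0" by (rule filterlim_compose[OF assms(15) lim])
      show "conv_in_prob M (\<lambda>n. \<Psi> (\<tau> n)) (\<lambda>\<omega>. 1) sequentially" by (rule conv_in_prob_compose[OF cond3ii lim])
      show "bounded_in_prob M (\<lambda>n. cond_nn_expect M C (\<lambda>\<omega>. inverse (LINT u:U_set \<Theta> \<theta>\<^sub>s (a (\<tau> n))|lborel. Z (\<tau> n) \<omega> u))) sequentially"
        by (rule bounded_in_prob_compose[OF cond4 lim])
      show "conv_in_prob N
            (\<lambda>n \<omega>. cond_expect M C
               (\<lambda>\<omega>. g (\<lambda>i. if i < k then Z (\<tau> n) \<omega> (u i) else 0) * \<Psi> (\<tau> n) \<omega> * Y \<omega>) (\<pi> \<omega>))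
            (cond_expect N (lift_field N \<pi> C)
               (\<lambda>\<omega>. g (\<lambda>i. if i < k then apply_bcontfun (Zlim \<omega>) (u i) else 0) * Y (\<pi> \<omega>)))
            sequentially"
        if "1 \<le> k" "continuous_map (Euclidean_space k) euclideanreal g"
          "bounded (g ` topspace (Euclidean_space k))" "bounded_rv G Y"
        for k and u :: "nat \<Rightarrow> real^'p" and g Y
        by (rule conv_in_prob_compose[OF cond3i[OF that] lim])
    qed (fact assms UV tail[OF \<tau>] cond2[OF _ _ \<tau>] | rule assms path tail[OF \<tau>] cond2[OF _ _ \<tau>] \<tau>I | assumption)+
  qed
  have "\<exists>t\<ge>t0. t \<in> I \<and> True" for t0 using assms(6) by (meson bdd_above.I less_imp_le not_le)
  then obtain \<tau> where "\<tau> \<in> divergent_seqs I T0"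
    using divergent_seq_through[OF assms(6), of "\<lambda>_. True" T0] by blast
  note along = quasi_bayes.convergence_along_sequence[OF qb]
  have f: "continuous_on UNIV f" "bdd_above (range (\<lambda>u. norm (f u) / (1 + norm u powr q)))" "bounded_rv G Y"
    using assms by auto
  show ?thesis
  proof (intro conjI)
    show "conv_in_prob N
      (\<lambda>T \<omega>. cond_expect M C (\<lambda>\<omega>. Y \<omega> *\<^sub>R f (u_tilde \<Theta> \<theta>\<^sub>s (a T) \<rho> (H T \<omega>))) (\<pi> \<omega>))
      (cond_expect N (lift_field N \<pi> C) (\<lambda>\<omega>. Y (\<pi> \<omega>) *\<^sub>R f (u_limit (apply_bcontfun (Zlim \<omega>)))))
      (at_top_in I)"
      by (rule conv_in_prob_at_top_in[OF assms(6), where ?T0.0=T0]) (rule along(3)[OF _ f])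
  qed (fact along(1,2)[OF \<open>\<tau> \<in> divergent_seqs I T0\<close> f])+
qed

end
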